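(* Let $d\ge 2$, $p>1$, and let $\Omega\subset\mathbb{R}^d$ be a domain. Let $s\in[1,\infty]$ and $t\in(1/(p-1),\infty]$ satisfy $$\frac1s+\frac1t<\frac{p}{d-1}.$$ Let $a:\Omega\times\mathbb{R}^d\to\mathbb{R}^d$ be a Carathéodory function with $a(\cdot,0)\equiv 0$ such that the functions $$\lambda(x):=\inf_{\xi\in\mathbb{R}^d\setminus\{0\}}\frac{a(x,\xi)\cdot\xi}{|\xi|^p},\qquad \mu(x):=\sup_{\xi\in\mathbb{R}^d\setminus\{0\}}\frac{|a(x,\xi)|^p}{(a(x,\xi)\cdot\xi)^{p-1}}$$ are nonnegative and satisfy $\mu\in L^s(\Omega)$ and $\frac1\lambda\in L^t(\Omega)$. Then any weak subsolution of $\nabla\cdot a(x,\nabla u)=0$ in $\Omega$ is locally bounded from above in $\Omega$.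
   Context: Conventions: $1/\infty=0$. "Locally bounded from above" means that every point of $\Omega$ has a neighbourhood on which $u$ is essentially bounded from above. Weak subsolutions. Let $a$ be such that $\frac1\lambda\in L^{\frac1{p-1}}(\Omega)$ and $\mu\in L^1(\Omega)$ (standing assumption in the definition of the spaces below; when $\Omega$ has finite measure it follows from $\frac1\lambda\in L^t(\Omega)$, $t>\frac1{p-1}$, and $\mu\in L^s(\Omega)$, $s\ge1$). The spaces $H^{1,p}_0(\Omega,a)$ and $H^{1,p}(\Omega,a)$ are the completions of $C^1_c(\Omega)$ and of $C^1(\Omega)$ (functions of finite norm), respectively, with respect to the norm $$\|u\|_{H^{1,p}(\Omega,a)}:=\Bigl(\int_\Omega \lambda|\nabla u|^p+\mu|u|^p\,dx\Bigr)^{1/p}.$$ Their elements are identified with functions in $W^{1,1}(\Omega)$. A function $u$ is a weak subsolution of $\nabla\cdot a(x,\nabla u)=0$ in $\Omega$ if $u\in H^{1,p}(\Omega,a)$ and $$\int_\Omega a(x,\nabla u)\cdot\nabla\phi\,dx\le 0\qquad\text{for all }\phi\in H^{1,p}_0(\Omega,a)\text{ with }\phi\ge 0.$$ *)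

theory Defs
  imports "HOL-Analysis.Analysis"
begin

definition domain_set :: "'a::euclidean_space set \<Rightarrow> bool" where
  "domain_set \<Omega> \<longleftrightarrow> open \<Omega> \<and> connected \<Omega> \<and> \<Omega> \<noteq> {}"

definition caratheodory ::
    "'a::euclidean_space set \<Rightarrow> ('a \<Rightarrow> 'a \<Rightarrow> 'a) \<Rightarrow> bool" where
  "caratheodory \<Omega> a \<longleftrightarrow>
     (\<forall>\<xi>. (\<lambda>x. a x \<xi>) \<in> borel_measurable (lebesgue_on \<Omega>)) \<and>
     (AE x in lebesgue_on \<Omega>. continuous_on UNIV (a x))"

text \<open>
  The infimum and the supremum are taken in the extended reals. A quotient with vanishing
  denominator is \<open>\<infinity>\<close>, or \<open>0\<close> if the numerator vanishes too; this occurs in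
  the supremum only at points where the infimum is not positive. The power of the possibly
  negative number \<open>a x \<xi> \<bullet> \<xi>\<close> is meaningful only where the infimum is nonnegative.
\<close>

definition ellip_lower :: "real \<Rightarrow> ('a::euclidean_space \<Rightarrow> 'a \<Rightarrow> 'a) \<Rightarrow> 'a \<Rightarrow> ereal" where
  "ellip_lower p a x = (INF \<xi>\<in>{\<xi>. \<xi> \<noteq> 0}. ereal (a x \<xi> \<bullet> \<xi>) / ereal (norm \<xi> powr p))"

definition ellip_upper :: "real \<Rightarrow> ('a::euclidean_space \<Rightarrow> 'a \<Rightarrow> 'a) \<Rightarrow> 'a \<Rightarrow> ereal" where
  "ellip_upper p a x =
     (SUP \<xi>\<in>{\<xi>. \<xi> \<noteq> 0}. ereal (norm (a x \<xi>) powr p) / ereal ((a x \<xi> \<bullet> \<xi>) powr (p - 1)))"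

text \<open>Membership in \<open>L\<^sup>q\<close> for \<open>0 < q \<le> \<infinity>\<close>; exponents below 1 are allowed.\<close>

definition in_Lp :: "ereal \<Rightarrow> 'a measure \<Rightarrow> ('a \<Rightarrow> ereal) \<Rightarrow> bool" where
  "in_Lp q M f \<longleftrightarrow>
     f \<in> borel_measurable M \<and> (AE x in M. \<bar>f x\<bar> \<noteq> \<infinity>) \<and>
     (if q = \<infinity> then \<exists>C. AE x in M. \<bar>f x\<bar> \<le> ereal C
      else integrable M (\<lambda>x. \<bar>real_of_ereal (f x)\<bar> powr real_of_ereal q))"

definition grad :: "('a::euclidean_space \<Rightarrow> real) \<Rightarrow> 'a \<Rightarrow> 'a" where
  "grad u x = (\<Sum>b\<in>Basis. frechet_derivative u (at x) b *\<^sub>R b)"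

definition C1 :: "'a::euclidean_space set \<Rightarrow> ('a \<Rightarrow> real) set" where
  "C1 \<Omega> = {u. (\<forall>x\<in>\<Omega>. u differentiable (at x)) \<and> continuous_on \<Omega> (grad u)}"

definition C1c :: "'a::euclidean_space set \<Rightarrow> ('a \<Rightarrow> real) set" where
  "C1c \<Omega> = {u \<in> C1 \<Omega>. \<exists>K. compact K \<and> K \<subseteq> \<Omega> \<and> (\<forall>x\<in>\<Omega> - K. u x = 0)}"

text \<open>
  \<open>u\<close> belongs to \<open>W\<^sup>1\<^sup>,\<^sup>1(\<Omega>)\<close> and \<open>G\<close> is its weak gradient. Test functions of
  class \<open>C\<^sup>1\<close> with compact support give the same notion as smooth ones.
\<close>

definition has_W11_gradient ::
    "'a::euclidean_space set \<Rightarrow> ('a \<Rightarrow> real) \<Rightarrow> ('a \<Rightarrow> 'a) \<Rightarrow> bool" where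
  "has_W11_gradient \<Omega> u G \<longleftrightarrow>
     integrable (lebesgue_on \<Omega>) u \<and> integrable (lebesgue_on \<Omega>) G \<and>
     (\<forall>\<phi>\<in>C1c \<Omega>. (\<integral>x. u x *\<^sub>R grad \<phi> x \<partial>lebesgue_on \<Omega>)
                  = - (\<integral>x. \<phi> x *\<^sub>R G x \<partial>lebesgue_on \<Omega>))"

definition H1p_energy ::
    "real \<Rightarrow> 'a::euclidean_space set \<Rightarrow> ('a \<Rightarrow> 'a \<Rightarrow> 'a) \<Rightarrow> ('a \<Rightarrow> real) \<Rightarrow> ennreal" where
  "H1p_energy p \<Omega> a u =
     (\<integral>\<^sup>+x. e2ennreal (ellip_lower p a x) * ennreal (norm (grad u x) powr p)
         + e2ennreal (ellip_upper p a x) * ennreal (\<bar>u x\<bar> powr p) \<partial>lebesgue_on \<Omega>)"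

definition H1p_norm ::
    "real \<Rightarrow> 'a::euclidean_space set \<Rightarrow> ('a \<Rightarrow> 'a \<Rightarrow> 'a) \<Rightarrow> ('a \<Rightarrow> real) \<Rightarrow> real" where
  "H1p_norm p \<Omega> a u = enn2real (H1p_energy p \<Omega> a u) powr (1 / p)"

text \<open>
  The completion of the functions of finite norm in \<open>V\<close>, realised inside
  \<open>W\<^sup>1\<^sup>,\<^sup>1(\<Omega>)\<close>: a Cauchy sequence for the weighted norm is identified with its limit
  in \<open>W\<^sup>1\<^sup>,\<^sup>1(\<Omega>)\<close>. The limit exists, and determines the class of the sequence, when
  the reciprocal of \<open>ellip_lower p a\<close> is in \<open>L\<^sup>q(\<Omega>)\<close> with \<open>q = 1/(p - 1)\<close> and
  \<open>ellip_upper p a\<close> is in \<open>L\<^sup>1(\<Omega>)\<close>; note \<open>ellip_lower p a \<le> ellip_upper p a\<close> wherever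
  \<open>ellip_lower p a\<close> is nonnegative.
\<close>

definition H1p_completion ::
    "real \<Rightarrow> 'a::euclidean_space set \<Rightarrow> ('a \<Rightarrow> 'a \<Rightarrow> 'a) \<Rightarrow> ('a \<Rightarrow> real) set \<Rightarrow> ('a \<Rightarrow> real) set"
  where
  "H1p_completion p \<Omega> a V =
     {u. \<exists>G v. has_W11_gradient \<Omega> u G \<and>
           (\<forall>n::nat. v n \<in> V \<and> H1p_energy p \<Omega> a (v n) < \<infinity>) \<and>
           (\<forall>e>0. \<exists>N. \<forall>m\<ge>N. \<forall>n\<ge>N. H1p_norm p \<Omega> a (\<lambda>x. v m x - v n x) < e) \<and>
           (\<lambda>n. \<integral>\<^sup>+x. ennreal (\<bar>v n x - u x\<bar> + norm (grad (v n) x - G x)) \<partial>lebesgue_on \<Omega>)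
             \<longlonglongrightarrow> 0}"

definition H1p ::
    "real \<Rightarrow> 'a::euclidean_space set \<Rightarrow> ('a \<Rightarrow> 'a \<Rightarrow> 'a) \<Rightarrow> ('a \<Rightarrow> real) set" where
  "H1p p \<Omega> a = H1p_completion p \<Omega> a (C1 \<Omega>)"

definition H1p0 ::
    "real \<Rightarrow> 'a::euclidean_space set \<Rightarrow> ('a \<Rightarrow> 'a \<Rightarrow> 'a) \<Rightarrow> ('a \<Rightarrow> real) set" where
  "H1p0 p \<Omega> a = H1p_completion p \<Omega> a (C1c \<Omega>)"

text \<open>
  The Lebesgue integral of \<open>f\<close> exists in \<open>[-\<infinity>, \<infinity>]\<close> and is at most 0. The Bochner integral
  is not used because it is 0 for functions that are not integrable.
\<close>

definition integral_nonpos :: "'a measure \<Rightarrow> ('a \<Rightarrow> real) \<Rightarrow> bool" where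
  "integral_nonpos M f \<longleftrightarrow>
     f \<in> borel_measurable M \<and>
     (\<integral>\<^sup>+x. ennreal (f x) \<partial>M) < \<infinity> \<and>
     (\<integral>\<^sup>+x. ennreal (f x) \<partial>M) \<le> (\<integral>\<^sup>+x. ennreal (- f x) \<partial>M)"

text \<open>Weak gradients are unique almost everywhere, so the choice of \<open>G\<close> and \<open>\<Phi>\<close> is immaterial.\<close>

definition weak_subsolution ::
    "real \<Rightarrow> 'a::euclidean_space set \<Rightarrow> ('a \<Rightarrow> 'a \<Rightarrow> 'a) \<Rightarrow> ('a \<Rightarrow> real) \<Rightarrow> bool" where
  "weak_subsolution p \<Omega> a u \<longleftrightarrow>
     u \<in> H1p p \<Omega> a \<and>
     (\<exists>G. has_W11_gradient \<Omega> u G \<and>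
        (\<forall>\<phi> \<Phi>. \<phi> \<in> H1p0 p \<Omega> a \<and> has_W11_gradient \<Omega> \<phi> \<Phi> \<and>
                (AE x in lebesgue_on \<Omega>. 0 \<le> \<phi> x) \<longrightarrow>
                integral_nonpos (lebesgue_on \<Omega>) (\<lambda>x. a x (G x) \<bullet> \<Phi> x)))"

definition locally_bounded_above :: "'a::euclidean_space set \<Rightarrow> ('a \<Rightarrow> real) \<Rightarrow> bool" where
  "locally_bounded_above \<Omega> u \<longleftrightarrow>
     (\<forall>x\<in>\<Omega>. \<exists>U C. open U \<and> x \<in> U \<and> U \<subseteq> \<Omega> \<and> (AE y in lebesgue_on U. u y \<le> C))"

end

theory Submission
  imports Defs
begin

text \<open>
  De Giorgi iteration on cubes, with cutoffs adapted to the subsolution. Testing with a power of a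
  cutoff \<open>\<eta>\<close> times the positive part of \<open>u - k\<close> bounds the energy
  \<open>\<integral>\<lambda> \<eta>\<^sup>m |\<nabla>(u - k)\<^sub>+|\<^sup>p\<close> by \<open>\<integral>\<mu> |\<nabla>\<eta>|\<^sup>p (u - k)\<^sub>+\<^sup>p\<close>.
  The cutoff is a product of functions of one coordinate each, whose derivatives are chosen to avoid
  the hyperplanes on which \<open>\<mu> (u - k)\<^sub>+\<^sup>p\<close> has a large integral. The right hand side
  is then controlled by an \<open>L\<^sup>\<delta>\<close> quasi-norm, \<open>\<delta> < 1\<close>, of the integrals over
  hyperplanes, and these are estimated by the Sobolev inequality in dimension \<open>d - 1\<close>; this is
  where \<open>1/s + 1/t < p/(d - 1)\<close> comes from. By Hoelder's inequality the energy dominates the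
  \<open>L\<^sup>q\<close> norm of the gradient for \<open>q = pt/(t + 1)\<close>. As the inequality between the
  exponents is strict, a slightly smaller exponent \<open>q1 < q\<close> suffices on the hyperplanes, and
  the gain \<open>\<theta> = q/q1 - 1\<close> makes the iteration superlinear.
\<close>

text \<open>Were the cutoff fixed in advance, the integral of mu (u - k)_+^p would have to be
  bounded over cubes of dimension d, and the Sobolev inequality there requires 1/s + 1/t < p/d.
  Choosing the cutoff after the function is what lowers the dimension by one. With q = pt/(t + 1)
  one has p/q = 1 + 1/t, so the hypothesis reads (d - 1)(p/q - 1 + 1/s) < p, the subcritical
  condition for potentials of order one on a hyperplane to map L^q into L^p with a weight in L^s. A
  weak derivative has no values on a single hyperplane. The estimates are therefore made for
  potentials, which are defined everywhere for Borel functions, and a function is compared with the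
  potential of its gradient only almost everywhere; by Fubini's theorem the comparison holds on
  almost every hyperplane. The exponent \<delta> solves \<delta>(1/s + p/q1) = 1. Hoelder's
  inequality in the variable normal to the hyperplanes then combines the integrals of mu^s and of
  the q1-th power of the gradient over hyperplanes into integrals over the space.\<close>

section \<open>Powers and integrals of extended nonnegative reals\<close>

text \<open>Meant for \<open>a \<ge> 0\<close>. In contrast to \<^const>\<open>powr\<close>, \<open>epow 0 0 = 1\<close>.\<close>

definition epow :: "ennreal \<Rightarrow> real \<Rightarrow> ennreal" where
  "epow x a = (if a = 0 then 1 else if x = \<infinity> then \<infinity> else ennreal (enn2real x powr a))"

lemma epow_0_right [simp]: "epow x 0 = 1"
  by (simp add: epow_def)

lemma epow_1_right [simp]: "epow x 1 = x"
  by (cases x) (auto simp: epow_def)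

lemma epow_0_left [simp]: "a \<noteq> 0 \<Longrightarrow> epow 0 a = 0"
  by (simp add: epow_def)

lemma epow_1_left [simp]: "epow 1 a = 1"
  by (simp add: epow_def)

lemma epow_top [simp]: "a \<noteq> 0 \<Longrightarrow> epow \<infinity> a = \<infinity>" "a \<noteq> 0 \<Longrightarrow> epow top a = top"
  by (simp_all add: epow_def)

lemma epow_ennreal: "0 \<le> x \<Longrightarrow> a \<noteq> 0 \<Longrightarrow> epow (ennreal x) a = ennreal (x powr a)"
  by (simp add: epow_def)

lemma epow_less_top: "x < \<infinity> \<Longrightarrow> epow x a < \<infinity>"
  by (auto simp: epow_def)

lemma epow_eq_0_iff: "epow x a = 0 \<longleftrightarrow> a \<noteq> 0 \<and> x = 0"
  by (cases x) (auto simp: epow_def)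

lemma epow_mono: "0 \<le> a \<Longrightarrow> x \<le> y \<Longrightarrow> epow x a \<le> epow y a"
  by (cases x; cases y) (auto simp: epow_def top_unique intro!: ennreal_leI powr_mono2)

lemma epow_mult: "0 \<le> a \<Longrightarrow> epow (x * y) a = epow x a * epow y a"
  by (cases x; cases y)
    (auto simp: epow_def ennreal_mult_top ennreal_top_mult powr_mult enn2real_mult
      simp flip: ennreal_mult)

lemma epow_add: "0 \<le> a \<Longrightarrow> 0 \<le> b \<Longrightarrow> epow x (a + b) = epow x a * epow x b"
  by (cases x) (auto simp: epow_def powr_add ennreal_top_mult simp flip: ennreal_mult)

lemma epow_epow: "0 \<le> a \<Longrightarrow> 0 \<le> b \<Longrightarrow> epow (epow x a) b = epow x (a * b)"
  by (cases x) (auto simp: epow_def powr_powr)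

lemma measurable_epow [measurable]:
  "f \<in> borel_measurable M \<Longrightarrow> (\<lambda>x. epow (f x) a) \<in> borel_measurable M"
  by (cases "a = 0") (simp_all add: epow_def)

lemma ennreal_Young:
  assumes "0 \<le> a" "a \<le> 1"
  shows "epow x a * epow y (1 - a) \<le> ennreal a * x + ennreal (1 - a) * y"
proof (cases "a = 0 \<or> a = 1")
  case False
  then have a: "0 < a" "a < 1" using assms by auto
  show ?thesis
  proof (cases "x = 0 \<or> y = 0 \<or> x = \<infinity> \<or> y = \<infinity>")
    case True
    then show ?thesis using a by (auto simp: ennreal_mult_top)
  next
    case False
    then obtain r s where "x = ennreal r" "y = ennreal s" "0 < r" "0 < s"
      by (cases x; cases y) (auto simp: less_le)
    then show ?thesis
      using Youngs_inequality_0[of a "1 - a" r s] a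
      by (simp add: epow_ennreal flip: ennreal_mult ennreal_plus)
  qed
qed auto

text \<open>Conjugate exponents are written as \<open>1 / a\<close> and \<open>1 / (1 - a)\<close>,
  so that the end points \<open>a = 0\<close> and \<open>a = 1\<close> are included by
  \<open>epow x 0 = 1\<close>; this covers the exponent s = 1 later. If both integrals are positive
  and finite, dividing by them reduces the claim to Young's inequality. If one vanishes, so does the
  integrand on the left almost everywhere; otherwise the right-hand side is infinite.\<close>

lemma nn_integral_Holder:
  assumes f [measurable]: "f \<in> borel_measurable M" and g [measurable]: "g \<in> borel_measurable M"
    and a: "0 \<le> a" "a \<le> 1"
  shows "(\<integral>\<^sup>+x. epow (f x) a * epow (g x) (1 - a) \<partial>M)
           \<le> epow (\<integral>\<^sup>+x. f x \<partial>M) a * epow (\<integral>\<^sup>+x. g x \<partial>M) (1 - a)"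
proof (cases "a = 0 \<or> a = 1")
  case False
  then have a: "0 < a" "a < 1" using a by auto
  define F G where "F = (\<integral>\<^sup>+x. f x \<partial>M)" and "G = (\<integral>\<^sup>+x. g x \<partial>M)"
  consider "F = 0 \<or> G = 0" | "F \<noteq> 0" "G \<noteq> 0" "F = \<infinity> \<or> G = \<infinity>"
    | "F \<noteq> 0" "G \<noteq> 0" "F \<noteq> \<infinity>" "G \<noteq> \<infinity>" by blast
  then show ?thesis
  proof cases
    case 1
    then have "AE x in M. f x = 0 \<or> g x = 0"
      unfolding F_def G_def by (auto simp: nn_integral_0_iff_AE)
    then have "AE x in M. epow (f x) a * epow (g x) (1 - a) = 0"
      by eventually_elim (use a in auto)
    then have "(\<integral>\<^sup>+x. epow (f x) a * epow (g x) (1 - a) \<partial>M) = 0"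
      by (subst nn_integral_0_iff_AE) auto
    then show ?thesis by simp
  next
    case 2
    then have "epow F a * epow G (1 - a) = \<infinity>"
      using a by (auto simp: ennreal_top_mult ennreal_mult_top epow_eq_0_iff)
    then show ?thesis by (simp add: F_def G_def)
  next
    case 3
    have F: "F * inverse F = 1" and G: "G * inverse G = 1"
      using 3 by (auto simp: less_top simp flip: divide_ennreal_def)
    let ?A = "epow F a" let ?B = "epow G (1 - a)"
    have "(\<integral>\<^sup>+x. epow (f x) a * epow (g x) (1 - a) \<partial>M)
      = (\<integral>\<^sup>+x. (?A * ?B) * (epow (f x * inverse F) a * epow (g x * inverse G) (1 - a)) \<partial>M)"
    proof (rule nn_integral_cong)
      fix x
      have "?A * epow (f x * inverse F) a = epow (f x) a"
      proof -
        have "?A * epow (f x * inverse F) a = epow (f x * (F * inverse F)) a"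
          using a by (simp add: epow_mult ac_simps)
        then show ?thesis using F by simp
      qed
      moreover have "?B * epow (g x * inverse G) (1 - a) = epow (g x) (1 - a)"
      proof -
        have "?B * epow (g x * inverse G) (1 - a) = epow (g x * (G * inverse G)) (1 - a)"
          using a by (simp add: epow_mult ac_simps)
        then show ?thesis using G by simp
      qed
      ultimately show "epow (f x) a * epow (g x) (1 - a)
          = ?A * ?B * (epow (f x * inverse F) a * epow (g x * inverse G) (1 - a))"
        by (metis mult.assoc mult.left_commute)
    qed
    also have "\<dots> = ?A * ?B * (\<integral>\<^sup>+x. epow (f x * inverse F) a * epow (g x * inverse G) (1 - a) \<partial>M)"
      by (intro nn_integral_cmult) auto
    also have "(\<integral>\<^sup>+x. epow (f x * inverse F) a * epow (g x * inverse G) (1 - a) \<partial>M)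
        \<le> (\<integral>\<^sup>+x. ennreal a * (f x * inverse F) + ennreal (1 - a) * (g x * inverse G) \<partial>M)"
      using a by (intro nn_integral_mono ennreal_Young) auto
    also have "\<dots> = ennreal a * (F * inverse F) + ennreal (1 - a) * (G * inverse G)"
      by (simp add: nn_integral_add nn_integral_cmult nn_integral_multc F_def G_def)
    also have "\<dots> = 1"
      using a F G by (simp flip: ennreal_plus)
    finally show ?thesis by (simp add: F_def G_def mult_left_mono)
  qed
qed auto

text \<open>Hoelder's inequality against the constant function 1. For total mass 1 it is Jensen's
  inequality.\<close>

lemma nn_integral_power_le:
  assumes [measurable]: "f \<in> borel_measurable M" and q: "1 \<le> q"
  shows "epow (\<integral>\<^sup>+x. f x \<partial>M) q \<le> epow (emeasure M (space M)) (q - 1) * (\<integral>\<^sup>+x. epow (f x) q \<partial>M)"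
proof -
  have "(\<integral>\<^sup>+x. f x \<partial>M) = (\<integral>\<^sup>+x. epow (epow (f x) q) (1/q) * epow 1 (1 - 1/q) \<partial>M)"
    using q by (simp add: epow_epow)
  also have "\<dots> \<le> epow (\<integral>\<^sup>+x. epow (f x) q \<partial>M) (1/q) * epow (\<integral>\<^sup>+x. 1 \<partial>M) (1 - 1/q)"
    using q by (intro nn_integral_Holder) auto
  also have "(\<integral>\<^sup>+x. 1 \<partial>M) = emeasure M (space M)"
    by simp
  finally have "epow (\<integral>\<^sup>+x. f x \<partial>M) q
      \<le> epow (epow (\<integral>\<^sup>+x. epow (f x) q \<partial>M) (1/q) * epow (emeasure M (space M)) (1 - 1/q)) q"
    by (rule epow_mono[rotated]) (use q in simp)
  also have "\<dots> = epow (\<integral>\<^sup>+x. epow (f x) q \<partial>M) (1/q * q) * epow (emeasure M (space M)) ((1 - 1/q) * q)"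
    using q by (subst epow_mult, simp, subst (1 2) epow_epow) auto
  also have "1/q * q = 1" using q by simp
  also have "(1 - 1/q) * q = q - 1" using q by (simp add: left_diff_distrib)
  finally show ?thesis by (simp add: mult.commute)
qed

section \<open>Hyperplane integrals and potentials\<close>

definition proj :: "'a::euclidean_space \<Rightarrow> 'a \<Rightarrow> 'a" where
  "proj b z = z - (z \<bullet> b) *\<^sub>R b"

definition strip :: "'a::euclidean_space \<Rightarrow> 'a set" where
  "strip b = {z. 0 \<le> z \<bullet> b \<and> z \<bullet> b \<le> 1}"

text \<open>
  The integral over the hyperplane \<open>{x. x \<bullet> b = r}\<close>: the integrand is constant in
  direction \<open>b\<close> on a strip of thickness 1.
\<close>

definition slice :: "'a::euclidean_space \<Rightarrow> ('a \<Rightarrow> ennreal) \<Rightarrow> real \<Rightarrow> ennreal" where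
  "slice b F r = (\<integral>\<^sup>+z. F (r *\<^sub>R b + proj b z) \<partial>density lborel (indicator (strip b)))"

text \<open>A translate of the unit cube: the coordinate along \<open>b\<close> runs over [0,1],
  every other one over [1,2]. For \<open>z\<close> in the shell, \<open>proj b z\<close> is parallel
  to the hyperplane and bounded away from 0 in each remaining coordinate, so that moving along it
  leaves any cube after a bounded time.\<close>

definition shell :: "'a::euclidean_space \<Rightarrow> 'a set" where
  "shell b = cbox (\<Sum>Basis - b) (2 *\<^sub>R \<Sum>Basis - b)"

text \<open>The mean value over a (d - 1)-dimensional cube of side \<open>\<tau>\<close> in the
  hyperplane through \<open>x\<close>, placed at a distance comparable to \<open>\<tau>\<close>.
  Integrating over the full-dimensional shell instead of a set in the hyperplane keeps everything in
  terms of Lebesgue measure on one space.\<close>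

definition avg :: "'a::euclidean_space \<Rightarrow> real \<Rightarrow> ('a \<Rightarrow> ennreal) \<Rightarrow> 'a \<Rightarrow> ennreal" where
  "avg b \<tau> h x = (\<integral>\<^sup>+z. h (x + \<tau> *\<^sub>R proj b z) \<partial>density lborel (indicator (shell b)))"

text \<open>A truncated Riesz potential of order one inside the hyperplane, restricted to a cone:
  carrying out the integration in \<open>\<tau>\<close> gives a kernel comparable to |y| to the
  power 2 - d, where d - 1 is the dimension of the hyperplane.\<close>

definition pot :: "'a::euclidean_space \<Rightarrow> real \<Rightarrow> ('a \<Rightarrow> ennreal) \<Rightarrow> 'a \<Rightarrow> ennreal" where
  "pot b L h x = (\<integral>\<^sup>+\<tau>. avg b \<tau> h x \<partial>density lborel (indicator {0<..L}))"

lemma proj_measurable [measurable]: "proj b \<in> borel_measurable borel"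
  unfolding proj_def by measurable

lemma strip_sets [measurable]: "strip b \<in> sets borel"
proof -
  have "strip b = {z \<in> space borel. 0 \<le> z \<bullet> b \<and> z \<bullet> b \<le> 1}" by (auto simp: strip_def)
  also have "\<dots> \<in> sets borel" by measurable
  finally show ?thesis .
qed

lemma shell_sets [measurable]: "shell b \<in> sets borel"
  by (simp add: shell_def)

lemma shell_inner:
  assumes "b \<in> Basis" "z \<in> shell b"
  shows "0 \<le> z \<bullet> b" "z \<bullet> b \<le> 1" "c \<in> Basis \<Longrightarrow> c \<noteq> b \<Longrightarrow> 1 \<le> z \<bullet> c"
    "c \<in> Basis \<Longrightarrow> c \<noteq> b \<Longrightarrow> z \<bullet> c \<le> 2"
  using assms unfolding shell_def mem_box
  by (force simp: inner_diff_left inner_sum_left_Basis inner_not_same_Basis)+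

lemma emeasure_shell: "b \<in> Basis \<Longrightarrow> emeasure lborel (shell b) = 1"
  unfolding shell_def
  by (subst emeasure_lborel_cbox_eq)
    (auto simp: inner_diff_left inner_sum_left_Basis inner_Basis)

lemma emeasure_shell_space:
  assumes "b \<in> Basis"
  shows "emeasure (density lborel (indicator (shell b))) (space (density lborel (indicator (shell b)))) = 1"
  using emeasure_shell[OF assms] by (simp add: emeasure_density)

lemma proj_inner: "b \<in> Basis \<Longrightarrow> proj b z \<bullet> b = 0"
  by (simp add: proj_def inner_diff_left)

lemma slice_unfold:
  assumes [measurable]: "F \<in> borel_measurable borel"
  shows "slice b F r = (\<integral>\<^sup>+z. indicator (strip b) z * F (r *\<^sub>R b + proj b z) \<partial>lborel)"
  unfolding slice_def by (subst nn_integral_density) auto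

lemma avg_unfold:
  assumes [measurable]: "h \<in> borel_measurable borel"
  shows "avg b \<tau> h x = (\<integral>\<^sup>+z. indicator (shell b) z * h (x + \<tau> *\<^sub>R proj b z) \<partial>lborel)"
  unfolding avg_def by (subst nn_integral_density) auto

section \<open>Measurability in the parameters\<close>

lemma slice_measurable [measurable]:
  assumes [measurable]: "F \<in> borel_measurable borel"
  shows "slice b F \<in> borel_measurable borel"
  unfolding slice_unfold[OF assms, abs_def] by measurable

lemma avg_measurable_pair:
  assumes [measurable]: "h \<in> borel_measurable borel"
  shows "(\<lambda>(x, \<tau>). avg b \<tau> h x) \<in> borel_measurable (borel \<Otimes>\<^sub>M borel)"
  unfolding avg_unfold[OF assms, abs_def] by measurable

lemma avg_measurable [measurable (raw)]:
  assumes [measurable]: "h \<in> borel_measurable borel" "f \<in> borel_measurable M" "g \<in> borel_measurable M"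
  shows "(\<lambda>x. avg b (f x) h (g x)) \<in> borel_measurable M"
  using measurable_compose[OF _ avg_measurable_pair[OF assms(1), of b], of "\<lambda>x. (g x, f x)" M]
  by simp

lemma pot_unfold:
  assumes [measurable]: "h \<in> borel_measurable borel"
  shows "pot b L h x = (\<integral>\<^sup>+\<tau>. indicator {0<..L} \<tau> * avg b \<tau> h x \<partial>lborel)"
  unfolding pot_def by (subst nn_integral_density) auto

lemma pot_measurable [measurable (raw)]:
  assumes [measurable]: "h \<in> borel_measurable borel" "g \<in> borel_measurable M"
  shows "(\<lambda>x. pot b L h (g x)) \<in> borel_measurable M"
proof -
  have "pot b L h \<in> borel_measurable borel"
    unfolding pot_unfold[OF assms(1), abs_def] by measurable
  from measurable_compose[OF assms(2) this] show ?thesis .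
qed

section \<open>Translation invariance and Fubini's theorem for hyperplane integrals\<close>

lemma nn_integral_lborel_shift:
  fixes v :: "'a::euclidean_space"
  assumes [measurable]: "F \<in> borel_measurable borel"
  shows "(\<integral>\<^sup>+x. F (v + x) \<partial>lborel) = (\<integral>\<^sup>+x. F x \<partial>lborel)"
    and "(\<integral>\<^sup>+x. F (x + v) \<partial>lborel) = (\<integral>\<^sup>+x. F x \<partial>lborel)"
proof -
  have "(\<integral>\<^sup>+x. F x \<partial>lborel) = (\<integral>\<^sup>+x. F x \<partial>distr lborel borel ((+) v))"
    by (simp add: lborel_distr_plus)
  also have "\<dots> = (\<integral>\<^sup>+x. F (v + x) \<partial>lborel)"
    by (subst nn_integral_distr) auto
  finally show "(\<integral>\<^sup>+x. F (v + x) \<partial>lborel) = (\<integral>\<^sup>+x. F x \<partial>lborel)" by simp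
  then show "(\<integral>\<^sup>+x. F (x + v) \<partial>lborel) = (\<integral>\<^sup>+x. F x \<partial>lborel)" by (simp add: add.commute)
qed

lemma nn_integral_swap:
  fixes f :: "'a::euclidean_space \<Rightarrow> 'b::euclidean_space \<Rightarrow> ennreal"
  assumes "(\<lambda>(x, y). f x y) \<in> borel_measurable (borel \<Otimes>\<^sub>M borel)"
  shows "(\<integral>\<^sup>+x. \<integral>\<^sup>+y. f x y \<partial>lborel \<partial>lborel) = (\<integral>\<^sup>+y. \<integral>\<^sup>+x. f x y \<partial>lborel \<partial>lborel)"
proof -
  have "(\<lambda>(x, y). f x y) \<in> borel_measurable (lborel \<Otimes>\<^sub>M lborel)"
    using assms by (simp cong: measurable_cong_sets sets_pair_measure_cong)
  from lborel_pair.Fubini'[OF this] show ?thesis by simp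
qed

text \<open>Fubini's theorem without splitting the space. Translating \<open>r\<close> by
  \<open>z \<bullet> b\<close> replaces \<open>proj b z\<close> by \<open>z\<close>; translating
  \<open>z\<close> then moves \<open>r\<close> into the indicator of the strip, which has thickness
  1 and integrates to 1 in \<open>r\<close>.\<close>

lemma nn_integral_slice:
  assumes b: "b \<in> Basis" and [measurable]: "F \<in> borel_measurable borel"
  shows "(\<integral>\<^sup>+r. slice b F r \<partial>lborel) = (\<integral>\<^sup>+x. F x \<partial>lborel)"
proof -
  have "(\<integral>\<^sup>+r. slice b F r \<partial>lborel)
      = (\<integral>\<^sup>+z. \<integral>\<^sup>+r. indicator (strip b) z * F (r *\<^sub>R b + proj b z) \<partial>lborel \<partial>lborel)"
    unfolding slice_unfold[OF assms(2)] by (rule nn_integral_swap) measurable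
  also have "\<dots> = (\<integral>\<^sup>+z. \<integral>\<^sup>+r. indicator (strip b) z * F (r *\<^sub>R b + z) \<partial>lborel \<partial>lborel)"
  proof (rule nn_integral_cong)
    fix z :: 'a
    have "(\<integral>\<^sup>+r. indicator (strip b) z * F (r *\<^sub>R b + proj b z) \<partial>lborel)
       = (\<integral>\<^sup>+r. indicator (strip b) z * F ((z \<bullet> b + r) *\<^sub>R b + proj b z) \<partial>lborel)"
      by (subst nn_integral_lborel_shift(1)[where v = "z \<bullet> b", symmetric]) auto
    also have "\<dots> = (\<integral>\<^sup>+r. indicator (strip b) z * F (r *\<^sub>R b + z) \<partial>lborel)"
      by (simp add: proj_def scaleR_left_distrib)
    finally show "(\<integral>\<^sup>+r. indicator (strip b) z * F (r *\<^sub>R b + proj b z) \<partial>lborel)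
      = (\<integral>\<^sup>+r. indicator (strip b) z * F (r *\<^sub>R b + z) \<partial>lborel)" .
  qed
  also have "\<dots> = (\<integral>\<^sup>+r. \<integral>\<^sup>+z. indicator (strip b) z * F (r *\<^sub>R b + z) \<partial>lborel \<partial>lborel)"
    by (rule nn_integral_swap) measurable
  also have "\<dots> = (\<integral>\<^sup>+r. \<integral>\<^sup>+z. indicator (strip b) (z - r *\<^sub>R b) * F z \<partial>lborel \<partial>lborel)"
  proof (rule nn_integral_cong)
    fix r :: real
    show "(\<integral>\<^sup>+z. indicator (strip b) z * F (r *\<^sub>R b + z) \<partial>lborel)
        = (\<integral>\<^sup>+z. indicator (strip b) (z - r *\<^sub>R b) * F z \<partial>lborel)"
      by (subst nn_integral_lborel_shift(1)[where v = "r *\<^sub>R b", symmetric]) auto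
  qed
  also have "\<dots> = (\<integral>\<^sup>+z. \<integral>\<^sup>+r. indicator (strip b) (z - r *\<^sub>R b) * F z \<partial>lborel \<partial>lborel)"
    by (rule nn_integral_swap) measurable
  also have "\<dots> = (\<integral>\<^sup>+z. F z \<partial>lborel)"
  proof (rule nn_integral_cong)
    fix z :: 'a
    have "(\<integral>\<^sup>+r. indicator (strip b) (z - r *\<^sub>R b) * F z \<partial>lborel)
        = (\<integral>\<^sup>+r. indicator {z \<bullet> b - 1 .. z \<bullet> b} r * F z \<partial>lborel)"
      by (intro nn_integral_cong arg_cong2[where f = "(*)"])
        (use b in \<open>auto simp: strip_def inner_diff_left split: split_indicator\<close>)
    then show "(\<integral>\<^sup>+r. indicator (strip b) (z - r *\<^sub>R b) * F z \<partial>lborel) = F z"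
      by (simp add: nn_integral_multc)
  qed
  finally show ?thesis .
qed

lemma slice_shift:
  assumes [measurable]: "F \<in> borel_measurable borel" and v: "v \<bullet> b = 0"
  shows "slice b (\<lambda>x. F (x + v)) r = slice b F r"
proof -
  have "slice b F r = (\<integral>\<^sup>+z. indicator (strip b) (z + v) * F (r *\<^sub>R b + proj b (z + v)) \<partial>lborel)"
    unfolding slice_unfold[OF assms(1)] by (subst nn_integral_lborel_shift(2)[where v = v]) auto
  also have "\<dots> = slice b (\<lambda>x. F (x + v)) r"
    by (subst slice_unfold)
      (auto simp: strip_def proj_def inner_add_left v algebra_simps intro!: nn_integral_cong
         split: split_indicator)
  finally show ?thesis ..
qed

text \<open>The average moves mass only parallel to the hyperplane, and the shell has measure
  1.\<close>

lemma slice_avg: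
  assumes b: "b \<in> Basis" and [measurable]: "h \<in> borel_measurable borel"
  shows "slice b (avg b \<tau> h) r = slice b h r"
proof -
  have "slice b (avg b \<tau> h) r = (\<integral>\<^sup>+y. \<integral>\<^sup>+z. indicator (strip b) y * (indicator (shell b) z *
       h (r *\<^sub>R b + proj b y + \<tau> *\<^sub>R proj b z)) \<partial>lborel \<partial>lborel)"
    by (subst slice_unfold) (auto simp: avg_unfold nn_integral_cmult)
  also have "\<dots> = (\<integral>\<^sup>+z. \<integral>\<^sup>+y. indicator (strip b) y * (indicator (shell b) z *
       h (r *\<^sub>R b + proj b y + \<tau> *\<^sub>R proj b z)) \<partial>lborel \<partial>lborel)"
    by (rule nn_integral_swap) measurable
  also have "\<dots> = (\<integral>\<^sup>+z. indicator (shell b) z * slice b (\<lambda>x. h (x + \<tau> *\<^sub>R proj b z)) r \<partial>lborel)"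
    by (subst slice_unfold) (auto simp: nn_integral_cmult mult.left_commute)
  also have "\<dots> = (\<integral>\<^sup>+z. indicator (shell b) z * slice b h r \<partial>lborel)"
    using b by (subst slice_shift) (auto simp: proj_inner)
  also have "\<dots> = slice b h r"
    using b by (simp add: nn_integral_multc emeasure_shell)
  finally show ?thesis .
qed

lemma nn_integral_avg:
  assumes b: "b \<in> Basis" and [measurable]: "h \<in> borel_measurable borel"
  shows "(\<integral>\<^sup>+x. avg b \<tau> h x \<partial>lborel) = (\<integral>\<^sup>+x. h x \<partial>lborel)"
  using assms by (simp add: slice_avg flip: nn_integral_slice[OF b])

text \<open>The diagonal map with factor 1 along \<open>b\<close> and \<open>\<tau>\<close> in all
  other directions, in the coordinate form of the change of variables formula. Its determinant is
  \<open>\<tau>\<close> to the power d - 1.\<close>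

lemma proj_scale:
  assumes b: "b \<in> Basis"
  shows "(\<Sum>j\<in>Basis. ((if j = b then 1 else \<tau>) * (y \<bullet> j)) *\<^sub>R j) = \<tau> *\<^sub>R proj b y + (y \<bullet> b) *\<^sub>R b"
proof (rule euclidean_eqI)
  fix i :: 'a assume i: "i \<in> Basis"
  show "(\<Sum>j\<in>Basis. ((if j = b then 1 else \<tau>) * (y \<bullet> j)) *\<^sub>R j) \<bullet> i
      = (\<tau> *\<^sub>R proj b y + (y \<bullet> b) *\<^sub>R b) \<bullet> i"
    unfolding inner_sum_left_Basis[OF i] using b i
    by (cases "i = b") (auto simp: proj_def inner_add_left inner_diff_left inner_Basis)
qed

text \<open>An average over a cube of side \<open>\<tau>\<close> is at most the total integral
  divided by the measure of the cube. The diagonal map of \<open>proj_scale\<close> carries out the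
  dilation, and the shell lies in the strip.\<close>

lemma avg_le_slice:
  assumes b: "b \<in> Basis" and \<tau>: "0 < \<tau>" and [measurable]: "h \<in> borel_measurable borel"
  shows "ennreal (\<tau> ^ (DIM('a) - 1)) * avg b \<tau> h x \<le> slice b h ((x::'a::euclidean_space) \<bullet> b)"
proof -
  define c where "c = (\<lambda>j::'a. if j = b then 1 else \<tau>)"
  define U where "U = (\<lambda>y. proj b x + (\<Sum>j\<in>Basis. (c j * (y \<bullet> j)) *\<^sub>R j))"
  have U: "U y = proj b x + \<tau> *\<^sub>R proj b y + (y \<bullet> b) *\<^sub>R b" for y
    unfolding U_def c_def proj_scale[OF b] add.assoc ..
  have c: "(\<Prod>j\<in>Basis. \<bar>c j\<bar>) = \<tau> ^ (DIM('a) - 1)"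
    using b \<tau> by (subst prod.remove[of _ b]) (auto simp: c_def)
  have [measurable]: "U \<in> borel_measurable borel" unfolding U_def by measurable
  have lb: "lborel = density (distr lborel borel U) (\<lambda>_. ennreal (\<tau> ^ (DIM('a) - 1)))"
    unfolding c[symmetric] U_def by (rule lborel_affine_euclidean) (use \<tau> in \<open>auto simp: c_def\<close>)
  let ?f = "\<lambda>z. indicator (strip b) z * h ((x \<bullet> b) *\<^sub>R b + proj b z)"
  have "slice b h (x \<bullet> b) = (\<integral>\<^sup>+z. ?f z \<partial>density (distr lborel borel U) (\<lambda>_. ennreal (\<tau> ^ (DIM('a) - 1))))"
    by (subst lb[symmetric]) (simp add: slice_unfold)
  also have "\<dots> = ennreal (\<tau> ^ (DIM('a) - 1)) * (\<integral>\<^sup>+z. ?f (U z) \<partial>lborel)"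
    by (simp add: nn_integral_density nn_integral_cmult nn_integral_distr)
  also have "(\<integral>\<^sup>+z. ?f (U z) \<partial>lborel) = (\<integral>\<^sup>+z. indicator (strip b) z * h (x + \<tau> *\<^sub>R proj b z) \<partial>lborel)"
  proof (rule nn_integral_cong)
    fix z
    have "U z \<bullet> b = z \<bullet> b" using b by (simp add: U inner_add_left proj_inner)
    moreover have "(x \<bullet> b) *\<^sub>R b + proj b (U z) = x + \<tau> *\<^sub>R proj b z"
      using b \<open>U z \<bullet> b = z \<bullet> b\<close> unfolding proj_def[of b "U z"] by (simp add: U) (simp add: proj_def)
    ultimately show "?f (U z) = indicator (strip b) z * h (x + \<tau> *\<^sub>R proj b z)"
      by (simp add: strip_def indicator_def)
  qed
  finally have eq: "slice b h (x \<bullet> b)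
      = ennreal (\<tau> ^ (DIM('a) - 1)) * (\<integral>\<^sup>+z. indicator (strip b) z * h (x + \<tau> *\<^sub>R proj b z) \<partial>lborel)" .
  have "avg b \<tau> h x \<le> (\<integral>\<^sup>+z. indicator (strip b) z * h (x + \<tau> *\<^sub>R proj b z) \<partial>lborel)"
    unfolding avg_unfold[OF assms(3)]
    using shell_inner[OF b] by (intro nn_integral_mono) (auto simp: strip_def split: split_indicator)
  then show ?thesis unfolding eq by (intro mult_left_mono) auto
qed

section \<open>Jensen's and Hoelder's inequalities on hyperplanes\<close>

lemma slice_mono: 
  assumes "b \<in> Basis" "\<And>x. x \<bullet> b = r \<Longrightarrow> F x \<le> G x"
  shows "slice b F r \<le> slice b G r"
  unfolding slice_def using assms
  by (intro nn_integral_mono) (auto simp: inner_add_left proj_inner)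

lemma slice_cmult:
  assumes [measurable]: "F \<in> borel_measurable borel"
  shows "slice b (\<lambda>x. c * F x) r = c * slice b F r"
  unfolding slice_def by (intro nn_integral_cmult) auto

lemma slice_Holder:
  assumes [measurable]: "F \<in> borel_measurable borel" "G \<in> borel_measurable borel"
    and "0 \<le> a" "a \<le> 1"
  shows "slice b (\<lambda>x. epow (F x) a * epow (G x) (1 - a)) r
     \<le> epow (slice b F r) a * epow (slice b G r) (1 - a)"
  unfolding slice_def using assms by (intro nn_integral_Holder) auto

lemma epow_avg_le:
  assumes b: "b \<in> Basis" and [measurable]: "h \<in> borel_measurable borel" and q: "1 \<le> q"
  shows "epow (avg b \<tau> h x) q \<le> avg b \<tau> (\<lambda>x. epow (h x) q) x"
proof -
  have "epow (avg b \<tau> h x) q \<le> epow 1 (q - 1) * avg b \<tau> (\<lambda>x. epow (h x) q) x"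
    unfolding avg_def emeasure_shell_space[OF b, symmetric]
    by (intro nn_integral_power_le) (use q in auto)
  then show ?thesis by simp
qed

text \<open>With \<open>H\<close> the q-th power of \<open>h\<close>, Jensen's inequality bounds the
  p-th power of the average of \<open>h\<close> by the power p/q of the average of \<open>H\<close>.
  That exponent is split into \<open>e\<close> and \<open>1 - 1/s\<close>: the first factor is
  estimated by its supremum, which costs \<open>\<tau>\<close> to the power -(d - 1)
  \<open>e\<close>, the second by Hoelder's inequality against \<open>\<mu>\<close>.\<close>

lemma slice_avg_power:
  fixes \<mu> h :: "'a::euclidean_space \<Rightarrow> ennreal"
  assumes b: "b \<in> Basis" and [measurable]: "\<mu> \<in> borel_measurable borel" "h \<in> borel_measurable borel"
    and \<tau>: "0 < \<tau>" and q: "1 \<le> q" "q \<le> p" and s: "1 \<le> s"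
  shows "slice b (\<lambda>x. \<mu> x * epow (avg b \<tau> h x) p) r
     \<le> ennreal (\<tau> powr (- (real (DIM('a) - 1) * (p/q - 1 + 1/s)))) *
         (epow (slice b (\<lambda>x. epow (\<mu> x) s) r) (1/s) * epow (slice b (\<lambda>x. epow (h x) q) r) (p/q))"
proof -
  define H where "H = (\<lambda>x. epow (h x) q)"
  define n where "n = real (DIM('a) - 1)"
  define e where "e = p/q - 1 + 1/s"
  have [measurable]: "H \<in> borel_measurable borel" unfolding H_def by measurable
  have pq: "1 \<le> p/q" using q by simp
  have e: "0 < e" using pq s by (simp add: e_def add_nonneg_pos)
  have es: "p/q = e + (1 - 1/s)" and s': "0 \<le> 1 - 1/s" "1 - 1/s \<le> 1" using s by (auto simp: e_def)
  have sup: "avg b \<tau> H x \<le> ennreal (\<tau> powr (-n)) * slice b H (x \<bullet> b)" for x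
  proof -
    have "ennreal (\<tau> powr (-n)) * (ennreal (\<tau> ^ (DIM('a) - 1)) * avg b \<tau> H x)
       \<le> ennreal (\<tau> powr (-n)) * slice b H (x \<bullet> b)"
      using avg_le_slice[OF b \<tau>, of H x] by (intro mult_left_mono) auto
    moreover have "ennreal (\<tau> powr (-n)) * ennreal (\<tau> ^ (DIM('a) - 1)) = 1"
      using \<tau> unfolding n_def powr_minus powr_realpow[OF \<tau>] by (simp flip: ennreal_mult)
    ultimately show ?thesis by (simp add: mult.assoc[symmetric])
  qed
  let ?K = "epow (ennreal (\<tau> powr (-n)) * slice b H r) e"
  have "slice b (\<lambda>x. \<mu> x * epow (avg b \<tau> h x) p) r
      \<le> slice b (\<lambda>x. ?K * (\<mu> x * epow (avg b \<tau> H x) (1 - 1/s))) r"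
  proof (rule slice_mono[OF b])
    fix x assume x: "x \<bullet> b = r"
    have "epow (avg b \<tau> h x) p = epow (epow (avg b \<tau> h x) q) (p/q)"
      using q by (simp add: epow_epow)
    also have "\<dots> \<le> epow (avg b \<tau> H x) (p/q)"
      unfolding H_def using q pq by (intro epow_mono epow_avg_le b) auto
    also have "\<dots> = epow (avg b \<tau> H x) e * epow (avg b \<tau> H x) (1 - 1/s)"
      unfolding es using e s' by (intro epow_add) auto
    also have "\<dots> \<le> ?K * epow (avg b \<tau> H x) (1 - 1/s)"
      using e sup[of x] x by (intro mult_right_mono epow_mono) auto
    finally have "\<mu> x * epow (avg b \<tau> h x) p \<le> \<mu> x * (?K * epow (avg b \<tau> H x) (1 - 1/s))"
      by (rule mult_left_mono) simp
    then show "\<mu> x * epow (avg b \<tau> h x) p \<le> ?K * (\<mu> x * epow (avg b \<tau> H x) (1 - 1/s))"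
      by (subst mult.left_commute)
  qed
  also have "\<dots> = ?K * slice b (\<lambda>x. \<mu> x * epow (avg b \<tau> H x) (1 - 1/s)) r"
    by (rule slice_cmult) measurable
  also have "slice b (\<lambda>x. \<mu> x * epow (avg b \<tau> H x) (1 - 1/s)) r
    = slice b (\<lambda>x. epow (epow (\<mu> x) s) (1/s) * epow (avg b \<tau> H x) (1 - 1/s)) r"
    using s by (simp add: epow_epow)
  also have "\<dots> \<le> epow (slice b (\<lambda>x. epow (\<mu> x) s) r) (1/s) * epow (slice b (avg b \<tau> H) r) (1 - 1/s)"
    using s by (intro slice_Holder) (auto simp: eta_contract_eq)
  also have "slice b (avg b \<tau> H) r = slice b H r" by (simp add: slice_avg b)
  also have "?K = ennreal (\<tau> powr (-(n * e))) * epow (slice b H r) e"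
    using e by (simp add: epow_mult epow_ennreal powr_powr)
  finally have "slice b (\<lambda>x. \<mu> x * epow (avg b \<tau> h x) p) r
     \<le> ennreal (\<tau> powr (-(n * e))) * epow (slice b H r) e *
        (epow (slice b (\<lambda>x. epow (\<mu> x) s) r) (1/s) * epow (slice b H r) (1 - 1/s))"
    by (simp add: mult_left_mono)
  also have "\<dots> = ennreal (\<tau> powr (-(n * e))) *
        (epow (slice b (\<lambda>x. epow (\<mu> x) s) r) (1/s) * (epow (slice b H r) e * epow (slice b H r) (1 - 1/s)))"
    by (simp add: ac_simps)
  also have "epow (slice b H r) e * epow (slice b H r) (1 - 1/s) = epow (slice b H r) (p/q)"
    unfolding es using e s' by (intro epow_add[symmetric]) auto
  finally show ?thesis by (simp add: H_def n_def e_def)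
qed

lemma nn_integral_powr_Ioc:
  assumes "-1 < a" "0 \<le> L"
  shows "(\<integral>\<^sup>+\<tau>. ennreal (\<tau> powr a) \<partial>density lborel (indicator {0<..L})) = ennreal (L powr (a+1) / (a+1))"
proof -
  have "(\<integral>\<^sup>+\<tau>. ennreal (\<tau> powr a) \<partial>density lborel (indicator {0<..L}))
     = (\<integral>\<^sup>+\<tau>. ennreal (indicator {0<..L} \<tau> * \<tau> powr a) \<partial>lborel)"
    by (simp add: nn_integral_density ennreal_mult' ennreal_indicator)
  also have "\<dots> = ennreal (L powr (a+1) / (a+1))"
  proof (rule nn_integral_has_integral_lborel)
    have "(\<lambda>x. indicat_real {0<..L} x * x powr a) = (\<lambda>x. if x \<in> {0..L} then x powr a else 0)"
      by (rule ext) (use less_le in \<open>auto split: split_indicator\<close>)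
    then show "((\<lambda>x. indicat_real {0<..L} x * x powr a) has_integral L powr (a + 1) / (a + 1)) UNIV"
      using has_integral_powr_from_0[OF assms] by (simp only: has_integral_restrict_UNIV)
  qed auto
  finally show ?thesis .
qed

text \<open>
  The Sobolev inequality on hyperplanes, for potentials instead of functions. The hypothesis is
  subcritical, so Hoelder's inequality with a power weight in \<open>\<tau>\<close> suffices.
\<close>

lemma slice_pot_power:
  fixes p q s L :: real
  assumes p: "1 < p" and q: "1 \<le> q" "q \<le> p" and s: "1 \<le> s" and L: "0 \<le> L"
    and \<kappa>: "real (DIM('a::euclidean_space) - 1) * (p/q - 1 + 1/s) < p"
  obtains C :: real where "0 \<le> C"
    "\<And>(b::'a) \<mu> h r. b \<in> Basis \<Longrightarrow> \<mu> \<in> borel_measurable borel \<Longrightarrow> h \<in> borel_measurable borel \<Longrightarrow>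
      slice b (\<lambda>x. \<mu> x * epow (pot b L h x) p) r \<le> ennreal C *
        (epow (slice b (\<lambda>x. epow (\<mu> x) s) r) (1/s) * epow (slice b (\<lambda>x. epow (h x) q) r) (p/q))"
proof -
  define \<kappa> where "\<kappa> = real (DIM('a) - 1) * (p/q - 1 + 1/s)"
  \<comment> \<open>\<open>\<beta> * p\<close> is the midpoint of \<open>\<kappa> - 1\<close> and
    \<open>p - 1\<close>. As \<open>\<kappa> < p\<close>, both powers of \<open>\<tau>\<close> below
    have exponents greater than -1 and are integrable at 0.\<close>
  define \<beta> where "\<beta> = (\<kappa> + p - 2) / (2 * p)"
  define D where "D = density lborel (indicator {0<..L :: real})"
  have b1: "-1 < - (\<beta> * p / (p - 1))" and b2: "-1 < \<beta> * p - \<kappa>"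
    using p \<kappa>[folded \<kappa>_def] by (auto simp: \<beta>_def field_simps)
  define c1 where "c1 = L powr (- (\<beta> * p / (p - 1)) + 1) / (- (\<beta> * p / (p - 1)) + 1)"
  define c2 where "c2 = L powr (\<beta> * p - \<kappa> + 1) / (\<beta> * p - \<kappa> + 1)"
  have c: "0 \<le> c1" "0 \<le> c2" unfolding c1_def c2_def using b1 b2 by (intro divide_nonneg_nonneg; simp)+
  have I1: "(\<integral>\<^sup>+\<tau>. ennreal (\<tau> powr (- (\<beta> * p / (p - 1)))) \<partial>D) = ennreal c1"
    unfolding D_def c1_def using b1 L by (rule nn_integral_powr_Ioc)
  have I2: "(\<integral>\<^sup>+\<tau>. ennreal (\<tau> powr (\<beta> * p - \<kappa>)) \<partial>D) = ennreal c2"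
    unfolding D_def c2_def using b2 L by (rule nn_integral_powr_Ioc)
  have AED: "AE \<tau> in D. 0 < \<tau>"
    unfolding D_def by (subst AE_density) (auto split: split_indicator)
  show ?thesis
  proof (rule that[of "c1 powr (p - 1) * c2"])
    show "0 \<le> c1 powr (p - 1) * c2" using c by simp
    fix b :: 'a and \<mu> h :: "'a \<Rightarrow> ennreal" and r :: real
    assume b: "b \<in> Basis" and [measurable]: "\<mu> \<in> borel_measurable borel" "h \<in> borel_measurable borel"
    let ?W = "\<lambda>\<tau>. ennreal (\<tau> powr (\<beta> * p))"
    let ?Y = "epow (slice b (\<lambda>x. epow (\<mu> x) s) r) (1/s) * epow (slice b (\<lambda>x. epow (h x) q) r) (p/q)"
    have pot: "epow (pot b L h x) p \<le> ennreal (c1 powr (p - 1)) * (\<integral>\<^sup>+\<tau>. ?W \<tau> * epow (avg b \<tau> h x) p \<partial>D)" for x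
    proof -
      have [measurable]: "(\<lambda>\<tau>. avg b \<tau> h x) \<in> borel_measurable D" unfolding D_def by measurable
      have [measurable]: "(\<lambda>\<tau>. \<tau> powr a) \<in> borel_measurable D" for a unfolding D_def by measurable
      \<comment> \<open>A power weight is inserted for Hoelder's inequality; the two powers of
        \<open>\<tau>\<close> cancel.\<close>
      have "pot b L h x = (\<integral>\<^sup>+\<tau>. epow (?W \<tau> * epow (avg b \<tau> h x) p) (1/p) *
           epow (ennreal (\<tau> powr (- (\<beta> * p / (p - 1))))) (1 - 1/p) \<partial>D)"
        unfolding pot_def D_def[symmetric]
      proof (rule nn_integral_cong_AE)
        show "AE \<tau> in D. avg b \<tau> h x = epow (?W \<tau> * epow (avg b \<tau> h x) p) (1/p) *
           epow (ennreal (\<tau> powr (- (\<beta> * p / (p - 1))))) (1 - 1/p)"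
          using AED
        proof eventually_elim
          fix \<tau> :: real assume \<tau>: "0 < \<tau>"
          have "epow (ennreal (\<tau> powr (- (\<beta> * p / (p - 1))))) (1 - 1/p) = ennreal (\<tau> powr (-\<beta>))"
          proof -
            have "1 - 1/p = (p - 1) / p" using p by (simp add: diff_divide_distrib)
            then have e: "- (\<beta> * p / (p - 1)) * (1 - 1/p) = - \<beta>" using p by simp
            have "1 - 1/p \<noteq> 0" using p by simp
            then show ?thesis by (subst epow_ennreal) (simp_all only: powr_powr e powr_ge_zero not_False_eq_True)
          qed
          moreover have "epow (?W \<tau> * epow (avg b \<tau> h x) p) (1/p) = ennreal (\<tau> powr \<beta>) * avg b \<tau> h x"
            using p by (simp add: epow_mult epow_epow epow_ennreal powr_powr)
          moreover have "ennreal (\<tau> powr \<beta>) * ennreal (\<tau> powr (-\<beta>)) = 1"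
            using \<tau> by (simp add: powr_minus flip: ennreal_mult)
          ultimately show "avg b \<tau> h x = epow (?W \<tau> * epow (avg b \<tau> h x) p) (1/p) *
             epow (ennreal (\<tau> powr (- (\<beta> * p / (p - 1))))) (1 - 1/p)"
            by (simp add: mult.commute[of _ "avg b \<tau> h x"] mult.assoc)
        qed
      qed
      also have "\<dots> \<le> epow (\<integral>\<^sup>+\<tau>. ?W \<tau> * epow (avg b \<tau> h x) p \<partial>D) (1/p) * epow (ennreal c1) (1 - 1/p)"
        unfolding I1[symmetric] using p by (intro nn_integral_Holder) auto
      finally have "epow (pot b L h x) p \<le>
          epow (epow (\<integral>\<^sup>+\<tau>. ?W \<tau> * epow (avg b \<tau> h x) p \<partial>D) (1/p) * epow (ennreal c1) (1 - 1/p)) p"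
        using p by (intro epow_mono) auto
      also have "\<dots> = ennreal (c1 powr (p - 1)) * (\<integral>\<^sup>+\<tau>. ?W \<tau> * epow (avg b \<tau> h x) p \<partial>D)"
      proof -
        have "(1 - 1/p) * p = p - 1" using p by (simp add: left_diff_distrib)
        then have "epow (epow (ennreal c1) (1 - 1/p)) p = ennreal (c1 powr (p - 1))"
          using p c by (subst epow_epow) (auto simp: epow_ennreal)
        then show ?thesis
          using p by (simp add: epow_mult epow_epow mult.commute[of _ "ennreal (c1 powr (p - 1))"])
      qed
      finally show ?thesis .
    qed
    have pot_int: "(\<integral>\<^sup>+\<tau>. ?W \<tau> * epow (avg b \<tau> h x) p \<partial>D)
       = (\<integral>\<^sup>+\<tau>. indicator {0<..L} \<tau> * (?W \<tau> * epow (avg b \<tau> h x) p) \<partial>lborel)" for x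
      unfolding D_def by (subst nn_integral_density) auto
    have "slice b (\<lambda>x. \<mu> x * epow (pot b L h x) p) r
        \<le> slice b (\<lambda>x. ennreal (c1 powr (p - 1)) *
             (\<mu> x * (\<integral>\<^sup>+\<tau>. indicator {0<..L} \<tau> * (?W \<tau> * epow (avg b \<tau> h x) p) \<partial>lborel))) r"
    proof (rule slice_mono[OF b])
      fix x
      let ?I = "\<integral>\<^sup>+\<tau>. indicator {0<..L} \<tau> * (?W \<tau> * epow (avg b \<tau> h x) p) \<partial>lborel"
      have "\<mu> x * epow (pot b L h x) p \<le> \<mu> x * (ennreal (c1 powr (p - 1)) * ?I)"
        by (rule mult_left_mono[OF pot[of x, unfolded pot_int]]) simp
      then show "\<mu> x * epow (pot b L h x) p \<le> ennreal (c1 powr (p - 1)) * (\<mu> x * ?I)"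
        by (subst mult.left_commute)
    qed
    also have "\<dots> = ennreal (c1 powr (p - 1)) * slice b (\<lambda>x. 
         (\<mu> x * (\<integral>\<^sup>+\<tau>. indicator {0<..L} \<tau> * (?W \<tau> * epow (avg b \<tau> h x) p) \<partial>lborel))) r"
      by (rule slice_cmult) measurable
    also have "slice b (\<lambda>x. 
         (\<mu> x * (\<integral>\<^sup>+\<tau>. indicator {0<..L} \<tau> * (?W \<tau> * epow (avg b \<tau> h x) p) \<partial>lborel))) r
       = (\<integral>\<^sup>+z. \<integral>\<^sup>+\<tau>. indicator (strip b) z * (\<mu> (r *\<^sub>R b + proj b z) * (indicator {0<..L} \<tau> * (?W \<tau> * 
          epow (avg b \<tau> h (r *\<^sub>R b + proj b z)) p))) \<partial>lborel \<partial>lborel)"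
      by (subst slice_unfold) (auto simp: nn_integral_cmult)
    also have "\<dots> = (\<integral>\<^sup>+\<tau>. \<integral>\<^sup>+z. indicator (strip b) z * (\<mu> (r *\<^sub>R b + proj b z) * (indicator {0<..L} \<tau> * (?W \<tau> * 
          epow (avg b \<tau> h (r *\<^sub>R b + proj b z)) p))) \<partial>lborel \<partial>lborel)"
      by (rule nn_integral_swap) measurable
    also have "\<dots> = (\<integral>\<^sup>+\<tau>. indicator {0<..L} \<tau> * (?W \<tau> * slice b (\<lambda>x. \<mu> x * epow (avg b \<tau> h x) p) r) \<partial>lborel)"
    proof (rule nn_integral_cong)
      fix \<tau> :: real
      have "(\<integral>\<^sup>+z. indicator (strip b) z * (\<mu> (r *\<^sub>R b + proj b z) * (indicator {0<..L} \<tau> * (?W \<tau> * 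
          epow (avg b \<tau> h (r *\<^sub>R b + proj b z)) p))) \<partial>lborel)
        = (\<integral>\<^sup>+z. (indicator {0<..L} \<tau> * ?W \<tau>) * (indicator (strip b) z * (\<mu> (r *\<^sub>R b + proj b z) * 
          epow (avg b \<tau> h (r *\<^sub>R b + proj b z)) p)) \<partial>lborel)"
        by (simp add: ac_simps)
      also have "\<dots> = (indicator {0<..L} \<tau> * ?W \<tau>) * slice b (\<lambda>x. \<mu> x * epow (avg b \<tau> h x) p) r"
        by (subst nn_integral_cmult) (auto simp: slice_unfold)
      finally show "(\<integral>\<^sup>+z. indicator (strip b) z * (\<mu> (r *\<^sub>R b + proj b z) * (indicator {0<..L} \<tau> * (?W \<tau> * 
          epow (avg b \<tau> h (r *\<^sub>R b + proj b z)) p))) \<partial>lborel)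
        = indicator {0<..L} \<tau> * (?W \<tau> * slice b (\<lambda>x. \<mu> x * epow (avg b \<tau> h x) p) r)"
        by (simp add: mult.assoc)
    qed
    also have "\<dots> \<le> (\<integral>\<^sup>+\<tau>. indicator {0<..L} \<tau> * ennreal (\<tau> powr (\<beta> * p - \<kappa>)) * ?Y \<partial>lborel)"
    proof (rule nn_integral_mono)
      fix \<tau> :: real
      show "indicator {0<..L} \<tau> * (?W \<tau> * slice b (\<lambda>x. \<mu> x * epow (avg b \<tau> h x) p) r)
         \<le> indicator {0<..L} \<tau> * ennreal (\<tau> powr (\<beta> * p - \<kappa>)) * ?Y"
      proof (cases "0 < \<tau>")
        case True
        have "?W \<tau> * slice b (\<lambda>x. \<mu> x * epow (avg b \<tau> h x) p) r \<le> ?W \<tau> * (ennreal (\<tau> powr (-\<kappa>)) * ?Y)"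
          unfolding \<kappa>_def using True q s b by (intro mult_left_mono slice_avg_power) auto
        also have "\<dots> = ennreal (\<tau> powr (\<beta> * p - \<kappa>)) * ?Y"
          using True by (simp add: mult.assoc[symmetric] powr_diff powr_minus divide_inverse flip: ennreal_mult)
        finally show ?thesis by (auto simp: mult.assoc split: split_indicator)
      qed auto
    qed
    also have "\<dots> = (\<integral>\<^sup>+\<tau>. indicator {0<..L} \<tau> * ennreal (\<tau> powr (\<beta> * p - \<kappa>)) \<partial>lborel) * ?Y"
      by (rule nn_integral_multc) measurable
    also have "(\<integral>\<^sup>+\<tau>. indicator {0<..L} \<tau> * ennreal (\<tau> powr (\<beta> * p - \<kappa>)) \<partial>lborel) = ennreal c2"
      unfolding I2[symmetric] D_def by (subst nn_integral_density) auto
    finally show "slice b (\<lambda>x. \<mu> x * epow (pot b L h x) p) r \<le> ennreal (c1 powr (p - 1) * c2) * ?Y"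
      using c by (simp add: ennreal_mult mult.assoc mult_left_mono)
  qed
qed

text \<open>\<open>\<delta> / s\<close> and \<open>\<delta> * p / q\<close> add up to 1, so
  Hoelder's inequality in \<open>r\<close> turns the product of hyperplane integrals into a product
  of integrals over the whole space.\<close>

lemma nn_integral_slice_pot:
  fixes p q s L :: real
  assumes p: "1 < p" and q: "1 \<le> q" "q \<le> p" and s: "1 \<le> s" and L: "0 \<le> L"
    and \<kappa>: "real (DIM('a::euclidean_space) - 1) * (p/q - 1 + 1/s) < p"
    and \<delta>: "\<delta> * (1/s + p/q) = 1"
  obtains C :: real where "0 \<le> C"
    "\<And>(b::'a) \<mu> h. b \<in> Basis \<Longrightarrow> \<mu> \<in> borel_measurable borel \<Longrightarrow> h \<in> borel_measurable borel \<Longrightarrow>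
      (\<integral>\<^sup>+r. epow (slice b (\<lambda>x. \<mu> x * epow (pot b L h x) p) r) \<delta> \<partial>lborel) \<le> ennreal C *
        (epow (\<integral>\<^sup>+x. epow (\<mu> x) s \<partial>lborel) (\<delta>/s) * epow (\<integral>\<^sup>+x. epow (h x) q \<partial>lborel) (\<delta> * p/q))"
proof -
  obtain C0 :: real where C0: "0 \<le> C0"
    and le: "\<And>(b::'a) \<mu> h r. b \<in> Basis \<Longrightarrow> \<mu> \<in> borel_measurable borel \<Longrightarrow> h \<in> borel_measurable borel \<Longrightarrow>
      slice b (\<lambda>x. \<mu> x * epow (pot b L h x) p) r \<le> ennreal C0 *
        (epow (slice b (\<lambda>x. epow (\<mu> x) s) r) (1/s) * epow (slice b (\<lambda>x. epow (h x) q) r) (p/q))"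
    using slice_pot_power[OF p q s L \<kappa>] by blast
  have e: "0 < 1/s + p/q" using p q s by (intro add_pos_pos) auto
  then have \<delta>0: "0 < \<delta>" using \<delta> by (metis zero_less_mult_pos2 zero_less_one)
  have \<delta>': "\<delta> * p / q = 1 - \<delta> / s" using \<delta> by (simp add: distrib_left)
  have "0 \<le> \<delta> * p / q" using \<delta>0 p q by (intro divide_nonneg_nonneg mult_nonneg_nonneg) auto
  then have \<delta>s: "0 \<le> \<delta> / s" "\<delta> / s \<le> 1" using \<delta>0 s unfolding \<delta>' by auto
  show ?thesis
  proof (rule that[of "C0 powr \<delta>"])
    fix b :: 'a and \<mu> h :: "'a \<Rightarrow> ennreal"
    assume b: "b \<in> Basis" and [measurable]: "\<mu> \<in> borel_measurable borel" "h \<in> borel_measurable borel"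
    let ?A = "slice b (\<lambda>x. epow (\<mu> x) s)" and ?B = "slice b (\<lambda>x. epow (h x) q)"
    have "(\<integral>\<^sup>+r. epow (slice b (\<lambda>x. \<mu> x * epow (pot b L h x) p) r) \<delta> \<partial>lborel)
      \<le> (\<integral>\<^sup>+r. ennreal (C0 powr \<delta>) * (epow (?A r) (\<delta>/s) * epow (?B r) (1 - \<delta>/s)) \<partial>lborel)"
    proof (rule nn_integral_mono)
      fix r
      have "epow (slice b (\<lambda>x. \<mu> x * epow (pot b L h x) p) r) \<delta> \<le>
         epow (ennreal C0 * (epow (?A r) (1/s) * epow (?B r) (p/q))) \<delta>"
        using \<delta>0 b by (intro epow_mono le) auto
      also have "\<dots> = ennreal (C0 powr \<delta>) * (epow (?A r) (\<delta>/s) * epow (?B r) (1 - \<delta>/s))"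
        using \<delta>0 s p q C0 by (simp add: epow_mult epow_epow epow_ennreal mult.commute flip: \<delta>')
      finally show "epow (slice b (\<lambda>x. \<mu> x * epow (pot b L h x) p) r) \<delta> \<le>
         ennreal (C0 powr \<delta>) * (epow (?A r) (\<delta>/s) * epow (?B r) (1 - \<delta>/s))" .
    qed
    also have "\<dots> = ennreal (C0 powr \<delta>) * (\<integral>\<^sup>+r. epow (?A r) (\<delta>/s) * epow (?B r) (1 - \<delta>/s) \<partial>lborel)"
      by (rule nn_integral_cmult) measurable
    also have "\<dots> \<le> ennreal (C0 powr \<delta>) * (epow (\<integral>\<^sup>+r. ?A r \<partial>lborel) (\<delta>/s) * epow (\<integral>\<^sup>+r. ?B r \<partial>lborel) (1 - \<delta>/s))"
      using \<delta>s by (intro mult_left_mono nn_integral_Holder) auto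
    finally show "(\<integral>\<^sup>+r. epow (slice b (\<lambda>x. \<mu> x * epow (pot b L h x) p) r) \<delta> \<partial>lborel) \<le> ennreal (C0 powr \<delta>) *
        (epow (\<integral>\<^sup>+x. epow (\<mu> x) s \<partial>lborel) (\<delta>/s) * epow (\<integral>\<^sup>+x. epow (h x) q \<partial>lborel) (\<delta> * p/q))"
      by (simp add: nn_integral_slice b \<delta>')
  qed simp
qed

text \<open>Jensen's inequality in \<open>\<tau>\<close> and in the average, then Fubini's theorem;
  averaging preserves the integral. The bound serves for full-dimensional norms and, with
  \<open>q = 1\<close>, for passing to limits in the representation by potentials.\<close>

lemma nn_integral_pot_power:
  assumes b: "b \<in> Basis" and [measurable]: "h \<in> borel_measurable borel" and q: "1 \<le> q" and L: "0 \<le> L"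
  shows "(\<integral>\<^sup>+x. epow (pot b L h x) q \<partial>lborel) \<le> ennreal (L powr q) * (\<integral>\<^sup>+x. epow (h x) q \<partial>lborel)"
proof -
  define D where "D = density lborel (indicator {0<..L :: real})"
  have D: "emeasure D (space D) = ennreal L"
    using L by (simp add: D_def emeasure_density)
  let ?h = "\<lambda>x. epow (h x) q"
  let ?c = "epow (ennreal L) (q - 1)"
  have "(\<integral>\<^sup>+x. epow (pot b L h x) q \<partial>lborel) \<le> (\<integral>\<^sup>+x. ?c * pot b L ?h x \<partial>lborel)"
  proof (rule nn_integral_mono)
    fix x
    have "epow (pot b L h x) q \<le> ?c * (\<integral>\<^sup>+\<tau>. epow (avg b \<tau> h x) q \<partial>D)"
      unfolding pot_def D_def[symmetric] D[symmetric]
      by (rule nn_integral_power_le) (use q in \<open>auto simp: D_def\<close>)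
    also have "\<dots> \<le> ?c * (\<integral>\<^sup>+\<tau>. avg b \<tau> ?h x \<partial>D)"
      using q b by (intro mult_left_mono nn_integral_mono epow_avg_le) auto
    finally show "epow (pot b L h x) q \<le> ?c * pot b L ?h x" by (simp add: pot_def D_def)
  qed
  also have "\<dots> = ?c * (\<integral>\<^sup>+x. \<integral>\<^sup>+\<tau>. indicator {0<..L} \<tau> * avg b \<tau> ?h x \<partial>lborel \<partial>lborel)"
    by (simp add: nn_integral_cmult pot_unfold)
  also have "(\<integral>\<^sup>+x. \<integral>\<^sup>+\<tau>. indicator {0<..L} \<tau> * avg b \<tau> ?h x \<partial>lborel \<partial>lborel)
     = (\<integral>\<^sup>+\<tau>. \<integral>\<^sup>+x. indicator {0<..L} \<tau> * avg b \<tau> ?h x \<partial>lborel \<partial>lborel)"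
    by (rule nn_integral_swap) measurable
  also have "\<dots> = ennreal L * (\<integral>\<^sup>+x. ?h x \<partial>lborel)"
    using L b by (simp add: nn_integral_cmult nn_integral_multc nn_integral_avg)
  also have "?c * (ennreal L * (\<integral>\<^sup>+x. ?h x \<partial>lborel)) = epow (ennreal L) q * (\<integral>\<^sup>+x. ?h x \<partial>lborel)"
    using q epow_add[of "q - 1" 1 "ennreal L"] by (simp add: mult.assoc)
  also have "epow (ennreal L) q = ennreal (L powr q)" using q L by (simp add: epow_ennreal)
  finally show ?thesis .
qed

section \<open>Continuously differentiable functions\<close>

text \<open>Cutoffs live on the whole space and carry their gradient along, in contrast to members
  of \<open>C1 \<Omega>\<close>, which are arbitrary outside \<open>\<Omega>\<close>.\<close>

definition C1_grad :: "('a::euclidean_space \<Rightarrow> real) \<Rightarrow> ('a \<Rightarrow> 'a) \<Rightarrow> bool" where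
  "C1_grad f F \<longleftrightarrow> (\<forall>x. (f has_derivative (\<lambda>h. F x \<bullet> h)) (at x)) \<and> continuous_on UNIV F"

lemma grad_eqI:
  assumes "(f has_derivative (\<lambda>h. v \<bullet> h)) (at x)"
  shows "grad f x = v"
proof -
  have "frechet_derivative f (at x) = (\<lambda>h. v \<bullet> h)" using assms by (rule frechet_derivative_at[symmetric])
  then show ?thesis unfolding grad_def by (simp only: euclidean_representation)
qed

lemma has_derivative_grad:
  assumes "f differentiable (at x)"
  shows "(f has_derivative (\<lambda>h. grad f x \<bullet> h)) (at x)"
proof -
  let ?D = "frechet_derivative f (at x)"
  have D: "(f has_derivative ?D) (at x)" using assms frechet_derivative_works by blast
  then interpret D: bounded_linear ?D by (rule has_derivative_bounded_linear)
  have "?D h = grad f x \<bullet> h" for h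
  proof -
    have "?D h = ?D (\<Sum>b\<in>Basis. (h \<bullet> b) *\<^sub>R b)" by (simp add: euclidean_representation)
    also have "\<dots> = (\<Sum>b\<in>Basis. (h \<bullet> b) * ?D b)" by (simp add: D.sum D.scaleR)
    also have "\<dots> = grad f x \<bullet> h"
      unfolding grad_def inner_sum_left inner_scaleR_left
      by (intro sum.cong refl) (simp add: inner_commute)
    finally show ?thesis .
  qed
  then have "?D = (\<lambda>h. grad f x \<bullet> h)" by blast
  with D show ?thesis by simp
qed

lemma C1_gradD:
  assumes "C1_grad f F"
  shows "(f has_derivative (\<lambda>h. F x \<bullet> h)) (at x)" "continuous_on S F" "continuous_on S f"
    "grad f = F" "F \<in> borel_measurable borel" "f \<in> borel_measurable borel"
proof -
  show d: "(f has_derivative (\<lambda>h. F x \<bullet> h)) (at x)" for x using assms by (simp add: C1_grad_def)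
  show F: "continuous_on S F" for S using assms continuous_on_subset by (auto simp: C1_grad_def)
  show f: "continuous_on S f" for S
    by (intro continuous_at_imp_continuous_on ballI has_derivative_continuous[OF d])
  show "grad f = F" by (rule ext) (rule grad_eqI[OF d])
  show "F \<in> borel_measurable borel" "f \<in> borel_measurable borel"
    using f F by (auto intro: borel_measurable_continuous_onI)
qed

lemma C1_I:
  assumes "\<And>x. x \<in> \<Omega> \<Longrightarrow> (f has_derivative (\<lambda>h. F x \<bullet> h)) (at x)" "continuous_on \<Omega> F"
  shows "f \<in> C1 \<Omega>" "\<And>x. x \<in> \<Omega> \<Longrightarrow> grad f x = F x"
proof -
  show g: "\<And>x. x \<in> \<Omega> \<Longrightarrow> grad f x = F x" using assms(1) grad_eqI by blast
  then have "continuous_on \<Omega> (grad f)"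
    using assms(2) by (subst continuous_on_cong[OF refl, of _ _ F]) auto
  then show "f \<in> C1 \<Omega>" using assms(1) by (auto simp: C1_def differentiable_def)
qed

lemma C1D:
  assumes "f \<in> C1 \<Omega>"
  shows "x \<in> \<Omega> \<Longrightarrow> (f has_derivative (\<lambda>h. grad f x \<bullet> h)) (at x)" "continuous_on \<Omega> (grad f)"
    "continuous_on \<Omega> f"
proof -
  show d: "x \<in> \<Omega> \<Longrightarrow> (f has_derivative (\<lambda>h. grad f x \<bullet> h)) (at x)" for x
    using assms by (auto simp: C1_def intro: has_derivative_grad)
  show "continuous_on \<Omega> (grad f)" using assms by (simp add: C1_def)
  show "continuous_on \<Omega> f"
    by (intro continuous_at_imp_continuous_on ballI has_derivative_continuous[OF d])
qed

lemma C1_mult: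
  assumes "f \<in> C1 \<Omega>" "g \<in> C1 \<Omega>"
  shows "(\<lambda>x. f x * g x) \<in> C1 \<Omega>"
    "x \<in> \<Omega> \<Longrightarrow> grad (\<lambda>x. f x * g x) x = f x *\<^sub>R grad g x + g x *\<^sub>R grad f x"
proof -
  have d: "((\<lambda>x. f x * g x) has_derivative (\<lambda>h. (f x *\<^sub>R grad g x + g x *\<^sub>R grad f x) \<bullet> h)) (at x)"
    if "x \<in> \<Omega>" for x
    using has_derivative_mult[OF C1D(1)[OF assms(1) that] C1D(1)[OF assms(2) that]]
    by (simp add: inner_add_left algebra_simps)
  have c: "continuous_on \<Omega> (\<lambda>x. f x *\<^sub>R grad g x + g x *\<^sub>R grad f x)"
    using C1D(2,3)[OF assms(1)] C1D(2,3)[OF assms(2)] by (intro continuous_intros)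
  show "(\<lambda>x. f x * g x) \<in> C1 \<Omega>" by (rule C1_I(1)[OF d c])
  show "x \<in> \<Omega> \<Longrightarrow> grad (\<lambda>x. f x * g x) x = f x *\<^sub>R grad g x + g x *\<^sub>R grad f x"
    by (rule C1_I(2)[OF d c])
qed

lemma C1_compose:
  assumes "f \<in> C1 \<Omega>" and \<psi>: "\<And>t. (\<psi> has_real_derivative \<psi>' t) (at t)" "continuous_on UNIV \<psi>'"
  shows "(\<lambda>x. \<psi> (f x)) \<in> C1 \<Omega>"
    "x \<in> \<Omega> \<Longrightarrow> grad (\<lambda>x. \<psi> (f x)) x = \<psi>' (f x) *\<^sub>R grad f x"
proof -
  have d: "((\<lambda>x. \<psi> (f x)) has_derivative (\<lambda>h. (\<psi>' (f x) *\<^sub>R grad f x) \<bullet> h)) (at x)"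
    if "x \<in> \<Omega>" for x
    using has_derivative_compose[OF C1D(1)[OF assms(1) that] \<psi>(1)[unfolded has_field_derivative_def]]
    by simp
  have c: "continuous_on \<Omega> (\<lambda>x. \<psi>' (f x) *\<^sub>R grad f x)"
    by (intro continuous_intros continuous_on_compose2[OF \<psi>(2)] C1D(2,3)[OF assms(1)]) auto
  show "(\<lambda>x. \<psi> (f x)) \<in> C1 \<Omega>" by (rule C1_I(1)[OF d c])
  show "x \<in> \<Omega> \<Longrightarrow> grad (\<lambda>x. \<psi> (f x)) x = \<psi>' (f x) *\<^sub>R grad f x"
    by (rule C1_I(2)[OF d c])
qed

lemma C1_grad_C1: "C1_grad f F \<Longrightarrow> f \<in> C1 \<Omega>"
  by (rule C1_I(1)[of _ f F]) (erule C1_gradD)+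

section \<open>Functions of compact support\<close>

lemma grad_eq_0:
  assumes "open S" "x \<in> S" "\<And>y. y \<in> S \<Longrightarrow> f y = 0"
  shows "grad f x = 0"
proof (rule grad_eqI)
  have "((\<lambda>x. 0) has_derivative (\<lambda>h. 0 \<bullet> h)) (at x)" by simp
  then show "(f has_derivative (\<lambda>h. 0 \<bullet> h)) (at x)"
    by (rule has_derivative_transform_within_open[OF _ assms(1,2)]) (simp add: assms(3))
qed

lemma C1_grad_eq_0:
  assumes "C1_grad f F" "closed K" "\<And>y. y \<notin> K \<Longrightarrow> f y = 0" "x \<notin> K"
  shows "F x = 0"
  using grad_eq_0[of "- K" x f] assms C1_gradD(4)[OF assms(1)] by auto

text \<open>\<open>\<Omega>\<close> and the complement of \<open>K\<close> are open and cover the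
  space; on their overlap both formulas give 0. The values of \<open>f\<close> outside
  \<open>\<Omega>\<close> are arbitrary and have to be discarded first.\<close>

lemma C1c_extend:
  assumes "open \<Omega>" "f \<in> C1 \<Omega>" "compact K" "K \<subseteq> \<Omega>" "\<And>x. x \<in> \<Omega> \<Longrightarrow> x \<notin> K \<Longrightarrow> f x = 0"
  shows "C1_grad (\<lambda>x. if x \<in> \<Omega> then f x else 0) (\<lambda>x. if x \<in> \<Omega> then grad f x else 0)"
proof -
  let ?f = "\<lambda>x. if x \<in> \<Omega> then f x else 0" and ?F = "\<lambda>x. if x \<in> \<Omega> then grad f x else 0"
  have oK: "open (- K)" using assms(3) by (simp add: compact_imp_closed open_Compl)
  have F0: "?F x = 0" if "x \<notin> K" for x
    using grad_eq_0[of "\<Omega> \<inter> - K" x f] that assms oK by auto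
  have "(?f has_derivative (\<lambda>h. ?F x \<bullet> h)) (at x)" for x
  proof (cases "x \<in> \<Omega>")
    case True
    show ?thesis
      by (rule has_derivative_transform_within_open[OF _ assms(1) True, of f])
        (use True C1D(1)[OF assms(2) True] in auto)
  next
    case False
    then have x: "x \<in> - K" using assms(4) by auto
    show ?thesis
      by (rule has_derivative_transform_within_open[OF _ oK x, of "\<lambda>x. 0"])
        (use F0[of x] x assms(5) in auto)
  qed
  moreover have "continuous_on (\<Omega> \<union> - K) ?F"
  proof (rule continuous_on_open_Un[OF assms(1) oK])
    show "continuous_on \<Omega> ?F"
      using C1D(2)[OF assms(2)] by (rule continuous_on_cong[THEN iffD1, rotated -1]) auto
    show "continuous_on (- K) ?F"
      by (rule continuous_on_cong[THEN iffD1, of _ _ "\<lambda>x. 0"]) (use F0 in auto)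
  qed
  moreover have "\<Omega> \<union> - K = UNIV" using assms(4) by auto
  ultimately show ?thesis by (simp add: C1_grad_def)
qed

lemma integrable_continuous_compact_support:
  fixes F :: "'a::euclidean_space \<Rightarrow> 'b::euclidean_space"
  assumes "continuous_on UNIV F" "compact K" "\<And>x. x \<notin> K \<Longrightarrow> F x = 0"
  shows "integrable lborel F"
proof -
  have "integrable lborel (\<lambda>x. indicator K x *\<^sub>R F x)"
    using assms(1,2) continuous_on_subset by (blast intro: borel_integrable_compact)
  also have "(\<lambda>x. indicator K x *\<^sub>R F x) = F"
    using assms(3) by (auto simp: indicator_def)
  finally show ?thesis .
qed

lemma integral_lborel_shift:
  fixes F :: "'a::euclidean_space \<Rightarrow> real"
  assumes "F \<in> borel_measurable borel"
  shows "(\<integral>x. F (v + x) \<partial>lborel) = (\<integral>x. F x \<partial>lborel)"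
proof -
  have "(\<integral>x. F x \<partial>lborel) = (\<integral>x. F x \<partial>distr lborel borel ((+) v))"
    by (simp add: lborel_distr_plus)
  also have "\<dots> = (\<integral>x. F (v + x) \<partial>lborel)"
    using assms by (subst integral_distr) auto
  finally show ?thesis by simp
qed

text \<open>By translation invariance the integral equals its mean over the shifts by
  \<open>h *\<^sub>R b\<close> with \<open>h\<close> in [0,1]. After Fubini's theorem the
  fundamental theorem of calculus in \<open>h\<close> leaves the integral of
  \<open>f (b + x) - f x\<close>, which vanishes, again by translation invariance.\<close>

lemma integral_grad_eq_0:
  fixes b :: "'a::euclidean_space"
  assumes f: "C1_grad f F" and K: "compact K" "\<And>x. x \<notin> K \<Longrightarrow> f x = 0"
  shows "(\<integral>x. F x \<bullet> b \<partial>lborel) = 0"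
proof -
  have F0: "F x = 0" if "x \<notin> K" for x
    using C1_grad_eq_0[OF f _ K(2) that] K(1) compact_imp_closed by blast
  have [measurable]: "F \<in> borel_measurable borel" "f \<in> borel_measurable borel"
    using C1_gradD(5,6)[OF f] by auto
  have cF: "continuous_on UNIV F" and cf: "continuous_on UNIV f" using C1_gradD[OF f] by auto
  define g where "g = (\<lambda>(h::real) x. indicator {0..1} h * (F (h *\<^sub>R b + x) \<bullet> b))"
  \<comment> \<open>\<open>K'\<close> contains every \<open>x\<close> that some shift by
    \<open>h *\<^sub>R b\<close> brings into \<open>K\<close>, so \<open>g\<close> is supported in
    the compact set \<open>{0..1} \<times> K'\<close> and Fubini's theorem applies.\<close>
  define K' where "K' = (\<lambda>(h, y). y - h *\<^sub>R b) ` ({0..1::real} \<times> K)"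
  have K': "compact ({0..1::real} \<times> K')"
    unfolding K'_def case_prod_beta
    by (intro compact_Times compact_continuous_image continuous_intros K) auto
  have "integrable lborel (\<lambda>w::real \<times> 'a. indicator ({0..1} \<times> K') w *\<^sub>R (F (fst w *\<^sub>R b + snd w) \<bullet> b))"
    by (intro borel_integrable_compact K' continuous_intros continuous_on_compose2[OF cF]) auto
  also have "(\<lambda>w::real \<times> 'a. indicator ({0..1} \<times> K') w *\<^sub>R (F (fst w *\<^sub>R b + snd w) \<bullet> b)) = case_prod g"
  proof (rule ext)
    fix w :: "real \<times> 'a"
    obtain h x where w: "w = (h, x)" by (cases w)
    have "x \<in> K'" if h: "h \<in> {0..1}" and nz: "F (h *\<^sub>R b + x) \<bullet> b \<noteq> 0"
    proof -
      have "h *\<^sub>R b + x \<in> K" using F0 nz by fastforce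
      then show ?thesis unfolding K'_def
        using h by (intro image_eqI[of _ _ "(h, h *\<^sub>R b + x)"]) auto
    qed
    then show "indicator ({0..1} \<times> K') w *\<^sub>R (F (fst w *\<^sub>R b + snd w) \<bullet> b) = case_prod g w"
      by (cases "F (h *\<^sub>R b + x) \<bullet> b = 0") (auto simp: w g_def indicator_def)
  qed
  finally have int: "integrable (lborel \<Otimes>\<^sub>M lborel) (case_prod g)" by (simp add: lborel_prod)
  have i1: "integrable lborel (\<lambda>x. f (v + x))" for v
  proof (rule integrable_continuous_compact_support)
    show "continuous_on UNIV (\<lambda>x. f (v + x))"
      by (intro continuous_on_compose2[OF cf] continuous_intros) auto
    show "compact ((\<lambda>x. x - v) ` K)" by (intro compact_continuous_image continuous_intros K)
    show "f (v + x) = 0" if "x \<notin> (\<lambda>x. x - v) ` K" for x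
      using that by (intro K(2)) (force simp: image_iff)
  qed
  have "(\<integral>x. F x \<bullet> b \<partial>lborel) = (\<integral>h. indicat_real {0..1::real} h * (\<integral>x. F x \<bullet> b \<partial>lborel) \<partial>lborel)"
    by simp
  also have "\<dots> = (\<integral>h. (\<integral>x. g h x \<partial>lborel) \<partial>lborel)"
    unfolding g_def using integral_lborel_shift[of "\<lambda>x. F x \<bullet> b"] by simp
  also have "\<dots> = (\<integral>x. (\<integral>h. g h x \<partial>lborel) \<partial>lborel)"
    by (rule lborel_pair.Fubini_integral[OF int, symmetric])
  also have "\<dots> = (\<integral>x. f (b + x) - f (0 + x) \<partial>lborel)"
  proof (rule Bochner_Integration.integral_cong[OF refl])
    fix x
    have "(LBINT h. indicator {0..1} h *\<^sub>R (F (h *\<^sub>R b + x) \<bullet> b)) = f (1 *\<^sub>R b + x) - f (0 *\<^sub>R b + x)"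
    proof (rule integral_FTC_atLeastAtMost)
      show "((\<lambda>h. f (h *\<^sub>R b + x)) has_vector_derivative F (h *\<^sub>R b + x) \<bullet> b) (at h within {0..1})" for h
      proof -
        have "((\<lambda>h. h *\<^sub>R b + x) has_derivative (\<lambda>t. t *\<^sub>R b + 0)) (at h)"
          by (rule has_derivative_add[OF has_derivative_scaleR_left[OF has_derivative_ident] has_derivative_const])
        from has_derivative_compose[OF this C1_gradD(1)[OF f]] show ?thesis
          by - (rule has_vector_derivative_at_within, simp add: has_vector_derivative_def)
      qed
      show "continuous_on {0..1} (\<lambda>h. F (h *\<^sub>R b + x) \<bullet> b)"
        by (intro continuous_intros continuous_on_compose2[OF cF]) auto
    qed auto
    then show "(\<integral>h. g h x \<partial>lborel) = f (b + x) - f (0 + x)" by (simp add: g_def)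
  qed
  also have "\<dots> = (\<integral>x. f (b + x) \<partial>lborel) - (\<integral>x. f (0 + x) \<partial>lborel)"
    using i1[of b] i1[of 0] by (rule Bochner_Integration.integral_diff)
  also have "\<dots> = 0" by (simp add: integral_lborel_shift)
  finally show ?thesis .
qed

section \<open>Representation by potentials\<close>

definition cube :: "'a::euclidean_space \<Rightarrow> real \<Rightarrow> 'a set" where
  "cube c R = {x. \<forall>j\<in>Basis. \<bar>x \<bullet> j - c \<bullet> j\<bar> \<le> R}"

lemma cube_eq_cbox: "cube c R = cbox (c - R *\<^sub>R \<Sum>Basis) (c + R *\<^sub>R \<Sum>Basis)"
proof -
  have "\<bar>x \<bullet> j - c \<bullet> j\<bar> \<le> R \<longleftrightarrow> (c - R *\<^sub>R \<Sum>Basis) \<bullet> j \<le> x \<bullet> j \<and> x \<bullet> j \<le> (c + R *\<^sub>R \<Sum>Basis) \<bullet> j"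
    if "j \<in> Basis" for x j :: 'a
    using that by (auto simp: inner_diff_left inner_add_left inner_sum_left_Basis abs_le_iff algebra_simps)
  then show ?thesis by (auto simp: cube_def mem_box)
qed

lemma compact_cube: "compact (cube c R)" and cube_sets [measurable]: "cube c R \<in> sets borel"
  by (simp_all add: cube_eq_cbox)

lemma cube_mono: "R \<le> R' \<Longrightarrow> cube c R \<subseteq> cube c R'"
  unfolding cube_def by force

lemma nn_integral_Ioc_continuous:
  assumes g: "continuous_on UNIV g" "\<And>x. 0 \<le> g x"
  shows "(\<integral>\<^sup>+\<tau>. indicator {0<..L} \<tau> * ennreal (g \<tau>) \<partial>lborel) = ennreal (integral {0..L::real} g)"
proof -
  have [measurable]: "g \<in> borel_measurable borel" using g(1) by (rule borel_measurable_continuous_onI)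
  have "(\<integral>\<^sup>+\<tau>. indicator {0<..L} \<tau> * ennreal (g \<tau>) \<partial>lborel)
      = (\<integral>\<^sup>+\<tau>. ennreal (indicator {0..L} \<tau> * g \<tau>) \<partial>lborel)"
    by (intro nn_integral_cong_AE eventually_mono[OF AE_lborel_singleton[of 0]])
      (auto split: split_indicator)
  also have "\<dots> = ennreal (integral {0..L} g)"
  proof (rule nn_integral_has_integral_lborel)
    have "(g has_integral integral {0..L} g) {0..L}"
      using g(1) continuous_on_subset by (intro integrable_integral integrable_continuous_real) auto
    then have "((\<lambda>x. if x \<in> {0..L} then g x else 0) has_integral integral {0..L} g) UNIV"
      by (simp only: has_integral_restrict_UNIV)
    then show "((\<lambda>x. indicat_real {0..L} x * g x) has_integral integral {0..L} g) UNIV"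
      by (rule has_integral_eq[rotated]) (auto simp: indicator_def)
  qed (use g in auto)
  finally show ?thesis .
qed

text \<open>For \<open>z\<close> in the shell, follow the ray from \<open>x\<close> in direction
  \<open>v = proj b z\<close>. As the dimension is at least 2, there is a coordinate
  \<open>e\<close> other than \<open>b\<close>; it grows by at least \<open>L > 2 * R\<close>, so
  the ray has left the support at time \<open>L\<close>. The fundamental theorem of calculus bounds
  \<open>f x\<close> by the gradient along the ray, and averaging over \<open>z\<close> gives the
  potential. The factor 2d bounds the length of \<open>v\<close>.\<close>

lemma pot_representation:
  fixes f :: "'a::euclidean_space \<Rightarrow> real"
  assumes f: "C1_grad f F" and b: "b \<in> Basis" and d: "DIM('a) \<ge> 2"
    and supp: "\<And>x. f x \<noteq> 0 \<Longrightarrow> x \<in> cube c R" and L: "0 \<le> L" "2 * R < L"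
  shows "ennreal \<bar>f x\<bar> \<le> ennreal (2 * DIM('a)) * pot b L (\<lambda>x. ennreal (norm (F x))) x"
proof (cases "f x = 0")
  case False
  let ?K = "real (2 * DIM('a))"
  have [measurable]: "F \<in> borel_measurable borel" using C1_gradD(5)[OF f] .
  have cF: "continuous_on UNIV F" using C1_gradD[OF f] by auto
  obtain e :: 'a where e: "e \<in> Basis" "e \<noteq> b"
  proof -
    have "\<not> Basis \<subseteq> {b}"
      using d card_mono[of "{b}" "Basis :: 'a set"] by auto
    then show ?thesis using that by auto
  qed
  have main: "ennreal \<bar>f x\<bar> \<le> (\<integral>\<^sup>+\<tau>. indicator {0<..L} \<tau> * ennreal (?K * norm (F (x + \<tau> *\<^sub>R proj b z))) \<partial>lborel)"
    if z: "z \<in> shell b" for z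
  proof -
    define v where "v = proj b z"
    have vj: "\<bar>v \<bullet> j\<bar> \<le> 2" if "j \<in> Basis" for j
      using shell_inner[OF b z] b that
      by (cases "j = b") (auto simp: v_def proj_inner proj_def inner_diff_left inner_Basis, force+)
    have "norm v \<le> (\<Sum>j\<in>Basis. \<bar>v \<bullet> j\<bar>)" by (rule norm_le_l1)
    also have "\<dots> \<le> (\<Sum>j\<in>(Basis::'a set). 2)" by (intro sum_mono vj)
    finally have nv: "norm v \<le> ?K" by simp
    have ve: "1 \<le> v \<bullet> e"
      using shell_inner(3)[OF b z e] b e by (simp add: v_def proj_def inner_diff_left inner_Basis)
    have fL: "f (x + L *\<^sub>R v) = 0"
    proof (rule ccontr)
      assume "f (x + L *\<^sub>R v) \<noteq> 0"
      then have "\<bar>(x + L *\<^sub>R v) \<bullet> e - c \<bullet> e\<bar> \<le> R" "\<bar>x \<bullet> e - c \<bullet> e\<bar> \<le> R"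
        using supp False e by (auto simp: cube_def)
      moreover have "L \<le> L * (v \<bullet> e)" using L ve mult_left_mono[of 1 "v \<bullet> e" L] by simp
      ultimately show False using L by (simp add: inner_add_left)
    qed
    have I: "((\<lambda>\<tau>. F (x + \<tau> *\<^sub>R v) \<bullet> v) has_integral (f (x + L *\<^sub>R v) - f (x + 0 *\<^sub>R v))) {0..L}"
    proof (rule fundamental_theorem_of_calculus[OF L(1)])
      show "((\<lambda>\<tau>. f (x + \<tau> *\<^sub>R v)) has_vector_derivative F (x + \<tau> *\<^sub>R v) \<bullet> v) (at \<tau> within {0..L})" for \<tau>
      proof -
        have "((\<lambda>\<tau>. x + \<tau> *\<^sub>R v) has_derivative (\<lambda>t. 0 + t *\<^sub>R v)) (at \<tau>)"
          by (rule has_derivative_add[OF has_derivative_const has_derivative_scaleR_left[OF has_derivative_ident]])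
        from has_derivative_compose[OF this C1_gradD(1)[OF f]] show ?thesis
          by - (rule has_vector_derivative_at_within, simp add: has_vector_derivative_def)
      qed
    qed
    have cG: "continuous_on UNIV (\<lambda>\<tau>. ?K * norm (F (x + \<tau> *\<^sub>R v)))"
      by (intro continuous_intros continuous_on_compose2[OF cF]) auto
    have "\<bar>f x\<bar> = norm (integral {0..L} (\<lambda>\<tau>. F (x + \<tau> *\<^sub>R v) \<bullet> v))"
      using I fL by (simp add: integral_unique)
    also have "\<dots> \<le> integral {0..L} (\<lambda>\<tau>. ?K * norm (F (x + \<tau> *\<^sub>R v)))"
    proof (rule integral_norm_bound_integral)
      show "(\<lambda>\<tau>. F (x + \<tau> *\<^sub>R v) \<bullet> v) integrable_on {0..L}" using I by blast
      show "(\<lambda>\<tau>. ?K * norm (F (x + \<tau> *\<^sub>R v))) integrable_on {0..L}"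
        using cG continuous_on_subset by (intro integrable_continuous_real) auto
      fix \<tau>
      have "norm (F (x + \<tau> *\<^sub>R v) \<bullet> v) \<le> norm (F (x + \<tau> *\<^sub>R v)) * norm v"
        by (simp add: Cauchy_Schwarz_ineq2)
      also have "\<dots> \<le> norm (F (x + \<tau> *\<^sub>R v)) * ?K" using nv by (intro mult_left_mono) auto
      finally show "norm (F (x + \<tau> *\<^sub>R v) \<bullet> v) \<le> ?K * norm (F (x + \<tau> *\<^sub>R v))" by (simp only: mult.commute)
    qed
    finally have "ennreal \<bar>f x\<bar> \<le> ennreal (integral {0..L} (\<lambda>\<tau>. ?K * norm (F (x + \<tau> *\<^sub>R v))))"
      by (rule ennreal_leI)
    also have "\<dots> = (\<integral>\<^sup>+\<tau>. indicator {0<..L} \<tau> * ennreal (?K * norm (F (x + \<tau> *\<^sub>R v))) \<partial>lborel)"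
      by (rule nn_integral_Ioc_continuous[symmetric]) (use cG in auto)
    finally show ?thesis by (simp add: v_def)
  qed
  have "ennreal \<bar>f x\<bar> = (\<integral>\<^sup>+z. indicator (shell b) z * ennreal \<bar>f x\<bar> \<partial>lborel)"
    using b by (simp add: nn_integral_multc emeasure_shell)
  also have "\<dots> \<le> (\<integral>\<^sup>+z. \<integral>\<^sup>+\<tau>. indicator (shell b) z * (indicator {0<..L} \<tau> *
      ennreal (?K * norm (F (x + \<tau> *\<^sub>R proj b z)))) \<partial>lborel \<partial>lborel)"
    using main by (intro nn_integral_mono) (auto simp: nn_integral_cmult split: split_indicator)
  also have "\<dots> = (\<integral>\<^sup>+\<tau>. \<integral>\<^sup>+z. indicator (shell b) z * (indicator {0<..L} \<tau> *
      ennreal (?K * norm (F (x + \<tau> *\<^sub>R proj b z)))) \<partial>lborel \<partial>lborel)"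
    by (rule nn_integral_swap) measurable
  also have "\<dots> = (\<integral>\<^sup>+\<tau>. ennreal ?K * (indicator {0<..L} \<tau> *
      avg b \<tau> (\<lambda>x. ennreal (norm (F x))) x) \<partial>lborel)"
  proof (rule nn_integral_cong)
    fix \<tau> :: real
    have "(\<integral>\<^sup>+z. indicator (shell b) z * (indicator {0<..L} \<tau> *
        ennreal (?K * norm (F (x + \<tau> *\<^sub>R proj b z)))) \<partial>lborel)
      = (\<integral>\<^sup>+z. (ennreal ?K * indicator {0<..L} \<tau>) * (indicator (shell b) z *
          ennreal (norm (F (x + \<tau> *\<^sub>R proj b z)))) \<partial>lborel)"
      by (intro nn_integral_cong) (simp add: ennreal_mult split: split_indicator)
    also have "\<dots> = (ennreal ?K * indicator {0<..L} \<tau>) * avg b \<tau> (\<lambda>x. ennreal (norm (F x))) x"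
      by (subst nn_integral_cmult) (auto simp: avg_unfold)
    finally show "(\<integral>\<^sup>+z. indicator (shell b) z * (indicator {0<..L} \<tau> *
        ennreal (?K * norm (F (x + \<tau> *\<^sub>R proj b z)))) \<partial>lborel)
      = ennreal ?K * (indicator {0<..L} \<tau> * avg b \<tau> (\<lambda>x. ennreal (norm (F x))) x)"
      by (simp only: mult.assoc)
  qed
  also have "\<dots> = ennreal ?K * pot b L (\<lambda>x. ennreal (norm (F x))) x"
    by (subst nn_integral_cmult) (auto simp: pot_unfold)
  finally show ?thesis by simp
qed simp

lemma avg_add:
  assumes [measurable]: "f \<in> borel_measurable borel" "g \<in> borel_measurable borel"
  shows "avg b \<tau> (\<lambda>x. f x + g x) x = avg b \<tau> f x + avg b \<tau> g x"
  unfolding avg_def by (intro nn_integral_add) auto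

lemma pot_add:
  assumes [measurable]: "f \<in> borel_measurable borel" "g \<in> borel_measurable borel"
  shows "pot b L (\<lambda>x. f x + g x) x = pot b L f x + pot b L g x"
  unfolding pot_def avg_add[OF assms] by (intro nn_integral_add) auto

lemma pot_mono: "(\<And>x. f x \<le> g x) \<Longrightarrow> pot b L f x \<le> pot b L g x"
  unfolding pot_def avg_def by (intro nn_integral_mono) auto

text \<open>Potentials are bounded on L^1, so the inequality survives L^1 convergence of functions
  and gradients. What is integrated is the amount by which the left side exceeds the right side;
  subtraction in \<open>ennreal\<close> is truncated, so this amount is 0 where the potential is
  infinite.\<close>

lemma pot_representation_limit:
  fixes f :: "'a::euclidean_space \<Rightarrow> real"
  assumes fn: "\<And>n. C1_grad (fn n) (Fn n)" and b: "b \<in> Basis" and d: "DIM('a) \<ge> 2"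
    and supp: "\<And>n x. fn n x \<noteq> 0 \<Longrightarrow> x \<in> cube c R" and L: "0 \<le> L" "2 * R < L"
    and [measurable]: "f \<in> borel_measurable borel" "F \<in> borel_measurable borel"
    and lim: "(\<lambda>n. \<integral>\<^sup>+x. ennreal (\<bar>fn n x - f x\<bar> + norm (Fn n x - F x)) \<partial>lborel) \<longlonglongrightarrow> 0"
  shows "AE x in lborel. ennreal \<bar>f x\<bar> \<le> ennreal (2 * DIM('a)) * pot b L (\<lambda>x. ennreal (norm (F x))) x"
proof -
  let ?K = "ennreal (2 * DIM('a))"
  let ?P = "\<lambda>x. ?K * pot b L (\<lambda>x. ennreal (norm (F x))) x"
  let ?Q = "\<lambda>n x. pot b L (\<lambda>x. ennreal (norm (Fn n x - F x))) x"
  let ?J = "\<lambda>n. \<integral>\<^sup>+x. ennreal (\<bar>fn n x - f x\<bar> + norm (Fn n x - F x)) \<partial>lborel"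
  have [measurable]: "Fn n \<in> borel_measurable borel" "fn n \<in> borel_measurable borel" for n
    using C1_gradD(5,6)[OF fn] by auto
  have le: "ennreal \<bar>f x\<bar> - ?P x \<le> ennreal \<bar>fn n x - f x\<bar> + ?K * ?Q n x" for n x
  proof -
    have "ennreal \<bar>f x\<bar> \<le> ennreal \<bar>fn n x - f x\<bar> + ennreal \<bar>fn n x\<bar>"
      by (simp flip: ennreal_plus add: ennreal_leI)
    also have "ennreal \<bar>fn n x\<bar> \<le> ?K * pot b L (\<lambda>x. ennreal (norm (Fn n x))) x"
      by (rule pot_representation[OF fn b d supp L])
    also have "pot b L (\<lambda>x. ennreal (norm (Fn n x))) x
        \<le> pot b L (\<lambda>x. ennreal (norm (Fn n x - F x)) + ennreal (norm (F x))) x"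
      by (intro pot_mono) (simp flip: ennreal_plus add: ennreal_leI norm_triangle_sub add.commute)
    also have "\<dots> = ?Q n x + pot b L (\<lambda>x. ennreal (norm (F x))) x"
      by (rule pot_add) auto
    finally have "ennreal \<bar>f x\<bar> \<le> ennreal \<bar>fn n x - f x\<bar> + ?K * ?Q n x + ?P x"
      by (simp add: mult_left_mono add_left_mono distrib_left add.assoc)
    then show ?thesis by (simp add: ennreal_minus_le_iff add.commute)
  qed
  have "(\<integral>\<^sup>+x. ennreal \<bar>f x\<bar> - ?P x \<partial>lborel) \<le> ?J n + ?K * (ennreal L * ?J n)" for n
  proof -
    have "(\<integral>\<^sup>+x. ennreal \<bar>f x\<bar> - ?P x \<partial>lborel)
        \<le> (\<integral>\<^sup>+x. ennreal \<bar>fn n x - f x\<bar> + ?K * ?Q n x \<partial>lborel)"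
      by (intro nn_integral_mono le)
    also have "\<dots> = (\<integral>\<^sup>+x. ennreal \<bar>fn n x - f x\<bar> \<partial>lborel) + ?K * (\<integral>\<^sup>+x. ?Q n x \<partial>lborel)"
      by (subst nn_integral_add) (auto simp: nn_integral_cmult)
    also have "(\<integral>\<^sup>+x. ?Q n x \<partial>lborel) \<le> ennreal L * (\<integral>\<^sup>+x. ennreal (norm (Fn n x - F x)) \<partial>lborel)"
      using nn_integral_pot_power[OF b, of "\<lambda>x. ennreal (norm (Fn n x - F x))" 1 L] L(1)
      by (cases "L = 0") simp_all
    also have "(\<integral>\<^sup>+x. ennreal (norm (Fn n x - F x)) \<partial>lborel) \<le> ?J n"
      by (intro nn_integral_mono ennreal_leI) simp
    also have "(\<integral>\<^sup>+x. ennreal \<bar>fn n x - f x\<bar> \<partial>lborel) \<le> ?J n"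
      by (intro nn_integral_mono ennreal_leI) simp
    finally show ?thesis by (simp add: add_mono mult_left_mono)
  qed
  moreover have "(\<lambda>n. ?J n + ?K * (ennreal L * ?J n)) \<longlonglongrightarrow> 0 + ?K * (ennreal L * 0)"
    by (intro tendsto_add tendsto_mult_ennreal tendsto_const lim) auto
  ultimately have "(\<integral>\<^sup>+x. ennreal \<bar>f x\<bar> - ?P x \<partial>lborel) \<le> 0"
    by (intro LIMSEQ_le_const[of _ 0]) auto
  then have "AE x in lborel. ennreal \<bar>f x\<bar> - ?P x = 0"
    by (subst nn_integral_0_iff_AE[symmetric]) auto
  then show ?thesis
    by eventually_elim (simp add: ennreal_minus_eq_0)
qed

section \<open>Adapted cutoffs\<close>

text \<open>Chebyshev's inequality for the power \<open>\<delta>\<close> of \<open>g\<close>: the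
  threshold \<open>N\<close> is chosen so that at most a quarter of the interval lies above
  it.\<close>

lemma measure_sublevel_ge:
  fixes g :: "real \<Rightarrow> ennreal"
  assumes ab: "\<alpha> < \<beta>" and [measurable]: "g \<in> borel_measurable borel"
    and D: "(\<integral>\<^sup>+x. indicator {\<alpha><..<\<beta>} x * epow (g x) \<delta> \<partial>lborel) \<le> ennreal D" "0 < D" and \<delta>: "0 < \<delta>"
  defines "N \<equiv> (4 * D / (\<beta> - \<alpha>)) powr (1/\<delta>)"
  shows "3/4 * (\<beta> - \<alpha>) \<le> measure lborel {x \<in> {\<alpha><..<\<beta>}. g x \<le> ennreal N}"
proof -
  define E where "E = {x \<in> {\<alpha><..<\<beta>}. g x \<le> ennreal N}"
  define B where "B = {x \<in> {\<alpha><..<\<beta>}. \<not> g x \<le> ennreal N}"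
  have [measurable]: "E \<in> sets borel" "B \<in> sets borel" unfolding E_def B_def by measurable
  have fin: "emeasure lborel {\<alpha><..<\<beta>} < \<infinity>" using ab by simp
  have sub_fin: "emeasure lborel A \<noteq> \<infinity>" if "A \<subseteq> {\<alpha><..<\<beta>}" for A
    using emeasure_mono[OF that, of lborel] fin by (auto simp: top_unique)
  have fE: "emeasure lborel E \<noteq> \<infinity>" "emeasure lborel B \<noteq> \<infinity>"
    by (rule sub_fin, force simp: E_def B_def)+
  have N: "0 < N" "ennreal (4 * D / (\<beta> - \<alpha>)) = epow (ennreal N) \<delta>"
    using ab D \<delta> by (auto simp: N_def epow_ennreal powr_powr)
  have "ennreal (4 * D / (\<beta> - \<alpha>)) * emeasure lborel B = (\<integral>\<^sup>+x. ennreal (4 * D / (\<beta> - \<alpha>)) * indicator B x \<partial>lborel)"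
    by (simp add: nn_integral_cmult_indicator)
  also have "\<dots> \<le> (\<integral>\<^sup>+x. indicator {\<alpha><..<\<beta>} x * epow (g x) \<delta> \<partial>lborel)"
  proof (rule nn_integral_mono)
    fix x
    show "ennreal (4 * D / (\<beta> - \<alpha>)) * indicator B x \<le> indicator {\<alpha><..<\<beta>} x * epow (g x) \<delta>"
    proof (cases "x \<in> B")
      case True
      then have "ennreal N \<le> g x" by (auto simp: B_def)
      then have "epow (ennreal N) \<delta> \<le> epow (g x) \<delta>" using \<delta> by (intro epow_mono) auto
      then show ?thesis using True N(2) by (simp add: B_def)
    qed simp
  qed
  also have "\<dots> \<le> ennreal D" by (rule D)
  finally have "ennreal (4 * D / (\<beta> - \<alpha>)) * ennreal (measure lborel B) \<le> ennreal D"
    using fE by (simp add: emeasure_eq_ennreal_measure)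
  then have le: "4 * D / (\<beta> - \<alpha>) * measure lborel B \<le> D"
    using ab D by (simp flip: ennreal_mult)
  have B: "measure lborel B \<le> (\<beta> - \<alpha>) / 4"
  proof -
    have "D * (4 / (\<beta> - \<alpha>) * measure lborel B) \<le> D * 1" using le by (simp add: ac_simps)
    then have "4 / (\<beta> - \<alpha>) * measure lborel B \<le> 1" using D(2) by (simp only: mult_le_cancel_left_pos)
    then show ?thesis using ab by (simp add: field_simps)
  qed
  have "{\<alpha><..<\<beta>} = E \<union> B" "E \<inter> B = {}" by (auto simp: E_def B_def)
  then have "measure lborel {\<alpha><..<\<beta>} = measure lborel E + measure lborel B"
    using fE by (simp add: measure_Union)
  then show ?thesis using B ab by (simp add: E_def)
qed

text \<open>
  A weight \<open>h\<close> of mass 1 avoiding the points where \<open>g\<close> is large, by Chebyshev's inequality for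
  \<open>g powr \<delta>\<close>. For small \<open>\<delta>\<close> this beats any \<open>h\<close> chosen independently of \<open>g\<close>.
\<close>

lemma bump_exists:
  fixes g :: "real \<Rightarrow> ennreal"
  assumes ab: "\<alpha> < \<beta>" and [measurable]: "g \<in> borel_measurable borel"
    and D: "(\<integral>\<^sup>+x. indicator {\<alpha><..<\<beta>} x * epow (g x) \<delta> \<partial>lborel) \<le> ennreal D" "0 < D" and \<delta>: "0 < \<delta>"
    and g: "(\<integral>\<^sup>+x. indicator {\<alpha><..<\<beta>} x * g x \<partial>lborel) < \<infinity>" and p: "0 < p"
  obtains h :: "real \<Rightarrow> real" where "continuous_on UNIV h" "\<And>x. 0 \<le> h x"
    "\<And>x. x \<notin> {\<alpha><..<\<beta>} \<Longrightarrow> h x = 0" "(h has_integral 1) UNIV" "\<And>x. h x \<le> 2 / (\<beta> - \<alpha>)"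
    "(\<integral>\<^sup>+x. ennreal (h x powr p) * g x \<partial>lborel)
       \<le> ennreal (2 * (\<beta> - \<alpha>) * (2 / (\<beta> - \<alpha>)) powr p * (4 * D / (\<beta> - \<alpha>)) powr (1/\<delta>))"
proof -
  define N where "N = (4 * D / (\<beta> - \<alpha>)) powr (1/\<delta>)"
  have N: "0 < N" using ab D by (simp add: N_def)
  define E where "E = {x \<in> {\<alpha><..<\<beta>}. g x \<le> ennreal N}"
  have E: "3/4 * (\<beta> - \<alpha>) \<le> measure lborel E"
    unfolding E_def N_def by (rule measure_sublevel_ge[OF ab assms(2) D \<delta>])
  have [measurable]: "E \<in> sets borel" unfolding E_def by measurable
  have fin: "emeasure lborel {\<alpha><..<\<beta>} < \<infinity>" using ab by simp
  have sub_fin: "emeasure lborel A \<noteq> \<infinity>" if "A \<subseteq> {\<alpha><..<\<beta>}" for A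
    using emeasure_mono[OF that, of lborel] fin by (auto simp: top_unique)
  \<comment> \<open>Inner regularity costs at most another quarter of the interval, so the closed
    set \<open>T\<close> still has half its length.\<close>
  have "E \<in> sets lebesgue" by simp
  moreover have "0 < (\<beta> - \<alpha>) / 4" using ab by simp
  ultimately obtain T where T: "closed T" "T \<subseteq> E" "emeasure lebesgue (E - T) < ennreal ((\<beta> - \<alpha>) / 4)"
    using sets_lebesgue_inner_closed by metis
  have Tab: "T \<subseteq> {\<alpha><..<\<beta>}" "T \<subseteq> {\<alpha>..\<beta>}" using T(2) by (auto simp: E_def)
  have cT: "compact T" using T(1) Tab(2) by (meson bounded_closed_interval bounded_subset compact_eq_bounded_closed)
  have [measurable]: "T \<in> sets borel" using T(1) by auto
  have ET: "emeasure lborel (E - T) \<noteq> \<infinity>" "emeasure lborel E \<noteq> \<infinity>"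
    by (rule sub_fin, force simp: E_def)+
  have "emeasure lborel (E - T) < ennreal ((\<beta> - \<alpha>) / 4)" using T(3) by (subst (asm) emeasure_completion) auto
  then have "measure lborel (E - T) < (\<beta> - \<alpha>) / 4"
    using ab ET by (subst (asm) emeasure_eq_ennreal_measure) (auto simp: ennreal_less_iff)
  moreover have "measure lborel (E - T) = measure lborel E - measure lborel T"
    using T(2) ET by (intro measure_Diff) auto
  ultimately have mT: "(\<beta> - \<alpha>) / 2 \<le> measure lborel T" using E by (simp add: field_simps)
  then have T0: "T \<noteq> {}" using ab by auto
  obtain e where e: "0 < e" "{x. infdist x T \<le> e} \<subseteq> {\<alpha><..<\<beta>}"
    using compact_in_open_separated[OF T0 cT _ Tab(1)] by auto
  \<comment> \<open>Lipschitz functions decreasing to the indicator of \<open>T\<close>. A slope of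
    at least \<open>1 / e\<close> keeps their supports inside the interval for every
    \<open>n\<close>.\<close>
  define h where "h n x = max 0 (1 - (real n + 1 / e) * infdist x T)" for n x
  have hc: "continuous_on UNIV (h n)" for n unfolding h_def by (intro continuous_intros)
  have [measurable]: "h n \<in> borel_measurable borel" for n using hc by (rule borel_measurable_continuous_onI)
  have hb: "0 \<le> h n x" "h n x \<le> 1" for n x
    using e by (auto simp: h_def infdist_nonneg)
  have hs: "h n x = 0" if "x \<notin> {\<alpha><..<\<beta>}" for n x
  proof -
    have "e < infdist x T" using e(2) that by force
    then have "1 \<le> 1 / e * infdist x T" using e(1) by (simp add: field_simps)
    also have "\<dots> \<le> (real n + 1 / e) * infdist x T"
      by (intro mult_right_mono infdist_nonneg) simp
    finally show ?thesis by (simp add: h_def)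
  qed
  have hT: "h n x = 1" if "x \<in> T" for n x using that by (simp add: h_def)
  have hlim: "(\<lambda>n. h n x) \<longlonglongrightarrow> indicator T x" for x
  proof (cases "x \<in> T")
    case False
    then have pos: "0 < infdist x T"
      using T(1) T0 infdist_nonneg[of x T] by (metis in_closed_iff_infdist_zero less_le)
    obtain n0 where n0: "1 / infdist x T < real n0" using reals_Archimedean2 by blast
    have "h n x = 0" if "n0 \<le> n" for n
    proof -
      have "1 / infdist x T \<le> real n + 1/e" using n0 that e(1)
        by (smt (verit) of_nat_le_iff zero_le_divide_1_iff)
      then have "1 \<le> (real n + 1 / e) * infdist x T" using pos by (simp add: field_simps)
      then show ?thesis by (simp add: h_def)
    qed
    then have "\<forall>\<^sub>F n in sequentially. h n x = indicator T x"
      using False by (intro eventually_sequentiallyI[of n0]) simp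
    then show ?thesis by (rule tendsto_eventually)
  qed (simp add: hT)
  \<comment> \<open>The integrable majorant is \<open>g\<close> on the interval. The finiteness of
    its integral is qualitative and leaves no trace in the final bound.\<close>
  have "(\<lambda>n. \<integral>\<^sup>+x. ennreal (h n x powr p) * g x \<partial>lborel) \<longlonglongrightarrow> (\<integral>\<^sup>+x. ennreal (indicator T x powr p) * g x \<partial>lborel)"
  proof (rule nn_integral_dominated_convergence)
    show "AE x in lborel. ennreal (h n x powr p) * g x \<le> indicator {\<alpha><..<\<beta>} x * g x" for n
    proof (rule AE_I2)
      fix x
      have "h n x powr p \<le> 1" using hb p by (intro powr_le1) auto
      then show "ennreal (h n x powr p) * g x \<le> indicator {\<alpha><..<\<beta>} x * g x"
        using hs[of x n] p by (intro mult_right_mono) (auto split: split_indicator simp: ennreal_le_1)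
    qed
    have "AE x in lborel. indicator {\<alpha><..<\<beta>} x * g x \<noteq> \<infinity>"
      using g by (intro nn_integral_PInf_AE) auto
    then show "AE x in lborel. (\<lambda>n. ennreal (h n x powr p) * g x) \<longlonglongrightarrow> ennreal (indicator T x powr p) * g x"
    proof eventually_elim
      fix x assume fin: "indicator {\<alpha><..<\<beta>} x * g x \<noteq> \<infinity>"
      show "(\<lambda>n. ennreal (h n x powr p) * g x) \<longlonglongrightarrow> ennreal (indicator T x powr p) * g x"
      proof (cases "x \<in> {\<alpha><..<\<beta>}")
        case True
        then have "g x \<noteq> \<infinity>" using fin by simp
        then show ?thesis
          using p hb by (intro tendsto_mult_ennreal tendsto_const tendsto_ennrealI tendsto_powr2 hlim) auto
      next
        case False
        then have "x \<notin> T" "\<And>n. h n x = 0" using hs Tab(1) by blast+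
        then show ?thesis by simp
      qed
    qed
  qed (use g in auto)
  \<comment> \<open>The factor 2 makes the inequality strict, so that it persists for some finite
    \<open>n\<close>.\<close>
  moreover have "(\<integral>\<^sup>+x. ennreal (indicator T x powr p) * g x \<partial>lborel) < ennreal (2 * (\<beta> - \<alpha>) * N)"
  proof -
    have "(\<integral>\<^sup>+x. ennreal (indicator T x powr p) * g x \<partial>lborel) \<le> (\<integral>\<^sup>+x. ennreal N * indicator {\<alpha><..<\<beta>} x \<partial>lborel)"
      using T(2) by (intro nn_integral_mono) (auto simp: E_def split: split_indicator)
    also have "\<dots> = ennreal (N * (\<beta> - \<alpha>))"
      using ab N by (simp add: nn_integral_cmult_indicator ennreal_mult)
    also have "\<dots> < ennreal (2 * (\<beta> - \<alpha>) * N)"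
      using ab N by (intro ennreal_lessI) auto
    finally show ?thesis .
  qed
  ultimately have "\<forall>\<^sub>F n in sequentially. (\<integral>\<^sup>+x. ennreal (h n x powr p) * g x \<partial>lborel) < ennreal (2 * (\<beta> - \<alpha>) * N)"
    by (rule order_tendstoD)
  then obtain n where n: "(\<integral>\<^sup>+x. ennreal (h n x powr p) * g x \<partial>lborel) < ennreal (2 * (\<beta> - \<alpha>) * N)"
    by (auto simp: eventually_sequentially)
  have int: "integrable lborel (h n)"
    by (rule integrable_continuous_compact_support[OF hc, of "{\<alpha>..\<beta>}"]) (use hs in auto)
  define I where "I = (\<integral>x. h n x \<partial>lborel)"
  have "measure lborel T = (\<integral>x. indicator T x \<partial>lborel)" by simp
  also have "\<dots> \<le> I" unfolding I_def
    using sub_fin[OF Tab(1)] int hT hb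
    by (intro integral_mono integrable_real_indicator) (auto simp: less_top split: split_indicator)
  finally have I: "(\<beta> - \<alpha>) / 2 \<le> I" using mT by simp
  then have I0: "0 < I" using ab by simp
  \<comment> \<open>The mass \<open>I\<close> is at least half the length of the interval, so
    normalising \<open>h n\<close>, which is at most 1, gives the bound
    \<open>2 / (\<beta> - \<alpha>)\<close>.\<close>
  have invI: "1 / I \<le> 2 / (\<beta> - \<alpha>)" using I I0 ab by (simp add: field_simps)
  show ?thesis
  proof (rule that[of "\<lambda>x. h n x / I"])
    show "continuous_on UNIV (\<lambda>x. h n x / I)" using I0 by (intro continuous_intros hc) auto
    show "0 \<le> h n x / I" for x using hb I0 by simp
    show "h n x / I = 0" if "x \<notin> {\<alpha><..<\<beta>}" for x using hs[OF that] by simp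
    show "h n x / I \<le> 2 / (\<beta> - \<alpha>)" for x
      using hb[of n x] I0 invI by (meson divide_right_mono less_imp_le order_trans)
    have "(h n has_integral I) UNIV" unfolding I_def by (rule has_integral_integral_lborel[OF int])
    from has_integral_divide[OF this, of I] show "((\<lambda>x. h n x / I) has_integral 1) UNIV"
      using I0 by simp
    have "(\<integral>\<^sup>+x. ennreal ((h n x / I) powr p) * g x \<partial>lborel)
        = (\<integral>\<^sup>+x. ennreal ((1 / I) powr p) * (ennreal (h n x powr p) * g x) \<partial>lborel)"
      using I0 hb by (intro nn_integral_cong)
        (simp add: powr_divide mult.assoc[symmetric] mult.commute[of "1 / (I powr p)"] flip: ennreal_mult)
    also have "\<dots> = ennreal ((1 / I) powr p) * (\<integral>\<^sup>+x. ennreal (h n x powr p) * g x \<partial>lborel)"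
      by (rule nn_integral_cmult) auto
    also have "\<dots> \<le> ennreal ((2 / (\<beta> - \<alpha>)) powr p) * ennreal (2 * (\<beta> - \<alpha>) * N)"
      using n invI I0 p by (intro mult_mono ennreal_leI powr_mono2) auto
    also have "\<dots> = ennreal (2 * (\<beta> - \<alpha>) * (2 / (\<beta> - \<alpha>)) powr p * N)"
      using ab N by (simp flip: ennreal_mult add: mult_ac)
    finally show "(\<integral>\<^sup>+x. ennreal ((h n x / I) powr p) * g x \<partial>lborel)
      \<le> ennreal (2 * (\<beta> - \<alpha>) * (2 / (\<beta> - \<alpha>)) powr p * (4 * D / (\<beta> - \<alpha>)) powr (1/\<delta>))"
      by (simp add: N_def)
  qed
qed

lemma primitive_exists:
  fixes h :: "real \<Rightarrow> real"
  assumes h: "continuous_on UNIV h" "\<And>x. 0 \<le> h x" "\<And>x. x \<notin> {\<alpha><..<\<beta>} \<Longrightarrow> h x = 0" "(h has_integral 1) UNIV"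
    and ab: "\<alpha> < \<beta>"
  obtains e where "\<And>x. (e has_real_derivative h x) (at x)" "\<And>x. x \<le> \<alpha> \<Longrightarrow> e x = 0"
    "\<And>x. \<beta> \<le> x \<Longrightarrow> e x = 1" "\<And>x. 0 \<le> e x" "\<And>x. e x \<le> 1"
proof -
  \<comment> \<open>The lower limit lies strictly to the left of \<open>\<alpha>\<close>, so that
    the fundamental theorem of calculus yields a two-sided derivative for every
    \<open>x > \<alpha> - 1\<close>; further to the left \<open>e\<close> is constantly 0.\<close>
  define e where "e x = integral {\<alpha> - 1..x} h" for x
  have e0: "e x = 0" if "x \<le> \<alpha>" for x
  proof -
    have "integral {\<alpha> - 1..x} h = integral {\<alpha> - 1..x} (\<lambda>_. 0)"
      using that by (intro integral_cong h(3)) auto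
    then show ?thesis by (simp add: e_def)
  qed
  have e1: "e x = 1" if "\<beta> \<le> x" for x
  proof -
    have "(h has_integral 1) {\<alpha> - 1..x}"
    proof -
      have "(\<lambda>y. if y \<in> {\<alpha> - 1..x} then h y else 0) = h"
        by (rule ext) (use h(3) that in auto)
      then show ?thesis using h(4) by (simp only: flip: has_integral_restrict_UNIV[of _ h])
    qed
    then show ?thesis by (simp add: e_def integral_unique)
  qed
  have d: "(e has_real_derivative h x) (at x)" for x
  proof (cases "\<alpha> - 1 < x")
    case True
    have "continuous_on {\<alpha> - 1..x + 1} h" using h(1) continuous_on_subset by blast
    then have "(e has_real_derivative h x) (at x within {\<alpha> - 1..x + 1})"
      unfolding e_def using True by (intro integral_has_real_derivative) auto
    moreover have "at x within {\<alpha> - 1..x + 1} = at x" using True by (intro at_within_interior) auto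
    ultimately show ?thesis by simp
  next
    case False
    have "((\<lambda>x. 0) has_real_derivative h x) (at x)" using h(3)[of x] False by simp
    then show ?thesis
      by (rule has_field_derivative_transform_within_open[where S = "{..<\<alpha>}"]) (use False e0 in auto)
  qed
  have mono: "e x \<le> e y" if "x \<le> y" for x y
    using d h(2) by (intro DERIV_nonneg_imp_nondecreasing[OF that]) blast
  show ?thesis
  proof (rule that[of e])
    show "0 \<le> e x" for x using mono[of "min x \<alpha>" x] e0[of "min x \<alpha>"] by simp
    show "e x \<le> 1" for x using mono[of x "max x \<beta>"] e1[of "max x \<beta>"] by simp
  qed (use d e0 e1 in auto)
qed

text \<open>One bump on each side of \<open>c\<close> and the difference of their primitives, so the
  bound of \<open>bump_exists\<close> is doubled. The bumps have disjoint supports, hence at each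
  point the derivative is, up to sign, one of the two.\<close>

lemma cutoff_interval:
  fixes g :: "real \<Rightarrow> ennreal"
  assumes \<rho>: "0 \<le> \<rho>" "\<rho> < \<sigma>" and [measurable]: "g \<in> borel_measurable borel"
    and D: "(\<integral>\<^sup>+x. epow (g x) \<delta> \<partial>lborel) \<le> ennreal D" "0 < D" and \<delta>: "0 < \<delta>"
    and g: "(\<integral>\<^sup>+x. g x \<partial>lborel) < \<infinity>" and p: "0 < p"
  obtains e e' :: "real \<Rightarrow> real" where "\<And>x. (e has_real_derivative e' x) (at x)" "continuous_on UNIV e'"
    "\<And>x. 0 \<le> e x" "\<And>x. e x \<le> 1" "\<And>x. \<bar>x - c\<bar> \<le> \<rho> \<Longrightarrow> e x = 1"
    "\<And>x. \<sigma> \<le> \<bar>x - c\<bar> \<Longrightarrow> e x = 0" "\<And>x. \<sigma> \<le> \<bar>x - c\<bar> \<Longrightarrow> e' x = 0" "\<And>x. \<bar>e' x\<bar> \<le> 2 / (\<sigma> - \<rho>)"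
    "(\<integral>\<^sup>+x. ennreal (\<bar>e' x\<bar> powr p) * g x \<partial>lborel)
       \<le> ennreal (4 * (\<sigma> - \<rho>) * (2 / (\<sigma> - \<rho>)) powr p * (4 * D / (\<sigma> - \<rho>)) powr (1/\<delta>))"
proof -
  let ?B = "2 * (\<sigma> - \<rho>) * (2 / (\<sigma> - \<rho>)) powr p * (4 * D / (\<sigma> - \<rho>)) powr (1/\<delta>)"
  have "\<exists>h. continuous_on UNIV h \<and> (\<forall>x. 0 \<le> h x) \<and> (\<forall>x. x \<notin> {\<alpha><..<\<beta>} \<longrightarrow> h x = 0) \<and>
      (h has_integral 1) UNIV \<and> (\<forall>x. h x \<le> 2 / (\<sigma> - \<rho>)) \<and>
      (\<integral>\<^sup>+x. ennreal (h x powr p) * g x \<partial>lborel) \<le> ennreal ?B" if "\<beta> - \<alpha> = \<sigma> - \<rho>" for \<alpha> \<beta>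
  proof -
    have ab: "\<alpha> < \<beta>" using that \<rho> by simp
    have "(\<integral>\<^sup>+x. indicator {\<alpha><..<\<beta>} x * epow (g x) \<delta> \<partial>lborel) \<le> (\<integral>\<^sup>+x. epow (g x) \<delta> \<partial>lborel)"
      by (intro nn_integral_mono) (auto split: split_indicator)
    then have 1: "(\<integral>\<^sup>+x. indicator {\<alpha><..<\<beta>} x * epow (g x) \<delta> \<partial>lborel) \<le> ennreal D"
      using D(1) by (rule order_trans)
    have "(\<integral>\<^sup>+x. indicator {\<alpha><..<\<beta>} x * g x \<partial>lborel) \<le> (\<integral>\<^sup>+x. g x \<partial>lborel)"
      by (intro nn_integral_mono) (auto split: split_indicator)
    then have 2: "(\<integral>\<^sup>+x. indicator {\<alpha><..<\<beta>} x * g x \<partial>lborel) < \<infinity>" using g by (rule le_less_trans)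
    show ?thesis
      by (rule bump_exists[OF ab assms(3) 1 D(2) \<delta> 2 p, unfolded that]) blast
  qed
  note ex = this
  obtain h1 where h1: "continuous_on UNIV h1" "\<And>x. 0 \<le> h1 x" "\<And>x. x \<notin> {c - \<sigma><..<c - \<rho>} \<Longrightarrow> h1 x = 0"
      "(h1 has_integral 1) UNIV" "\<And>x. h1 x \<le> 2 / (\<sigma> - \<rho>)"
      "(\<integral>\<^sup>+x. ennreal (h1 x powr p) * g x \<partial>lborel) \<le> ennreal ?B"
    using ex[of "c - \<rho>" "c - \<sigma>"] by auto
  obtain h2 where h2: "continuous_on UNIV h2" "\<And>x. 0 \<le> h2 x" "\<And>x. x \<notin> {c + \<rho><..<c + \<sigma>} \<Longrightarrow> h2 x = 0"
      "(h2 has_integral 1) UNIV" "\<And>x. h2 x \<le> 2 / (\<sigma> - \<rho>)"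
      "(\<integral>\<^sup>+x. ennreal (h2 x powr p) * g x \<partial>lborel) \<le> ennreal ?B"
    using ex[of "c + \<sigma>" "c + \<rho>"] by auto
  have l1: "c - \<sigma> < c - \<rho>" and l2: "c + \<rho> < c + \<sigma>" using \<rho> by auto
  obtain e1 where e1: "\<And>x. (e1 has_real_derivative h1 x) (at x)" "\<And>x. x \<le> c - \<sigma> \<Longrightarrow> e1 x = 0"
    "\<And>x. c - \<rho> \<le> x \<Longrightarrow> e1 x = 1" "\<And>x. 0 \<le> e1 x" "\<And>x. e1 x \<le> 1"
    by (rule primitive_exists[OF h1(1,2,3,4) l1], assumption) (rule that, assumption+)
  obtain e2 where e2: "\<And>x. (e2 has_real_derivative h2 x) (at x)" "\<And>x. x \<le> c + \<rho> \<Longrightarrow> e2 x = 0"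
    "\<And>x. c + \<sigma> \<le> x \<Longrightarrow> e2 x = 1" "\<And>x. 0 \<le> e2 x" "\<And>x. e2 x \<le> 1"
    by (rule primitive_exists[OF h2(1,2,3,4) l2], assumption) (rule that, assumption+)
  have cases: "e2 x = 0 \<or> e1 x = 1" for x
    using e1(3)[of x] e2(2)[of x] \<rho> by linarith
  have hcases: "h1 x = 0 \<or> h2 x = 0" for x
    using h1(3)[of x] h2(3)[of x] \<rho> by (cases "x < c") auto
  have [measurable]: "h1 \<in> borel_measurable borel" "h2 \<in> borel_measurable borel"
    using h1(1) h2(1) by (auto intro: borel_measurable_continuous_onI)
  show ?thesis
  proof (rule that[of "\<lambda>x. e1 x - e2 x" "\<lambda>x. h1 x - h2 x"])
    show "((\<lambda>x. e1 x - e2 x) has_real_derivative h1 x - h2 x) (at x)" for x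
      by (intro DERIV_diff e1 e2)
    show "continuous_on UNIV (\<lambda>x. h1 x - h2 x)" by (intro continuous_intros h1 h2)
    show "0 \<le> e1 x - e2 x" "e1 x - e2 x \<le> 1" for x
      using cases[of x] e1(4,5)[of x] e2(4,5)[of x] by auto
    show "e1 x - e2 x = 1" if "\<bar>x - c\<bar> \<le> \<rho>" for x using that e1(3)[of x] e2(2)[of x] by auto
    show "e1 x - e2 x = 0" if "\<sigma> \<le> \<bar>x - c\<bar>" for x
      using that e1(2,3)[of x] e2(2,3)[of x] \<rho> by (cases "x < c") auto
    show "h1 x - h2 x = 0" if "\<sigma> \<le> \<bar>x - c\<bar>" for x
    proof -
      have "h1 x = 0" by (rule h1(3)) (use that \<rho> in auto)
      moreover have "h2 x = 0" by (rule h2(3)) (use that \<rho> in auto)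
      ultimately show ?thesis by simp
    qed
    show "\<bar>h1 x - h2 x\<bar> \<le> 2 / (\<sigma> - \<rho>)" for x
      using hcases[of x] h1(2,5)[of x] h2(2,5)[of x] by auto
    have "(\<integral>\<^sup>+x. ennreal (\<bar>h1 x - h2 x\<bar> powr p) * g x \<partial>lborel)
        = (\<integral>\<^sup>+x. ennreal (h1 x powr p) * g x + ennreal (h2 x powr p) * g x \<partial>lborel)"
    proof (rule nn_integral_cong)
      fix x show "ennreal (\<bar>h1 x - h2 x\<bar> powr p) * g x = ennreal (h1 x powr p) * g x + ennreal (h2 x powr p) * g x"
        using hcases[of x] h1(2)[of x] h2(2)[of x] by auto
    qed
    also have "\<dots> = (\<integral>\<^sup>+x. ennreal (h1 x powr p) * g x \<partial>lborel) + (\<integral>\<^sup>+x. ennreal (h2 x powr p) * g x \<partial>lborel)"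
      by (intro nn_integral_add) auto
    also have "\<dots> \<le> ennreal ?B + ennreal ?B" by (intro add_mono h1 h2)
    also have "\<dots> = ennreal (4 * (\<sigma> - \<rho>) * (2 / (\<sigma> - \<rho>)) powr p * (4 * D / (\<sigma> - \<rho>)) powr (1/\<delta>))"
      using \<rho> by (simp flip: ennreal_plus)
    finally show "(\<integral>\<^sup>+x. ennreal (\<bar>h1 x - h2 x\<bar> powr p) * g x \<partial>lborel)
       \<le> ennreal (4 * (\<sigma> - \<rho>) * (2 / (\<sigma> - \<rho>)) powr p * (4 * D / (\<sigma> - \<rho>)) powr (1/\<delta>))" .
  qed
qed

section \<open>Products of cutoffs in one variable\<close>

lemma sum_powr_le:
  fixes a :: "'i \<Rightarrow> real"
  assumes A: "finite A" and a: "\<And>i. i \<in> A \<Longrightarrow> 0 \<le> a i" and p: "0 < p"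
  shows "(\<Sum>i\<in>A. a i) powr p \<le> real (card A) powr p * (\<Sum>i\<in>A. a i powr p)"
proof (cases "A = {}")
  case False
  define m where "m = Max (a ` A)"
  have "m \<in> a ` A" unfolding m_def using A False by (intro Max_in) auto
  then obtain k where k: "k \<in> A" "a k = m" by auto
  have le: "a i \<le> m" if "i \<in> A" for i unfolding m_def using A that by auto
  have m0: "0 \<le> m" using k a by auto
  have "(\<Sum>i\<in>A. a i) \<le> real (card A) * m" using le by (rule sum_bounded_above)
  then have "(\<Sum>i\<in>A. a i) powr p \<le> (real (card A) * m) powr p"
    using p a by (intro powr_mono2 sum_nonneg) auto
  also have "\<dots> = real (card A) powr p * a k powr p" using m0 k by (simp add: powr_mult)
  also have "\<dots> \<le> real (card A) powr p * (\<Sum>i\<in>A. a i powr p)"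
    using A k by (intro mult_left_mono member_le_sum) auto
  finally show ?thesis .
qed simp

text \<open>In each partial derivative the remaining factors lie in [0,1], so the gradient is
  controlled by functions of one coordinate each.\<close>

lemma cutoff_product:
  fixes c :: "'a::euclidean_space" and e e' :: "'a \<Rightarrow> real \<Rightarrow> real"
  assumes d: "\<And>j x. j \<in> Basis \<Longrightarrow> (e j has_real_derivative e' j x) (at x)"
    and c': "\<And>j. j \<in> Basis \<Longrightarrow> continuous_on UNIV (e' j)"
    and e01: "\<And>j x. j \<in> Basis \<Longrightarrow> 0 \<le> e j x" "\<And>j x. j \<in> Basis \<Longrightarrow> e j x \<le> 1"
  defines "\<eta> \<equiv> \<lambda>x. \<Prod>j\<in>Basis. e j (x \<bullet> j)"
    and "F \<equiv> \<lambda>x. \<Sum>j\<in>Basis. (e' j (x \<bullet> j) * (\<Prod>i\<in>Basis - {j}. e i (x \<bullet> i))) *\<^sub>R j"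
  shows "C1_grad \<eta> F" "0 \<le> \<eta> x" "\<eta> x \<le> 1" "norm (F x) \<le> (\<Sum>j\<in>Basis. \<bar>e' j (x \<bullet> j)\<bar>)"
proof -
  have ce: "continuous_on UNIV (e j)" if "j \<in> Basis" for j
    using DERIV_continuous_on[of UNIV "e j" "e' j"] d[OF that] by (auto intro: DERIV_subset)
  have "(\<eta> has_derivative (\<lambda>h. F x \<bullet> h)) (at x)" for x
  proof -
    have "((\<lambda>x. e j (x \<bullet> j)) has_derivative (\<lambda>h. e' j (x \<bullet> j) * (h \<bullet> j))) (at x)" if "j \<in> Basis" for j
      using has_derivative_compose[OF has_derivative_inner_left[OF has_derivative_ident]
          d[OF that, of "x \<bullet> j", unfolded has_field_derivative_def]] .
    from has_derivative_prod[OF this, of Basis "\<lambda>j. j"]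
    have "(\<eta> has_derivative (\<lambda>h. \<Sum>j\<in>Basis. e' j (x \<bullet> j) * (h \<bullet> j) * (\<Prod>i\<in>Basis - {j}. e i (x \<bullet> i)))) (at x)"
      unfolding \<eta>_def by simp
    moreover have "(\<lambda>h. \<Sum>j\<in>Basis. e' j (x \<bullet> j) * (h \<bullet> j) * (\<Prod>i\<in>Basis - {j}. e i (x \<bullet> i))) = (\<lambda>h. F x \<bullet> h)"
      unfolding F_def inner_sum_left inner_scaleR_left
      by (rule ext, rule sum.cong[OF refl]) (simp add: inner_commute)
    ultimately show ?thesis by simp
  qed
  moreover have "continuous_on UNIV F"
    unfolding F_def by (intro continuous_intros continuous_on_compose2[OF c'] continuous_on_compose2[OF ce]) auto
  ultimately show "C1_grad \<eta> F" by (simp add: C1_grad_def)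
  show "0 \<le> \<eta> x" unfolding \<eta>_def using e01 by (intro prod_nonneg) auto
  show "\<eta> x \<le> 1" unfolding \<eta>_def using e01 by (intro prod_le_1) auto
  have "norm (F x) \<le> (\<Sum>j\<in>Basis. norm ((e' j (x \<bullet> j) * (\<Prod>i\<in>Basis - {j}. e i (x \<bullet> i))) *\<^sub>R j))"
    unfolding F_def by (rule norm_sum)
  also have "\<dots> \<le> (\<Sum>j\<in>Basis. \<bar>e' j (x \<bullet> j)\<bar>)"
  proof (rule sum_mono)
    fix j :: 'a assume j: "j \<in> Basis"
    have "0 \<le> (\<Prod>i\<in>Basis - {j}. e i (x \<bullet> i))" "(\<Prod>i\<in>Basis - {j}. e i (x \<bullet> i)) \<le> 1"
      using e01 by (auto intro!: prod_nonneg prod_le_1)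
    then have "\<bar>\<Prod>i\<in>Basis - {j}. e i (x \<bullet> i)\<bar> \<le> 1" by simp
    then have "\<bar>e' j (x \<bullet> j)\<bar> * \<bar>\<Prod>i\<in>Basis - {j}. e i (x \<bullet> i)\<bar> \<le> \<bar>e' j (x \<bullet> j)\<bar> * 1"
      by (rule mult_left_mono) simp
    then show "norm ((e' j (x \<bullet> j) * (\<Prod>i\<in>Basis - {j}. e i (x \<bullet> i))) *\<^sub>R j) \<le> \<bar>e' j (x \<bullet> j)\<bar>"
      using j by (simp add: abs_mult)
  qed
  finally show "norm (F x) \<le> (\<Sum>j\<in>Basis. \<bar>e' j (x \<bullet> j)\<bar>)" .
qed

lemma slice_inner_mult:
  assumes b: "b \<in> Basis" and [measurable]: "W \<in> borel_measurable borel" "f \<in> borel_measurable borel"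
  shows "slice b (\<lambda>x. f (x \<bullet> b) * W x) r = f r * slice b W r"
proof -
  have "slice b (\<lambda>x. f (x \<bullet> b) * W x) r = slice b (\<lambda>x. f r * W x) r"
    unfolding slice_def using b by (simp add: inner_add_left proj_inner)
  also have "\<dots> = f r * slice b W r" by (rule slice_cmult) measurable
  finally show ?thesis .
qed

text \<open>The derivative of the factor in direction \<open>b\<close> depends on
  \<open>x \<bullet> b\<close> alone, so its p-th power integrated against \<open>W\<close> becomes
  a one-dimensional integral against the slices of \<open>W\<close>. Hence each factor can be
  adapted separately to its own family of parallel hyperplanes.\<close>

lemma cutoff_exists:
  fixes W :: "'a::euclidean_space \<Rightarrow> ennreal"
  assumes \<rho>: "0 \<le> \<rho>" "\<rho> < \<sigma>" and [measurable]: "W \<in> borel_measurable borel"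
    and D: "\<And>b. b \<in> Basis \<Longrightarrow> (\<integral>\<^sup>+r. epow (slice b W r) \<delta> \<partial>lborel) \<le> ennreal D" "0 < D" and \<delta>: "0 < \<delta>"
    and W: "(\<integral>\<^sup>+x. W x \<partial>lborel) < \<infinity>" and p: "0 < p"
  obtains \<eta> F where "C1_grad \<eta> F" "\<And>x. 0 \<le> \<eta> x" "\<And>x. \<eta> x \<le> 1" "\<And>x. x \<in> cube c \<rho> \<Longrightarrow> \<eta> x = 1"
    "\<And>x. x \<notin> cube c \<sigma> \<Longrightarrow> \<eta> x = 0" "\<And>x. norm (F x) \<le> real DIM('a) * (2 / (\<sigma> - \<rho>))"
    "(\<integral>\<^sup>+x. ennreal (norm (F x) powr p) * W x \<partial>lborel) \<le> ennreal (real DIM('a) powr p * (real DIM('a) *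
       (4 * (\<sigma> - \<rho>) * (2 / (\<sigma> - \<rho>)) powr p * (4 * D / (\<sigma> - \<rho>)) powr (1/\<delta>))))"
proof -
  let ?B = "4 * (\<sigma> - \<rho>) * (2 / (\<sigma> - \<rho>)) powr p * (4 * D / (\<sigma> - \<rho>)) powr (1/\<delta>)"
  let ?d = "real DIM('a)"
  have B: "0 \<le> ?B" using \<rho> by simp
  define P where "P = (\<lambda>j e e'. (\<forall>x. (e has_real_derivative e' x) (at x)) \<and> continuous_on UNIV e' \<and>
    (\<forall>x. 0 \<le> e x) \<and> (\<forall>x. e x \<le> 1) \<and> (\<forall>x. \<bar>x - c \<bullet> j\<bar> \<le> \<rho> \<longrightarrow> e x = 1) \<and>
    (\<forall>x. \<sigma> \<le> \<bar>x - c \<bullet> j\<bar> \<longrightarrow> e x = 0) \<and> (\<forall>x. \<bar>e' x\<bar> \<le> 2 / (\<sigma> - \<rho>)) \<and>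
    (\<integral>\<^sup>+x. ennreal (\<bar>e' x\<bar> powr p) * slice j W x \<partial>lborel) \<le> ennreal ?B)"
  have "\<exists>e e'. P j e e'" if j: "j \<in> Basis" for j
  proof -
    have "(\<integral>\<^sup>+x. slice j W x \<partial>lborel) < \<infinity>" using W by (simp add: nn_integral_slice j)
    then show ?thesis unfolding P_def
      by (rule cutoff_interval[OF \<rho> slice_measurable[OF assms(3)] D(1)[OF j] D(2) \<delta> _ p, of "c \<bullet> j"]) blast
  qed
  then obtain e where "\<forall>j\<in>Basis. \<exists>e'. P j (e j) e'" by metis
  then obtain e' where "\<forall>j\<in>Basis. P j (e j) (e' j)" by metis
  then have e: "\<And>j x. j \<in> Basis \<Longrightarrow> (e j has_real_derivative e' j x) (at x)"
    "\<And>j. j \<in> Basis \<Longrightarrow> continuous_on UNIV (e' j)"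
    "\<And>j x. j \<in> Basis \<Longrightarrow> 0 \<le> e j x" "\<And>j x. j \<in> Basis \<Longrightarrow> e j x \<le> 1"
    "\<And>j x. j \<in> Basis \<Longrightarrow> \<bar>x - c \<bullet> j\<bar> \<le> \<rho> \<Longrightarrow> e j x = 1"
    "\<And>j x. j \<in> Basis \<Longrightarrow> \<sigma> \<le> \<bar>x - c \<bullet> j\<bar> \<Longrightarrow> e j x = 0"
    "\<And>j x. j \<in> Basis \<Longrightarrow> \<bar>e' j x\<bar> \<le> 2 / (\<sigma> - \<rho>)"
    "\<And>j. j \<in> Basis \<Longrightarrow> (\<integral>\<^sup>+x. ennreal (\<bar>e' j x\<bar> powr p) * slice j W x \<partial>lborel) \<le> ennreal ?B"
    unfolding P_def by blast+
  define \<eta> where "\<eta> = (\<lambda>x::'a. \<Prod>j\<in>Basis. e j (x \<bullet> j))"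
  define F where "F = (\<lambda>x::'a. \<Sum>j\<in>Basis. (e' j (x \<bullet> j) * (\<Prod>i\<in>Basis - {j}. e i (x \<bullet> i))) *\<^sub>R j)"
  have P: "C1_grad \<eta> F" "0 \<le> \<eta> x" "\<eta> x \<le> 1" "norm (F x) \<le> (\<Sum>j\<in>Basis. \<bar>e' j (x \<bullet> j)\<bar>)" for x
    unfolding \<eta>_def F_def by (rule cutoff_product[where e = e and e' = e', OF e(1-4)]; assumption)+
  have e'm [measurable]: "e' j \<in> borel_measurable borel" if "j \<in> Basis" for j
    using e(2)[OF that] by (rule borel_measurable_continuous_onI)
  show ?thesis
  proof (rule that[of \<eta> F])
    show "C1_grad \<eta> F" "0 \<le> \<eta> x" "\<eta> x \<le> 1" for x using P by auto
    show "\<eta> x = 1" if "x \<in> cube c \<rho>" for x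
      unfolding \<eta>_def using that e(5) by (intro prod.neutral) (auto simp: cube_def)
    show "\<eta> x = 0" if x: "x \<notin> cube c \<sigma>" for x
    proof -
      obtain j where j: "j \<in> Basis" "\<sigma> \<le> \<bar>x \<bullet> j - c \<bullet> j\<bar>"
        using x by (force simp: cube_def)
      then have "e j (x \<bullet> j) = 0" using e(6) by blast
      then show ?thesis unfolding \<eta>_def using j(1) by (intro prod_zero) auto
    qed
    show "norm (F x) \<le> ?d * (2 / (\<sigma> - \<rho>))" for x
      using P(4)[of x] sum_bounded_above[of Basis "\<lambda>j. \<bar>e' j (x \<bullet> j)\<bar>" "2 / (\<sigma> - \<rho>)"] e(7)
      by simp
    have "(\<integral>\<^sup>+x. ennreal (norm (F x) powr p) * W x \<partial>lborel)
       \<le> (\<integral>\<^sup>+x. ennreal (?d powr p) * (\<Sum>j\<in>Basis. ennreal (\<bar>e' j (x \<bullet> j)\<bar> powr p) * W x) \<partial>lborel)"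
    proof (rule nn_integral_mono)
      fix x :: 'a
      have "norm (F x) powr p \<le> (\<Sum>j\<in>Basis. \<bar>e' j (x \<bullet> j)\<bar>) powr p"
        using P(4)[of x] p by (intro powr_mono2) auto
      also have "\<dots> \<le> ?d powr p * (\<Sum>j\<in>Basis. \<bar>e' j (x \<bullet> j)\<bar> powr p)"
        using p by (intro sum_powr_le) auto
      finally have "ennreal (norm (F x) powr p) * W x
          \<le> ennreal (?d powr p * (\<Sum>j\<in>Basis. \<bar>e' j (x \<bullet> j)\<bar> powr p)) * W x"
        by (intro mult_right_mono ennreal_leI) auto
      also have "\<dots> = ennreal (?d powr p) * (\<Sum>j\<in>Basis. ennreal (\<bar>e' j (x \<bullet> j)\<bar> powr p) * W x)"
        by (simp add: ennreal_mult sum_nonneg sum_distrib_right mult.assoc flip: sum_ennreal)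
      finally show "ennreal (norm (F x) powr p) * W x
          \<le> ennreal (?d powr p) * (\<Sum>j\<in>Basis. ennreal (\<bar>e' j (x \<bullet> j)\<bar> powr p) * W x)" .
    qed
    also have "\<dots> = ennreal (?d powr p) * (\<integral>\<^sup>+x. (\<Sum>j\<in>Basis. ennreal (\<bar>e' j (x \<bullet> j)\<bar> powr p) * W x) \<partial>lborel)"
      by (rule nn_integral_cmult) (auto intro!: borel_measurable_sum borel_measurable_times measurable_compose[OF _ e'm] )
    also have "(\<integral>\<^sup>+x. (\<Sum>j\<in>Basis. ennreal (\<bar>e' j (x \<bullet> j)\<bar> powr p) * W x) \<partial>lborel)
       = (\<Sum>j\<in>Basis. \<integral>\<^sup>+x. ennreal (\<bar>e' j (x \<bullet> j)\<bar> powr p) * W x \<partial>lborel)"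
      by (rule nn_integral_sum) (auto intro!: borel_measurable_times measurable_compose[OF _ e'm])
    also have "\<dots> = (\<Sum>j\<in>Basis. \<integral>\<^sup>+r. ennreal (\<bar>e' j r\<bar> powr p) * slice j W r \<partial>lborel)"
    proof (rule sum.cong[OF refl])
      fix j :: 'a assume j: "j \<in> Basis"
      note [measurable] = e'm[OF j]
      have "(\<integral>\<^sup>+x. ennreal (\<bar>e' j (x \<bullet> j)\<bar> powr p) * W x \<partial>lborel)
          = (\<integral>\<^sup>+r. slice j (\<lambda>x. ennreal (\<bar>e' j (x \<bullet> j)\<bar> powr p) * W x) r \<partial>lborel)"
        by (rule nn_integral_slice[OF j, symmetric]) measurable
      also have "\<dots> = (\<integral>\<^sup>+r. ennreal (\<bar>e' j r\<bar> powr p) * slice j W r \<partial>lborel)"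
        by (subst slice_inner_mult[OF j, of W "\<lambda>r. ennreal (\<bar>e' j r\<bar> powr p)"]) auto
      finally show "(\<integral>\<^sup>+x. ennreal (\<bar>e' j (x \<bullet> j)\<bar> powr p) * W x \<partial>lborel)
          = (\<integral>\<^sup>+r. ennreal (\<bar>e' j r\<bar> powr p) * slice j W r \<partial>lborel)" .
    qed
    also have "\<dots> \<le> of_nat (card (Basis::'a set)) * ennreal ?B" using e(8) by (rule sum_bounded_above)
    finally show "(\<integral>\<^sup>+x. ennreal (norm (F x) powr p) * W x \<partial>lborel) \<le> ennreal (?d powr p * (?d * ?B))"
      using B by (simp add: ennreal_mult mult_left_mono ennreal_of_nat_eq_real_of_nat)
  qed
qed

lemma cutoff_interval_simple:
  fixes \<rho> \<sigma> c :: real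
  assumes "0 \<le> \<rho>" "\<rho> < \<sigma>"
  shows "\<exists>e e'. (\<forall>x. (e has_real_derivative e' x) (at x)) \<and> continuous_on UNIV e' \<and>
    (\<forall>x. 0 \<le> e x) \<and> (\<forall>x. e x \<le> 1) \<and> (\<forall>x. \<bar>x - c\<bar> \<le> \<rho> \<longrightarrow> e x = 1) \<and> (\<forall>x. \<sigma> \<le> \<bar>x - c\<bar> \<longrightarrow> e x = 0)"
  by (rule cutoff_interval[OF assms, of "\<lambda>_. 0" 1 1 1 c]) (simp_all, blast)

text \<open>Approximation from inside: the half-width \<open>\<rho> n j\<close> of the plateau
  increases to the half-width \<open>\<sigma> j\<close> of the box. Integrals over boxes thereby
  become limits of integrals against test functions.\<close>

lemma box_cutoff:
  fixes l w :: "'a::euclidean_space"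
  assumes lw: "\<And>j. j \<in> Basis \<Longrightarrow> l \<bullet> j < w \<bullet> j"
  obtains \<phi> F where "\<And>n. C1_grad (\<phi> n) (F n)" "\<And>n x. 0 \<le> \<phi> n x" "\<And>n x. \<phi> n x \<le> 1"
    "\<And>n x. x \<notin> box l w \<Longrightarrow> \<phi> n x = 0" "\<And>x. (\<lambda>n. \<phi> n x) \<longlonglongrightarrow> indicator (box l w) x"
proof -
  define c where "c j = (l \<bullet> j + w \<bullet> j) / 2" for j
  define \<sigma> where "\<sigma> j = (w \<bullet> j - l \<bullet> j) / 2" for j
  define \<rho> where "\<rho> n j = \<sigma> j * (1 - 1 / real (Suc n))" for n j
  have \<sigma>: "0 < \<sigma> j" if "j \<in> Basis" for j using lw[OF that] by (simp add: \<sigma>_def)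
  have \<rho>: "0 \<le> \<rho> n j" "\<rho> n j < \<sigma> j" if "j \<in> Basis" for n j
    using \<sigma>[OF that] by (auto simp: \<rho>_def field_simps)
  define P where "P = (\<lambda>n j e e'. (\<forall>x. (e has_real_derivative e' x) (at x)) \<and> continuous_on UNIV e' \<and>
    (\<forall>x. 0 \<le> e x) \<and> (\<forall>x. e x \<le> 1) \<and> (\<forall>x. \<bar>x - c j\<bar> \<le> \<rho> n j \<longrightarrow> e x = 1) \<and> (\<forall>x. \<sigma> j \<le> \<bar>x - c j\<bar> \<longrightarrow> e x = (0::real)))"
  have "\<exists>e e'. P n j e e'" if "j \<in> Basis" for n j
    unfolding P_def using cutoff_interval_simple[OF \<rho>[OF that]] .
  then have "\<forall>n. \<forall>j\<in>Basis. \<exists>e e'. P n j e e'" by blast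
  then obtain e where "\<forall>n. \<forall>j\<in>Basis. \<exists>e'. P n j (e n j) e'" by metis
  then obtain e' where "\<forall>n. \<forall>j\<in>Basis. P n j (e n j) (e' n j)" by metis
  then have e: "\<And>n j x. j \<in> Basis \<Longrightarrow> (e n j has_real_derivative e' n j x) (at x)"
    "\<And>n j. j \<in> Basis \<Longrightarrow> continuous_on UNIV (e' n j)"
    "\<And>n j x. j \<in> Basis \<Longrightarrow> 0 \<le> e n j x" "\<And>n j x. j \<in> Basis \<Longrightarrow> e n j x \<le> 1"
    "\<And>n j x. j \<in> Basis \<Longrightarrow> \<bar>x - c j\<bar> \<le> \<rho> n j \<Longrightarrow> e n j x = 1"
    "\<And>n j x. j \<in> Basis \<Longrightarrow> \<sigma> j \<le> \<bar>x - c j\<bar> \<Longrightarrow> e n j x = 0"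
    unfolding P_def by blast+
  have inbox: "x \<in> box l w \<longleftrightarrow> (\<forall>j\<in>Basis. \<bar>x \<bullet> j - c j\<bar> < \<sigma> j)" for x
    unfolding mem_box by (intro ball_cong) (auto simp: c_def \<sigma>_def abs_less_iff field_simps)
  define \<phi> where "\<phi> n x = (\<Prod>j\<in>Basis. e n j (x \<bullet> j))" for n and x :: 'a
  define F where "F n x = (\<Sum>j\<in>Basis. (e' n j (x \<bullet> j) * (\<Prod>i\<in>Basis - {j}. e n i (x \<bullet> i))) *\<^sub>R j)" for n and x :: 'a
  have P: "C1_grad (\<phi> n) (F n)" "0 \<le> \<phi> n x" "\<phi> n x \<le> 1" for n x
    unfolding \<phi>_def F_def by (rule cutoff_product[where e = "e n" and e' = "e' n", OF e(1-4)]; assumption)+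
  have 0: "\<phi> n x = 0" if nb: "x \<notin> box l w" for n x
  proof -
    obtain j where "j \<in> Basis" "\<sigma> j \<le> \<bar>x \<bullet> j - c j\<bar>" using nb unfolding inbox by force
    then show ?thesis unfolding \<phi>_def using e(6) by (intro prod_zero) auto
  qed
  have lim: "(\<lambda>n. \<phi> n x) \<longlonglongrightarrow> indicator (box l w) x" for x
  proof (cases "x \<in> box l w")
    case True
    have "\<forall>\<^sub>F n in sequentially. \<bar>x \<bullet> j - c j\<bar> \<le> \<rho> n j" if "j \<in> Basis" for j
    proof -
      have "(\<lambda>n. \<sigma> j * (1 - inverse (real (Suc n)))) \<longlonglongrightarrow> \<sigma> j * (1 - 0)"
        by (intro tendsto_intros LIMSEQ_inverse_real_of_nat)
      then have "(\<lambda>n. \<rho> n j) \<longlonglongrightarrow> \<sigma> j" by (simp add: \<rho>_def divide_inverse)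
      moreover have "\<bar>x \<bullet> j - c j\<bar> < \<sigma> j" using True that by (simp add: inbox)
      ultimately have "\<forall>\<^sub>F n in sequentially. \<bar>x \<bullet> j - c j\<bar> < \<rho> n j" by (rule order_tendstoD(1))
      then show ?thesis by eventually_elim simp
    qed
    then have "\<forall>\<^sub>F n in sequentially. \<forall>j\<in>Basis. \<bar>x \<bullet> j - c j\<bar> \<le> \<rho> n j"
      by (intro eventually_ball_finite) auto
    then have "\<forall>\<^sub>F n in sequentially. \<phi> n x = indicator (box l w) x"
      by eventually_elim (use True e(5) in \<open>simp add: \<phi>_def\<close>)
    then show ?thesis by (rule tendsto_eventually)
  qed (simp add: 0)
  show ?thesis by (rule that[OF P 0 lim])
qed

section \<open>Uniqueness of weak gradients\<close>

text \<open>The positive and the negative part of \<open>h\<close>, taken as densities, define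
  measures that agree on boxes. Boxes are stable under intersection and generate the Borel sets, so
  the densities agree almost everywhere; as at most one of them is nonzero at a point, both
  vanish.\<close>

lemma AE_eq_0_if_box_integrals_0:
  fixes h :: "'a::euclidean_space \<Rightarrow> real"
  assumes h: "integrable lborel h" and 0: "\<And>l w. (\<integral>x. indicator (box l w) x * h x \<partial>lborel) = 0"
  shows "AE x in lborel. h x = 0"
proof -
  have [measurable]: "h \<in> borel_measurable borel" using borel_measurable_integrable[OF h] by simp
  have fin: "(\<integral>\<^sup>+x. ennreal (f x) * indicator A x \<partial>lborel) \<noteq> \<infinity>" if "f = h \<or> f = (\<lambda>x. - h x)" for f A
  proof -
    have "(\<integral>\<^sup>+x. ennreal (f x) * indicator A x \<partial>lborel) \<le> (\<integral>\<^sup>+x. ennreal (norm (h x)) \<partial>lborel)"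
      using that by (intro nn_integral_mono) (auto split: split_indicator intro!: ennreal_leI)
    also have "\<dots> < \<infinity>" using h by (simp add: integrable_iff_bounded)
    finally show ?thesis by simp
  qed
  have eq: "(\<integral>\<^sup>+x. ennreal (h x) * indicator (box l w) x \<partial>lborel)
      = (\<integral>\<^sup>+x. ennreal (- h x) * indicator (box l w) x \<partial>lborel)" for l w
  proof -
    let ?f = "\<lambda>x. indicator (box l w) x * h x"
    have int: "integrable lborel ?f" using integrable_mult_indicator[OF _ h, of "box l w"] by simp
    have "enn2real (\<integral>\<^sup>+x. ennreal (?f x) \<partial>lborel) - enn2real (\<integral>\<^sup>+x. ennreal (- ?f x) \<partial>lborel) = 0"
      using real_lebesgue_integral_def[OF int] 0[of l w] by simp
    moreover have "(\<integral>\<^sup>+x. ennreal (?f x) \<partial>lborel) = (\<integral>\<^sup>+x. ennreal (h x) * indicator (box l w) x \<partial>lborel)"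
      by (intro nn_integral_cong) (auto split: split_indicator)
    moreover have "(\<integral>\<^sup>+x. ennreal (- ?f x) \<partial>lborel) = (\<integral>\<^sup>+x. ennreal (- h x) * indicator (box l w) x \<partial>lborel)"
      by (intro nn_integral_cong) (auto split: split_indicator)
    ultimately have "enn2real (\<integral>\<^sup>+x. ennreal (h x) * indicator (box l w) x \<partial>lborel)
       = enn2real (\<integral>\<^sup>+x. ennreal (- h x) * indicator (box l w) x \<partial>lborel)" by simp
    note eq = this
    show ?thesis
    proof -
      have "(\<integral>\<^sup>+x. ennreal (h x) * indicator (box l w) x \<partial>lborel)
          = ennreal (enn2real (\<integral>\<^sup>+x. ennreal (h x) * indicator (box l w) x \<partial>lborel))"
        using fin[of h "box l w"] by (simp add: less_top)
      also have "\<dots> = (\<integral>\<^sup>+x. ennreal (- h x) * indicator (box l w) x \<partial>lborel)"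
        unfolding eq using fin[of "\<lambda>x. - h x" "box l w"] by (simp add: less_top)
      finally show ?thesis .
    qed
  qed
  let ?M = "density lborel (\<lambda>x. ennreal (h x))" and ?N = "density lborel (\<lambda>x. ennreal (- h x))"
  let ?E = "range (\<lambda>(a, b). box a b::'a set)"
  let ?A = "\<lambda>n::nat. box (- (real n *\<^sub>R One)) (real n *\<^sub>R One) :: 'a set"
  have "?M = ?N"
  proof (rule measure_eqI_generator_eq)
    show "Int_stable ?E"
      by (auto simp: Int_stable_def box_Int_box)
    show "?E \<subseteq> Pow UNIV" "sets ?M = sigma_sets UNIV ?E" "sets ?N = sigma_sets UNIV ?E"
      by (simp_all add: borel_eq_box)
    show "range ?A \<subseteq> ?E" "(\<Union>i. ?A i) = UNIV"
      unfolding UN_box_eq_UNIV by auto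
    show "emeasure ?M (?A i) \<noteq> \<infinity>" for i
      using fin[of h "?A i"] by (simp add: emeasure_density)
    show "emeasure ?M X = emeasure ?N X" if "X \<in> ?E" for X
      using that eq by (auto simp: emeasure_density)
  qed
  then have "AE x in lborel. ennreal (h x) = ennreal (- h x)"
    by (intro sigma_finite_measure.density_unique[OF sigma_finite_lborel]) auto
  then show ?thesis
  proof eventually_elim
    fix x assume "ennreal (h x) = ennreal (- h x)"
    then show "h x = 0" by (cases "0 \<le> h x") (auto simp: ennreal_neg ennreal_eq_0_iff)
  qed
qed

text \<open>A subsolution comes with one weak gradient and its approximating sequence with another,
  and the two have to be identified. Cutoffs of boxes as test functions show that the difference
  \<open>H\<close> has integral 0 over every box whose closure lies in \<open>\<Omega>\<close>, and
  countably many closed boxes cover \<open>\<Omega>\<close>.\<close>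

lemma has_W11_gradient_unique:
  fixes \<Omega> :: "'a::euclidean_space set"
  assumes \<Omega>: "open \<Omega>" and G: "has_W11_gradient \<Omega> u G" and G': "has_W11_gradient \<Omega> u G'"
  shows "AE x in lebesgue_on \<Omega>. G x = G' x"
proof -
  let ?M = "lebesgue_on \<Omega>"
  define H where "H x = G x - G' x" for x
  have \<Omega>m: "\<Omega> \<in> sets lebesgue" using \<Omega> by simp
  have iG: "integrable ?M G" "integrable ?M G'" using G G' by (auto simp: has_W11_gradient_def)
  then have iH: "integrable ?M H" unfolding H_def by simp
  have mG: "G \<in> borel_measurable ?M" "G' \<in> borel_measurable ?M" "H \<in> borel_measurable ?M"
    using iG iH by auto
  have test: "(\<integral>x. \<phi> x *\<^sub>R H x \<partial>?M) = 0" if \<phi>: "C1_grad \<phi> F" "\<And>x. 0 \<le> \<phi> x" "\<And>x. \<phi> x \<le> 1"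
     "compact K" "K \<subseteq> \<Omega>" "\<And>x. x \<notin> K \<Longrightarrow> \<phi> x = 0" for \<phi> F K
  proof -
    have "\<phi> \<in> C1c \<Omega>" unfolding C1c_def using C1_grad_C1[OF \<phi>(1)] \<phi>(4-6) by auto
    then have "(\<integral>x. \<phi> x *\<^sub>R G x \<partial>?M) = (\<integral>x. \<phi> x *\<^sub>R G' x \<partial>?M)"
      using G G' by (simp add: has_W11_gradient_def)
    moreover have "\<phi> \<in> borel_measurable ?M"
      using C1_gradD(3)[OF \<phi>(1)] \<Omega>m by (rule continuous_imp_measurable_on_sets_lebesgue)
    then have "integrable ?M (\<lambda>x. \<phi> x *\<^sub>R G x)" "integrable ?M (\<lambda>x. \<phi> x *\<^sub>R G' x)"
      using \<phi>(2,3) mG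
      by (auto intro!: Bochner_Integration.integrable_bound[OF iG(1), of "\<lambda>x. \<phi> x *\<^sub>R G x"]
        Bochner_Integration.integrable_bound[OF iG(2), of "\<lambda>x. \<phi> x *\<^sub>R G' x"] mult_left_le_one_le AE_I2)
    ultimately show ?thesis by (simp add: H_def scaleR_diff_right Bochner_Integration.integral_diff)
  qed
  have box0: "(\<integral>x. indicator (box l w) x *\<^sub>R H x \<partial>?M) = 0" if sub: "cbox l w \<subseteq> \<Omega>" for l w
  proof (cases "box l w = {}")
    case False
    then have lw: "l \<bullet> j < w \<bullet> j" if "j \<in> Basis" for j using that by (auto simp: box_ne_empty)
    obtain \<phi> F where \<phi>: "\<And>n. C1_grad (\<phi> n) (F n)" "\<And>n x. 0 \<le> \<phi> n x" "\<And>n x. \<phi> n x \<le> 1"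
      "\<And>n x. x \<notin> box l w \<Longrightarrow> \<phi> n x = 0" "\<And>x. (\<lambda>n. \<phi> n x) \<longlonglongrightarrow> indicator (box l w) x"
      by (rule box_cutoff[OF lw], assumption) (rule that, assumption+)
    have mes: "\<phi> n \<in> borel_measurable ?M" for n
      using C1_gradD(3)[OF \<phi>(1)] \<Omega>m by (rule continuous_imp_measurable_on_sets_lebesgue)
    have "(\<lambda>n. \<integral>x. \<phi> n x *\<^sub>R H x \<partial>?M) \<longlonglongrightarrow> (\<integral>x. indicator (box l w) x *\<^sub>R H x \<partial>?M)"
    proof (rule integral_dominated_convergence[where w = "\<lambda>x. norm (H x)"])
      show "(\<lambda>x. indicat_real (box l w) x *\<^sub>R H x) \<in> borel_measurable ?M"
      proof -
        have "box l w \<in> sets ?M"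
          using sub box_subset_cbox[of l w] \<Omega>m by (subst sets_restrict_space_iff) auto
        then show ?thesis using mG(3) by (intro borel_measurable_scaleR borel_measurable_indicator)
      qed
      show "AE x in ?M. (\<lambda>n. \<phi> n x *\<^sub>R H x) \<longlonglongrightarrow> indicat_real (box l w) x *\<^sub>R H x"
        by (intro AE_I2 tendsto_scaleR \<phi>(5) tendsto_const)
      show "AE x in ?M. norm (\<phi> n x *\<^sub>R H x) \<le> norm (H x)" for n
        using \<phi>(2,3) by (intro AE_I2) (simp add: mult_left_le_one_le)
    qed (use mes mG iH in auto)
    moreover have "(\<integral>x. \<phi> n x *\<^sub>R H x \<partial>?M) = 0" for n
      by (rule test[OF \<phi>(1) \<phi>(2) \<phi>(3) compact_cbox sub]) (use \<phi>(4) box_subset_cbox[of l w] in blast)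
    ultimately show ?thesis by (simp add: LIMSEQ_const_iff)
  qed simp
  have AEbox: "AE x in lebesgue. x \<in> box l w \<longrightarrow> H x \<bullet> b = 0" if sub: "cbox l w \<subseteq> \<Omega>" for l w b
  proof -
    \<comment> \<open>Restricted to the box and extended by 0, a component of \<open>H\<close> is
      integrable on the whole space. Its integral over any other box vanishes, because the
      intersection of two boxes is again a box.\<close>
    define k where "k x = indicator (box l w) x * (indicator \<Omega> x * (H x \<bullet> b))" for x
    have "integrable lebesgue (\<lambda>x. indicator \<Omega> x *\<^sub>R H x)"
      using iH \<Omega>m by (simp add: integrable_restrict_space)
    then have "integrable lebesgue (\<lambda>x. (indicator \<Omega> x *\<^sub>R H x) \<bullet> b)" by (rule integrable_inner_left)
    then have ik: "integrable lebesgue k"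
      unfolding k_def using integrable_mult_indicator[of "box l w" lebesgue "\<lambda>x. (indicator \<Omega> x *\<^sub>R H x) \<bullet> b"] by simp
    then obtain h where h: "h \<in> borel_measurable lborel" "AE x in lborel. k x = h x"
      using completion_ex_borel_measurable_real[of k lborel] by auto
    have hk: "AE x in lebesgue. k x = h x" using h(2) by (rule AE_completion)
    have ih: "integrable lborel h"
    proof -
      have "integrable lebesgue h"
        using ik integrable_cong_AE[OF borel_measurable_integrable[OF ik] measurable_completion[OF h(1)] hk] by simp
      then show ?thesis using h(1) by (simp add: integrable_completion)
    qed
    have "(\<integral>x. indicator (box l' w') x * h x \<partial>lborel) = 0" for l' w'
    proof -
      obtain l2 w2 where b2: "box l' w' \<inter> box l w = box l2 w2" by (auto simp: box_Int_box)
      have ss: "box l2 w2 \<subseteq> \<Omega>" using sub b2 box_subset_cbox[of l w] by blast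
      have "(\<integral>x. indicator (box l' w') x * h x \<partial>lborel) = (\<integral>x. indicator (box l' w') x * h x \<partial>lebesgue)"
        using h(1) by (intro integral_completion[symmetric]) auto
      also have "\<dots> = (\<integral>x. indicator (box l' w') x * k x \<partial>lebesgue)"
      proof (intro integral_cong_AE)
        show "AE x in lebesgue. indicator (box l' w') x * h x = indicator (box l' w') x * k x"
          using hk by eventually_elim simp
        show "(\<lambda>x. indicat_real (box l' w') x * h x) \<in> borel_measurable lebesgue"
          using measurable_completion[OF h(1)] by (intro borel_measurable_times borel_measurable_indicator) auto
        show "(\<lambda>x. indicat_real (box l' w') x * k x) \<in> borel_measurable lebesgue"
          using borel_measurable_integrable[OF ik] by (intro borel_measurable_times borel_measurable_indicator) auto
      qed
      also have "\<dots> = (\<integral>x. indicator \<Omega> x *\<^sub>R (indicator (box l2 w2) x * (H x \<bullet> b)) \<partial>lebesgue)"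
        unfolding k_def b2[symmetric] by (intro Bochner_Integration.integral_cong) (auto split: split_indicator)
      also have "\<dots> = (\<integral>x. indicator (box l2 w2) x * (H x \<bullet> b) \<partial>?M)"
        using \<Omega>m by (intro integral_restrict_space[symmetric]) auto
      also have "\<dots> = 0"
      proof (cases "box l2 w2 = {}")
        case False
        then have "cbox l2 w2 = closure (box l2 w2)" by (simp add: closure_box)
        also have "\<dots> \<subseteq> closure (box l w)" using b2 by (intro closure_mono) auto
        also have "\<dots> \<subseteq> cbox l w" by (intro closure_minimal box_subset_cbox closed_cbox)
        finally have sub2: "cbox l2 w2 \<subseteq> \<Omega>" using sub by blast
        have "(\<integral>x. (indicator (box l2 w2) x *\<^sub>R H x) \<bullet> b \<partial>?M) = (\<integral>x. indicator (box l2 w2) x *\<^sub>R H x \<partial>?M) \<bullet> b"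
        proof (rule integral_inner_left)
          have "box l2 w2 \<in> sets ?M" using ss \<Omega>m by (subst sets_restrict_space_iff) auto
          then show "b \<noteq> 0 \<Longrightarrow> integrable ?M (\<lambda>x. indicat_real (box l2 w2) x *\<^sub>R H x)"
            using iH by (rule integrable_mult_indicator)
        qed
        then show ?thesis using box0[OF sub2] by simp
      qed simp
      finally show ?thesis .
    qed
    from AE_eq_0_if_box_integrals_0[OF ih this] have "AE x in lebesgue. h x = 0" by (rule AE_completion)
    then show ?thesis using hk
    proof eventually_elim
      fix x assume "h x = 0" "k x = h x"
      then show "x \<in> box l w \<longrightarrow> H x \<bullet> b = 0"
        using sub box_subset_cbox[of l w] by (auto simp: k_def indicator_def split: if_splits)
    qed
  qed
  obtain \<D> where \<D>: "countable \<D>" "\<D> \<subseteq> Pow \<Omega>" "\<And>X. X \<in> \<D> \<Longrightarrow> \<exists>a b. X = cbox a b" "\<Union>\<D> = \<Omega>"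
    using open_countable_Union_open_cbox[OF \<Omega>] by metis
  have "AE x in lebesgue. x \<in> X \<longrightarrow> H x = 0" if X: "X \<in> \<D>" for X
  proof -
    obtain l w where lw: "X = cbox l w" using \<D>(3)[OF X] by blast
    then have sub: "cbox l w \<subseteq> \<Omega>" using X \<D>(2) by auto
    have "AE x in lebesgue. \<forall>b\<in>Basis. x \<in> box l w \<longrightarrow> H x \<bullet> b = 0"
      using AEbox[OF sub] by (intro AE_finite_allI) auto
    \<comment> \<open>The cover consists of closed boxes while \<open>AEbox\<close> speaks of their
      interiors; the faces are null sets.\<close>
    moreover have "AE x in lebesgue. x \<notin> cbox l w - box l w"
      using negligible_frontier_interval[of l w] by (intro AE_not_in) (simp add: negligible_iff_null_sets)
    ultimately show ?thesis
    proof eventually_elim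
      fix x assume "\<forall>b\<in>Basis. x \<in> box l w \<longrightarrow> H x \<bullet> b = 0" "x \<notin> cbox l w - box l w"
      then show "x \<in> X \<longrightarrow> H x = 0" unfolding lw by (auto simp: euclidean_all_zero_iff)
    qed
  qed
  then have "AE x in lebesgue. \<forall>X\<in>\<D>. x \<in> X \<longrightarrow> H x = 0"
    using \<D>(1) by (subst AE_ball_countable) auto
  then have "AE x in lebesgue. x \<in> \<Omega> \<longrightarrow> G x = G' x"
    by eventually_elim (use \<D>(4) in \<open>auto simp: H_def\<close>)
  then show ?thesis using \<Omega>m by (subst AE_restrict_space_iff) auto
qed

section \<open>De Giorgi iteration\<close>

text \<open>The exceptional null set need not be null on a given hyperplane. Let \<open>Z\<close> be
  infinite on it and 0 elsewhere: its integral is 0, so by Fubini's theorem its slices vanish for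
  almost every \<open>r\<close>, while \<open>F \<le> G + Z\<close> holds everywhere.\<close>

lemma slice_mono_AE:
  assumes b: "b \<in> Basis" and [measurable]: "F \<in> borel_measurable borel" "G \<in> borel_measurable borel"
    and le: "AE x in lborel. F x \<le> G x"
  shows "AE r in lborel. slice b F r \<le> slice b G r"
proof -
  define Z where "Z = (\<lambda>x. if F x \<le> G x then 0 else \<infinity> :: ennreal)"
  have [measurable]: "Z \<in> borel_measurable borel" unfolding Z_def by measurable
  have "AE x in lborel. Z x = 0"
    using le by eventually_elim (simp add: Z_def)
  then have "(\<integral>\<^sup>+r. slice b Z r \<partial>lborel) = 0"
    by (simp add: nn_integral_slice[OF b] nn_integral_0_iff_AE)
  then have "AE r in lborel. slice b Z r = 0"
    by (subst (asm) nn_integral_0_iff_AE) auto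
  then show ?thesis
  proof eventually_elim
    fix r assume 0: "slice b Z r = 0"
    have "slice b F r \<le> slice b (\<lambda>x. G x + Z x) r"
      by (intro slice_mono[OF b]) (simp add: Z_def)
    also have "\<dots> = slice b G r + slice b Z r"
      unfolding slice_def by (intro nn_integral_add) auto
    finally show "slice b F r \<le> slice b G r" using 0 by simp
  qed
qed

lemma powr_add_le:
  fixes x y :: real
  assumes "0 \<le> x" "0 \<le> y" "0 < p"
  shows "(x + y) powr p \<le> 2 powr p * (x powr p + y powr p)"
proof -
  have "(x + y) powr p \<le> (2 * max x y) powr p" using assms by (intro powr_mono2) auto
  also have "\<dots> = 2 powr p * max x y powr p" using assms by (simp add: powr_mult)
  also have "\<dots> \<le> 2 powr p * (x powr p + y powr p)"
    by (intro mult_left_mono) (auto simp: max_def)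
  finally show ?thesis .
qed

lemma C1_grad_power:
  assumes f: "C1_grad f F"
  shows "C1_grad (\<lambda>x. f x ^ m) (\<lambda>x. (real m * f x ^ (m - 1)) *\<^sub>R F x)"
  unfolding C1_grad_def
proof safe
  fix x
  show "((\<lambda>x. f x ^ m) has_derivative (\<lambda>h. ((real m * f x ^ (m - 1)) *\<^sub>R F x) \<bullet> h)) (at x)"
    using has_derivative_power[OF C1_gradD(1)[OF f], of m x] by (simp add: mult_ac)
  show "continuous_on UNIV (\<lambda>x. (real m * f x ^ (m - 1)) *\<^sub>R F x)"
    by (intro continuous_intros C1_gradD(2,3)[OF f])
qed

definition excess :: "('a \<Rightarrow> real) \<Rightarrow> real \<Rightarrow> 'a \<Rightarrow> real" where
  "excess u k x = max 0 (u x - k)"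

text \<open>For \<open>g\<close> the norm of the weak gradient of \<open>u\<close>, this is the norm
  of the gradient of \<open>excess u k\<close>. Only norms of gradients enter the iteration.\<close>

definition level_grad :: "('a \<Rightarrow> real) \<Rightarrow> ('a \<Rightarrow> real) \<Rightarrow> real \<Rightarrow> 'a \<Rightarrow> real" where
  "level_grad u g k x = (if k < u x then g x else 0)"

lemma excess_measurable [measurable]:
  assumes [measurable]: "u \<in> borel_measurable M"
  shows "excess u k \<in> borel_measurable M"
  unfolding excess_def[abs_def] by measurable

lemma level_grad_measurable [measurable]:
  assumes [measurable]: "u \<in> borel_measurable M" "g \<in> borel_measurable M"
  shows "level_grad u g k \<in> borel_measurable M"
  unfolding level_grad_def[abs_def] by measurable

lemma excess_simps: "0 \<le> excess u k x" "k \<le> l \<Longrightarrow> excess u l x \<le> excess u k x"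
  "\<not> k < u x \<Longrightarrow> excess u k x = 0" "0 \<le> k \<Longrightarrow> excess u k x \<le> \<bar>u x\<bar>" "l < u x \<Longrightarrow> l - k \<le> excess u k x"
  by (auto simp: excess_def)

lemma level_grad_simps: "(\<And>x. 0 \<le> g x) \<Longrightarrow> 0 \<le> level_grad u g k x"
  "(\<And>x. 0 \<le> g x) \<Longrightarrow> k \<le> l \<Longrightarrow> level_grad u g l x \<le> level_grad u g k x"
  "\<not> k < u x \<Longrightarrow> level_grad u g k x = 0" "(\<And>x. 0 \<le> g x) \<Longrightarrow> level_grad u g k x \<le> g x"
  by (auto simp: level_grad_def)

text \<open>The iteration is separated from the equation. It sees the subsolution only through
  \<open>cacc\<close>, the energy inequality on level sets, and \<open>repr\<close>, which takes the
  place of the Sobolev inequality. All functions are real-valued and Borel on the whole space, since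
  hyperplane integrals are taken of Borel functions; the integrability assumptions concern the cube
  only.\<close>

locale degiorgi =
  fixes p s t :: real and c :: "'a::euclidean_space" and R0 K L C0 :: real and m :: nat
    and lam mu u g :: "'a \<Rightarrow> real"
  assumes d: "2 \<le> DIM('a)" and p: "1 < p" and s: "1 \<le> s" and t: "1 / (p - 1) < t"
    and st: "1 / s + 1 / t < p / (real DIM('a) - 1)"
    and R0: "0 < R0" and K: "0 \<le> K" and L: "0 \<le> L" and C0: "0 \<le> C0" and m: "1 \<le> m"
    and meas [measurable]: "lam \<in> borel_measurable borel" "mu \<in> borel_measurable borel"
      "u \<in> borel_measurable borel" "g \<in> borel_measurable borel"
    and nonneg: "\<And>x. 0 \<le> lam x" "\<And>x. 0 \<le> mu x" "\<And>x. 0 \<le> g x"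
    and lam_pos: "AE x in lborel. x \<in> cube c R0 \<longrightarrow> 0 < lam x"
    and lam_le: "AE x in lborel. x \<in> cube c R0 \<longrightarrow> lam x \<le> mu x"
    and mu_s: "(\<integral>\<^sup>+x. indicator (cube c R0) x * ennreal (mu x powr s) \<partial>lborel) < \<infinity>"
    and lam_t: "(\<integral>\<^sup>+x. indicator (cube c R0) x * ennreal (lam x powr (-t)) \<partial>lborel) < \<infinity>"
    and g_p: "(\<integral>\<^sup>+x. indicator (cube c R0) x * ennreal (lam x * g x powr p) \<partial>lborel) < \<infinity>"
    and u_p: "(\<integral>\<^sup>+x. indicator (cube c R0) x * ennreal (mu x * \<bar>u x\<bar> powr p) \<partial>lborel) < \<infinity>"
    and repr: "\<And>\<zeta> F b k. C1_grad \<zeta> F \<Longrightarrow> (\<And>x. 0 \<le> \<zeta> x) \<Longrightarrow> (\<And>x. \<zeta> x \<le> 1) \<Longrightarrow>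
      (\<And>x. x \<notin> cube c R0 \<Longrightarrow> \<zeta> x = 0) \<Longrightarrow> b \<in> Basis \<Longrightarrow> 0 \<le> k \<Longrightarrow>
      AE x in lborel. ennreal (\<zeta> x * excess u k x)
        \<le> ennreal K * pot b L (\<lambda>x. ennreal (\<zeta> x * level_grad u g k x + norm (F x) * excess u k x)) x"
    and cacc: "\<And>\<eta> F k. C1_grad \<eta> F \<Longrightarrow> (\<And>x. 0 \<le> \<eta> x) \<Longrightarrow> (\<And>x. \<eta> x \<le> 1) \<Longrightarrow>
      (\<And>x. x \<notin> cube c R0 \<Longrightarrow> \<eta> x = 0) \<Longrightarrow> 0 \<le> k \<Longrightarrow>
      (\<integral>\<^sup>+x. ennreal (lam x * \<eta> x ^ m * level_grad u g k x powr p) \<partial>lborel)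
        \<le> ennreal C0 * (\<integral>\<^sup>+x. ennreal (mu x * norm (F x) powr p * excess u k x powr p) \<partial>lborel)"
begin

abbreviation Q where "Q \<equiv> cube c R0"

section \<open>Exponents and Hoelder's inequality for the weight\<close>

definition r where "r = t / (t + 1)"
definition q where "q = p * r"

lemma t0: "0 < t" using t p by (smt (verit) zero_less_divide_1_iff)

lemma r: "0 < r" "r < 1" "1 - r = 1 / (t + 1)" "t * (1 - r) = r"
  using t0 by (auto simp: r_def field_simps)

lemma q: "1 < q" "q < p" "0 < q" "q / p = r"
proof -
  have "1 < t * (p - 1)" using t p by (simp add: field_simps)
  then show "1 < q" using t0 by (simp add: q_def r_def field_simps)
  then show "0 < q" by simp
  show "q < p" "q / p = r" using r p by (auto simp: q_def)
qed

definition \<Lambda> where "\<Lambda> = epow (\<integral>\<^sup>+x. indicator Q x * ennreal (lam x powr (-t)) \<partial>lborel) (1 - r)"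

lemma \<Lambda>: "\<Lambda> < \<infinity>" unfolding \<Lambda>_def using lam_t by (rule epow_less_top)

text \<open>The identity \<open>t * (1 - r) = r\<close> makes the powers of \<open>lam\<close>
  cancel in the product of the r-th power of \<open>lam * f powr p\<close> and the (1 - r)-th power
  of \<open>lam powr (-t)\<close>, which leaves \<open>f powr q\<close>.\<close>

lemma weighted_Holder:
  assumes [measurable]: "f \<in> borel_measurable borel" and f: "\<And>x. 0 \<le> f x"
  shows "(\<integral>\<^sup>+x. indicator Q x * ennreal (f x powr q) \<partial>lborel)
    \<le> epow (\<integral>\<^sup>+x. indicator Q x * ennreal (lam x * f x powr p) \<partial>lborel) r * \<Lambda>"
proof -
  have "(\<integral>\<^sup>+x. indicator Q x * ennreal (f x powr q) \<partial>lborel)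
    \<le> (\<integral>\<^sup>+x. epow (indicator Q x * ennreal (lam x * f x powr p)) r *
         epow (indicator Q x * ennreal (lam x powr (-t))) (1 - r) \<partial>lborel)"
  proof (rule nn_integral_mono_AE)
    show "AE x in lborel. indicator Q x * ennreal (f x powr q)
       \<le> epow (indicator Q x * ennreal (lam x * f x powr p)) r *
         epow (indicator Q x * ennreal (lam x powr (-t))) (1 - r)"
      using lam_pos
    proof eventually_elim
      fix x assume pos: "x \<in> Q \<longrightarrow> 0 < lam x"
      show "indicator Q x * ennreal (f x powr q)
       \<le> epow (indicator Q x * ennreal (lam x * f x powr p)) r *
         epow (indicator Q x * ennreal (lam x powr (-t))) (1 - r)"
      proof (cases "x \<in> Q")
        case True
        then have l: "0 < lam x" using pos by simp
        have "(lam x * f x powr p) powr r * (lam x powr (-t)) powr (1 - r) = f x powr q"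
        proof -
          have "(lam x powr (-t)) powr (1 - r) = lam x powr (-r)"
            unfolding powr_powr using r(4) by (simp only: mult_minus_left)
          then show ?thesis
            using l f[of x] by (simp add: powr_mult powr_powr q_def powr_minus)
        qed
        then show ?thesis using True l r(1,2) f[of x]
          by (simp add: epow_ennreal flip: ennreal_mult)
      qed simp
    qed
  qed
  also have "\<dots> \<le> epow (\<integral>\<^sup>+x. indicator Q x * ennreal (lam x * f x powr p) \<partial>lborel) r * \<Lambda>"
    unfolding \<Lambda>_def using r by (intro nn_integral_Holder) auto
  finally show ?thesis .
qed

text \<open>The quantity that is iterated. It contains the function besides its gradient because the
  source of the potential at the next level involves the excess times the gradient of a
  cutoff.\<close>

definition X where
  "X k R = (\<integral>\<^sup>+x. indicator (cube c R) x * ennreal (level_grad u g k x powr q + excess u k x powr q) \<partial>lborel)"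

text \<open>For the function part, \<open>lam \<le> mu\<close> turns the integrability of
  \<open>mu * \<bar>u\<bar> powr p\<close> into a bound with the weight \<open>lam\<close>, to which
  \<open>weighted_Holder\<close> applies.\<close>

lemma X_finite: "X 0 R0 < \<infinity>"
proof -
  have 1: "(\<integral>\<^sup>+x. indicator Q x * ennreal (level_grad u g 0 x powr q) \<partial>lborel) < \<infinity>"
  proof -
    have "(\<integral>\<^sup>+x. indicator Q x * ennreal (lam x * level_grad u g 0 x powr p) \<partial>lborel)
        \<le> (\<integral>\<^sup>+x. indicator Q x * ennreal (lam x * g x powr p) \<partial>lborel)"
      using nonneg p by (intro nn_integral_mono mult_left_mono ennreal_leI powr_mono2 level_grad_simps) auto
    then have "(\<integral>\<^sup>+x. indicator Q x * ennreal (lam x * level_grad u g 0 x powr p) \<partial>lborel) < \<infinity>"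
      using g_p by (rule le_less_trans)
    then have "epow (\<integral>\<^sup>+x. indicator Q x * ennreal (lam x * level_grad u g 0 x powr p) \<partial>lborel) r * \<Lambda> < \<infinity>"
      using \<Lambda> epow_less_top by (simp add: ennreal_mult_less_top)
    moreover have "(\<integral>\<^sup>+x. indicator Q x * ennreal (level_grad u g 0 x powr q) \<partial>lborel) \<le>
       epow (\<integral>\<^sup>+x. indicator Q x * ennreal (lam x * level_grad u g 0 x powr p) \<partial>lborel) r * \<Lambda>"
      using nonneg by (intro weighted_Holder level_grad_simps) auto
    ultimately show ?thesis by (rule le_less_trans[rotated])
  qed
  have 2: "(\<integral>\<^sup>+x. indicator Q x * ennreal (excess u 0 x powr q) \<partial>lborel) < \<infinity>"
  proof -
    have "(\<integral>\<^sup>+x. indicator Q x * ennreal (lam x * excess u 0 x powr p) \<partial>lborel)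
        \<le> (\<integral>\<^sup>+x. indicator Q x * ennreal (mu x * \<bar>u x\<bar> powr p) \<partial>lborel)"
    proof (rule nn_integral_mono_AE)
      show "AE x in lborel. indicator Q x * ennreal (lam x * excess u 0 x powr p)
          \<le> indicator Q x * ennreal (mu x * \<bar>u x\<bar> powr p)"
        using lam_le
      proof eventually_elim
        fix x assume "x \<in> Q \<longrightarrow> lam x \<le> mu x"
        then show "indicator Q x * ennreal (lam x * excess u 0 x powr p)
          \<le> indicator Q x * ennreal (mu x * \<bar>u x\<bar> powr p)"
          using nonneg p excess_simps(1)[of u 0 x] excess_simps(4)[of 0 u x]
          by (cases "x \<in> Q") (auto intro!: ennreal_leI mult_mono powr_mono2)
      qed
    qed
    then have "(\<integral>\<^sup>+x. indicator Q x * ennreal (lam x * excess u 0 x powr p) \<partial>lborel) < \<infinity>"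
      using u_p by (rule le_less_trans)
    then have "epow (\<integral>\<^sup>+x. indicator Q x * ennreal (lam x * excess u 0 x powr p) \<partial>lborel) r * \<Lambda> < \<infinity>"
      using \<Lambda> epow_less_top by (simp add: ennreal_mult_less_top)
    moreover have "(\<integral>\<^sup>+x. indicator Q x * ennreal (excess u 0 x powr q) \<partial>lborel) \<le>
       epow (\<integral>\<^sup>+x. indicator Q x * ennreal (lam x * excess u 0 x powr p) \<partial>lborel) r * \<Lambda>"
      by (intro weighted_Holder excess_simps) auto
    ultimately show ?thesis by (rule le_less_trans[rotated])
  qed
  have "X 0 R0 = (\<integral>\<^sup>+x. indicator Q x * ennreal (level_grad u g 0 x powr q) + indicator Q x * ennreal (excess u 0 x powr q) \<partial>lborel)"
    unfolding X_def by (intro nn_integral_cong) (simp add: distrib_left)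
  also have "\<dots> = (\<integral>\<^sup>+x. indicator Q x * ennreal (level_grad u g 0 x powr q) \<partial>lborel)
      + (\<integral>\<^sup>+x. indicator Q x * ennreal (excess u 0 x powr q) \<partial>lborel)"
    by (intro nn_integral_add) auto
  also have "\<dots> < \<infinity>" using 1 2 by (simp add: less_top[symmetric])
  finally show ?thesis .
qed

lemma X_mono: "k \<le> l \<Longrightarrow> R \<le> R' \<Longrightarrow> X l R \<le> X k R'"
  unfolding X_def using cube_mono[of R R' c] nonneg q
  by (intro nn_integral_mono mult_mono ennreal_leI add_mono powr_mono2 level_grad_simps excess_simps)
    (auto split: split_indicator)

lemma level_set_le:
  assumes kl: "k < l"
  shows "ennreal ((l - k) powr q) * emeasure lborel {x \<in> cube c R. l < u x} \<le> X k R"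
proof -
  have "ennreal ((l - k) powr q) * emeasure lborel {x \<in> cube c R. l < u x}
      = (\<integral>\<^sup>+x. ennreal ((l - k) powr q) * indicator {x \<in> cube c R. l < u x} x \<partial>lborel)"
    by (subst nn_integral_cmult_indicator) auto
  also have "\<dots> \<le> X k R"
    unfolding X_def
  proof (rule nn_integral_mono)
    fix x
    have "(l - k) powr q \<le> level_grad u g k x powr q + excess u k x powr q" if "l < u x"
    proof -
      have "l - k \<le> excess u k x" using that by (simp add: excess_def)
      then have "(l - k) powr q \<le> excess u k x powr q" using kl q by (intro powr_mono2) auto
      then show ?thesis by (simp add: add_increasing)
    qed
    then show "ennreal ((l - k) powr q) * indicator {x \<in> cube c R. l < u x} x
        \<le> indicator (cube c R) x * ennreal (level_grad u g k x powr q + excess u k x powr q)"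
      by (auto intro!: ennreal_leI split: split_indicator simp del: ennreal_plus)
  qed
  finally show ?thesis .
qed

text \<open>The origin of the superlinear gain. \<open>h\<close> vanishes off the set where
  \<open>u > l\<close>, whose measure inside the cube is at most
  \<open>(l - k) powr (-q) * x\<close>. Hoelder's inequality against the indicator of this set
  lowers the exponent from \<open>q\<close> to \<open>q1\<close>; the powers \<open>q1 / q\<close>
  and \<open>1 - q1 / q\<close> of \<open>x\<close> multiply to \<open>x\<close> itself, a higher
  power than the \<open>q1 / q\<close> that comes from the norm of \<open>h\<close> alone.\<close>

lemma source_bound:
  assumes kl: "k < l" and e: "0 \<le> e" and q1: "0 < q1" "q1 < q" and x: "X k R \<le> ennreal x" "0 < x"
    and [measurable]: "h \<in> borel_measurable borel"
    and h: "\<And>y. y \<in> cube c R \<Longrightarrow> h y \<le> ennreal (level_grad u g l y + e * excess u l y)"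
      "\<And>y. y \<notin> cube c R \<Longrightarrow> h y = 0"
  shows "(\<integral>\<^sup>+y. epow (h y) q1 \<partial>lborel)
    \<le> ennreal ((2 * (1 + e)) powr q1 * x * (l - k) powr (- (q - q1)))"
proof -
  define S where "S = {x \<in> cube c R. l < u x}"
  have [measurable]: "S \<in> sets borel" unfolding S_def by measurable
  have h0: "h y = 0" if "y \<notin> S" for y
    using that h(1)[of y] h(2)[of y] by (cases "y \<in> cube c R") (auto simp: S_def level_grad_simps excess_simps)
  have \<alpha>: "0 < q1 / q" "q1 / q < 1" using q1 by auto
  have "(\<integral>\<^sup>+y. epow (h y) q1 \<partial>lborel)
      \<le> (\<integral>\<^sup>+y. epow (epow (h y) q) (q1 / q) * epow (indicator S y) (1 - q1 / q) \<partial>lborel)"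
  proof (rule nn_integral_mono)
    fix y
    show "epow (h y) q1 \<le> epow (epow (h y) q) (q1 / q) * epow (indicator S y) (1 - q1 / q)"
      using h0[of y] q1 by (cases "y \<in> S") (auto simp: epow_epow)
  qed
  also have "\<dots> \<le> epow (\<integral>\<^sup>+y. epow (h y) q \<partial>lborel) (q1 / q) * epow (\<integral>\<^sup>+y. indicator S y \<partial>lborel) (1 - q1 / q)"
    using \<alpha> by (intro nn_integral_Holder) auto
  also have "\<dots> \<le> epow (ennreal ((2 * (1 + e)) powr q * x)) (q1 / q) * epow (ennreal ((l - k) powr (-q) * x)) (1 - q1 / q)"
  proof (rule mult_mono)
  show "epow (\<integral>\<^sup>+y. epow (h y) q \<partial>lborel) (q1 / q) \<le> epow (ennreal ((2 * (1 + e)) powr q * x)) (q1 / q)"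
  proof (rule epow_mono)
    show "0 \<le> q1 / q" using \<alpha> by simp
    have "(\<integral>\<^sup>+y. epow (h y) q \<partial>lborel) \<le> (\<integral>\<^sup>+y. ennreal ((2 * (1 + e)) powr q) * (indicator (cube c R) y *
          ennreal (level_grad u g k y powr q + excess u k y powr q)) \<partial>lborel)"
    proof (rule nn_integral_mono)
      fix y
      show "epow (h y) q \<le> ennreal ((2 * (1 + e)) powr q) * (indicator (cube c R) y *
          ennreal (level_grad u g k y powr q + excess u k y powr q))"
      proof (cases "y \<in> cube c R")
        case True
        let ?a = "level_grad u g k y" and ?w = "excess u k y"
        have aw: "0 \<le> ?a" "0 \<le> ?w"
          by (rule level_grad_simps(1), rule nonneg) (rule excess_simps(1))
        have "level_grad u g l y \<le> ?a" "excess u l y \<le> ?w"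
          by (rule level_grad_simps(2), rule nonneg, use kl in simp) (rule excess_simps(2), use kl in simp)
        then have "level_grad u g l y + e * excess u l y \<le> ?a + e * ?w"
          using e by (intro add_mono mult_left_mono)
        also have "\<dots> \<le> (1 + e) * (?a + ?w)" using e aw by (simp add: algebra_simps)
        finally have "h y \<le> ennreal ((1 + e) * (?a + ?w))"
          using h(1)[OF True] ennreal_leI order_trans by blast
        then have "epow (h y) q \<le> epow (ennreal ((1 + e) * (?a + ?w))) q" using q by (intro epow_mono) auto
        also have "\<dots> = ennreal ((1 + e) powr q * (?a + ?w) powr q)"
          using q e aw by (simp add: epow_ennreal powr_mult)
        also have "\<dots> \<le> ennreal ((1 + e) powr q * (2 powr q * (?a powr q + ?w powr q)))"
          using q e aw by (intro ennreal_leI mult_left_mono powr_add_le) auto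
        also have "\<dots> = ennreal ((2 * (1 + e)) powr q) * ennreal (?a powr q + ?w powr q)"
        proof -
          have "(2 * (1 + e)) powr q = 2 powr q * (1 + e) powr q" using e by (simp only: powr_mult)
          then show ?thesis by (subst ennreal_mult[symmetric]) (simp_all add: mult_ac del: ennreal_plus)
        qed
        finally show ?thesis using True by simp
      qed (use h(2) q in simp)
    qed
    also have "\<dots> = ennreal ((2 * (1 + e)) powr q) * X k R"
      unfolding X_def by (intro nn_integral_cmult) auto
    also have "\<dots> \<le> ennreal ((2 * (1 + e)) powr q) * ennreal x"
      using x by (intro mult_left_mono) auto
    finally show "(\<integral>\<^sup>+y. epow (h y) q \<partial>lborel) \<le> ennreal ((2 * (1 + e)) powr q * x)"
      using x by (simp add: ennreal_mult)
  qed
  show "epow (\<integral>\<^sup>+y. indicator S y \<partial>lborel) (1 - q1 / q) \<le> epow (ennreal ((l - k) powr (-q) * x)) (1 - q1 / q)"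
  proof (rule epow_mono)
    show "0 \<le> 1 - q1 / q" using \<alpha> by simp
    have "ennreal ((l - k) powr (-q)) * (ennreal ((l - k) powr q) * emeasure lborel S)
        \<le> ennreal ((l - k) powr (-q)) * ennreal x"
      unfolding S_def using level_set_le[OF kl, of R] x(1) by (intro mult_left_mono) auto
    moreover have "ennreal ((l - k) powr (-q)) * ennreal ((l - k) powr q) = 1"
      using kl by (simp add: powr_minus flip: ennreal_mult)
    ultimately show "(\<integral>\<^sup>+y. indicator S y \<partial>lborel) \<le> ennreal ((l - k) powr (-q) * x)"
      by (simp add: mult.assoc[symmetric] ennreal_mult x(2) less_imp_le)
  qed
  qed auto
  also have "\<dots> = ennreal (((2 * (1 + e)) powr q * x) powr (q1 / q) * ((l - k) powr (-q) * x) powr (1 - q1 / q))"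
  proof -
    have ne: "q1 / q \<noteq> 0" "1 - q1 / q \<noteq> 0" using \<alpha> by auto
    have nn: "0 \<le> (2 * (1 + e)) powr q * x" "0 \<le> (l - k) powr (-q) * x" using x by auto
    show ?thesis unfolding epow_ennreal[OF nn(1) ne(1)] epow_ennreal[OF nn(2) ne(2)]
      by (rule ennreal_mult[symmetric]) auto
  qed
  also have "((2 * (1 + e)) powr q * x) powr (q1 / q) = (2 * (1 + e)) powr q1 * x powr (q1 / q)"
    using x e q by (simp add: powr_mult powr_powr)
  also have "((l - k) powr (-q) * x) powr (1 - q1 / q) = (l - k) powr (- (q - q1)) * x powr (1 - q1 / q)"
  proof -
    have "- q * (1 - q1 / q) = - (q - q1)" using q by (simp add: algebra_simps)
    then show ?thesis using x kl by (simp add: powr_mult powr_powr)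
  qed
  also have "(2 * (1 + e)) powr q1 * x powr (q1 / q) * ((l - k) powr (- (q - q1)) * x powr (1 - q1 / q))
      = (2 * (1 + e)) powr q1 * (x powr (q1 / q) * x powr (1 - q1 / q)) * (l - k) powr (- (q - q1))"
    by (simp only: mult_ac)
  also have "x powr (q1 / q) * x powr (1 - q1 / q) = x" using x by (simp flip: powr_add)
  finally show ?thesis .
qed

text \<open>\<open>p / q1\<close> is the midpoint of \<open>p / q\<close> and the critical value M =
  p/(d - 1) + 1 - 1/s, but at most \<open>p\<close>, so that \<open>q1\<close> is at least 1. As
  \<open>p / q = 1 + 1 / t\<close>, the hypothesis on s and t says that \<open>p / q\<close> is less
  than M; that \<open>p / q1\<close> is less than M is the subcriticality required by
  \<open>slice_pot_power\<close>.\<close>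

definition q1 where "q1 = p / min p ((p / q + (p / (real DIM('a) - 1) + 1 - 1 / s)) / 2)"

definition \<delta> where "\<delta> = 1 / (1 / s + p / q1)"

definition \<theta> where "\<theta> = q / q1 - 1"

lemma q1: "1 \<le> q1" "q1 < q" "real (DIM('a) - 1) * (p / q1 - 1 + 1 / s) < p"
proof -
  define M where "M = p / (real DIM('a) - 1) + 1 - 1 / s"
  define y where "y = min p ((p / q + M) / 2)"
  have q1: "q1 = p / y" by (simp add: q1_def y_def M_def)
  have "p / q = 1 / r" using p q by (simp add: q_def)
  also have "\<dots> = 1 + 1 / t" using t0 by (simp add: r_def field_simps)
  finally have "p / q < M" using st by (simp add: M_def)
  moreover have "p / q < p" using p q(1) by (simp add: divide_less_eq)
  moreover have "z < min p ((z + M) / 2) \<and> min p ((z + M) / 2) < M \<and> min p ((z + M) / 2) \<le> p"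
    if "z < M" "z < p" for z using that by (auto simp: min_def field_simps)
  ultimately have y: "p / q < y" "y < M" "y \<le> p" unfolding y_def by blast+
  have "0 < p / q" using p q by simp
  then have y0: "0 < y" using y by simp
  show "1 \<le> q1" using y y0 by (simp add: q1)
  show "q1 < q" using y y0 q by (simp add: q1 field_simps)
  have n: "real (DIM('a) - 1) = real DIM('a) - 1" "0 < real DIM('a) - 1" using d by auto
  have "p / q1 = y" using p y0 by (simp add: q1)
  then have "(real DIM('a) - 1) * (p / q1 - 1 + 1 / s) < (real DIM('a) - 1) * (p / (real DIM('a) - 1))"
    using y n by (intro mult_strict_left_mono) (auto simp: M_def)
  then show "real (DIM('a) - 1) * (p / q1 - 1 + 1 / s) < p" using n by simp
qed

lemma \<delta>: "0 < \<delta>" "\<delta> * (1 / s + p / q1) = 1"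
proof -
  have "0 < 1 / s + p / q1" using s p q1 by (intro add_pos_pos) auto
  then show "0 < \<delta>" "\<delta> * (1 / s + p / q1) = 1" by (auto simp: \<delta>_def)
qed

lemma \<theta>: "0 < \<theta>" "q / q1 = 1 + \<theta>" using q1 by (auto simp: \<theta>_def)

text \<open>The exponent of \<open>a\<close> collects 1 from the length of the interval,
  \<open>-p\<close> from the derivative of the adapted cutoff, \<open>-1/\<delta>\<close> from
  Chebyshev's inequality and another \<open>-p\<close> from the ordinary cutoff contained in
  \<open>H\<close>. As \<open>a \<le> R0\<close>, the summand 1 in 1 + 4d/a is absorbed by
  R0/a.\<close>

lemma energy_bound_arith:
  assumes a: "0 < a" "a \<le> R0" and x: "0 < x" and kl: "0 < y" and Cc: "0 < Cc"
  defines "H \<equiv> (2 * (1 + real DIM('a) * (4 / a))) powr q1 * x * y powr (- (q - q1))"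
  defines "D \<equiv> Cc * H powr (\<delta> * p / q1)"
  shows "real DIM('a) powr p * (real DIM('a) * (4 * (a/2) * (2 / (a/2)) powr p * (4 * D / (a/2)) powr (1/\<delta>)))
    \<le> real DIM('a) powr p * (real DIM('a) * (2 * 4 powr p * (8 * Cc) powr (1/\<delta>) * (2 * (R0 + 4 * real DIM('a))) powr p)) *
       (a powr (1 - 2 * p - 1 / \<delta>) * y powr (- (p * \<theta>)) * x powr (p / q1))"
proof -
  let ?d = "real DIM('a)"
  let ?E = "2 * (1 + ?d * (4 / a))"
  have E0: "0 < ?E" using a by (simp add: add_pos_nonneg)
  have H0: "0 < H" unfolding H_def using E0 x kl by simp
  have "H powr (p / q1) = ?E powr p * x powr (p / q1) * y powr (- (p * \<theta>))"
  proof -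
    have e: "- (q - q1) * (p / q1) = - (p * \<theta>)" using q1 by (simp add: \<theta>_def field_simps)
    have "H powr (p / q1) = (?E powr q1) powr (p / q1) * x powr (p / q1) * (y powr (- (q - q1))) powr (p / q1)"
      unfolding H_def using x E0 kl by (simp add: powr_mult)
    also have "(?E powr q1) powr (p / q1) = ?E powr p" using q1 by (simp add: powr_powr)
    also have "(y powr (- (q - q1))) powr (p / q1) = y powr (- (p * \<theta>))" unfolding powr_powr e ..
    finally show ?thesis .
  qed
  moreover have "?E powr p \<le> (2 * (R0 + 4 * ?d)) powr p * a powr (- p)"
  proof -
    have "?E powr p \<le> (2 * (R0 + 4 * ?d) / a) powr p"
      using a p E0 by (intro powr_mono2) (auto simp: field_simps)
    also have "\<dots> = (2 * (R0 + 4 * ?d)) powr p * a powr (- p)"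
      by (subst powr_divide) (use a R0 in \<open>auto simp: powr_minus divide_inverse\<close>)
    finally show ?thesis .
  qed
  ultimately have Hle: "H powr (p / q1) \<le> (2 * (R0 + 4 * ?d)) powr p * a powr (- p) * x powr (p / q1) * y powr (- (p * \<theta>))"
    by (simp add: mult_right_mono)
  have "(4 * D / (a/2)) powr (1/\<delta>) = (8 * Cc) powr (1/\<delta>) * a powr (- (1/\<delta>)) * H powr (p / q1)"
  proof -
    have "4 * D / (a/2) = (8 * Cc) * (1 / a) * H powr (\<delta> * p / q1)" using a by (simp add: D_def field_simps)
    then have "(4 * D / (a/2)) powr (1/\<delta>) = ((8 * Cc) * (1 / a) * H powr (\<delta> * p / q1)) powr (1/\<delta>)"
      by (rule arg_cong)
    also have "\<dots> = (8 * Cc) powr (1/\<delta>) * (1 / a) powr (1/\<delta>) * (H powr (\<delta> * p / q1)) powr (1/\<delta>)"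
      by (simp only: powr_mult)
    also have "(1 / a) powr (1/\<delta>) = a powr (- (1/\<delta>))"
      by (subst powr_divide) (use a in \<open>auto simp: powr_minus divide_inverse\<close>)
    also have "(H powr (\<delta> * p / q1)) powr (1/\<delta>) = H powr (p / q1)" using \<delta>(1) by (simp add: powr_powr)
    finally show ?thesis .
  qed
  moreover have "(2 / (a/2)) powr p = 4 powr p * a powr (- p)"
  proof -
    have "(2 / (a/2)) powr p = (4 / a) powr p" by simp
    also have "\<dots> = 4 powr p * a powr (- p)"
      by (subst powr_divide) (use a in \<open>auto simp: powr_minus divide_inverse\<close>)
    finally show ?thesis .
  qed
  moreover have "4 * (a/2) = 2 * a" by simp
  ultimately have "4 * (a/2) * (2 / (a/2)) powr p * (4 * D / (a/2)) powr (1/\<delta>)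
    = 2 * 4 powr p * (8 * Cc) powr (1/\<delta>) * (a * a powr (- p) * a powr (- (1/\<delta>))) * H powr (p / q1)"
    by (simp only: mult_ac)
  also have "\<dots> \<le> 2 * 4 powr p * (8 * Cc) powr (1/\<delta>) * (a * a powr (- p) * a powr (- (1/\<delta>))) *
      ((2 * (R0 + 4 * ?d)) powr p * a powr (- p) * x powr (p / q1) * y powr (- (p * \<theta>)))"
    using a Hle by (intro mult_left_mono) auto
  also have "\<dots> = 2 * 4 powr p * (8 * Cc) powr (1/\<delta>) * (2 * (R0 + 4 * ?d)) powr p *
      ((a * a powr (- p) * a powr (- (1/\<delta>)) * a powr (- p)) * y powr (- (p * \<theta>)) * x powr (p / q1))"
    by (simp only: mult_ac)
  also have "a * a powr (- p) * a powr (- (1/\<delta>)) * a powr (- p) = a powr (1 - 2 * p - 1 / \<delta>)"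
  proof -
    have "a * a powr (- p) * a powr (- (1/\<delta>)) * a powr (- p) = a powr 1 * a powr (- p) * a powr (- (1/\<delta>)) * a powr (- p)"
      using a by simp
    also have "\<dots> = a powr (1 + - p + - (1/\<delta>) + - p)" by (simp only: powr_add)
    also have "1 + - p + - (1/\<delta>) + - p = 1 - 2 * p - 1 / \<delta>" by simp
    finally show ?thesis .
  qed
  finally have "4 * (a/2) * (2 / (a/2)) powr p * (4 * D / (a/2)) powr (1/\<delta>)
     \<le> 2 * 4 powr p * (8 * Cc) powr (1/\<delta>) * (2 * (R0 + 4 * ?d)) powr p *
      (a powr (1 - 2 * p - 1 / \<delta>) * y powr (- (p * \<theta>)) * x powr (p / q1))" .
  then have "?d powr p * (?d * (4 * (a/2) * (2 / (a/2)) powr p * (4 * D / (a/2)) powr (1/\<delta>)))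
     \<le> ?d powr p * (?d * (2 * 4 powr p * (8 * Cc) powr (1/\<delta>) * (2 * (R0 + 4 * ?d)) powr p *
      (a powr (1 - 2 * p - 1 / \<delta>) * y powr (- (p * \<theta>)) * x powr (p / q1))))"
    by (intro mult_left_mono) auto
  then show ?thesis by (simp only: mult.assoc)
qed

text \<open>Two cutoffs are used in succession. An ordinary one, \<open>\<zeta>\<close>, between the
  cubes of size \<open>\<sigma>'\<close> and \<open>\<sigma>\<close> localises the representation by
  potentials and so bounds the hyperplane integrals of \<open>W\<close>, which lives on the cube of
  size \<open>\<sigma>'\<close>. The second one, \<open>\<eta>\<close>, is adapted to
  \<open>W\<close> and falls off between \<open>\<rho>\<close> and \<open>\<sigma>'\<close>, so that
  its gradient is seen only where \<open>W\<close> has been estimated.\<close>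

lemma energy_step:
  obtains C :: real where "0 < C" "\<And>k l \<rho> \<sigma> x. 0 \<le> k \<Longrightarrow> k < l \<Longrightarrow> 0 \<le> \<rho> \<Longrightarrow> \<rho> < \<sigma> \<Longrightarrow> \<sigma> \<le> R0 \<Longrightarrow>
    X k \<sigma> \<le> ennreal x \<Longrightarrow> 0 < x \<Longrightarrow> \<exists>\<eta> F. C1_grad \<eta> F \<and> (\<forall>x. 0 \<le> \<eta> x) \<and> (\<forall>x. \<eta> x \<le> 1) \<and>
      (\<forall>x\<in>cube c \<rho>. \<eta> x = 1) \<and> (\<forall>x. x \<notin> cube c \<sigma> \<longrightarrow> \<eta> x = 0) \<and>
      (\<integral>\<^sup>+x. ennreal (mu x * norm (F x) powr p * excess u l x powr p) \<partial>lborel)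
        \<le> ennreal (C * ((\<sigma> - \<rho>) powr (1 - 2 * p - 1 / \<delta>) * (l - k) powr (- (p * \<theta>)) * x powr (p / q1)))"
proof -
  let ?d = "real DIM('a)"
  have q1p: "q1 \<le> p" using q1 q by simp
  obtain C1 :: real where C1: "0 \<le> C1"
    "\<And>(b::'a) \<mu> h. b \<in> Basis \<Longrightarrow> \<mu> \<in> borel_measurable borel \<Longrightarrow> h \<in> borel_measurable borel \<Longrightarrow>
      (\<integral>\<^sup>+r. epow (slice b (\<lambda>x. \<mu> x * epow (pot b L h x) p) r) \<delta> \<partial>lborel) \<le> ennreal C1 *
        (epow (\<integral>\<^sup>+x. epow (\<mu> x) s \<partial>lborel) (\<delta>/s) * epow (\<integral>\<^sup>+x. epow (h x) q1 \<partial>lborel) (\<delta> * p/q1))"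
    using nn_integral_slice_pot[OF p q1(1) q1p s L q1(3) \<delta>(2)] by blast
  define Mu where "Mu = (\<lambda>x. indicator Q x * ennreal (mu x))"
  have [measurable]: "Mu \<in> borel_measurable borel" unfolding Mu_def by measurable
  define Ms where "Ms = epow (\<integral>\<^sup>+x. epow (Mu x) s \<partial>lborel) (\<delta>/s)"
  have "(\<integral>\<^sup>+x. epow (Mu x) s \<partial>lborel) = (\<integral>\<^sup>+x. indicator Q x * ennreal (mu x powr s) \<partial>lborel)"
    using s nonneg(2) by (intro nn_integral_cong) (auto simp: Mu_def epow_ennreal split: split_indicator)
  then have Ms: "Ms < \<infinity>" unfolding Ms_def using mu_s by (intro epow_less_top) simp
  \<comment> \<open>The summand 1 keeps \<open>D\<close> below positive, as the choice of the
    adapted cutoff requires.\<close>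
  define Cc where "Cc = K powr (p * \<delta>) * (C1 * enn2real Ms) + 1"
  have Cc: "0 < Cc" unfolding Cc_def using C1 by (simp add: add_nonneg_pos)
  define C where "C = ?d powr p * (?d * (2 * 4 powr p * (8 * Cc) powr (1/\<delta>) * (2 * (R0 + 4 * ?d)) powr p))"
  show ?thesis
  proof (rule that[of C])
    show "0 < C" unfolding C_def using Cc R0 by (intro mult_pos_pos) (auto simp: add_pos_nonneg)
  next
    fix k l \<rho> \<sigma> x :: real
    assume k: "0 \<le> k" "k < l" and \<rho>: "0 \<le> \<rho>" "\<rho> < \<sigma>" "\<sigma> \<le> R0" and x: "X k \<sigma> \<le> ennreal x" "0 < x"
    define a where "a = \<sigma> - \<rho>"
    define \<sigma>' where "\<sigma>' = (\<rho> + \<sigma>) / 2"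
    have a: "0 < a" "a \<le> R0" using \<rho> by (auto simp: a_def)
    have \<sigma>': "\<sigma>' - \<rho> = a / 2" "\<sigma> - \<sigma>' = a / 2" by (auto simp: \<sigma>'_def a_def field_simps)
    have \<sigma>'2: "0 \<le> \<sigma>'" "\<rho> < \<sigma>'" "\<sigma>' < \<sigma>" using \<rho> by (auto simp: \<sigma>'_def)
    \<comment> \<open>Adapted to the weight 0, the cutoff is an ordinary one; what matters is the
      pointwise bound for its gradient.\<close>
    obtain \<zeta> Z where \<zeta>: "C1_grad \<zeta> Z" "\<And>x. 0 \<le> \<zeta> x" "\<And>x. \<zeta> x \<le> 1" "\<And>x. x \<in> cube c \<sigma>' \<Longrightarrow> \<zeta> x = 1"
      "\<And>x. x \<notin> cube c \<sigma> \<Longrightarrow> \<zeta> x = 0" "\<And>x. norm (Z x) \<le> ?d * (2 / (\<sigma> - \<sigma>'))"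
      by (rule cutoff_exists[of \<sigma>' \<sigma> "\<lambda>_. 0" 1 1 1 c])
        (use \<sigma>'2 in \<open>auto simp: slice_def\<close>)
    have [measurable]: "\<zeta> \<in> borel_measurable borel" "Z \<in> borel_measurable borel" using C1_gradD[OF \<zeta>(1)] by auto
    have Z0: "Z x = 0" if "x \<notin> cube c \<sigma>" for x
      using C1_grad_eq_0[OF \<zeta>(1) _ \<zeta>(5) that] compact_imp_closed[OF compact_cube] by blast
    define h where "h = (\<lambda>x. ennreal (\<zeta> x * level_grad u g l x + norm (Z x) * excess u l x))"
    have [measurable]: "h \<in> borel_measurable borel" unfolding h_def by measurable
    let ?e = "?d * (4 / a)"
    define H where "H = (2 * (1 + ?e)) powr q1 * x * (l - k) powr (- (q - q1))"
    have E0: "0 < 2 * (1 + ?e)" using a by (intro mult_pos_pos add_pos_nonneg) auto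
    have H0: "0 < H" unfolding H_def
      by (intro mult_pos_pos powr_gt_zero[THEN iffD2] E0[THEN less_imp_neq, symmetric] x(2)) (use k in auto)
    have hH: "(\<integral>\<^sup>+y. epow (h y) q1 \<partial>lborel) \<le> ennreal H"
      unfolding H_def
    proof (rule source_bound[OF k(2) _ _ q1(2) x])
      show "h y \<le> ennreal (level_grad u g l y + ?e * excess u l y)" if "y \<in> cube c \<sigma>" for y
      proof -
        have "\<zeta> y * level_grad u g l y \<le> 1 * level_grad u g l y"
          by (intro mult_right_mono \<zeta> level_grad_simps(1) nonneg)
        moreover have "norm (Z y) * excess u l y \<le> ?e * excess u l y"
          using \<zeta>(6)[of y] \<sigma>'(2) by (intro mult_right_mono excess_simps) simp
        ultimately show ?thesis unfolding h_def by (intro ennreal_leI) simp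
      qed
      show "h y = 0" if "y \<notin> cube c \<sigma>" for y using \<zeta>(5)[OF that] Z0[OF that] by (simp add: h_def)
    qed (use a q1 in auto)
    define W where "W = (\<lambda>x. indicator (cube c \<sigma>') x * ennreal (mu x * excess u l x powr p))"
    have [measurable]: "W \<in> borel_measurable borel" unfolding W_def by measurable
    define D where "D = Cc * H powr (\<delta> * p / q1)"
    have D0: "0 < D" using Cc H0 by (simp add: D_def)
    have cQ: "cube c \<sigma>' \<subseteq> Q" "cube c \<sigma> \<subseteq> Q" using \<rho> \<sigma>'2 by (auto intro!: cube_mono)
    have WD: "(\<integral>\<^sup>+r. epow (slice b W r) \<delta> \<partial>lborel) \<le> ennreal D" if b: "b \<in> Basis" for b
    proof -
      let ?P = "\<lambda>x. Mu x * epow (pot b L h x) p"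
      have "AE x in lborel. W x \<le> ennreal (K powr p) * ?P x"
      proof -
        have "AE x in lborel. ennreal (\<zeta> x * excess u l x) \<le> ennreal K * pot b L h x"
          unfolding h_def using k cQ(2) by (intro repr[OF \<zeta>(1-3) _ b]) (auto intro!: \<zeta>(5))
        then show ?thesis
        proof eventually_elim
          fix y assume le: "ennreal (\<zeta> y * excess u l y) \<le> ennreal K * pot b L h y"
          show "W y \<le> ennreal (K powr p) * ?P y"
          proof (cases "y \<in> cube c \<sigma>'")
            case True
            then have "ennreal (excess u l y) \<le> ennreal K * pot b L h y" using le \<zeta>(4) by simp
            then have "epow (ennreal (excess u l y)) p \<le> epow (ennreal K * pot b L h y) p"
              using p by (intro epow_mono) auto
            then have "ennreal (excess u l y powr p) \<le> ennreal (K powr p) * epow (pot b L h y) p"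
              using p K by (simp add: epow_mult epow_ennreal excess_simps(1))
            then have "ennreal (mu y) * ennreal (excess u l y powr p) \<le> ennreal (mu y) * (ennreal (K powr p) * epow (pot b L h y) p)"
              by (rule mult_left_mono) simp
            moreover have "y \<in> Q" using True cQ by auto
            ultimately show ?thesis
              using True nonneg(2)[of y] by (simp add: W_def Mu_def ennreal_mult mult.left_commute)
          qed (simp add: W_def)
        qed
      qed
      then have "AE r in lborel. slice b W r \<le> slice b (\<lambda>x. ennreal (K powr p) * ?P x) r"
        by (intro slice_mono_AE[OF b]) auto
      then have "(\<integral>\<^sup>+r. epow (slice b W r) \<delta> \<partial>lborel)
          \<le> (\<integral>\<^sup>+r. ennreal (K powr (p * \<delta>)) * epow (slice b ?P r) \<delta> \<partial>lborel)"
      proof (intro nn_integral_mono_AE, eventually_elim)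
        fix r assume "slice b W r \<le> slice b (\<lambda>x. ennreal (K powr p) * ?P x) r"
        then have "slice b W r \<le> ennreal (K powr p) * slice b ?P r" by (subst (asm) slice_cmult) auto
        then have "epow (slice b W r) \<delta> \<le> epow (ennreal (K powr p) * slice b ?P r) \<delta>"
          using \<delta>(1) by (intro epow_mono) auto
        then show "epow (slice b W r) \<delta> \<le> ennreal (K powr (p * \<delta>)) * epow (slice b ?P r) \<delta>"
          using \<delta>(1) by (simp add: epow_mult epow_ennreal powr_powr)
      qed
      also have "\<dots> = ennreal (K powr (p * \<delta>)) * (\<integral>\<^sup>+r. epow (slice b ?P r) \<delta> \<partial>lborel)"
        by (intro nn_integral_cmult) auto
      also have "\<dots> \<le> ennreal (K powr (p * \<delta>)) * (ennreal C1 * (Ms * epow (\<integral>\<^sup>+x. epow (h x) q1 \<partial>lborel) (\<delta> * p/q1)))"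
        unfolding Ms_def using b by (intro mult_left_mono C1(2)) auto
      also have "\<dots> \<le> ennreal (K powr (p * \<delta>)) * (ennreal C1 * (Ms * epow (ennreal H) (\<delta> * p/q1)))"
        using \<delta> p q1 by (intro mult_left_mono epow_mono hH) auto
      also have "\<dots> = ennreal (K powr (p * \<delta>) * (C1 * enn2real Ms) * H powr (\<delta> * p / q1))"
        using Ms C1(1) H0 \<delta>(1) p q1 by (simp add: epow_ennreal ennreal_mult mult.assoc)
      also have "\<dots> \<le> ennreal D"
        unfolding D_def Cc_def by (intro ennreal_leI mult_right_mono) auto
      finally show ?thesis .
    qed
    \<comment> \<open>A priori finiteness, from the norm of \<open>u\<close>. It serves the
      dominated convergence in \<open>bump_exists\<close> and does not enter the constants.\<close>
    have Wfin: "(\<integral>\<^sup>+x. W x \<partial>lborel) < \<infinity>"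
    proof -
      have "(\<integral>\<^sup>+x. W x \<partial>lborel) \<le> (\<integral>\<^sup>+x. indicator Q x * ennreal (mu x * \<bar>u x\<bar> powr p) \<partial>lborel)"
      proof (rule nn_integral_mono)
        fix y
        have "mu y * excess u l y powr p \<le> mu y * \<bar>u y\<bar> powr p"
          using p k excess_simps(1)[of u l y] excess_simps(4)[of l u y] nonneg(2)
          by (intro mult_left_mono powr_mono2) auto
        then show "W y \<le> indicator Q y * ennreal (mu y * \<bar>u y\<bar> powr p)"
          using cQ by (auto simp: W_def intro!: ennreal_leI split: split_indicator)
      qed
      then show ?thesis using u_p by (rule le_less_trans)
    qed
    obtain \<eta> F where \<eta>: "C1_grad \<eta> F" "\<And>x. 0 \<le> \<eta> x" "\<And>x. \<eta> x \<le> 1" "\<And>x. x \<in> cube c \<rho> \<Longrightarrow> \<eta> x = 1"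
      "\<And>x. x \<notin> cube c \<sigma>' \<Longrightarrow> \<eta> x = 0"
      "(\<integral>\<^sup>+x. ennreal (norm (F x) powr p) * W x \<partial>lborel) \<le> ennreal (?d powr p * (?d *
         (4 * (\<sigma>' - \<rho>) * (2 / (\<sigma>' - \<rho>)) powr p * (4 * D / (\<sigma>' - \<rho>)) powr (1/\<delta>))))"
      by (rule cutoff_exists[of \<rho> \<sigma>' W \<delta> D p c]) (use \<rho> \<sigma>'2 WD D0 \<delta> Wfin p in auto)
    have F0: "F x = 0" if "x \<notin> cube c \<sigma>'" for x
      using C1_grad_eq_0[OF \<eta>(1) _ \<eta>(5) that] compact_imp_closed[OF compact_cube] by blast
    have "(\<integral>\<^sup>+x. ennreal (mu x * norm (F x) powr p * excess u l x powr p) \<partial>lborel)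
        = (\<integral>\<^sup>+x. ennreal (norm (F x) powr p) * W x \<partial>lborel)"
    proof (rule nn_integral_cong)
      fix y
      show "ennreal (mu y * norm (F y) powr p * excess u l y powr p) = ennreal (norm (F y) powr p) * W y"
        using F0[of y] nonneg(2)[of y] p
        by (cases "y \<in> cube c \<sigma>'") (auto simp: W_def ennreal_mult mult_ac)
    qed
    also have "\<dots> \<le> ennreal (C * ((\<sigma> - \<rho>) powr (1 - 2 * p - 1 / \<delta>) * (l - k) powr (- (p * \<theta>)) * x powr (p / q1)))"
      using \<eta>(6) energy_bound_arith[OF a x(2) _ Cc, of "l - k", folded H_def, folded D_def] k(2)
      unfolding \<sigma>'(1) a_def[symmetric] C_def[symmetric] by (auto intro: order_trans ennreal_leI)
    finally have J: "(\<integral>\<^sup>+x. ennreal (mu x * norm (F x) powr p * excess u l x powr p) \<partial>lborel)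
        \<le> ennreal (C * ((\<sigma> - \<rho>) powr (1 - 2 * p - 1 / \<delta>) * (l - k) powr (- (p * \<theta>)) * x powr (p / q1)))" .
    have "\<eta> y = 0" if "y \<notin> cube c \<sigma>" for y
      using \<eta>(5)[of y] that cube_mono[of \<sigma>' \<sigma> c] \<sigma>'2 by auto
    then show "\<exists>\<eta> F. C1_grad \<eta> F \<and> (\<forall>x. 0 \<le> \<eta> x) \<and> (\<forall>x. \<eta> x \<le> 1) \<and>
      (\<forall>x\<in>cube c \<rho>. \<eta> x = 1) \<and> (\<forall>x. x \<notin> cube c \<sigma> \<longrightarrow> \<eta> x = 0) \<and>
      (\<integral>\<^sup>+x. ennreal (mu x * norm (F x) powr p * excess u l x powr p) \<partial>lborel)
        \<le> ennreal (C * ((\<sigma> - \<rho>) powr (1 - 2 * p - 1 / \<delta>) * (l - k) powr (- (p * \<theta>)) * x powr (p / q1)))"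
      using \<eta>(1-4) J by (intro exI[of _ \<eta>] exI[of _ F] conjI) auto
  qed
qed

section \<open>One step of the iteration\<close>

definition \<gamma> where "\<gamma> = (2 * p - 1 + 1 / \<delta>) * r"

lemma powr_le_self: "0 \<le> x \<Longrightarrow> x \<le> 1 \<Longrightarrow> x powr p \<le> (x::real)"
  using powr_mono'[of 1 p x] p by (cases "x = 0") auto

text \<open>Both parts of \<open>X\<close> are controlled by the same \<open>J\<close>. The gradient
  is estimated by \<open>cacc\<close> on the smaller cube, where the cutoff is 1. The function is
  estimated by its potential, whose source consists of the gradient, again subject to
  \<open>cacc\<close>, and of \<open>norm (Z x)\<close> times the excess; since
  \<open>lam \<le> mu\<close>, the weighted integral of the latter is at most \<open>J\<close> up to
  a factor.\<close>

lemma X_step_aux: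
  assumes k: "0 \<le> l" and \<rho>: "0 \<le> \<rho>" "\<rho> < \<sigma>" "\<sigma> \<le> R0" and J: "0 < J"
    and \<eta>: "C1_grad \<eta> F" "\<And>x. 0 \<le> \<eta> x" "\<And>x. \<eta> x \<le> 1" "\<And>x. x \<in> cube c \<rho> \<Longrightarrow> \<eta> x = 1"
      "\<And>x. x \<notin> cube c \<sigma> \<Longrightarrow> \<eta> x = 0"
      "(\<integral>\<^sup>+x. ennreal (mu x * norm (F x) powr p * excess u l x powr p) \<partial>lborel) \<le> ennreal J"
  shows "X l \<rho> \<le> ennreal (enn2real \<Lambda> * (C0 powr r + K powr q * L powr q * (2 powr p * (C0 + real m powr p)) powr r) * J powr r)"
proof -
  define \<Lambda>r where "\<Lambda>r = enn2real \<Lambda>"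
  have \<Lambda>r: "\<Lambda> = ennreal \<Lambda>r" "0 \<le> \<Lambda>r" using \<Lambda> by (simp_all add: \<Lambda>r_def)
  have cQ: "cube c \<sigma> \<subseteq> Q" "cube c \<rho> \<subseteq> Q" using \<rho> by (auto intro!: cube_mono)
  have \<eta>Q: "\<eta> x = 0" if "x \<notin> Q" for x using that cQ \<eta>(5) by blast
  have [measurable]: "\<eta> \<in> borel_measurable borel" "F \<in> borel_measurable borel" using C1_gradD[OF \<eta>(1)] by auto
  let ?g = "level_grad u g l" and ?w = "excess u l"
  have gw: "0 \<le> ?g x" "0 \<le> ?w x" for x
    by (rule level_grad_simps(1), rule nonneg) (rule excess_simps(1))
  have E: "(\<integral>\<^sup>+x. ennreal (lam x * \<eta> x ^ m * ?g x powr p) \<partial>lborel) \<le> ennreal (C0 * J)"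
  proof -
    have "(\<integral>\<^sup>+x. ennreal (lam x * \<eta> x ^ m * ?g x powr p) \<partial>lborel) \<le> ennreal C0 *
      (\<integral>\<^sup>+x. ennreal (mu x * norm (F x) powr p * ?w x powr p) \<partial>lborel)"
      by (rule cacc[OF \<eta>(1-3) \<eta>Q k])
    also have "\<dots> \<le> ennreal C0 * ennreal J" by (intro mult_left_mono \<eta>(6)) simp
    finally show ?thesis using C0 by (simp add: ennreal_mult')
  qed
  have I1: "(\<integral>\<^sup>+x. indicator (cube c \<rho>) x * ennreal (?g x powr q) \<partial>lborel) \<le> ennreal ((C0 * J) powr r * \<Lambda>r)"
  proof -
    define f where "f = (\<lambda>x. indicator (cube c \<rho>) x * ?g x)"
    have [measurable]: "f \<in> borel_measurable borel" unfolding f_def by measurable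
    have "(\<integral>\<^sup>+x. indicator (cube c \<rho>) x * ennreal (?g x powr q) \<partial>lborel)
        \<le> (\<integral>\<^sup>+x. indicator Q x * ennreal (f x powr q) \<partial>lborel)"
      using cQ by (intro nn_integral_mono) (auto simp: f_def split: split_indicator)
    also have "\<dots> \<le> epow (\<integral>\<^sup>+x. indicator Q x * ennreal (lam x * f x powr p) \<partial>lborel) r * \<Lambda>"
      using gw by (intro weighted_Holder) (auto simp: f_def)
    also have "\<dots> \<le> epow (ennreal (C0 * J)) r * \<Lambda>"
    proof (intro mult_right_mono epow_mono)
      have "(\<integral>\<^sup>+x. indicator Q x * ennreal (lam x * f x powr p) \<partial>lborel)
        \<le> (\<integral>\<^sup>+x. ennreal (lam x * \<eta> x ^ m * ?g x powr p) \<partial>lborel)"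
      proof (rule nn_integral_mono)
        fix x
        show "indicator Q x * ennreal (lam x * f x powr p) \<le> ennreal (lam x * \<eta> x ^ m * ?g x powr p)"
          using \<eta>(4)[of x] p by (cases "x \<in> cube c \<rho>") (auto simp: f_def split: split_indicator)
      qed
      then show "(\<integral>\<^sup>+x. indicator Q x * ennreal (lam x * f x powr p) \<partial>lborel) \<le> ennreal (C0 * J)"
        using E by (rule order_trans)
    qed (use r in auto)
    also have "\<dots> = ennreal ((C0 * J) powr r * \<Lambda>r)"
      using r(1) C0 J \<Lambda>r by (subst epow_ennreal) (auto simp: ennreal_mult)
    finally show ?thesis .
  qed
  \<comment> \<open>The representation is applied with the cutoff \<open>\<eta> ^ m\<close>, the
    power that occurs in \<open>cacc\<close>; its gradient is at most \<open>m\<close> times that of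
    \<open>\<eta>\<close>.\<close>
  define Z where "Z = (\<lambda>x. (real m * \<eta> x ^ (m - 1)) *\<^sub>R F x)"
  have \<chi>: "C1_grad (\<lambda>x. \<eta> x ^ m) Z" unfolding Z_def by (rule C1_grad_power[OF \<eta>(1)])
  have [measurable]: "Z \<in> borel_measurable borel" using C1_gradD[OF \<chi>] by auto
  have \<chi>01: "0 \<le> \<eta> x ^ m" "\<eta> x ^ m \<le> 1" for x using \<eta>(2,3) by (auto intro: power_le_one)
  have \<chi>Q: "\<eta> x ^ m = 0" if "x \<notin> Q" for x using \<eta>Q[OF that] m by simp
  have ZQ: "Z x = 0" if "x \<notin> Q" for x
    using C1_grad_eq_0[OF \<chi> _ \<chi>Q that] compact_imp_closed[OF compact_cube] by blast
  have ZF: "norm (Z x) \<le> real m * norm (F x)" for x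
  proof -
    have "\<bar>real m * \<eta> x ^ (m - 1)\<bar> \<le> real m * 1"
      using \<eta>(2,3)[of x] by (simp add: abs_mult power_le_one mult_left_le)
    then show ?thesis unfolding Z_def norm_scaleR by (intro mult_right_mono) auto
  qed
  define f where "f = (\<lambda>x. \<eta> x ^ m * ?g x + norm (Z x) * ?w x)"
  have [measurable]: "f \<in> borel_measurable borel" unfolding f_def by measurable
  have f0: "0 \<le> f x" for x unfolding f_def using gw \<chi>01 by (intro add_nonneg_nonneg mult_nonneg_nonneg) auto
  have fQ: "f x = 0" if "x \<notin> Q" for x using \<chi>Q[OF that] ZQ[OF that] by (simp add: f_def)
  obtain b :: 'a where b: "b \<in> Basis" using nonempty_Basis by blast
  have I2: "(\<integral>\<^sup>+x. indicator (cube c \<rho>) x * ennreal (?w x powr q) \<partial>lborel)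
      \<le> ennreal (K powr q * L powr q * (2 powr p * (C0 + real m powr p) * J) powr r * \<Lambda>r)"
  proof -
    have "AE x in lborel. ennreal (\<eta> x ^ m * ?w x) \<le> ennreal K * pot b L (\<lambda>x. ennreal (f x)) x"
      unfolding f_def by (rule repr[OF \<chi> \<chi>01 \<chi>Q b k])
    then have "(\<integral>\<^sup>+x. indicator (cube c \<rho>) x * ennreal (?w x powr q) \<partial>lborel)
       \<le> (\<integral>\<^sup>+x. ennreal (K powr q) * epow (pot b L (\<lambda>x. ennreal (f x)) x) q \<partial>lborel)"
    proof (intro nn_integral_mono_AE, eventually_elim)
      fix x assume le: "ennreal (\<eta> x ^ m * ?w x) \<le> ennreal K * pot b L (\<lambda>x. ennreal (f x)) x"
      show "indicator (cube c \<rho>) x * ennreal (?w x powr q) \<le> ennreal (K powr q) * epow (pot b L (\<lambda>x. ennreal (f x)) x) q"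
      proof (cases "x \<in> cube c \<rho>")
        case True
        then have "ennreal (?w x) \<le> ennreal K * pot b L (\<lambda>x. ennreal (f x)) x" using le \<eta>(4) by simp
        then have "epow (ennreal (?w x)) q \<le> epow (ennreal K * pot b L (\<lambda>x. ennreal (f x)) x) q"
          using q(3) by (intro epow_mono) auto
        then show ?thesis using True q(3) K gw by (simp add: epow_mult epow_ennreal)
      qed simp
    qed
    also have "\<dots> = ennreal (K powr q) * (\<integral>\<^sup>+x. epow (pot b L (\<lambda>x. ennreal (f x)) x) q \<partial>lborel)"
      by (rule nn_integral_cmult) measurable
    also have "\<dots> \<le> ennreal (K powr q) * (ennreal (L powr q) * (\<integral>\<^sup>+x. epow (ennreal (f x)) q \<partial>lborel))"
      using q(1) L b by (intro mult_left_mono nn_integral_pot_power) auto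
    also have "(\<integral>\<^sup>+x. epow (ennreal (f x)) q \<partial>lborel) = (\<integral>\<^sup>+x. indicator Q x * ennreal (f x powr q) \<partial>lborel)"
      using q(3) f0 fQ by (intro nn_integral_cong) (auto simp: epow_ennreal split: split_indicator)
    also have "\<dots> \<le> epow (\<integral>\<^sup>+x. indicator Q x * ennreal (lam x * f x powr p) \<partial>lborel) r * \<Lambda>"
      using f0 by (intro weighted_Holder) auto
    also have "\<dots> \<le> epow (ennreal (2 powr p * (C0 + real m powr p) * J)) r * \<Lambda>"
    proof (intro mult_right_mono epow_mono)
      have "(\<integral>\<^sup>+x. indicator Q x * ennreal (lam x * f x powr p) \<partial>lborel)
        \<le> (\<integral>\<^sup>+x. ennreal (2 powr p) * (ennreal (lam x * \<eta> x ^ m * ?g x powr p) +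
            ennreal (real m powr p) * ennreal (mu x * norm (F x) powr p * ?w x powr p)) \<partial>lborel)"
      proof (rule nn_integral_mono_AE)
        show "AE x in lborel. indicator Q x * ennreal (lam x * f x powr p) \<le> ennreal (2 powr p) *
            (ennreal (lam x * \<eta> x ^ m * ?g x powr p) +
             ennreal (real m powr p) * ennreal (mu x * norm (F x) powr p * ?w x powr p))"
          using lam_le
        proof eventually_elim
          fix x assume lm: "x \<in> Q \<longrightarrow> lam x \<le> mu x"
          show "indicator Q x * ennreal (lam x * f x powr p) \<le> ennreal (2 powr p) *
            (ennreal (lam x * \<eta> x ^ m * ?g x powr p) +
             ennreal (real m powr p) * ennreal (mu x * norm (F x) powr p * ?w x powr p))"
          proof (cases "x \<in> Q")
            case True
            have "f x powr p \<le> 2 powr p * ((\<eta> x ^ m * ?g x) powr p + (norm (Z x) * ?w x) powr p)"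
              unfolding f_def using gw \<chi>01 p by (intro powr_add_le mult_nonneg_nonneg) auto
            also have "(\<eta> x ^ m * ?g x) powr p \<le> \<eta> x ^ m * ?g x powr p"
              unfolding powr_mult by (intro mult_right_mono powr_le_self \<chi>01) auto
            also have "(norm (Z x) * ?w x) powr p \<le> (real m * norm (F x) * ?w x) powr p"
              using p gw by (intro powr_mono2 mult_right_mono ZF) auto
            also have "\<dots> = real m powr p * (norm (F x) powr p * ?w x powr p)"
              by (simp only: powr_mult mult.assoc)
            finally have "lam x * f x powr p \<le> lam x * (2 powr p * (\<eta> x ^ m * ?g x powr p +
                real m powr p * (norm (F x) powr p * ?w x powr p)))"
              using nonneg by (intro mult_left_mono) auto
            also have "\<dots> = 2 powr p * (lam x * \<eta> x ^ m * ?g x powr p +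
                lam x * (real m powr p * (norm (F x) powr p * ?w x powr p)))"
              by (simp add: algebra_simps)
            also have "\<dots> \<le> 2 powr p * (lam x * \<eta> x ^ m * ?g x powr p +
                mu x * (real m powr p * (norm (F x) powr p * ?w x powr p)))"
              using lm True by (intro mult_left_mono add_left_mono mult_right_mono) auto
            also have "\<dots> = 2 powr p * (lam x * \<eta> x ^ m * ?g x powr p +
                real m powr p * (mu x * norm (F x) powr p * ?w x powr p))"
              by (simp add: mult_ac)
            finally have "ennreal (lam x * f x powr p) \<le> ennreal (2 powr p * (lam x * \<eta> x ^ m * ?g x powr p +
                real m powr p * (mu x * norm (F x) powr p * ?w x powr p)))"
              by (rule ennreal_leI)
            also have "\<dots> = ennreal (2 powr p) * (ennreal (lam x * \<eta> x ^ m * ?g x powr p) +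
             ennreal (real m powr p) * ennreal (mu x * norm (F x) powr p * ?w x powr p))"
            proof -
              have 1: "0 \<le> lam x * \<eta> x ^ m * ?g x powr p" "0 \<le> mu x * norm (F x) powr p * ?w x powr p"
                using nonneg \<chi>01 by auto
              then show ?thesis
                by (simp add: ennreal_mult' ennreal_plus[symmetric] del: ennreal_plus)
                  (simp add: ennreal_mult' ennreal_plus)
            qed
            finally show ?thesis using True by simp
          qed simp
        qed
      qed
      also have "\<dots> = ennreal (2 powr p) * ((\<integral>\<^sup>+x. ennreal (lam x * \<eta> x ^ m * ?g x powr p) \<partial>lborel) +
            ennreal (real m powr p) * (\<integral>\<^sup>+x. ennreal (mu x * norm (F x) powr p * ?w x powr p) \<partial>lborel))"
        by (subst nn_integral_cmult, measurable, subst nn_integral_add, measurable, subst nn_integral_cmult) auto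
      also have "\<dots> \<le> ennreal (2 powr p) * (ennreal (C0 * J) + ennreal (real m powr p) * ennreal J)"
        by (intro mult_left_mono add_mono E \<eta>(6)) auto
      also have "\<dots> = ennreal (2 powr p) * ennreal (C0 * J + real m powr p * J)"
        using C0 J by (simp add: ennreal_mult')
      also have "\<dots> = ennreal (2 powr p * (C0 + real m powr p) * J)"
        by (simp add: distrib_right mult.assoc flip: ennreal_mult')
      finally show "(\<integral>\<^sup>+x. indicator Q x * ennreal (lam x * f x powr p) \<partial>lborel)
          \<le> ennreal (2 powr p * (C0 + real m powr p) * J)" .
    qed (use r in auto)
    also have "\<dots> = ennreal ((2 powr p * (C0 + real m powr p) * J) powr r * \<Lambda>r)"
      using r(1) C0 J \<Lambda>r by (subst epow_ennreal) (auto simp: ennreal_mult)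
    finally show ?thesis by (simp add: mult_left_mono ennreal_mult' mult.assoc)
  qed
  have "X l \<rho> = (\<integral>\<^sup>+x. indicator (cube c \<rho>) x * ennreal (?g x powr q) + indicator (cube c \<rho>) x * ennreal (?w x powr q) \<partial>lborel)"
    unfolding X_def by (intro nn_integral_cong) (simp add: distrib_left)
  also have "\<dots> = (\<integral>\<^sup>+x. indicator (cube c \<rho>) x * ennreal (?g x powr q) \<partial>lborel)
      + (\<integral>\<^sup>+x. indicator (cube c \<rho>) x * ennreal (?w x powr q) \<partial>lborel)"
    by (intro nn_integral_add) auto
  also have "\<dots> \<le> ennreal ((C0 * J) powr r * \<Lambda>r) +
      ennreal (K powr q * L powr q * (2 powr p * (C0 + real m powr p) * J) powr r * \<Lambda>r)"
    by (intro add_mono I1 I2)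
  also have "\<dots> = ennreal ((C0 * J) powr r * \<Lambda>r +
      K powr q * L powr q * (2 powr p * (C0 + real m powr p) * J) powr r * \<Lambda>r)"
    by (rule ennreal_plus[symmetric]) (use \<Lambda>r in auto)
  also have "(C0 * J) powr r * \<Lambda>r + K powr q * L powr q * (2 powr p * (C0 + real m powr p) * J) powr r * \<Lambda>r
     = \<Lambda>r * (C0 powr r + K powr q * L powr q * (2 powr p * (C0 + real m powr p)) powr r) * J powr r"
    unfolding powr_mult[of _ J] by (simp add: algebra_simps)
  finally show ?thesis by (simp only: \<Lambda>r_def)
qed

text \<open>The r-th power from \<open>weighted_Holder\<close> multiplies all exponents of
  \<open>energy_step\<close> by \<open>r\<close>; in particular that of \<open>x\<close> becomes
  \<open>p * r / q1 = q / q1 = 1 + \<theta>\<close>.\<close>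

lemma X_step:
  obtains C :: real where "0 < C" "\<And>k l \<rho> \<sigma> x. 0 \<le> k \<Longrightarrow> k < l \<Longrightarrow> 0 \<le> \<rho> \<Longrightarrow> \<rho> < \<sigma> \<Longrightarrow> \<sigma> \<le> R0 \<Longrightarrow>
    X k \<sigma> \<le> ennreal x \<Longrightarrow> 0 < x \<Longrightarrow>
    X l \<rho> \<le> ennreal (C * ((\<sigma> - \<rho>) powr (-\<gamma>) * (l - k) powr (- (q * \<theta>)) * x powr (1 + \<theta>)))"
proof -
  obtain C4 :: real where C4: "0 < C4" "\<And>k l \<rho> \<sigma> x. 0 \<le> k \<Longrightarrow> k < l \<Longrightarrow> 0 \<le> \<rho> \<Longrightarrow> \<rho> < \<sigma> \<Longrightarrow> \<sigma> \<le> R0 \<Longrightarrow>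
    X k \<sigma> \<le> ennreal x \<Longrightarrow> 0 < x \<Longrightarrow> \<exists>\<eta> F. C1_grad \<eta> F \<and> (\<forall>x. 0 \<le> \<eta> x) \<and> (\<forall>x. \<eta> x \<le> 1) \<and>
      (\<forall>x\<in>cube c \<rho>. \<eta> x = 1) \<and> (\<forall>x. x \<notin> cube c \<sigma> \<longrightarrow> \<eta> x = 0) \<and>
      (\<integral>\<^sup>+x. ennreal (mu x * norm (F x) powr p * excess u l x powr p) \<partial>lborel)
        \<le> ennreal (C4 * ((\<sigma> - \<rho>) powr (1 - 2 * p - 1 / \<delta>) * (l - k) powr (- (p * \<theta>)) * x powr (p / q1)))"
    using energy_step by blast
  define C5 where "C5 = enn2real \<Lambda> * (C0 powr r + K powr q * L powr q * (2 powr p * (C0 + real m powr p)) powr r)"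
  have C5: "0 \<le> C5" unfolding C5_def by (intro mult_nonneg_nonneg add_nonneg_nonneg) auto
  show ?thesis
  \<comment> \<open>\<open>C5\<close> may vanish; adding 1 makes the constant positive.\<close>
  proof (rule that[of "(C5 + 1) * C4 powr r"])
    show "0 < (C5 + 1) * C4 powr r" using C4(1) C5 by (intro mult_pos_pos) auto
  next
    fix k l \<rho> \<sigma> x :: real
    assume k: "0 \<le> k" "k < l" and \<rho>: "0 \<le> \<rho>" "\<rho> < \<sigma>" "\<sigma> \<le> R0" and x: "X k \<sigma> \<le> ennreal x" "0 < x"
    define J where "J = C4 * ((\<sigma> - \<rho>) powr (1 - 2 * p - 1 / \<delta>) * (l - k) powr (- (p * \<theta>)) * x powr (p / q1))"
    have J: "0 < J" unfolding J_def using C4(1) k \<rho> x by (intro mult_pos_pos) auto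
    obtain \<eta> F where "C1_grad \<eta> F" "\<forall>x. 0 \<le> \<eta> x" "\<forall>x. \<eta> x \<le> 1" "\<forall>x\<in>cube c \<rho>. \<eta> x = 1"
      "\<forall>x. x \<notin> cube c \<sigma> \<longrightarrow> \<eta> x = 0"
      "(\<integral>\<^sup>+x. ennreal (mu x * norm (F x) powr p * excess u l x powr p) \<partial>lborel) \<le> ennreal J"
      using C4(2)[OF k \<rho> x] unfolding J_def[symmetric] by blast
    then have "X l \<rho> \<le> ennreal (C5 * J powr r)"
      unfolding C5_def using k by (intro X_step_aux[OF _ \<rho> J, of l \<eta> F]) auto
    also have "\<dots> \<le> ennreal ((C5 + 1) * J powr r)" by (intro ennreal_leI mult_right_mono) auto
    also have "J powr r = C4 powr r * ((\<sigma> - \<rho>) powr (-\<gamma>) * (l - k) powr (- (q * \<theta>)) * x powr (1 + \<theta>))"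
    proof -
      have e1: "(1 - 2 * p - 1 / \<delta>) * r = - \<gamma>" by (simp add: \<gamma>_def algebra_simps)
      have e2: "- (p * \<theta>) * r = - (q * \<theta>)" by (simp add: q_def)
      have e3: "p / q1 * r = 1 + \<theta>" using \<theta>(2) by (simp add: q_def)
      show ?thesis unfolding J_def powr_mult powr_powr e1 e2 e3 ..
    qed
    finally show "X l \<rho> \<le> ennreal ((C5 + 1) * C4 powr r * ((\<sigma> - \<rho>) powr (-\<gamma>) * (l - k) powr (- (q * \<theta>)) * x powr (1 + \<theta>)))"
      by (simp only: mult.assoc)
  qed
qed

text \<open>With radii and levels approaching their limits geometrically, the recursion bounds the
  next value of \<open>X\<close> by a constant times
  \<open>M powr (- (q * \<theta>)) * B ^ j\<close> times the power \<open>1 + \<theta>\<close> of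
  the current one. Superlinearity lets a geometric decay with ratio
  \<open>B powr (- (1/\<theta>))\<close> reproduce itself once the limit level \<open>M\<close> is
  large enough, so \<open>X\<close> vanishes in the limit.\<close>

theorem bounded_above: "\<exists>M. AE x in lborel. x \<in> cube c (R0 / 2) \<longrightarrow> u x \<le> M"
proof -
  obtain C :: real where C: "0 < C" "\<And>k l \<rho> \<sigma> x. 0 \<le> k \<Longrightarrow> k < l \<Longrightarrow> 0 \<le> \<rho> \<Longrightarrow> \<rho> < \<sigma> \<Longrightarrow> \<sigma> \<le> R0 \<Longrightarrow>
    X k \<sigma> \<le> ennreal x \<Longrightarrow> 0 < x \<Longrightarrow>
    X l \<rho> \<le> ennreal (C * ((\<sigma> - \<rho>) powr (-\<gamma>) * (l - k) powr (- (q * \<theta>)) * x powr (1 + \<theta>)))"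
    using X_step by blast
  \<comment> \<open>The factor by which the coefficient grows in each step, when the distances of
    the radii and of the levels are both halved.\<close>
  define B where "B = 2 powr (\<gamma> + q * \<theta>)"
  have B0: "0 < B" by (simp add: B_def)
  have \<gamma>0: "0 \<le> \<gamma>" unfolding \<gamma>_def using p \<delta>(1) r(1) by (intro mult_nonneg_nonneg add_nonneg_nonneg) auto
  have q\<theta>: "0 < q * \<theta>" using q(3) \<theta>(1) by simp
  have B1: "1 < B" unfolding B_def using \<gamma>0 q\<theta> by simp
  \<comment> \<open>The summand 1 makes \<open>x0\<close> positive even if
    \<open>X 0 R0 = 0\<close>.\<close>
  define x0 where "x0 = enn2real (X 0 R0) + 1"
  have x0: "0 < x0" by (simp add: x0_def add_nonneg_pos)
  define A where "A = C * ((R0/4) powr (-\<gamma>) * 2 powr (q * \<theta>)) * x0 powr \<theta>"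
  have A: "0 < A" unfolding A_def using C(1) R0 x0 by simp
  \<comment> \<open>\<open>M\<close> solves
    \<open>A * M powr (- (q * \<theta>)) = B powr (- (1/\<theta>))\<close>, so that the bound of the
    induction step equals the next term of the geometric sequence.\<close>
  define M where "M = (B powr (- (1/\<theta>)) / A) powr (- (1 / (q * \<theta>)))"
  have M0: "0 < M" unfolding M_def using A B0 by simp
  have MA: "A * M powr (- (q * \<theta>)) = B powr (- (1/\<theta>))"
  proof -
    have "- (1 / z) * - z = 1" if "0 < z" for z :: real using that by simp
    then have "M powr (- (q * \<theta>)) = B powr (- (1/\<theta>)) / A"
      unfolding M_def powr_powr using q(3) \<theta>(1) A B0 by simp
    then show ?thesis using A by simp
  qed
  define k where "k j = M * (1 - 2 powr (- real j))" for j
  define R where "R j = R0 / 2 * (1 + 2 powr (- real j))" for j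
  have half: "2 powr (- real (Suc j)) = 2 powr (- real j) / 2" for j
    by (simp add: powr_diff powr_minus_divide)
  have le1: "2 powr (- real j) \<le> 1" for j :: nat using powr_mono[of "- real j" 0 2] by simp
  have claim: "X (k j) (R j) \<le> ennreal (x0 * B powr (- (real j / \<theta>)))" for j
  proof (induction j)
    case 0
    have "X 0 R0 \<le> ennreal x0" using X_finite by (simp add: x0_def ennreal_plus)
    then show ?case using B0 by (simp add: k_def R_def)
  next
    case (Suc j)
    define e where "e = 2 powr (- real j)"
    have e: "0 < e" "e \<le> 1" using le1[of j] by (auto simp: e_def)
    have ke: "k j = M * (1 - e)" "k (Suc j) = M * (1 - e / 2)" "k (Suc j) - k j = M * e / 2"
      unfolding k_def half e_def by (simp_all add: algebra_simps)
    have Re: "R j = R0 / 2 * (1 + e)" "R (Suc j) = R0 / 2 * (1 + e / 2)" "R j - R (Suc j) = R0 / 4 * e"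
      unfolding R_def half e_def by (simp_all add: algebra_simps)
    have k0: "0 \<le> k j" unfolding ke using M0 e by simp
    have kl: "k j < k (Suc j)" proof -
      have "0 < M * e / 2" using M0 e by simp
      then show ?thesis unfolding ke(3)[symmetric] by simp
    qed
    have R1: "0 \<le> R (Suc j)" unfolding Re using R0 e by simp
    have R2: "R (Suc j) < R j" proof -
      have "0 < R0 / 4 * e" using R0 e by simp
      then show ?thesis unfolding Re(3)[symmetric] by simp
    qed
    have R3: "R j \<le> R0" unfolding Re using R0 e by (simp add: mult_left_le)
    have y: "0 < x0 * B powr (- (real j / \<theta>))" using x0 B0 by simp
    have "X (k (Suc j)) (R (Suc j)) \<le> ennreal (C * ((R0 / 4 * e) powr (-\<gamma>) * (M * e / 2) powr (- (q * \<theta>)) *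
        (x0 * B powr (- (real j / \<theta>))) powr (1 + \<theta>)))"
      using C(2)[OF k0 kl R1 R2 R3 Suc y] unfolding ke(3) Re(3) .
    also have "C * ((R0 / 4 * e) powr (-\<gamma>) * (M * e / 2) powr (- (q * \<theta>)) *
        (x0 * B powr (- (real j / \<theta>))) powr (1 + \<theta>)) = x0 * B powr (- (real (Suc j) / \<theta>))"
    proof -
      have 1: "(R0 / 4 * e) powr (-\<gamma>) = (R0/4) powr (-\<gamma>) * e powr (-\<gamma>)" by (simp only: powr_mult)
      have 2: "(M * e / 2) powr (- (q * \<theta>)) = M powr (- (q * \<theta>)) * e powr (- (q * \<theta>)) * 2 powr (q * \<theta>)"
      proof -
        have "M * e / 2 = M * e * 2 powr (-1)" by simp
        then show ?thesis by (simp only: powr_mult powr_powr) simp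
      qed
      have 3: "e powr (-\<gamma>) * e powr (- (q * \<theta>)) = B powr (real j)"
      proof -
        have "e powr (-\<gamma>) * e powr (- (q * \<theta>)) = e powr (-\<gamma> + - (q * \<theta>))" by (simp only: powr_add)
        also have "\<dots> = B powr (real j)" unfolding e_def B_def powr_powr by (simp add: algebra_simps)
        finally show ?thesis .
      qed
      have 4: "(x0 * B powr (- (real j / \<theta>))) powr (1 + \<theta>) = x0 powr \<theta> * x0 * B powr (- (real j / \<theta>)) * B powr (- real j)"
      proof -
        have "- (real j / \<theta>) * (1 + \<theta>) = - (real j / \<theta>) + - real j" using \<theta>(1) by (simp add: field_simps)
        then have "(B powr (- (real j / \<theta>))) powr (1 + \<theta>) = B powr (- (real j / \<theta>)) * B powr (- real j)"
          unfolding powr_powr by (simp only: powr_add[symmetric])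
        moreover have "x0 powr (1 + \<theta>) = x0 powr \<theta> * x0" using x0 by (simp add: powr_add)
        ultimately show ?thesis by (simp only: powr_mult mult.assoc)
      qed
      have 5: "B powr (real j) * B powr (- real j) = 1" using B0 by (simp flip: powr_add)
      have "C * ((R0 / 4 * e) powr (-\<gamma>) * (M * e / 2) powr (- (q * \<theta>)) *
        (x0 * B powr (- (real j / \<theta>))) powr (1 + \<theta>))
        = (C * ((R0/4) powr (-\<gamma>) * 2 powr (q * \<theta>)) * x0 powr \<theta> * M powr (- (q * \<theta>))) *
          (e powr (-\<gamma>) * e powr (- (q * \<theta>)) * B powr (- real j)) * (x0 * B powr (- (real j / \<theta>)))"
        unfolding 1 2 4 by (simp only: mult_ac)
      also have "\<dots> = B powr (- (1/\<theta>)) * (x0 * B powr (- (real j / \<theta>)))"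
        unfolding 3 5 A_def[symmetric] MA by simp
      also have "\<dots> = x0 * (B powr (- (1/\<theta>)) * B powr (- (real j / \<theta>)))" by (simp only: mult_ac)
      also have "B powr (- (1/\<theta>)) * B powr (- (real j / \<theta>)) = B powr (- (1/\<theta>) + - (real j / \<theta>))"
        by (simp only: powr_add)
      also have "- (1/\<theta>) + - (real j / \<theta>) = - (real (Suc j) / \<theta>)" by (simp add: add_divide_distrib)
      finally show ?thesis .
    qed
    finally show ?case .
  qed
  have "X M (R0 / 2) \<le> ennreal (x0 * B powr (- (real j / \<theta>)))" for j
  proof -
    have "X M (R0 / 2) \<le> X (k j) (R j)"
      using M0 R0 by (intro X_mono) (auto simp: k_def R_def mult_left_le)
    then show ?thesis using claim[of j] by (rule order_trans)
  qed
  moreover have "(\<lambda>j. ennreal (x0 * B powr (- (real j / \<theta>)))) \<longlonglongrightarrow> ennreal (x0 * 0)"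
  proof (intro tendsto_ennrealI tendsto_mult tendsto_const)
    have "(\<lambda>j. (B powr (- (1/\<theta>))) ^ j) \<longlonglongrightarrow> 0"
      using B1 \<theta>(1) by (intro LIMSEQ_realpow_zero) (auto simp: powr_less_one)
    also have "(\<lambda>j. (B powr (- (1/\<theta>))) ^ j) = (\<lambda>j. B powr (- (real j / \<theta>)))"
      using B0 by (simp add: powr_realpow[symmetric] powr_powr)
    finally show "(\<lambda>j. B powr (- (real j / \<theta>))) \<longlonglongrightarrow> 0" .
  qed
  ultimately have "X M (R0 / 2) \<le> 0" by (intro LIMSEQ_le_const) auto
  then have "AE x in lborel. indicator (cube c (R0/2)) x * ennreal (level_grad u g M x powr q + excess u M x powr q) = 0"
    unfolding X_def by (subst nn_integral_0_iff_AE[symmetric]) auto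
  then have "AE x in lborel. x \<in> cube c (R0 / 2) \<longrightarrow> u x \<le> M"
  proof eventually_elim
    fix x assume 0: "indicator (cube c (R0/2)) x * ennreal (level_grad u g M x powr q + excess u M x powr q) = 0"
    show "x \<in> cube c (R0 / 2) \<longrightarrow> u x \<le> M"
    proof
      assume "x \<in> cube c (R0 / 2)"
      then have "level_grad u g M x powr q + excess u M x powr q \<le> 0" using 0 by (simp add: ennreal_eq_0_iff del: ennreal_plus)
      then have "excess u M x powr q \<le> 0" using powr_ge_zero[of "level_grad u g M x" q] by linarith
      then show "u x \<le> M" by (simp add: excess_def max_def split: if_splits)
    qed
  qed
  then show ?thesis by blast
qed

end

section \<open>Test functions in the weighted space\<close>

locale h1p_weight =
  fixes \<Omega> :: "'a::euclidean_space set" and p :: real and lam mu :: "'a \<Rightarrow> real"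
  assumes op: "open \<Omega>" and p: "1 < p"
    and weight_meas [measurable]: "lam \<in> borel_measurable (lebesgue_on \<Omega>)" "mu \<in> borel_measurable (lebesgue_on \<Omega>)"
    and nonneg: "\<And>x. 0 \<le> lam x" "\<And>x. 0 \<le> mu x"
    and lam_le: "AE x in lebesgue_on \<Omega>. lam x \<le> mu x"
begin

abbreviation M where "M \<equiv> lebesgue_on \<Omega>"

text \<open>The gradient is a separate argument so that the energy applies to
  \<open>v n - u\<close>, where \<open>u\<close> has only a weak gradient.\<close>

definition En :: "('a \<Rightarrow> real) \<Rightarrow> ('a \<Rightarrow> 'a) \<Rightarrow> ennreal" where
  "En f F = (\<integral>\<^sup>+x. ennreal (lam x * norm (F x) powr p + mu x * \<bar>f x\<bar> powr p) \<partial>M)"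

lemma C1_meas:
  assumes "f \<in> C1 \<Omega>"
  shows "f \<in> borel_measurable M" "grad f \<in> borel_measurable M"
  using C1D(2,3)[OF assms] op by (auto intro: continuous_imp_measurable_on_sets_lebesgue)

lemma En_add_le:
  assumes [measurable]: "f \<in> borel_measurable M" "F \<in> borel_measurable M"
    "g \<in> borel_measurable M" "H \<in> borel_measurable M"
    and le: "AE x in M. \<bar>h x\<bar> \<le> \<bar>f x\<bar> + \<bar>g x\<bar>" "AE x in M. norm (K x) \<le> norm (F x) + norm (H x)"
  shows "En h K \<le> ennreal (2 powr p) * (En f F + En g H)"
proof -
  have "En h K \<le> (\<integral>\<^sup>+x. ennreal (2 powr p) * (ennreal (lam x * norm (F x) powr p + mu x * \<bar>f x\<bar> powr p) +
      ennreal (lam x * norm (H x) powr p + mu x * \<bar>g x\<bar> powr p)) \<partial>M)"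
    unfolding En_def
  proof (rule nn_integral_mono_AE)
    show "AE x in M. ennreal (lam x * norm (K x) powr p + mu x * \<bar>h x\<bar> powr p) \<le> ennreal (2 powr p) *
      (ennreal (lam x * norm (F x) powr p + mu x * \<bar>f x\<bar> powr p) +
      ennreal (lam x * norm (H x) powr p + mu x * \<bar>g x\<bar> powr p))"
      using le
    proof eventually_elim
      fix x assume h: "\<bar>h x\<bar> \<le> \<bar>f x\<bar> + \<bar>g x\<bar>" and K: "norm (K x) \<le> norm (F x) + norm (H x)"
      have "norm (K x) powr p \<le> 2 powr p * (norm (F x) powr p + norm (H x) powr p)"
        using powr_mono2[OF _ _ K, of p] powr_add_le[of "norm (F x)" "norm (H x)" p] p by simp
      then have 1: "lam x * norm (K x) powr p \<le> lam x * (2 powr p * (norm (F x) powr p + norm (H x) powr p))"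
        using nonneg by (intro mult_left_mono) auto
      have "\<bar>h x\<bar> powr p \<le> 2 powr p * (\<bar>f x\<bar> powr p + \<bar>g x\<bar> powr p)"
        using powr_mono2[OF _ _ h, of p] powr_add_le[of "\<bar>f x\<bar>" "\<bar>g x\<bar>" p] p by simp
      then have 2: "mu x * \<bar>h x\<bar> powr p \<le> mu x * (2 powr p * (\<bar>f x\<bar> powr p + \<bar>g x\<bar> powr p))"
        using nonneg by (intro mult_left_mono) auto
      have "lam x * norm (K x) powr p + mu x * \<bar>h x\<bar> powr p
        \<le> 2 powr p * ((lam x * norm (F x) powr p + mu x * \<bar>f x\<bar> powr p) +
           (lam x * norm (H x) powr p + mu x * \<bar>g x\<bar> powr p))"
        using add_mono[OF 1 2] by (simp add: algebra_simps)
      then have "ennreal (lam x * norm (K x) powr p + mu x * \<bar>h x\<bar> powr p)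
        \<le> ennreal (2 powr p * ((lam x * norm (F x) powr p + mu x * \<bar>f x\<bar> powr p) +
           (lam x * norm (H x) powr p + mu x * \<bar>g x\<bar> powr p)))" by (rule ennreal_leI)
      also have "\<dots> = ennreal (2 powr p) * (ennreal (lam x * norm (F x) powr p + mu x * \<bar>f x\<bar> powr p) +
           ennreal (lam x * norm (H x) powr p + mu x * \<bar>g x\<bar> powr p))"
        using nonneg by (subst ennreal_mult') (auto intro!: arg_cong2[where f = "(*)"] ennreal_plus)
      finally show "ennreal (lam x * norm (K x) powr p + mu x * \<bar>h x\<bar> powr p) \<le> ennreal (2 powr p) *
        (ennreal (lam x * norm (F x) powr p + mu x * \<bar>f x\<bar> powr p) +
         ennreal (lam x * norm (H x) powr p + mu x * \<bar>g x\<bar> powr p))" .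
    qed
  qed
  also have "\<dots> = ennreal (2 powr p) * (En f F + En g H)"
    unfolding En_def by (subst nn_integral_cmult, measurable, subst nn_integral_add) auto
  finally show ?thesis .
qed

end

text \<open>An element of the completion with a convenient approximating sequence. Convergence
  almost everywhere and convergence of the energies of \<open>v n - u\<close> are not part of the
  definition of \<open>H1p\<close>; they are provided by \<open>H1p_approximation\<close>.\<close>

locale h1p_limit = h1p_weight \<Omega> p lam mu for \<Omega> :: "'a::euclidean_space set" and p lam mu +
  fixes v :: "nat \<Rightarrow> 'a \<Rightarrow> real" and u :: "'a \<Rightarrow> real" and G :: "'a \<Rightarrow> 'a"
  assumes v: "\<And>n. v n \<in> C1 \<Omega>"
    and v_fin: "\<And>n. En (v n) (grad (v n)) < \<infinity>"
    and v_AE: "AE x in lebesgue_on \<Omega>. (\<lambda>n. v n x) \<longlonglongrightarrow> u x"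
    and v_L1: "(\<lambda>n. \<integral>\<^sup>+x. ennreal (\<bar>v n x - u x\<bar> + norm (grad (v n) x - G x)) \<partial>lebesgue_on \<Omega>) \<longlonglongrightarrow> 0"
    and v_E: "(\<lambda>n. En (\<lambda>x. v n x - u x) (\<lambda>x. grad (v n) x - G x)) \<longlonglongrightarrow> 0"
    and G_int: "integrable (lebesgue_on \<Omega>) G" and u_int: "integrable (lebesgue_on \<Omega>) u"
begin

lemma meas [measurable]: "u \<in> borel_measurable M" "G \<in> borel_measurable M"
  using G_int u_int by auto

lemma v_meas [measurable]: "v n \<in> borel_measurable M" "grad (v n) \<in> borel_measurable M"
  using C1_meas[OF v] by auto

lemma En_u_fin: "En u G < \<infinity>"
proof -
  have "\<forall>\<^sub>F n in sequentially. En (\<lambda>x. v n x - u x) (\<lambda>x. grad (v n) x - G x) < 1"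
    using order_tendstoD(2)[OF v_E] by simp
  then obtain n where n: "En (\<lambda>x. v n x - u x) (\<lambda>x. grad (v n) x - G x) < 1"
    by (auto simp: eventually_sequentially)
  have "En u G \<le> ennreal (2 powr p) * (En (v n) (grad (v n)) + En (\<lambda>x. v n x - u x) (\<lambda>x. grad (v n) x - G x))"
  proof (rule En_add_le)
    show "AE x in M. norm (G x) \<le> norm (grad (v n) x) + norm (grad (v n) x - G x)"
      by (intro AE_I2) (metis norm_minus_commute norm_triangle_sub)
  qed auto
  also have "\<dots> < \<infinity>"
    using v_fin[of n] less_trans[OF n, of \<infinity>] by (simp add: ennreal_mult_less_top)
  finally show ?thesis .
qed

lemma lam_G_fin: "(\<integral>\<^sup>+x. ennreal (lam x * norm (G x) powr p) \<partial>M) < \<infinity>"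
  and mu_u_fin: "(\<integral>\<^sup>+x. ennreal (mu x * \<bar>u x\<bar> powr p) \<partial>M) < \<infinity>"
proof -
  have "(\<integral>\<^sup>+x. ennreal (lam x * norm (G x) powr p) \<partial>M) \<le> En u G"
    "(\<integral>\<^sup>+x. ennreal (mu x * \<bar>u x\<bar> powr p) \<partial>M) \<le> En u G"
    unfolding En_def using nonneg by (intro nn_integral_mono ennreal_leI; simp)+
  then show "(\<integral>\<^sup>+x. ennreal (lam x * norm (G x) powr p) \<partial>M) < \<infinity>"
    "(\<integral>\<^sup>+x. ennreal (mu x * \<bar>u x\<bar> powr p) \<partial>M) < \<infinity>"
    using En_u_fin le_less_trans by blast+
qed

end

text \<open>Test functions of the form \<open>\<xi>\<close> times \<open>\<psi>\<close> of
  \<open>u\<close>. As \<open>\<psi>\<close> is continuously differentiable, replacing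
  \<open>u\<close> by \<open>v n\<close> gives members of \<open>C1c \<Omega>\<close>, which would
  fail for the positive part. Slope at most 1 and \<open>\<psi> 0 = 0\<close> give
  \<open>\<bar>\<psi> t\<bar> \<le> \<bar>t\<bar>\<close>, so that \<open>v n\<close> and its
  gradient dominate.\<close>

locale h1p_test = h1p_limit +
  fixes \<xi> :: "'a \<Rightarrow> real" and Y :: "'a \<Rightarrow> 'a" and K :: "'a set" and B :: real and \<psi> \<psi>' :: "real \<Rightarrow> real"
  assumes \<xi>: "C1_grad \<xi> Y" "\<And>x. \<bar>\<xi> x\<bar> \<le> 1" "\<And>x. norm (Y x) \<le> B"
    and K: "compact K" "K \<subseteq> \<Omega>" "\<And>x. x \<notin> K \<Longrightarrow> \<xi> x = 0"
    and \<psi>: "\<And>t. (\<psi> has_real_derivative \<psi>' t) (at t)" "continuous_on UNIV \<psi>'" "\<And>t. \<bar>\<psi>' t\<bar> \<le> 1" "\<psi> 0 = 0"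
begin

definition \<phi>n where "\<phi>n n x = \<xi> x * \<psi> (v n x)"
definition \<Phi>n where "\<Phi>n n x = (\<xi> x * \<psi>' (v n x)) *\<^sub>R grad (v n) x + \<psi> (v n x) *\<^sub>R Y x"
definition \<phi> where "\<phi> x = \<xi> x * \<psi> (u x)"
definition \<Phi> where "\<Phi> x = (\<xi> x * \<psi>' (u x)) *\<^sub>R G x + \<psi> (u x) *\<^sub>R Y x"

lemma B: "0 \<le> B" using \<xi>(3)[of 0] norm_ge_zero order_trans by blast

lemma \<psi>_Lip: "\<bar>\<psi> a - \<psi> b\<bar> \<le> \<bar>a - b\<bar>"
  using field_differentiable_bound[of UNIV \<psi> \<psi>' 1 b a] \<psi>(1,3) by (auto intro: DERIV_subset)

lemma \<psi>_le: "\<bar>\<psi> a\<bar> \<le> \<bar>a\<bar>"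
  using \<psi>_Lip[of a 0] \<psi>(4) by simp

lemma meas_test [measurable]: "\<psi> \<in> borel_measurable borel" "\<psi>' \<in> borel_measurable borel"
  "\<xi> \<in> borel_measurable M" "Y \<in> borel_measurable M"
proof -
  have "continuous_on UNIV \<psi>" using \<psi>(1) by (meson DERIV_continuous continuous_at_imp_continuous_on)
  then show "\<psi> \<in> borel_measurable borel" by (rule borel_measurable_continuous_onI)
  show "\<psi>' \<in> borel_measurable borel" using \<psi>(2) by (rule borel_measurable_continuous_onI)
  show "\<xi> \<in> borel_measurable M" "Y \<in> borel_measurable M"
    using C1_gradD(2,3)[OF \<xi>(1)] op by (auto intro: continuous_imp_measurable_on_sets_lebesgue)
qed

lemma \<phi>n_meas [measurable]: "\<phi>n n \<in> borel_measurable M" "\<Phi>n n \<in> borel_measurable M"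
  "\<phi> \<in> borel_measurable M" "\<Phi> \<in> borel_measurable M"
  unfolding \<phi>n_def[abs_def] \<Phi>n_def[abs_def] \<phi>_def[abs_def] \<Phi>_def[abs_def] by measurable

lemma \<phi>n_C1: "\<phi>n n \<in> C1 \<Omega>" "x \<in> \<Omega> \<Longrightarrow> grad (\<phi>n n) x = \<Phi>n n x"
proof -
  note c = C1_compose[OF v[of n] \<psi>(1,2)]
  note m = C1_mult[OF C1_grad_C1[OF \<xi>(1)] c(1)]
  show "\<phi>n n \<in> C1 \<Omega>" unfolding \<phi>n_def[abs_def] by (rule m(1))
  show "x \<in> \<Omega> \<Longrightarrow> grad (\<phi>n n) x = \<Phi>n n x"
    unfolding \<phi>n_def[abs_def] \<Phi>n_def
    by (subst m(2)) (auto simp: c(2) C1_gradD(4)[OF \<xi>(1)])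
qed

lemma \<phi>n_C1c: "\<phi>n n \<in> C1c \<Omega>"
  unfolding C1c_def using \<phi>n_C1(1) K by (auto simp: \<phi>n_def)

text \<open>Bounds the part of \<open>\<Phi>n n - \<Phi>\<close> that \<open>v n - u\<close> and its
  gradient do not control: \<open>\<psi>'\<close> is evaluated at different points in front of the
  same \<open>G\<close>. It tends to 0 by dominated convergence, since \<open>\<psi>'\<close> is
  continuous, \<open>v n\<close> converges almost everywhere and \<open>2 * norm (G x)\<close> is a
  majorant.\<close>

definition S where "S n x = \<bar>\<psi>' (v n x) - \<psi>' (u x)\<bar> * norm (G x)"

lemma S_meas [measurable]: "S n \<in> borel_measurable M"
  unfolding S_def[abs_def] by measurable

lemma S_props: "0 \<le> S n x" "S n x \<le> 2 * norm (G x)"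
proof -
  show "0 \<le> S n x" by (simp add: S_def)
  have "\<bar>\<psi>' (v n x) - \<psi>' (u x)\<bar> \<le> 2" using \<psi>(3)[of "v n x"] \<psi>(3)[of "u x"] by linarith
  then show "S n x \<le> 2 * norm (G x)" unfolding S_def by (intro mult_right_mono) auto
qed

lemma S_AE: "AE x in M. (\<lambda>n. S n x) \<longlonglongrightarrow> 0"
  using v_AE
proof eventually_elim
  fix x assume "(\<lambda>n. v n x) \<longlonglongrightarrow> u x"
  moreover have "isCont \<psi>' (u x)" using \<psi>(2) by (simp add: continuous_on_eq_continuous_at)
  ultimately have "(\<lambda>n. \<psi>' (v n x)) \<longlonglongrightarrow> \<psi>' (u x)" by (rule isCont_tendsto_compose[rotated])
  then have "(\<lambda>n. \<bar>\<psi>' (v n x) - \<psi>' (u x)\<bar> * norm (G x)) \<longlonglongrightarrow> \<bar>\<psi>' (u x) - \<psi>' (u x)\<bar> * norm (G x)"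
    by (intro tendsto_intros)
  then show "(\<lambda>n. S n x) \<longlonglongrightarrow> 0" by (simp add: S_def)
qed

lemma S_L1: "(\<lambda>n. \<integral>\<^sup>+x. ennreal (S n x) \<partial>M) \<longlonglongrightarrow> 0"
proof -
  have "(\<lambda>n. \<integral>\<^sup>+x. ennreal (S n x) \<partial>M) \<longlonglongrightarrow> (\<integral>\<^sup>+x. ennreal 0 \<partial>M)"
  proof (rule nn_integral_dominated_convergence[where w = "\<lambda>x. ennreal (2 * norm (G x))"])
    show "AE x in M. ennreal (S n x) \<le> ennreal (2 * norm (G x))" for n
      by (intro AE_I2 ennreal_leI S_props)
    have "(\<integral>\<^sup>+x. ennreal (2 * norm (G x)) \<partial>M) = 2 * (\<integral>\<^sup>+x. ennreal (norm (G x)) \<partial>M)"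
      by (simp add: ennreal_mult nn_integral_cmult)
    also have "\<dots> < \<infinity>" using G_int by (auto simp: integrable_iff_bounded ennreal_mult_less_top)
    finally show "(\<integral>\<^sup>+x. ennreal (2 * norm (G x)) \<partial>M) < \<infinity>" .
    show "AE x in M. (\<lambda>n. ennreal (S n x)) \<longlonglongrightarrow> ennreal 0"
      using S_AE by eventually_elim (rule tendsto_ennrealI)
  qed auto
  then show ?thesis by simp
qed

lemma S_Lp: "(\<lambda>n. \<integral>\<^sup>+x. ennreal (lam x * S n x powr p) \<partial>M) \<longlonglongrightarrow> 0"
proof -
  have "(\<lambda>n. \<integral>\<^sup>+x. ennreal (lam x * S n x powr p) \<partial>M) \<longlonglongrightarrow> (\<integral>\<^sup>+x. ennreal 0 \<partial>M)"
  proof (rule nn_integral_dominated_convergence[where w = "\<lambda>x. ennreal (2 powr p) * ennreal (lam x * norm (G x) powr p)"])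
    show "AE x in M. ennreal (lam x * S n x powr p) \<le> ennreal (2 powr p) * ennreal (lam x * norm (G x) powr p)" for n
    proof (intro AE_I2)
      fix x
      have "S n x powr p \<le> (2 * norm (G x)) powr p" using S_props p by (intro powr_mono2) auto
      also have "\<dots> = 2 powr p * norm (G x) powr p" by (simp only: powr_mult)
      finally have "lam x * S n x powr p \<le> lam x * (2 powr p * norm (G x) powr p)"
        using nonneg by (intro mult_left_mono) auto
      then show "ennreal (lam x * S n x powr p) \<le> ennreal (2 powr p) * ennreal (lam x * norm (G x) powr p)"
        using nonneg by (simp add: mult.left_commute ennreal_leI flip: ennreal_mult')
    qed
    show "(\<integral>\<^sup>+x. ennreal (2 powr p) * ennreal (lam x * norm (G x) powr p) \<partial>M) < \<infinity>"
      using lam_G_fin by (subst nn_integral_cmult) (auto simp: ennreal_mult_less_top)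
    show "AE x in M. (\<lambda>n. ennreal (lam x * S n x powr p)) \<longlonglongrightarrow> ennreal 0"
      using S_AE
    proof eventually_elim
      fix x assume s: "(\<lambda>n. S n x) \<longlonglongrightarrow> 0"
      have "(\<lambda>n. S n x powr p) \<longlonglongrightarrow> 0 powr p"
        by (rule tendsto_powr2[OF s tendsto_const]) (use p S_props(1) in auto)
      then have "(\<lambda>n. lam x * S n x powr p) \<longlonglongrightarrow> lam x * 0 powr p" by (rule tendsto_mult[OF tendsto_const])
      then show "(\<lambda>n. ennreal (lam x * S n x powr p)) \<longlonglongrightarrow> ennreal 0"
        using p by (intro tendsto_ennrealI) simp
    qed
  qed auto
  then show ?thesis by simp
qed

lemma \<phi>n_diff: "\<bar>\<phi>n n x - \<phi> x\<bar> \<le> \<bar>v n x - u x\<bar>"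
proof -
  have "\<bar>\<phi>n n x - \<phi> x\<bar> = \<bar>\<xi> x\<bar> * \<bar>\<psi> (v n x) - \<psi> (u x)\<bar>"
    by (simp add: \<phi>n_def \<phi>_def abs_mult flip: right_diff_distrib)
  also have "\<dots> \<le> 1 * \<bar>v n x - u x\<bar>" by (intro mult_mono \<xi> \<psi>_Lip) auto
  finally show ?thesis by simp
qed

lemma \<Phi>n_diff: "norm (\<Phi>n n x - \<Phi> x) \<le> norm (grad (v n) x - G x) + (S n x + B * \<bar>v n x - u x\<bar>)"
proof -
  have norm3: "norm (a + (b + c)) \<le> norm a + (norm b + norm c)" for a b c :: 'a
    using norm_triangle_ineq[of a "b + c"] norm_triangle_ineq[of b c] by linarith
  have eq: "\<Phi>n n x - \<Phi> x = (\<xi> x * \<psi>' (v n x)) *\<^sub>R (grad (v n) x - G x) +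
     ((\<xi> x * (\<psi>' (v n x) - \<psi>' (u x))) *\<^sub>R G x + (\<psi> (v n x) - \<psi> (u x)) *\<^sub>R Y x)"
    by (simp add: \<Phi>n_def \<Phi>_def algebra_simps)
  have "norm (\<Phi>n n x - \<Phi> x) \<le> norm ((\<xi> x * \<psi>' (v n x)) *\<^sub>R (grad (v n) x - G x)) +
     (norm ((\<xi> x * (\<psi>' (v n x) - \<psi>' (u x))) *\<^sub>R G x) + norm ((\<psi> (v n x) - \<psi> (u x)) *\<^sub>R Y x))"
    unfolding eq by (rule norm3)
  also have "\<dots> \<le> norm (grad (v n) x - G x) + (S n x + B * \<bar>v n x - u x\<bar>)"
  proof (intro add_mono)
    have "\<bar>\<xi> x * \<psi>' (v n x)\<bar> \<le> 1 * 1" unfolding abs_mult by (intro mult_mono \<xi> \<psi>) auto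
    then show "norm ((\<xi> x * \<psi>' (v n x)) *\<^sub>R (grad (v n) x - G x)) \<le> norm (grad (v n) x - G x)"
      by (simp add: mult_left_le_one_le)
    have "\<bar>\<xi> x\<bar> * (\<bar>\<psi>' (v n x) - \<psi>' (u x)\<bar> * norm (G x)) \<le> 1 * (\<bar>\<psi>' (v n x) - \<psi>' (u x)\<bar> * norm (G x))"
      by (intro mult_right_mono \<xi>) auto
    then show "norm ((\<xi> x * (\<psi>' (v n x) - \<psi>' (u x))) *\<^sub>R G x) \<le> S n x"
      by (simp add: S_def abs_mult mult.assoc)
    have "\<bar>\<psi> (v n x) - \<psi> (u x)\<bar> * norm (Y x) \<le> \<bar>v n x - u x\<bar> * B" by (intro mult_mono \<psi>_Lip \<xi>) auto
    then show "norm ((\<psi> (v n x) - \<psi> (u x)) *\<^sub>R Y x) \<le> B * \<bar>v n x - u x\<bar>" by (simp add: mult.commute)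
  qed
  finally show ?thesis .
qed

lemma \<phi>n_L1: "(\<lambda>n. \<integral>\<^sup>+x. ennreal (\<bar>\<phi>n n x - \<phi> x\<bar> + norm (\<Phi>n n x - \<Phi> x)) \<partial>M) \<longlonglongrightarrow> 0"
proof (rule tendsto_sandwich[OF _ _ tendsto_const])
  let ?D = "\<lambda>n. \<integral>\<^sup>+x. ennreal (\<bar>v n x - u x\<bar> + norm (grad (v n) x - G x)) \<partial>M"
  let ?T = "\<lambda>n. \<integral>\<^sup>+x. ennreal (S n x) \<partial>M"
  show "\<forall>\<^sub>F n in sequentially. (\<integral>\<^sup>+x. ennreal (\<bar>\<phi>n n x - \<phi> x\<bar> + norm (\<Phi>n n x - \<Phi> x)) \<partial>M)
      \<le> ennreal (1 + B) * ?D n + ?T n"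
  proof (intro always_eventually allI)
    fix n
    have "(\<integral>\<^sup>+x. ennreal (\<bar>\<phi>n n x - \<phi> x\<bar> + norm (\<Phi>n n x - \<Phi> x)) \<partial>M)
      \<le> (\<integral>\<^sup>+x. ennreal (1 + B) * ennreal (\<bar>v n x - u x\<bar> + norm (grad (v n) x - G x)) + ennreal (S n x) \<partial>M)"
    proof (rule nn_integral_mono)
      fix x
      have "\<bar>\<phi>n n x - \<phi> x\<bar> + norm (\<Phi>n n x - \<Phi> x) \<le> (1 + B) * (\<bar>v n x - u x\<bar> + norm (grad (v n) x - G x)) + S n x"
        using \<phi>n_diff[of n x] \<Phi>n_diff[of n x] mult_nonneg_nonneg[OF B norm_ge_zero[of "grad (v n) x - G x"]]
        by (simp add: algebra_simps)
      then have "ennreal (\<bar>\<phi>n n x - \<phi> x\<bar> + norm (\<Phi>n n x - \<Phi> x))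
          \<le> ennreal ((1 + B) * (\<bar>v n x - u x\<bar> + norm (grad (v n) x - G x)) + S n x)" by (rule ennreal_leI)
      also have "\<dots> = ennreal (1 + B) * ennreal (\<bar>v n x - u x\<bar> + norm (grad (v n) x - G x)) + ennreal (S n x)"
      proof -
        have nn: "0 \<le> 1 + B" "0 \<le> (1 + B) * (\<bar>v n x - u x\<bar> + norm (grad (v n) x - G x))" using B by auto
        show ?thesis by (simp only: ennreal_plus[OF nn(2) S_props(1)] ennreal_mult'[OF nn(1)])
      qed
      finally show "ennreal (\<bar>\<phi>n n x - \<phi> x\<bar> + norm (\<Phi>n n x - \<Phi> x)) \<le>
        ennreal (1 + B) * ennreal (\<bar>v n x - u x\<bar> + norm (grad (v n) x - G x)) + ennreal (S n x)" .
    qed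
    also have "\<dots> = ennreal (1 + B) * ?D n + ?T n"
      by (subst nn_integral_add, measurable, subst nn_integral_cmult) auto
    finally show "(\<integral>\<^sup>+x. ennreal (\<bar>\<phi>n n x - \<phi> x\<bar> + norm (\<Phi>n n x - \<Phi> x)) \<partial>M) \<le> ennreal (1 + B) * ?D n + ?T n" .
  qed
  have "(\<lambda>n. ennreal (1 + B) * ?D n + ?T n) \<longlonglongrightarrow> ennreal (1 + B) * 0 + 0"
    by (intro tendsto_add tendsto_mult_ennreal tendsto_const v_L1 S_L1) auto
  then show "(\<lambda>n. ennreal (1 + B) * ?D n + ?T n) \<longlonglongrightarrow> 0" by simp
qed auto

text \<open>The gradient of the cutoff produces the term
  \<open>lam x * (B * \<bar>v n x - u x\<bar>) powr p\<close>; it is \<open>lam \<le> mu\<close>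
  that brings it under the control of the energy.\<close>

lemma \<phi>n_En: "(\<lambda>n. En (\<lambda>x. \<phi>n n x - \<phi> x) (\<lambda>x. \<Phi>n n x - \<Phi> x)) \<longlonglongrightarrow> 0"
proof (rule tendsto_sandwich[OF _ _ tendsto_const])
  \<comment> \<open>The factor \<open>4 powr p\<close> comes from splitting three summands by
    \<open>powr_add_le\<close> twice; the summand 1 makes room for the \<open>mu\<close> term of
    \<open>\<phi>n n - \<phi>\<close> itself.\<close>
  let ?c = "4 powr p * (1 + B powr p) + 1"
  let ?D = "\<lambda>n. En (\<lambda>x. v n x - u x) (\<lambda>x. grad (v n) x - G x)"
  let ?T = "\<lambda>n. \<integral>\<^sup>+x. ennreal (lam x * S n x powr p) \<partial>M"
  show "\<forall>\<^sub>F n in sequentially. En (\<lambda>x. \<phi>n n x - \<phi> x) (\<lambda>x. \<Phi>n n x - \<Phi> x)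
      \<le> ennreal ?c * ?D n + ennreal (4 powr p) * ?T n"
  proof (intro always_eventually allI)
    fix n
    have "En (\<lambda>x. \<phi>n n x - \<phi> x) (\<lambda>x. \<Phi>n n x - \<Phi> x)
      \<le> (\<integral>\<^sup>+x. ennreal ?c * ennreal (lam x * norm (grad (v n) x - G x) powr p + mu x * \<bar>v n x - u x\<bar> powr p)
           + ennreal (4 powr p) * ennreal (lam x * S n x powr p) \<partial>M)"
      unfolding En_def
    proof (rule nn_integral_mono_AE)
      show "AE x in M. ennreal (lam x * norm (\<Phi>n n x - \<Phi> x) powr p + mu x * \<bar>\<phi>n n x - \<phi> x\<bar> powr p) \<le>
        ennreal ?c * ennreal (lam x * norm (grad (v n) x - G x) powr p + mu x * \<bar>v n x - u x\<bar> powr p)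
           + ennreal (4 powr p) * ennreal (lam x * S n x powr p)"
        using lam_le
      proof eventually_elim
        fix x assume lm: "lam x \<le> mu x"
        let ?a = "norm (grad (v n) x - G x)" and ?s = "S n x" and ?w = "\<bar>v n x - u x\<bar>"
        have nn: "0 \<le> ?s" "0 \<le> lam x" "0 \<le> mu x" using S_props nonneg by auto
        have "norm (\<Phi>n n x - \<Phi> x) powr p \<le> (?a + (?s + B * ?w)) powr p"
          using p by (intro powr_mono2 \<Phi>n_diff) auto
        also have "\<dots> \<le> 2 powr p * (?a powr p + (?s + B * ?w) powr p)"
          using p nn B by (intro powr_add_le) auto
        also have "(?s + B * ?w) powr p \<le> 2 powr p * (?s powr p + (B * ?w) powr p)"
          using p nn B by (intro powr_add_le) auto
        also have "2 powr p * (?a powr p + 2 powr p * (?s powr p + (B * ?w) powr p))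
           \<le> 2 powr p * (2 powr p * ?a powr p + 2 powr p * (?s powr p + (B * ?w) powr p))"
        proof (intro mult_left_mono add_right_mono)
          have "1 \<le> (2::real) powr p" using p by (simp add: ge_one_powr_ge_zero)
          from mult_right_mono[OF this, of "?a powr p"] show "?a powr p \<le> 2 powr p * ?a powr p" by simp
        qed simp
        also have "\<dots> = (2 powr p * 2 powr p) * (?a powr p + ?s powr p + B powr p * ?w powr p)"
          by (simp only: powr_mult distrib_left add.assoc mult.assoc)
        also have "2 powr p * 2 powr p = (4::real) powr p" by (simp flip: powr_mult)
        finally have N: "norm (\<Phi>n n x - \<Phi> x) powr p \<le> 4 powr p * (?a powr p + ?s powr p + B powr p * ?w powr p)"
          by simp
        have "lam x * norm (\<Phi>n n x - \<Phi> x) powr p \<le> lam x * (4 powr p * (?a powr p + ?s powr p + B powr p * ?w powr p))"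
          using N nn by (intro mult_left_mono)
        also have "\<dots> = 4 powr p * (lam x * ?a powr p) + 4 powr p * (lam x * ?s powr p) + lam x * (4 powr p * (B powr p * ?w powr p))"
          by (simp add: algebra_simps)
        also have "lam x * (4 powr p * (B powr p * ?w powr p)) \<le> mu x * (4 powr p * (B powr p * ?w powr p))"
          using lm by (intro mult_right_mono) auto
        finally have 1: "lam x * norm (\<Phi>n n x - \<Phi> x) powr p \<le> 4 powr p * (lam x * ?a powr p) + 4 powr p * (lam x * ?s powr p)
            + mu x * (4 powr p * (B powr p * ?w powr p))" by simp
        have 2: "mu x * \<bar>\<phi>n n x - \<phi> x\<bar> powr p \<le> mu x * ?w powr p"
          using p nn \<phi>n_diff[of n x] by (intro mult_left_mono powr_mono2) auto
        have 3: "4 powr p * (lam x * ?a powr p) \<le> ?c * (lam x * ?a powr p)"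
          using nn by (intro mult_right_mono) (auto simp: algebra_simps)
        have "lam x * norm (\<Phi>n n x - \<Phi> x) powr p + mu x * \<bar>\<phi>n n x - \<phi> x\<bar> powr p
          \<le> ?c * (lam x * ?a powr p) + 4 powr p * (lam x * ?s powr p)
            + (mu x * (4 powr p * (B powr p * ?w powr p)) + mu x * ?w powr p)"
          using 1 2 3 by linarith
        also have "mu x * (4 powr p * (B powr p * ?w powr p)) + mu x * ?w powr p = (4 powr p * B powr p + 1) * (mu x * ?w powr p)"
          by (simp add: algebra_simps)
        also have "\<dots> \<le> ?c * (mu x * ?w powr p)" using nn by (intro mult_right_mono) (auto simp: algebra_simps)
        finally have "lam x * norm (\<Phi>n n x - \<Phi> x) powr p + mu x * \<bar>\<phi>n n x - \<phi> x\<bar> powr p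
          \<le> ?c * (lam x * ?a powr p + mu x * ?w powr p) + 4 powr p * (lam x * ?s powr p)"
          by (simp add: distrib_left)
        then have "ennreal (lam x * norm (\<Phi>n n x - \<Phi> x) powr p + mu x * \<bar>\<phi>n n x - \<phi> x\<bar> powr p)
          \<le> ennreal (?c * (lam x * ?a powr p + mu x * ?w powr p) + 4 powr p * (lam x * ?s powr p))" by (rule ennreal_leI)
        also have "\<dots> = ennreal ?c * ennreal (lam x * ?a powr p + mu x * ?w powr p) + ennreal (4 powr p) * ennreal (lam x * ?s powr p)"
        proof -
          have c: "0 \<le> ?c" "0 \<le> (4::real) powr p" by (auto intro!: add_nonneg_nonneg mult_nonneg_nonneg)
          have c2: "0 \<le> ?c * (lam x * ?a powr p + mu x * ?w powr p)" "0 \<le> 4 powr p * (lam x * ?s powr p)"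
            using nn by (intro mult_nonneg_nonneg add_nonneg_nonneg c; simp)+
          show ?thesis by (simp only: ennreal_plus[OF c2] ennreal_mult'[OF c(1)] ennreal_mult'[OF c(2)])
        qed
        finally show "ennreal (lam x * norm (\<Phi>n n x - \<Phi> x) powr p + mu x * \<bar>\<phi>n n x - \<phi> x\<bar> powr p) \<le>
          ennreal ?c * ennreal (lam x * ?a powr p + mu x * ?w powr p) + ennreal (4 powr p) * ennreal (lam x * ?s powr p)" .
      qed
    qed
    also have "\<dots> = ennreal ?c * ?D n + ennreal (4 powr p) * ?T n"
      unfolding En_def by (subst nn_integral_add, measurable, subst nn_integral_cmult, measurable, subst nn_integral_cmult) auto
    finally show "En (\<lambda>x. \<phi>n n x - \<phi> x) (\<lambda>x. \<Phi>n n x - \<Phi> x) \<le> ennreal ?c * ?D n + ennreal (4 powr p) * ?T n" .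
  qed
  have "(\<lambda>n. ennreal ?c * ?D n + ennreal (4 powr p) * ?T n) \<longlonglongrightarrow> ennreal ?c * 0 + ennreal (4 powr p) * 0"
    by (intro tendsto_add tendsto_mult_ennreal tendsto_const v_E S_Lp) auto
  then show "(\<lambda>n. ennreal ?c * ?D n + ennreal (4 powr p) * ?T n) \<longlonglongrightarrow> 0" by simp
qed auto

end

lemma C1c_bounded:
  assumes \<Omega>: "open \<Omega>" and f: "f \<in> C1c \<Omega>"
  obtains f0 F0 K B where "C1_grad f0 F0" "compact K" "K \<subseteq> \<Omega>" "\<And>x. x \<notin> K \<Longrightarrow> f0 x = 0"
    "\<And>x. x \<in> \<Omega> \<Longrightarrow> f0 x = f x" "\<And>x. x \<in> \<Omega> \<Longrightarrow> F0 x = grad f x" "\<And>x. x \<notin> K \<Longrightarrow> F0 x = 0"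
    "\<And>x. x \<in> \<Omega> \<Longrightarrow> \<bar>f x\<bar> \<le> B" "\<And>x. x \<in> \<Omega> \<Longrightarrow> norm (grad f x) \<le> B"
proof -
  obtain K where K: "compact K" "K \<subseteq> \<Omega>" "\<And>x. x \<in> \<Omega> \<Longrightarrow> x \<notin> K \<Longrightarrow> f x = 0" and f1: "f \<in> C1 \<Omega>"
    using f by (auto simp: C1c_def)
  define f0 where "f0 = (\<lambda>x. if x \<in> \<Omega> then f x else 0)"
  define F0 where "F0 = (\<lambda>x. if x \<in> \<Omega> then grad f x else 0)"
  have c: "C1_grad f0 F0" unfolding f0_def F0_def by (rule C1c_extend[OF \<Omega> f1 K])
  have 0: "f0 x = 0" if "x \<notin> K" for x using that K by (auto simp: f0_def)
  have F0: "F0 x = 0" if "x \<notin> K" for x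
    using C1_grad_eq_0[OF c compact_imp_closed[OF K(1)] 0 that] .
  have "bounded (f0 ` K)" "bounded (F0 ` K)"
    using C1_gradD(2,3)[OF c, of K] K(1) by (auto intro: compact_imp_bounded compact_continuous_image)
  then obtain B1 B2 where B: "\<forall>x\<in>K. \<bar>f0 x\<bar> \<le> B1" "\<forall>x\<in>K. norm (F0 x) \<le> B2"
    unfolding bounded_iff by auto
  have B': "\<bar>f0 x\<bar> \<le> max 0 (max B1 B2)" "norm (F0 x) \<le> max 0 (max B1 B2)" for x
    using B 0[of x] F0[of x] by (cases "x \<in> K"; force)+
  show ?thesis
  proof (rule that[OF c K(1,2) 0 _ _ F0, of "max 0 (max B1 B2)"])
    fix x assume "x \<in> \<Omega>"
    then show "\<bar>f x\<bar> \<le> max 0 (max B1 B2)" "norm (grad f x) \<le> max 0 (max B1 B2)"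
      using B'[of x] by (auto simp: f0_def F0_def)
  qed (auto simp: f0_def F0_def)
qed

section \<open>Integration by parts\<close>

lemma integral_lebesgue_on_eq:
  fixes f0 :: "'a::euclidean_space \<Rightarrow> 'b::euclidean_space"
  assumes "open \<Omega>" "f0 \<in> borel_measurable borel" "\<And>x. x \<in> \<Omega> \<Longrightarrow> f0 x = f x" "\<And>x. x \<notin> \<Omega> \<Longrightarrow> f0 x = 0"
  shows "(\<integral>x. f x \<partial>lebesgue_on \<Omega>) = (\<integral>x. f0 x \<partial>lborel)"
proof -
  have "(\<integral>x. f x \<partial>lebesgue_on \<Omega>) = (\<integral>x. indicator \<Omega> x *\<^sub>R f x \<partial>lebesgue)"
    using assms(1) by (intro integral_restrict_space) auto
  also have "(\<lambda>x. indicator \<Omega> x *\<^sub>R f x) = f0"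
    using assms(3,4) by (auto simp: indicator_def fun_eq_iff)
  also have "(\<integral>x. f0 x \<partial>lebesgue) = (\<integral>x. f0 x \<partial>lborel)"
    using assms(2) by (intro integral_completion) auto
  finally show ?thesis .
qed

text \<open>The gradient of the product of the two extensions by 0 has integral 0, and both terms of
  the product rule are continuous with compact support.\<close>

lemma integration_by_parts_C1c:
  fixes f g :: "'a::euclidean_space \<Rightarrow> real"
  assumes \<Omega>: "open \<Omega>" and f: "f \<in> C1c \<Omega>" and g: "g \<in> C1c \<Omega>"
  shows "(\<integral>x. f x *\<^sub>R grad g x \<partial>lebesgue_on \<Omega>) = - (\<integral>x. g x *\<^sub>R grad f x \<partial>lebesgue_on \<Omega>)"
proof -
  obtain f0 F0 K B where f0: "C1_grad f0 F0" "compact K" "K \<subseteq> \<Omega>" "\<And>x. x \<notin> K \<Longrightarrow> f0 x = 0"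
    "\<And>x. x \<in> \<Omega> \<Longrightarrow> f0 x = f x" "\<And>x. x \<in> \<Omega> \<Longrightarrow> F0 x = grad f x" "\<And>x. x \<notin> K \<Longrightarrow> F0 x = 0"
    by (rule C1c_bounded[OF \<Omega> f]) (rule that, assumption+)
  obtain g0 G0 K' B' where g0: "C1_grad g0 G0" "compact K'" "K' \<subseteq> \<Omega>" "\<And>x. x \<notin> K' \<Longrightarrow> g0 x = 0"
    "\<And>x. x \<in> \<Omega> \<Longrightarrow> g0 x = g x" "\<And>x. x \<in> \<Omega> \<Longrightarrow> G0 x = grad g x" "\<And>x. x \<notin> K' \<Longrightarrow> G0 x = 0"
    by (rule C1c_bounded[OF \<Omega> g]) (rule that, assumption+)
  let ?P = "\<lambda>x. f0 x *\<^sub>R G0 x + g0 x *\<^sub>R F0 x"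
  have P: "C1_grad (\<lambda>x. f0 x * g0 x) ?P"
    unfolding C1_grad_def
  proof safe
    fix x
    show "((\<lambda>x. f0 x * g0 x) has_derivative (\<lambda>h. ?P x \<bullet> h)) (at x)"
      using has_derivative_mult[OF C1_gradD(1)[OF f0(1), of x] C1_gradD(1)[OF g0(1), of x]]
      by (simp add: inner_add_left algebra_simps)
    show "continuous_on UNIV ?P"
      by (intro continuous_intros C1_gradD(2,3)[OF f0(1)] C1_gradD(2,3)[OF g0(1)])
  qed
  have i1: "integrable lborel (\<lambda>x. f0 x *\<^sub>R G0 x)" "integrable lborel (\<lambda>x. g0 x *\<^sub>R F0 x)"
    by (rule integrable_continuous_compact_support[OF _ f0(2)];
        auto intro!: continuous_intros C1_gradD(2,3)[OF f0(1)] C1_gradD(2,3)[OF g0(1)] simp: f0(4,7))+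
  then have iP: "integrable lborel ?P" by (rule Bochner_Integration.integrable_add)
  have "(\<integral>x. ?P x \<partial>lborel) = 0"
  proof (rule euclidean_eqI)
    fix b :: 'a
    have "(\<integral>x. ?P x \<partial>lborel) \<bullet> b = (\<integral>x. ?P x \<bullet> b \<partial>lborel)" using iP by (intro integral_inner_left[symmetric]) auto
    also have "\<dots> = 0" by (rule integral_grad_eq_0[OF P f0(2)]) (simp add: f0(4))
    finally show "(\<integral>x. ?P x \<partial>lborel) \<bullet> b = 0 \<bullet> b" by simp
  qed
  then have "(\<integral>x. f0 x *\<^sub>R G0 x \<partial>lborel) + (\<integral>x. g0 x *\<^sub>R F0 x \<partial>lborel) = 0"
    using Bochner_Integration.integral_add[OF i1] by simp
  moreover have "(\<integral>x. f x *\<^sub>R grad g x \<partial>lebesgue_on \<Omega>) = (\<integral>x. f0 x *\<^sub>R G0 x \<partial>lborel)"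
    using i1(1) f0(3,4) by (intro integral_lebesgue_on_eq[OF \<Omega>]) (auto simp: f0(5) g0(6))
  moreover have "(\<integral>x. g x *\<^sub>R grad f x \<partial>lebesgue_on \<Omega>) = (\<integral>x. g0 x *\<^sub>R F0 x \<partial>lborel)"
    using i1(2) g0(3,4) by (intro integral_lebesgue_on_eq[OF \<Omega>]) (auto simp: f0(6) g0(5))
  ultimately show ?thesis by (simp add: eq_neg_iff_add_eq_0)
qed

lemma grad_diff:
  assumes "f \<in> C1 \<Omega>" "g \<in> C1 \<Omega>" "x \<in> \<Omega>"
  shows "grad (\<lambda>x. f x - g x) x = grad f x - grad g x"
  using has_derivative_diff[OF C1D(1)[OF assms(1,3)] C1D(1)[OF assms(2,3)]]
  by (intro grad_eqI) (simp add: inner_diff_left)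

context h1p_test
begin

lemma \<phi>_le: "\<bar>\<phi> x\<bar> \<le> \<bar>u x\<bar>"
proof -
  have "\<bar>\<xi> x\<bar> * \<bar>\<psi> (u x)\<bar> \<le> 1 * \<bar>u x\<bar>" by (intro mult_mono \<xi> \<psi>_le) auto
  then show ?thesis by (simp add: \<phi>_def abs_mult)
qed

lemma \<Phi>_le: "norm (\<Phi> x) \<le> norm (G x) + B * \<bar>u x\<bar>"
proof -
  have 1: "\<bar>\<xi> x * \<psi>' (u x)\<bar> \<le> 1 * 1" unfolding abs_mult by (intro mult_mono \<xi> \<psi>) auto
  have "norm (\<Phi> x) \<le> norm ((\<xi> x * \<psi>' (u x)) *\<^sub>R G x) + norm (\<psi> (u x) *\<^sub>R Y x)"
    unfolding \<Phi>_def by (rule norm_triangle_ineq)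
  also have "\<dots> \<le> norm (G x) + \<bar>u x\<bar> * B"
    unfolding norm_scaleR using 1 by (intro add_mono mult_mono \<psi>_le \<xi>) (auto simp: mult_left_le_one_le)
  finally show ?thesis by (simp add: mult.commute)
qed

lemma \<phi>_int: "integrable M \<phi>" and \<Phi>_int: "integrable M \<Phi>"
proof -
  show "integrable M \<phi>" using \<phi>_le by (intro Bochner_Integration.integrable_bound[OF u_int]) auto
  have "integrable M (\<lambda>x. norm (G x) + B * \<bar>u x\<bar>)"
    using G_int u_int by (intro Bochner_Integration.integrable_add integrable_mult_right) auto
  then show "integrable M \<Phi>"
    by (rule Bochner_Integration.integrable_bound) (auto intro!: AE_I2 order_trans[OF \<Phi>_le])
qed

text \<open>Integration by parts passes from \<open>\<phi>n\<close> to the limit, because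
  \<open>\<zeta>\<close> and its gradient are bounded and \<open>\<phi>n\<close>,
  \<open>\<Phi>n\<close> converge in L^1.\<close>

lemma \<phi>n_scaleR_int:
  assumes "\<zeta> \<in> C1c \<Omega>"
  shows "(\<integral>x. \<phi> x *\<^sub>R grad \<zeta> x \<partial>M) = - (\<integral>x. \<zeta> x *\<^sub>R \<Phi> x \<partial>M)"
proof -
  obtain z0 Z0 K' Bz where "\<And>x. x \<in> \<Omega> \<Longrightarrow> \<bar>\<zeta> x\<bar> \<le> Bz" "\<And>x. x \<in> \<Omega> \<Longrightarrow> norm (grad \<zeta> x) \<le> Bz"
    by (rule C1c_bounded[OF op assms]) (rule that, assumption+)
  note Bz = this
  have [measurable]: "\<zeta> \<in> borel_measurable M" "grad \<zeta> \<in> borel_measurable M"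
    using C1_meas[of \<zeta>] assms by (auto simp: C1c_def)
  have Bz': "AE x in M. \<bar>\<zeta> x\<bar> \<le> \<bar>Bz\<bar>" "AE x in M. norm (grad \<zeta> x) \<le> \<bar>Bz\<bar>"
    using Bz by (force intro!: AE_I2)+
  have bd: "integrable M (\<lambda>x. f x *\<^sub>R H x)" if "integrable M f" "H \<in> borel_measurable M" "AE x in M. norm (H x) \<le> \<bar>Bz\<bar>"
    for f :: "'a \<Rightarrow> real" and H :: "'a \<Rightarrow> 'a"
  proof (rule Bochner_Integration.integrable_bound[of M "\<lambda>x. \<bar>Bz\<bar> * f x"])
    show "integrable M (\<lambda>x. \<bar>Bz\<bar> * f x)" using that(1) by simp
    show "AE x in M. norm (f x *\<^sub>R H x) \<le> norm (\<bar>Bz\<bar> * f x)"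
      using that(3) by eventually_elim (simp add: abs_mult mult.commute[of "\<bar>Bz\<bar>"] mult_left_mono)
  qed (use that in auto)
  have bd2: "integrable M (\<lambda>x. \<zeta> x *\<^sub>R H x)" if "integrable M H" for H :: "'a \<Rightarrow> 'a"
  proof (rule Bochner_Integration.integrable_bound[of M "\<lambda>x. \<bar>Bz\<bar> *\<^sub>R H x"])
    show "integrable M (\<lambda>x. \<bar>Bz\<bar> *\<^sub>R H x)" using that by simp
    show "AE x in M. norm (\<zeta> x *\<^sub>R H x) \<le> norm (\<bar>Bz\<bar> *\<^sub>R H x)"
      using Bz'(1) by eventually_elim (simp add: mult_right_mono)
  qed (use that in auto)
  \<comment> \<open>Integrability of \<open>\<phi>n n\<close> and \<open>\<Phi>n n\<close> is read
    off from their finite L^1 distance to \<open>\<phi>\<close> and \<open>\<Phi>\<close>, whence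
    the shift by \<open>N\<close>.\<close>
  obtain N where N: "\<And>n. n \<ge> N \<Longrightarrow> (\<integral>\<^sup>+x. ennreal (\<bar>\<phi>n n x - \<phi> x\<bar> + norm (\<Phi>n n x - \<Phi> x)) \<partial>M) < 1"
    using order_tendstoD(2)[OF \<phi>n_L1, of 1] by (auto simp: eventually_sequentially)
  have int_n: "integrable M (\<phi>n n)" "integrable M (\<Phi>n n)" if "n \<ge> N" for n
  proof -
    have 1: "(\<integral>\<^sup>+x. ennreal (\<bar>\<phi>n n x - \<phi> x\<bar> + norm (\<Phi>n n x - \<Phi> x)) \<partial>M) < \<infinity>" 
      using N[OF that] by (rule less_trans) simp
    have "(\<integral>\<^sup>+x. ennreal (norm (\<phi>n n x - \<phi> x)) \<partial>M) \<le> (\<integral>\<^sup>+x. ennreal (\<bar>\<phi>n n x - \<phi> x\<bar> + norm (\<Phi>n n x - \<Phi> x)) \<partial>M)"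
      "(\<integral>\<^sup>+x. ennreal (norm (\<Phi>n n x - \<Phi> x)) \<partial>M) \<le> (\<integral>\<^sup>+x. ennreal (\<bar>\<phi>n n x - \<phi> x\<bar> + norm (\<Phi>n n x - \<Phi> x)) \<partial>M)"
      by (intro nn_integral_mono ennreal_leI; simp)+
    then have "integrable M (\<lambda>x. \<phi>n n x - \<phi> x)" "integrable M (\<lambda>x. \<Phi>n n x - \<Phi> x)"
      using 1 by (auto simp: integrable_iff_bounded intro: le_less_trans)
    from Bochner_Integration.integrable_add[OF this(1) \<phi>_int] Bochner_Integration.integrable_add[OF this(2) \<Phi>_int]
    show "integrable M (\<phi>n n)" "integrable M (\<Phi>n n)" by simp_all
  qed
  let ?D = "\<lambda>n. \<integral>\<^sup>+x. ennreal (\<bar>\<phi>n (n + N) x - \<phi> x\<bar> + norm (\<Phi>n (n + N) x - \<Phi> x)) \<partial>M"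
  have D0: "(\<lambda>n. ennreal \<bar>Bz\<bar> * ?D n) \<longlonglongrightarrow> 0"
  proof -
    have "(\<lambda>n. ennreal \<bar>Bz\<bar> * ?D n) \<longlonglongrightarrow> ennreal \<bar>Bz\<bar> * 0"
      using LIMSEQ_ignore_initial_segment[OF \<phi>n_L1, of N] by (intro tendsto_mult_ennreal tendsto_const) auto
    then show ?thesis by simp
  qed
  have L1: "(\<lambda>n. \<integral>x. \<phi>n (n + N) x *\<^sub>R grad \<zeta> x \<partial>M) \<longlonglongrightarrow> (\<integral>x. \<phi> x *\<^sub>R grad \<zeta> x \<partial>M)"
  proof (rule tendsto_L1_int)
    show "integrable M (\<lambda>x. \<phi>n (n + N) x *\<^sub>R grad \<zeta> x)" for n by (intro bd int_n Bz') auto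
    show "integrable M (\<lambda>x. \<phi> x *\<^sub>R grad \<zeta> x)" by (intro bd \<phi>_int Bz') auto
    show "(\<lambda>n. \<integral>\<^sup>+x. ennreal (norm (\<phi>n (n + N) x *\<^sub>R grad \<zeta> x - \<phi> x *\<^sub>R grad \<zeta> x)) \<partial>M) \<longlonglongrightarrow> 0"
    proof (rule tendsto_sandwich[OF _ _ tendsto_const D0])
      show "\<forall>\<^sub>F n in sequentially. (\<integral>\<^sup>+x. ennreal (norm (\<phi>n (n + N) x *\<^sub>R grad \<zeta> x - \<phi> x *\<^sub>R grad \<zeta> x)) \<partial>M)
          \<le> ennreal \<bar>Bz\<bar> * ?D n"
      proof (intro always_eventually allI)
        fix n
        have "(\<integral>\<^sup>+x. ennreal (norm (\<phi>n (n + N) x *\<^sub>R grad \<zeta> x - \<phi> x *\<^sub>R grad \<zeta> x)) \<partial>M)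
          \<le> (\<integral>\<^sup>+x. ennreal \<bar>Bz\<bar> * ennreal (\<bar>\<phi>n (n + N) x - \<phi> x\<bar> + norm (\<Phi>n (n + N) x - \<Phi> x)) \<partial>M)"
        proof (rule nn_integral_mono_AE)
          show "AE x in M. ennreal (norm (\<phi>n (n + N) x *\<^sub>R grad \<zeta> x - \<phi> x *\<^sub>R grad \<zeta> x))
             \<le> ennreal \<bar>Bz\<bar> * ennreal (\<bar>\<phi>n (n + N) x - \<phi> x\<bar> + norm (\<Phi>n (n + N) x - \<Phi> x))"
            using Bz'(2)
          proof eventually_elim
            fix x assume b: "norm (grad \<zeta> x) \<le> \<bar>Bz\<bar>"
            have "norm (\<phi>n (n + N) x *\<^sub>R grad \<zeta> x - \<phi> x *\<^sub>R grad \<zeta> x) = norm (grad \<zeta> x) * \<bar>\<phi>n (n + N) x - \<phi> x\<bar>"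
              by (simp add: mult.commute flip: scaleR_diff_left)
            also have "\<dots> \<le> \<bar>Bz\<bar> * (\<bar>\<phi>n (n + N) x - \<phi> x\<bar> + norm (\<Phi>n (n + N) x - \<Phi> x))"
              using b by (intro mult_mono) auto
            finally show "ennreal (norm (\<phi>n (n + N) x *\<^sub>R grad \<zeta> x - \<phi> x *\<^sub>R grad \<zeta> x))
             \<le> ennreal \<bar>Bz\<bar> * ennreal (\<bar>\<phi>n (n + N) x - \<phi> x\<bar> + norm (\<Phi>n (n + N) x - \<Phi> x))"
              by (subst ennreal_mult'[symmetric]) (auto intro: ennreal_leI simp del: ennreal_plus)
          qed
        qed
        also have "\<dots> = ennreal \<bar>Bz\<bar> * ?D n" by (rule nn_integral_cmult) measurable
        finally show "(\<integral>\<^sup>+x. ennreal (norm (\<phi>n (n + N) x *\<^sub>R grad \<zeta> x - \<phi> x *\<^sub>R grad \<zeta> x)) \<partial>M) \<le> ennreal \<bar>Bz\<bar> * ?D n" .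
      qed
    qed auto
  qed
  have L2: "(\<lambda>n. \<integral>x. \<zeta> x *\<^sub>R \<Phi>n (n + N) x \<partial>M) \<longlonglongrightarrow> (\<integral>x. \<zeta> x *\<^sub>R \<Phi> x \<partial>M)"
  proof (rule tendsto_L1_int)
    show "integrable M (\<lambda>x. \<zeta> x *\<^sub>R \<Phi>n (n + N) x)" for n by (intro bd2 int_n) auto
    show "integrable M (\<lambda>x. \<zeta> x *\<^sub>R \<Phi> x)" by (intro bd2 \<Phi>_int)
    show "(\<lambda>n. \<integral>\<^sup>+x. ennreal (norm (\<zeta> x *\<^sub>R \<Phi>n (n + N) x - \<zeta> x *\<^sub>R \<Phi> x)) \<partial>M) \<longlonglongrightarrow> 0"
    proof (rule tendsto_sandwich[OF _ _ tendsto_const D0])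
      show "\<forall>\<^sub>F n in sequentially. (\<integral>\<^sup>+x. ennreal (norm (\<zeta> x *\<^sub>R \<Phi>n (n + N) x - \<zeta> x *\<^sub>R \<Phi> x)) \<partial>M)
          \<le> ennreal \<bar>Bz\<bar> * ?D n"
      proof (intro always_eventually allI)
        fix n
        have "(\<integral>\<^sup>+x. ennreal (norm (\<zeta> x *\<^sub>R \<Phi>n (n + N) x - \<zeta> x *\<^sub>R \<Phi> x)) \<partial>M)
          \<le> (\<integral>\<^sup>+x. ennreal \<bar>Bz\<bar> * ennreal (\<bar>\<phi>n (n + N) x - \<phi> x\<bar> + norm (\<Phi>n (n + N) x - \<Phi> x)) \<partial>M)"
        proof (rule nn_integral_mono_AE)
          show "AE x in M. ennreal (norm (\<zeta> x *\<^sub>R \<Phi>n (n + N) x - \<zeta> x *\<^sub>R \<Phi> x))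
             \<le> ennreal \<bar>Bz\<bar> * ennreal (\<bar>\<phi>n (n + N) x - \<phi> x\<bar> + norm (\<Phi>n (n + N) x - \<Phi> x))"
            using Bz'(1)
          proof eventually_elim
            fix x assume b: "\<bar>\<zeta> x\<bar> \<le> \<bar>Bz\<bar>"
            have "norm (\<zeta> x *\<^sub>R \<Phi>n (n + N) x - \<zeta> x *\<^sub>R \<Phi> x) = \<bar>\<zeta> x\<bar> * norm (\<Phi>n (n + N) x - \<Phi> x)"
              by (simp flip: scaleR_diff_right)
            also have "\<dots> \<le> \<bar>Bz\<bar> * (\<bar>\<phi>n (n + N) x - \<phi> x\<bar> + norm (\<Phi>n (n + N) x - \<Phi> x))"
              using b by (intro mult_mono) auto
            finally show "ennreal (norm (\<zeta> x *\<^sub>R \<Phi>n (n + N) x - \<zeta> x *\<^sub>R \<Phi> x))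
             \<le> ennreal \<bar>Bz\<bar> * ennreal (\<bar>\<phi>n (n + N) x - \<phi> x\<bar> + norm (\<Phi>n (n + N) x - \<Phi> x))"
              by (subst ennreal_mult'[symmetric]) (auto intro: ennreal_leI simp del: ennreal_plus)
          qed
        qed
        also have "\<dots> = ennreal \<bar>Bz\<bar> * ?D n" by (rule nn_integral_cmult) measurable
        finally show "(\<integral>\<^sup>+x. ennreal (norm (\<zeta> x *\<^sub>R \<Phi>n (n + N) x - \<zeta> x *\<^sub>R \<Phi> x)) \<partial>M) \<le> ennreal \<bar>Bz\<bar> * ?D n" .
      qed
    qed auto
  qed
  have "(\<integral>x. \<phi>n n x *\<^sub>R grad \<zeta> x \<partial>M) = - (\<integral>x. \<zeta> x *\<^sub>R \<Phi>n n x \<partial>M)" for n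
  proof -
    have "(\<integral>x. \<phi>n n x *\<^sub>R grad \<zeta> x \<partial>M) = - (\<integral>x. \<zeta> x *\<^sub>R grad (\<phi>n n) x \<partial>M)"
      by (rule integration_by_parts_C1c[OF op \<phi>n_C1c assms])
    also have "(\<integral>x. \<zeta> x *\<^sub>R grad (\<phi>n n) x \<partial>M) = (\<integral>x. \<zeta> x *\<^sub>R \<Phi>n n x \<partial>M)"
      by (intro Bochner_Integration.integral_cong) (auto simp: \<phi>n_C1(2))
    finally show ?thesis .
  qed
  then have "(\<lambda>n. \<integral>x. \<phi>n (n + N) x *\<^sub>R grad \<zeta> x \<partial>M) \<longlonglongrightarrow> - (\<integral>x. \<zeta> x *\<^sub>R \<Phi> x \<partial>M)"
    using tendsto_minus[OF L2] by simp
  with L1 show ?thesis by (rule LIMSEQ_unique)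
qed

lemma has_W11_gradient_\<phi>: "has_W11_gradient \<Omega> \<phi> \<Phi>"
  unfolding has_W11_gradient_def using \<phi>_int \<Phi>_int \<phi>n_scaleR_int by blast

lemma En_\<phi>n_fin: "En (\<phi>n n) (\<Phi>n n) < \<infinity>"
proof -
  let ?c = "2 powr p * (1 + B powr p) + 1"
  have "En (\<phi>n n) (\<Phi>n n) \<le> (\<integral>\<^sup>+x. ennreal ?c * ennreal (lam x * norm (grad (v n) x) powr p + mu x * \<bar>v n x\<bar> powr p) \<partial>M)"
    unfolding En_def
  proof (rule nn_integral_mono_AE)
    show "AE x in M. ennreal (lam x * norm (\<Phi>n n x) powr p + mu x * \<bar>\<phi>n n x\<bar> powr p)
      \<le> ennreal ?c * ennreal (lam x * norm (grad (v n) x) powr p + mu x * \<bar>v n x\<bar> powr p)"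
      using lam_le
    proof eventually_elim
      fix x assume lm: "lam x \<le> mu x"
      let ?a = "norm (grad (v n) x)" and ?w = "\<bar>v n x\<bar>"
      have nn: "0 \<le> lam x" "0 \<le> mu x" using nonneg by auto
      have 1: "\<bar>\<xi> x * \<psi>' (v n x)\<bar> \<le> 1 * 1" unfolding abs_mult by (intro mult_mono \<xi> \<psi>) auto
      have "norm (\<Phi>n n x) \<le> norm ((\<xi> x * \<psi>' (v n x)) *\<^sub>R grad (v n) x) + norm (\<psi> (v n x) *\<^sub>R Y x)"
        unfolding \<Phi>n_def by (rule norm_triangle_ineq)
      also have "\<dots> \<le> ?a + ?w * B"
        unfolding norm_scaleR using 1 by (intro add_mono mult_mono \<psi>_le \<xi>) (auto simp: mult_left_le_one_le)
      finally have "norm (\<Phi>n n x) powr p \<le> (?a + ?w * B) powr p" using p by (intro powr_mono2) auto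
      also have "\<dots> \<le> 2 powr p * (?a powr p + (?w * B) powr p)" using p B by (intro powr_add_le) auto
      also have "\<dots> = 2 powr p * (?a powr p + ?w powr p * B powr p)" by (simp only: powr_mult)
      finally have "lam x * norm (\<Phi>n n x) powr p \<le> lam x * (2 powr p * (?a powr p + ?w powr p * B powr p))"
        using nn by (intro mult_left_mono)
      also have "\<dots> = 2 powr p * (lam x * ?a powr p) + lam x * (2 powr p * (?w powr p * B powr p))"
        by (simp add: algebra_simps)
      also have "lam x * (2 powr p * (?w powr p * B powr p)) \<le> mu x * (2 powr p * (?w powr p * B powr p))"
        using lm by (intro mult_right_mono) auto
      finally have 2: "lam x * norm (\<Phi>n n x) powr p \<le> 2 powr p * (lam x * ?a powr p) + mu x * (2 powr p * (?w powr p * B powr p))"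
        by simp
      have "\<bar>\<xi> x\<bar> * \<bar>\<psi> (v n x)\<bar> \<le> 1 * ?w" by (intro mult_mono \<xi> \<psi>_le) auto
      then have "\<bar>\<phi>n n x\<bar> \<le> ?w" by (simp add: \<phi>n_def abs_mult)
      then have 3: "mu x * \<bar>\<phi>n n x\<bar> powr p \<le> mu x * ?w powr p"
        using p nn by (intro mult_left_mono powr_mono2) auto
      have 4: "2 powr p * (lam x * ?a powr p) \<le> ?c * (lam x * ?a powr p)"
        using nn by (intro mult_right_mono) (auto simp: algebra_simps)
      have 5: "mu x * (2 powr p * (?w powr p * B powr p)) + mu x * ?w powr p \<le> ?c * (mu x * ?w powr p)"
      proof -
        have "mu x * (2 powr p * (?w powr p * B powr p)) + mu x * ?w powr p = (2 powr p * B powr p + 1) * (mu x * ?w powr p)"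
          by (simp add: algebra_simps)
        also have "\<dots> \<le> ?c * (mu x * ?w powr p)" using nn by (intro mult_right_mono) (auto simp: algebra_simps)
        finally show ?thesis .
      qed
      have "lam x * norm (\<Phi>n n x) powr p + mu x * \<bar>\<phi>n n x\<bar> powr p \<le> ?c * (lam x * ?a powr p + mu x * ?w powr p)"
        using 2 3 4 5 by (simp only: distrib_left)
      then have "ennreal (lam x * norm (\<Phi>n n x) powr p + mu x * \<bar>\<phi>n n x\<bar> powr p)
          \<le> ennreal (?c * (lam x * ?a powr p + mu x * ?w powr p))" by (rule ennreal_leI)
      also have "\<dots> = ennreal ?c * ennreal (lam x * ?a powr p + mu x * ?w powr p)"
        by (rule ennreal_mult') (auto intro!: add_nonneg_nonneg mult_nonneg_nonneg)
      finally show "ennreal (lam x * norm (\<Phi>n n x) powr p + mu x * \<bar>\<phi>n n x\<bar> powr p)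
          \<le> ennreal ?c * ennreal (lam x * ?a powr p + mu x * ?w powr p)" .
    qed
  qed
  also have "\<dots> = ennreal ?c * En (v n) (grad (v n))"
    unfolding En_def by (rule nn_integral_cmult) measurable
  also have "\<dots> < \<infinity>" using v_fin[of n] by (simp add: ennreal_mult_less_top)
  finally show ?thesis .
qed

end

section \<open>Membership in the weighted space\<close>

lemma H1p_energy_eq:
  assumes "AE x in lebesgue_on \<Omega>. ellip_lower p a x = ereal (lam x) \<and> ellip_upper p a x = ereal (mu x)"
    and "\<And>x. 0 \<le> lam x" "\<And>x. 0 \<le> mu x" and "\<And>x. x \<in> \<Omega> \<Longrightarrow> grad f x = F x"
  shows "H1p_energy p \<Omega> a f = (\<integral>\<^sup>+x. ennreal (lam x * norm (F x) powr p + mu x * \<bar>f x\<bar> powr p) \<partial>lebesgue_on \<Omega>)"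
  unfolding H1p_energy_def
proof (rule nn_integral_cong_AE)
  show "AE x in lebesgue_on \<Omega>. e2ennreal (ellip_lower p a x) * ennreal (norm (grad f x) powr p) +
      e2ennreal (ellip_upper p a x) * ennreal (\<bar>f x\<bar> powr p)
    = ennreal (lam x * norm (F x) powr p + mu x * \<bar>f x\<bar> powr p)"
    using assms(1) AE_space
  proof eventually_elim
    fix x assume "ellip_lower p a x = ereal (lam x) \<and> ellip_upper p a x = ereal (mu x)" "x \<in> space (lebesgue_on \<Omega>)"
    then show "e2ennreal (ellip_lower p a x) * ennreal (norm (grad f x) powr p) +
      e2ennreal (ellip_upper p a x) * ennreal (\<bar>f x\<bar> powr p)
    = ennreal (lam x * norm (F x) powr p + mu x * \<bar>f x\<bar> powr p)"
      using assms(2-4) by (simp add: e2ennreal_ereal ennreal_mult)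
  qed
qed

context h1p_test
begin

lemma \<phi>_in_H1p0:
  assumes w: "AE x in M. ellip_lower p a x = ereal (lam x) \<and> ellip_upper p a x = ereal (mu x)"
  shows "\<phi> \<in> H1p0 p \<Omega> a"
proof -
  have 1: "\<phi>n n \<in> C1c \<Omega> \<and> H1p_energy p \<Omega> a (\<phi>n n) < \<infinity>" for n
    using \<phi>n_C1c H1p_energy_eq[OF w nonneg \<phi>n_C1(2), of n] En_\<phi>n_fin[of n] by (simp add: En_def)
  have 2: "\<exists>N. \<forall>m\<ge>N. \<forall>n\<ge>N. H1p_norm p \<Omega> a (\<lambda>x. \<phi>n m x - \<phi>n n x) < e" if e: "0 < e" for e
  proof -
    let ?E = "\<lambda>n. En (\<lambda>x. \<phi>n n x - \<phi> x) (\<lambda>x. \<Phi>n n x - \<Phi> x)"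
    \<comment> \<open>By \<open>En_add_le\<close> the energy of a difference is at most
      \<open>2 powr p * (2 * \<epsilon>)\<close>, which is half of \<open>e powr p\<close>.\<close>
    define \<epsilon> where "\<epsilon> = e powr p / (4 * 2 powr p)"
    have \<epsilon>: "0 < \<epsilon>" using e by (simp add: \<epsilon>_def)
    obtain N where N: "\<And>n. n \<ge> N \<Longrightarrow> ?E n < ennreal \<epsilon>"
      using order_tendstoD(2)[OF \<phi>n_En, of "ennreal \<epsilon>"] \<epsilon> by (auto simp: eventually_sequentially)
    have "H1p_norm p \<Omega> a (\<lambda>x. \<phi>n m x - \<phi>n n x) < e" if mn: "m \<ge> N" "n \<ge> N" for m n
    proof -
      have "H1p_energy p \<Omega> a (\<lambda>x. \<phi>n m x - \<phi>n n x) = En (\<lambda>x. \<phi>n m x - \<phi>n n x) (\<lambda>x. \<Phi>n m x - \<Phi>n n x)"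
        unfolding En_def
        by (rule H1p_energy_eq[OF w nonneg]) (simp add: grad_diff[OF \<phi>n_C1(1) \<phi>n_C1(1)] \<phi>n_C1(2))
      also have "\<dots> \<le> ennreal (2 powr p) * (?E m + ?E n)"
      proof (rule En_add_le)
        show "AE x in M. norm (\<Phi>n m x - \<Phi>n n x) \<le> norm (\<Phi>n m x - \<Phi> x) + norm (\<Phi>n n x - \<Phi> x)"
        proof (intro AE_I2)
          fix x show "norm (\<Phi>n m x - \<Phi>n n x) \<le> norm (\<Phi>n m x - \<Phi> x) + norm (\<Phi>n n x - \<Phi> x)"
            using norm_triangle_ineq4[of "\<Phi>n m x - \<Phi> x" "\<Phi>n n x - \<Phi> x"] by simp
        qed
        show "AE x in M. \<bar>\<phi>n m x - \<phi>n n x\<bar> \<le> \<bar>\<phi>n m x - \<phi> x\<bar> + \<bar>\<phi>n n x - \<phi> x\<bar>"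
          by (intro AE_I2) linarith
      qed auto
      also have "\<dots> \<le> ennreal (2 powr p) * (ennreal \<epsilon> + ennreal \<epsilon>)"
        using N mn by (intro mult_left_mono add_mono) (auto intro: less_imp_le)
      also have "\<dots> = ennreal (e powr p / 2)"
        using \<epsilon> by (simp add: \<epsilon>_def field_simps flip: ennreal_plus ennreal_mult)
      finally have le: "H1p_energy p \<Omega> a (\<lambda>x. \<phi>n m x - \<phi>n n x) \<le> ennreal (e powr p / 2)" .
      then have "enn2real (H1p_energy p \<Omega> a (\<lambda>x. \<phi>n m x - \<phi>n n x)) \<le> e powr p / 2"
        by (intro enn2real_leI) auto
      also have "\<dots> < e powr p" using e by simp
      finally have "enn2real (H1p_energy p \<Omega> a (\<lambda>x. \<phi>n m x - \<phi>n n x)) powr (1 / p) < (e powr p) powr (1 / p)"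
        using p by (intro powr_less_mono2) auto
      also have "\<dots> = e" using e p by (simp add: powr_powr)
      finally show ?thesis unfolding H1p_norm_def .
    qed
    then show ?thesis by blast
  qed
  have 3: "(\<lambda>n. \<integral>\<^sup>+x. ennreal (\<bar>\<phi>n n x - \<phi> x\<bar> + norm (grad (\<phi>n n) x - \<Phi> x)) \<partial>M) \<longlonglongrightarrow> 0"
  proof -
    have "(\<integral>\<^sup>+x. ennreal (\<bar>\<phi>n n x - \<phi> x\<bar> + norm (grad (\<phi>n n) x - \<Phi> x)) \<partial>M)
       = (\<integral>\<^sup>+x. ennreal (\<bar>\<phi>n n x - \<phi> x\<bar> + norm (\<Phi>n n x - \<Phi> x)) \<partial>M)" for n
      by (intro nn_integral_cong) (simp add: \<phi>n_C1(2))
    then show ?thesis using \<phi>n_L1 by simp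
  qed
  show ?thesis
    unfolding H1p0_def H1p_completion_def using has_W11_gradient_\<phi> 1 2 3 by blast
qed

end

text \<open>Along a subsequence, functions and gradients converge almost everywhere. Fatou's lemma,
  applied to the energy of \<open>v n - v m\<close> as \<open>m\<close> grows, then turns the Cauchy
  property into convergence of the energy of \<open>v n - u\<close> to 0.\<close>

lemma H1p_approximation:
  fixes u :: "'a::euclidean_space \<Rightarrow> real"
  assumes W: "h1p_weight \<Omega> p lam mu"
    and w: "AE x in lebesgue_on \<Omega>. ellip_lower p a x = ereal (lam x) \<and> ellip_upper p a x = ereal (mu x)"
    and u: "u \<in> H1p p \<Omega> a"
  obtains v G where "has_W11_gradient \<Omega> u G" "h1p_limit \<Omega> p lam mu v u G"
proof -
  interpret h1p_weight \<Omega> p lam mu by fact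
  obtain G v0 where G: "has_W11_gradient \<Omega> u G"
    and v0: "\<And>n::nat. v0 n \<in> C1 \<Omega>" "\<And>n. H1p_energy p \<Omega> a (v0 n) < \<infinity>"
    and Cau: "\<And>e. e > 0 \<Longrightarrow> \<exists>N. \<forall>m\<ge>N. \<forall>n\<ge>N. H1p_norm p \<Omega> a (\<lambda>x. v0 m x - v0 n x) < e"
    and L1: "(\<lambda>n. \<integral>\<^sup>+x. ennreal (\<bar>v0 n x - u x\<bar> + norm (grad (v0 n) x - G x)) \<partial>M) \<longlonglongrightarrow> 0"
    using u unfolding H1p_def H1p_completion_def by blast
  have G_int: "integrable M G" and u_int: "integrable M u" using G by (auto simp: has_W11_gradient_def)
  have [measurable]: "G \<in> borel_measurable M" "u \<in> borel_measurable M" using G_int u_int by auto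
  have [measurable]: "v0 n \<in> borel_measurable M" "grad (v0 n) \<in> borel_measurable M" for n
    using C1_meas[OF v0(1)] by auto
  have v0_fin: "En (v0 n) (grad (v0 n)) < \<infinity>" for n
    using v0(2)[of n] H1p_energy_eq[OF w nonneg refl, of "v0 n"] by (simp add: En_def)
  have Cau': "\<exists>N. \<forall>m\<ge>N. \<forall>n\<ge>N. En (\<lambda>x. v0 n x - v0 m x) (\<lambda>x. grad (v0 n) x - grad (v0 m) x) \<le> ennreal e" if e: "0 < e" for e
  proof -
    have "0 < e powr (1/p)" using e by simp
    then obtain N where N: "\<And>m n. m \<ge> N \<Longrightarrow> n \<ge> N \<Longrightarrow> H1p_norm p \<Omega> a (\<lambda>x. v0 m x - v0 n x) < e powr (1/p)"
      using Cau by meson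
    have "En (\<lambda>x. v0 n x - v0 m x) (\<lambda>x. grad (v0 n) x - grad (v0 m) x) \<le> ennreal e" if mn: "m \<ge> N" "n \<ge> N" for m n
    proof -
      have E: "H1p_energy p \<Omega> a (\<lambda>x. v0 n x - v0 m x) = En (\<lambda>x. v0 n x - v0 m x) (\<lambda>x. grad (v0 n) x - grad (v0 m) x)"
        unfolding En_def by (rule H1p_energy_eq[OF w nonneg]) (rule grad_diff[OF v0(1) v0(1)])
      \<comment> \<open>\<open>H1p_norm\<close> is defined through \<open>enn2real\<close>, which
        sends infinity to 0. A small norm therefore bounds the energy only once the energy is known
        to be finite.\<close>
      have "En (\<lambda>x. v0 n x - v0 m x) (\<lambda>x. grad (v0 n) x - grad (v0 m) x)
          \<le> ennreal (2 powr p) * (En (v0 n) (grad (v0 n)) + En (v0 m) (grad (v0 m)))"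
        by (rule En_add_le) (auto intro!: AE_I2 norm_triangle_ineq4 abs_triangle_ineq4)
      also have "\<dots> < \<infinity>" using v0_fin by (simp add: ennreal_mult_less_top)
      finally have fin: "En (\<lambda>x. v0 n x - v0 m x) (\<lambda>x. grad (v0 n) x - grad (v0 m) x) < \<infinity>" .
      have "enn2real (H1p_energy p \<Omega> a (\<lambda>x. v0 n x - v0 m x)) powr (1/p) < e powr (1/p)"
        using N[OF mn(2,1)] unfolding H1p_norm_def .
      then have "enn2real (H1p_energy p \<Omega> a (\<lambda>x. v0 n x - v0 m x)) < e"
        using p e powr_mono2[of "1/p" e "enn2real (H1p_energy p \<Omega> a (\<lambda>x. v0 n x - v0 m x))"]
        by (meson less_le_not_le linorder_not_less zero_le_divide_1_iff less_imp_le zero_less_one less_trans order_less_imp_le)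
      then have "ennreal (enn2real (H1p_energy p \<Omega> a (\<lambda>x. v0 n x - v0 m x))) \<le> ennreal e" by (intro ennreal_leI) simp
      then show ?thesis using fin unfolding E by simp
    qed
    then show ?thesis by blast
  qed
  obtain N where N: "\<And>n. n \<ge> N \<Longrightarrow> (\<integral>\<^sup>+x. ennreal (\<bar>v0 n x - u x\<bar> + norm (grad (v0 n) x - G x)) \<partial>M) < 1"
    using order_tendstoD(2)[OF L1, of 1] by (auto simp: eventually_sequentially)
  \<comment> \<open>Starting at \<open>N\<close> makes every \<open>D n\<close> integrable.\<close>
  define D where "D n x = \<bar>v0 (n + N) x - u x\<bar> + norm (grad (v0 (n + N)) x - G x)" for n x
  have D_int: "integrable M (D n)" for n
  proof -
    have "(\<integral>\<^sup>+x. ennreal (D n x) \<partial>M) < \<infinity>" using N[of "n + N"] unfolding D_def by (rule less_trans) auto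
    moreover have "D n \<in> borel_measurable M" unfolding D_def[abs_def] by measurable
    ultimately show ?thesis by (simp add: integrable_iff_bounded D_def)
  qed
  have "(\<lambda>n. \<integral>x. norm (D n x) \<partial>M) \<longlonglongrightarrow> 0"
  proof -
    have "(\<lambda>n. \<integral>\<^sup>+x. ennreal (D n x) \<partial>M) \<longlonglongrightarrow> 0"
      unfolding D_def using LIMSEQ_ignore_initial_segment[OF L1, of N] .
    moreover have "(\<integral>\<^sup>+x. ennreal (D n x) \<partial>M) = ennreal (\<integral>x. norm (D n x) \<partial>M)" for n
    proof -
      have "0 \<le> D n x" for x by (simp add: D_def)
      then show ?thesis using nn_integral_eq_integral[OF D_int[of n]] by simp
    qed
    ultimately have "(\<lambda>n. ennreal (\<integral>x. norm (D n x) \<partial>M)) \<longlonglongrightarrow> ennreal 0" by simp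
    then show ?thesis by (subst (asm) tendsto_ennreal_iff) auto
  qed
  from tendsto_L1_AE_subseq[OF D_int this] obtain r :: "nat \<Rightarrow> nat"
    where r: "strict_mono r" "AE x in M. (\<lambda>n. D (r n) x) \<longlonglongrightarrow> 0" by blast
  define v where "v n = v0 (r n + N)" for n
  have [measurable]: "v n \<in> borel_measurable M" "grad (v n) \<in> borel_measurable M" for n
    unfolding v_def by measurable
  have rN: "filterlim (\<lambda>n. r n + N) at_top sequentially"
    using filterlim_subseq[OF r(1)] by (rule filterlim_at_top_mono) (simp add: eventually_sequentially)
  have AE1: "AE x in M. (\<lambda>n. v n x) \<longlonglongrightarrow> u x" and AE2: "AE x in M. (\<lambda>n. grad (v n) x) \<longlonglongrightarrow> G x"
  proof -
    have "(\<lambda>n. v n x) \<longlonglongrightarrow> u x \<and> (\<lambda>n. grad (v n) x) \<longlonglongrightarrow> G x" if "(\<lambda>n. D (r n) x) \<longlonglongrightarrow> 0" for x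
    proof -
      have "(\<lambda>n. v n x - u x) \<longlonglongrightarrow> 0"
        by (rule tendsto_0_le[OF that, of _ 1]) (simp add: D_def v_def)
      moreover have "(\<lambda>n. grad (v n) x - G x) \<longlonglongrightarrow> 0"
        by (rule tendsto_0_le[OF that, of _ 1]) (simp add: D_def v_def)
      ultimately show ?thesis by (simp add: LIM_zero_iff)
    qed
    then show "AE x in M. (\<lambda>n. v n x) \<longlonglongrightarrow> u x" "AE x in M. (\<lambda>n. grad (v n) x) \<longlonglongrightarrow> G x"
      using r(2) by (auto elim: eventually_mono)
  qed
  have lim: "(\<lambda>n. En (\<lambda>x. v n x - u x) (\<lambda>x. grad (v n) x - G x)) \<longlonglongrightarrow> 0"
  proof (rule tendsto_zero_ennreal)
    fix e :: real assume e: "0 < e"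
    then obtain N' where N': "\<And>m n. m \<ge> N' \<Longrightarrow> n \<ge> N' \<Longrightarrow>
        En (\<lambda>x. v0 n x - v0 m x) (\<lambda>x. grad (v0 n) x - grad (v0 m) x) \<le> ennreal (e / 2)"
      using Cau'[of "e / 2"] by auto
    have ev: "\<forall>\<^sub>F n in sequentially. N' \<le> r n + N" using rN by (simp add: filterlim_at_top)
    then show "\<forall>\<^sub>F n in sequentially. En (\<lambda>x. v n x - u x) (\<lambda>x. grad (v n) x - G x) < ennreal e"
    proof eventually_elim
      fix n assume n: "N' \<le> r n + N"
      let ?f = "\<lambda>m x. ennreal (lam x * norm (grad (v n) x - grad (v m) x) powr p + mu x * \<bar>v n x - v m x\<bar> powr p)"
      have "En (\<lambda>x. v n x - u x) (\<lambda>x. grad (v n) x - G x) = (\<integral>\<^sup>+x. liminf (\<lambda>m. ?f m x) \<partial>M)"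
        unfolding En_def
      proof (rule nn_integral_cong_AE)
        show "AE x in M. ennreal (lam x * norm (grad (v n) x - G x) powr p + mu x * \<bar>v n x - u x\<bar> powr p)
           = liminf (\<lambda>m. ?f m x)"
          using AE1 AE2
        proof eventually_elim
          fix x assume 1: "(\<lambda>n. v n x) \<longlonglongrightarrow> u x" and 2: "(\<lambda>n. grad (v n) x) \<longlonglongrightarrow> G x"
          have 3: "(\<lambda>m. norm (grad (v n) x - grad (v m) x) powr p) \<longlonglongrightarrow> norm (grad (v n) x - G x) powr p"
            by (rule tendsto_powr2[OF tendsto_norm[OF tendsto_diff[OF tendsto_const 2]] tendsto_const]) (use p in auto)
          have 4: "(\<lambda>m. \<bar>v n x - v m x\<bar> powr p) \<longlonglongrightarrow> \<bar>v n x - u x\<bar> powr p"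
            by (rule tendsto_powr2[OF tendsto_rabs[OF tendsto_diff[OF tendsto_const 1]] tendsto_const]) (use p in auto)
          have "(\<lambda>m. ?f m x) \<longlonglongrightarrow> ennreal (lam x * norm (grad (v n) x - G x) powr p + mu x * \<bar>v n x - u x\<bar> powr p)"
            by (rule tendsto_ennrealI[OF tendsto_add[OF tendsto_mult[OF tendsto_const 3] tendsto_mult[OF tendsto_const 4]]])
          then show "ennreal (lam x * norm (grad (v n) x - G x) powr p + mu x * \<bar>v n x - u x\<bar> powr p)
             = liminf (\<lambda>m. ?f m x)"
            by (intro lim_imp_Liminf[symmetric]) auto
        qed
      qed
      also have "\<dots> \<le> liminf (\<lambda>m. \<integral>\<^sup>+x. ?f m x \<partial>M)" by (rule nn_integral_liminf) measurable
      also have "\<dots> \<le> ennreal (e / 2)"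
      proof (rule Liminf_le)
        show "\<forall>\<^sub>F m in sequentially. (\<integral>\<^sup>+x. ?f m x \<partial>M) \<le> ennreal (e / 2)"
          using ev
        proof eventually_elim
          fix m assume "N' \<le> r m + N"
          from N'[OF this n] show "(\<integral>\<^sup>+x. ?f m x \<partial>M) \<le> ennreal (e / 2)" by (simp add: En_def v_def)
        qed
      qed simp
      also have "\<dots> < ennreal e" using e by (intro ennreal_lessI) auto
      finally show "En (\<lambda>x. v n x - u x) (\<lambda>x. grad (v n) x - G x) < ennreal e" .
    qed
  qed
  have "h1p_limit \<Omega> p lam mu v u G"
  proof
    show "v n \<in> C1 \<Omega>" "En (v n) (grad (v n)) < \<infinity>" for n unfolding v_def using v0(1) v0_fin by auto
    show "(\<lambda>n. \<integral>\<^sup>+x. ennreal (\<bar>v n x - u x\<bar> + norm (grad (v n) x - G x)) \<partial>M) \<longlonglongrightarrow> 0"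
      unfolding v_def using filterlim_compose[OF L1 rN] by simp
  qed (use AE1 lim G_int u_int in auto)
  then show ?thesis using that G by blast
qed

text \<open>Young's inequality with constants fit for absorption. If the left side exceeds
  \<open>y / 2\<close>, then \<open>y powr (1 / p) < 2 * x\<close>, and inserting this into the left
  side gives the second summand.\<close>

lemma Young_absorb:
  fixes x y p :: real
  assumes "0 \<le> x" "0 \<le> y" "1 < p"
  shows "x * y powr ((p - 1) / p) \<le> y / 2 + 2 powr (p - 1) * x powr p"
proof (cases "x * y powr ((p - 1) / p) \<le> y / 2")
  case True
  then show ?thesis by (simp add: add_increasing2)
next
  case False
  then have y: "0 < y" using assms by (cases "y = 0") auto
  have yy: "y powr (1 / p) * y powr ((p - 1) / p) = y"
  proof -
    have "1 / p + (p - 1) / p = 1" using assms by (simp add: field_simps)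
    then show ?thesis using y by (simp flip: powr_add)
  qed
  have "y powr (1 / p) * y powr ((p - 1) / p) < 2 * x * y powr ((p - 1) / p)" using False yy by simp
  then have "y powr (1 / p) < 2 * x" using y by simp
  then have "(y powr (1 / p)) powr (p - 1) \<le> (2 * x) powr (p - 1)" using assms by (intro powr_mono2) auto
  then have "y powr ((p - 1) / p) \<le> (2 * x) powr (p - 1)" by (simp add: powr_powr)
  then have "x * y powr ((p - 1) / p) \<le> x * (2 * x) powr (p - 1)" using assms by (intro mult_left_mono)
  also have "\<dots> = 2 powr (p - 1) * (x * x powr (p - 1))" by (simp only: powr_mult mult_ac)
  also have "x * x powr (p - 1) = x powr p"
    using assms by (cases "x = 0") (auto simp: powr_mult_base)
  finally show ?thesis using y by simp
qed

context h1p_test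
begin

text \<open>The bound \<open>\<psi> t \<le> max 0 (t - k) * \<psi>' t\<close> puts the factor
  \<open>\<psi>'\<close> also into the term with the gradient of the cutoff. Since
  \<open>\<psi>' t \<le> 1\<close> and \<open>p \<le> real m\<close>, the factor
  \<open>\<eta> x ^ (m - 1) * \<psi>' (u x)\<close> there is at most the power (p - 1)/p of
  \<open>\<xi> x * \<psi>' (u x)\<close>, so \<open>Young_absorb\<close> moves that term into half
  of the main one plus \<open>R\<close>.\<close>

lemma caccioppoli:
  assumes \<eta>: "C1_grad \<eta> F" "\<And>x. 0 \<le> \<eta> x" "\<And>x. \<eta> x \<le> 1" and \<xi>\<eta>: "\<And>x. \<xi> x = \<eta> x ^ m" and mp: "p \<le> real m"
    and \<psi>w: "\<And>t. 0 \<le> \<psi> t" "\<And>t. 0 \<le> \<psi>' t" "\<And>t. \<psi> t \<le> max 0 (t - k) * \<psi>' t"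
    and aG: "AE x in M. lam x * norm (G x) powr p \<le> aG x \<bullet> G x"
      "AE x in M. norm (aG x) \<le> mu x powr (1 / p) * (aG x \<bullet> G x) powr ((p - 1) / p)"
    and sub: "integral_nonpos M (\<lambda>x. aG x \<bullet> \<Phi> x)"
  shows "(\<integral>\<^sup>+x. ennreal (lam x * \<xi> x * \<psi>' (u x) * norm (G x) powr p) \<partial>M)
    \<le> ennreal (2 * (2 powr (p - 1) * real m powr p)) * (\<integral>\<^sup>+x. ennreal (mu x * norm (F x) powr p * excess u k x powr p) \<partial>M)"
proof -
  have m1: "1 \<le> m" using mp p by linarith
  have Y: "Y x = (real m * \<eta> x ^ (m - 1)) *\<^sub>R F x" for x
  proof -
    have "\<xi> = (\<lambda>x. \<eta> x ^ m)" using \<xi>\<eta> by blast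
    then show ?thesis using C1_gradD(4)[OF \<xi>(1)] C1_gradD(4)[OF C1_grad_power[OF \<eta>(1), of m]] by metis
  qed
  have [measurable]: "F \<in> borel_measurable M" 
    using C1_gradD(2)[OF \<eta>(1)] op by (auto intro: continuous_imp_measurable_on_sets_lebesgue)
  define c where "c = 2 powr (p - 1) * real m powr p"
  have c0: "0 \<le> c" by (simp add: c_def)
  define f where "f x = aG x \<bullet> \<Phi> x" for x
  define P where "P x = lam x * \<xi> x * \<psi>' (u x) * norm (G x) powr p / 2" for x
  define R where "R x = c * (mu x * norm (F x) powr p * excess u k x powr p)" for x
  have fm [measurable]: "f \<in> borel_measurable M" and f_le: "(\<integral>\<^sup>+x. ennreal (f x) \<partial>M) \<le> (\<integral>\<^sup>+x. ennreal (- f x) \<partial>M)"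
    using sub by (auto simp: integral_nonpos_def f_def[abs_def])
  have [measurable]: "P \<in> borel_measurable M" "R \<in> borel_measurable M"
    unfolding P_def[abs_def] R_def[abs_def] by measurable
  have P0: "0 \<le> P x" for x unfolding P_def using nonneg \<psi>w(2) \<eta>(2) by (simp add: \<xi>\<eta>)
  have R0: "0 \<le> R x" for x unfolding R_def using nonneg c0 by simp
  have PfR: "AE x in M. P x \<le> f x + R x"
    using aG
  proof eventually_elim
    fix x assume lG: "lam x * norm (G x) powr p \<le> aG x \<bullet> G x"
      and aGn: "norm (aG x) \<le> mu x powr (1 / p) * (aG x \<bullet> G x) powr ((p - 1) / p)"
    define e where "e = aG x \<bullet> G x"
    define w where "w = excess u k x"
    define y where "y = \<xi> x * \<psi>' (u x) * e"
    define X where "X = real m * norm (F x) * w * mu x powr (1 / p)"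
    have e0: "0 \<le> e" using lG nonneg unfolding e_def by (meson mult_nonneg_nonneg order_trans powr_ge_zero)
    have w0: "0 \<le> w" unfolding w_def by (rule excess_simps(1))
    have \<psi>'1: "0 \<le> \<psi>' (u x)" "\<psi>' (u x) \<le> 1" using \<psi>w(2) \<psi>(3)[of "u x"] by auto
    have \<eta>01: "0 \<le> \<eta> x" "\<eta> x \<le> 1" using \<eta> by auto
    have X0: "0 \<le> X" unfolding X_def using w0 by simp
    have y0: "0 \<le> y" unfolding y_def \<xi>\<eta> using \<eta>01 \<psi>'1 e0 by simp
    have "\<eta> x ^ (m - 1) * \<psi>' (u x) \<le> (\<xi> x * \<psi>' (u x)) powr ((p - 1) / p)"
    proof -
      have pp: "(p - 1) / p \<le> 1" "0 \<le> (p - 1) / p" using p by auto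
      have "\<psi>' (u x) \<le> \<psi>' (u x) powr ((p - 1) / p)"
        using powr_mono'[OF pp(1), of "\<psi>' (u x)"] \<psi>'1 by (cases "\<psi>' (u x) = 0") auto
      moreover have "\<eta> x ^ (m - 1) \<le> \<xi> x powr ((p - 1) / p)"
      proof (cases "\<eta> x = 0")
        case True
        \<comment> \<open>Here \<open>0 ^ (m - 1)\<close> has to be 0 rather than
          \<open>0 ^ 0 = 1\<close>; \<open>m = 1\<close> is excluded by \<open>1 < p\<close> and
          \<open>p \<le> real m\<close>.\<close>
        have "m \<noteq> 1" using mp p by auto
        then show ?thesis using True m1 by (simp add: power_0_left)
      next
        case False
        then have h: "0 < \<eta> x" using \<eta>01 by simp
        \<comment> \<open>This inequality is equivalent to \<open>p \<le> real m\<close> and is the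
          reason for raising the cutoff to the power \<open>m\<close>.\<close>
        have "real m * ((p - 1) / p) \<le> real (m - 1)"
        proof -
          have "real m * ((p - 1) / p) = real m - real m / p" using p by (simp add: field_simps)
          moreover have "1 \<le> real m / p" using mp p by (simp add: field_simps)
          ultimately show ?thesis using m1 by (simp add: of_nat_diff)
        qed
        then have "\<eta> x powr real (m - 1) \<le> \<eta> x powr (real m * ((p - 1) / p))"
          using h \<eta>01 by (intro powr_mono') auto
        also have "\<dots> = \<xi> x powr ((p - 1) / p)"
          unfolding \<xi>\<eta> using h by (simp add: powr_powr flip: powr_realpow)
        finally show ?thesis using h by (simp add: powr_realpow)
      qed
      ultimately have "\<eta> x ^ (m - 1) * \<psi>' (u x) \<le> \<xi> x powr ((p - 1) / p) * \<psi>' (u x) powr ((p - 1) / p)"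
        using \<eta>01 \<psi>'1 by (intro mult_mono) auto
      then show ?thesis by (simp only: powr_mult)
    qed
    note A = this
    have "\<bar>aG x \<bullet> (\<psi> (u x) *\<^sub>R Y x)\<bar> \<le> norm (aG x) * (\<psi> (u x) * norm (Y x))"
      using Cauchy_Schwarz_ineq2[of "aG x" "\<psi> (u x) *\<^sub>R Y x"] \<psi>w(1)[of "u x"] by simp
    also have "\<dots> \<le> (mu x powr (1 / p) * e powr ((p - 1) / p)) * ((w * \<psi>' (u x)) * norm (Y x))"
      using aGn \<psi>w(1)[of "u x"] \<psi>w(3)[of "u x"] unfolding e_def w_def excess_def
      by (intro mult_mono mult_right_mono) auto
    also have "norm (Y x) = real m * \<eta> x ^ (m - 1) * norm (F x)" unfolding Y using \<eta>01 by simp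
    also have "(mu x powr (1 / p) * e powr ((p - 1) / p)) * ((w * \<psi>' (u x)) * (real m * \<eta> x ^ (m - 1) * norm (F x)))
       = X * ((\<eta> x ^ (m - 1) * \<psi>' (u x)) * e powr ((p - 1) / p))" by (simp only: X_def mult_ac)
    also have "\<dots> \<le> X * ((\<xi> x * \<psi>' (u x)) powr ((p - 1) / p) * e powr ((p - 1) / p))"
      using A X0 by (intro mult_left_mono mult_right_mono) auto
    also have "\<dots> = X * y powr ((p - 1) / p)" by (simp only: y_def powr_mult)
    also have "\<dots> \<le> y / 2 + 2 powr (p - 1) * X powr p" by (rule Young_absorb[OF X0 y0 p])
    also have "2 powr (p - 1) * X powr p = R x"
    proof -
      have "X powr p = real m powr p * norm (F x) powr p * w powr p * mu x"
        unfolding X_def powr_mult powr_powr using p nonneg by simp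
      then show ?thesis by (simp add: R_def c_def w_def)
    qed
    finally have "\<bar>aG x \<bullet> (\<psi> (u x) *\<^sub>R Y x)\<bar> \<le> y / 2 + R x" .
    moreover have "f x = y + aG x \<bullet> (\<psi> (u x) *\<^sub>R Y x)"
      by (simp add: f_def \<Phi>_def y_def e_def inner_add_right)
    moreover have "P x \<le> y / 2"
    proof -
      have "\<xi> x * \<psi>' (u x) * (lam x * norm (G x) powr p) \<le> \<xi> x * \<psi>' (u x) * e"
        using lG \<eta>01 \<psi>'1 unfolding e_def \<xi>\<eta> by (intro mult_left_mono) auto
      then show ?thesis by (simp add: P_def y_def mult_ac)
    qed
    ultimately show "P x \<le> f x + R x" by linarith
  qed
  \<comment> \<open>Integrability of \<open>f\<close> is not presupposed. As \<open>P\<close> is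
    nonnegative, the negative part of \<open>f\<close> is at most \<open>R\<close>; if the integral
    of \<open>R\<close> is finite, so is that of the negative part, which can then be cancelled
    after comparing it with the positive part.\<close>
  have main: "(\<integral>\<^sup>+x. ennreal (P x) \<partial>M) \<le> (\<integral>\<^sup>+x. ennreal (R x) \<partial>M)"
  proof (cases "(\<integral>\<^sup>+x. ennreal (R x) \<partial>M) = \<infinity>")
    case False
    have "(\<integral>\<^sup>+x. ennreal (- f x) \<partial>M) \<le> (\<integral>\<^sup>+x. ennreal (R x) \<partial>M)"
    proof (rule nn_integral_mono_AE)
      show "AE x in M. ennreal (- f x) \<le> ennreal (R x)"
        using PfR by eventually_elim (use P0 in \<open>smt (verit) ennreal_leI\<close>)
    qed
    then have fin: "(\<integral>\<^sup>+x. ennreal (- f x) \<partial>M) \<noteq> \<infinity>" using False by (auto simp: top_unique)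
    have "(\<integral>\<^sup>+x. ennreal (- f x) \<partial>M) + (\<integral>\<^sup>+x. ennreal (P x) \<partial>M) = (\<integral>\<^sup>+x. ennreal (- f x) + ennreal (P x) \<partial>M)"
      by (rule nn_integral_add[symmetric]) measurable
    also have "\<dots> \<le> (\<integral>\<^sup>+x. ennreal (f x) + ennreal (R x) \<partial>M)"
    proof (rule nn_integral_mono_AE)
      show "AE x in M. ennreal (- f x) + ennreal (P x) \<le> ennreal (f x) + ennreal (R x)"
        using PfR
      proof eventually_elim
        fix x assume le: "P x \<le> f x + R x"
        show "ennreal (- f x) + ennreal (P x) \<le> ennreal (f x) + ennreal (R x)"
        proof (cases "0 \<le> f x")
          case True
          then show ?thesis using le P0[of x] R0[of x]
            by (simp add: ennreal_neg ennreal_leI flip: ennreal_plus)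
        next
          case False
          then show ?thesis using le P0[of x] R0[of x]
            by (simp add: ennreal_neg ennreal_leI flip: ennreal_plus)
        qed
      qed
    qed
    also have "\<dots> = (\<integral>\<^sup>+x. ennreal (f x) \<partial>M) + (\<integral>\<^sup>+x. ennreal (R x) \<partial>M)"
      by (rule nn_integral_add) measurable
    also have "\<dots> \<le> (\<integral>\<^sup>+x. ennreal (- f x) \<partial>M) + (\<integral>\<^sup>+x. ennreal (R x) \<partial>M)"
      using f_le by (rule add_right_mono)
    finally show ?thesis using fin by (simp add: ennreal_add_left_cancel_le)
  qed simp
  have "(\<integral>\<^sup>+x. ennreal (lam x * \<xi> x * \<psi>' (u x) * norm (G x) powr p) \<partial>M) = (\<integral>\<^sup>+x. 2 * ennreal (P x) \<partial>M)"
  proof (rule nn_integral_cong)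
    fix x
    have "2 * ennreal (P x) = ennreal (2 * P x)" by (simp add: ennreal_mult')
    then show "ennreal (lam x * \<xi> x * \<psi>' (u x) * norm (G x) powr p) = 2 * ennreal (P x)" by (simp add: P_def)
  qed
  also have "\<dots> = 2 * (\<integral>\<^sup>+x. ennreal (P x) \<partial>M)" by (rule nn_integral_cmult) measurable
  also have "\<dots> \<le> 2 * (\<integral>\<^sup>+x. ennreal (R x) \<partial>M)" using main by (rule mult_left_mono) simp
  also have "(\<integral>\<^sup>+x. ennreal (R x) \<partial>M) = ennreal c * (\<integral>\<^sup>+x. ennreal (mu x * norm (F x) powr p * excess u k x powr p) \<partial>M)"
    unfolding R_def ennreal_mult'[OF c0] by (rule nn_integral_cmult) measurable
  finally show ?thesis using c0 unfolding c_def[symmetric] by (simp add: ennreal_mult' mult.assoc)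
qed

end

section \<open>The energy inequality on level sets\<close>

text \<open>A continuously differentiable approximation of the positive part of \<open>t - k\<close>
  from below, vanishing for \<open>t \<le> k\<close>. The square of the positive part is
  differentiable, and \<open>\<epsilon>\<close> keeps the argument of the root away from 0.\<close>

definition psi :: "real \<Rightarrow> real \<Rightarrow> real \<Rightarrow> real" where
  "psi \<epsilon> k t = sqrt (\<epsilon>\<^sup>2 + (max 0 (t - k))\<^sup>2) - \<epsilon>"

definition psi' :: "real \<Rightarrow> real \<Rightarrow> real \<Rightarrow> real" where
  "psi' \<epsilon> k t = max 0 (t - k) / sqrt (\<epsilon>\<^sup>2 + (max 0 (t - k))\<^sup>2)"

text \<open>Squaring removes the kink of the positive part: at \<open>k\<close> the difference
  quotient is at most \<open>\<bar>h\<bar>\<close>.\<close>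

lemma has_derivative_pos_part_square:
  "((\<lambda>t. (max 0 (t - k))\<^sup>2) has_real_derivative 2 * max 0 (t - k)) (at (t::real))"
proof -
  consider "t < k" | "k < t" | "t = k" by linarith
  then show ?thesis
  proof cases
    case 1
    have "((\<lambda>t. 0) has_real_derivative 2 * max 0 (t - k)) (at t)" using 1 by simp
    then show ?thesis
      by (rule has_field_derivative_transform_within_open[where S = "{..<k}"]) (use 1 in auto)
  next
    case 2
    have "((\<lambda>t. (t - k)\<^sup>2) has_real_derivative 2 * max 0 (t - k)) (at t)"
      using 2 by (auto intro!: derivative_eq_intros)
    then show ?thesis
      by (rule has_field_derivative_transform_within_open[where S = "{k<..}"]) (use 2 in auto)
  next
    case 3
    have "((\<lambda>h. ((max 0 (k + h - k))\<^sup>2 - (max 0 (k - k))\<^sup>2) / h) \<longlongrightarrow> 0) (at (0::real))"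
    proof (rule tendsto_0_le[where K = 1, OF tendsto_ident_at])
      show "\<forall>\<^sub>F h in at 0. norm (((max 0 (k + h - k))\<^sup>2 - (max 0 (k - k))\<^sup>2) / h) \<le> norm h * 1"
        by (intro always_eventually allI) (auto simp: max_def power2_eq_square)
    qed
    then show ?thesis unfolding 3 by (simp add: DERIV_def)
  qed
qed

text \<open>With \<open>?r\<close> the positive part and \<open>?s\<close> the root, the functions
  are \<open>?s - \<epsilon>\<close> and \<open>?r / ?s\<close>. The second bound of
  \<open>psi_bounds\<close> amounts to \<open>?s\<^sup>2 - \<epsilon> * ?s \<le> ?r\<^sup>2\<close>,
  that is, to \<open>\<epsilon> \<le> ?s\<close>.\<close>

lemma psi_props:
  assumes \<epsilon>: "0 < \<epsilon>"
  shows psi_deriv: "(psi \<epsilon> k has_real_derivative psi' \<epsilon> k t) (at t)"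
    and psi'_cont: "continuous_on UNIV (psi' \<epsilon> k)"
    and psi'_bounds: "0 \<le> psi' \<epsilon> k t" "\<bar>psi' \<epsilon> k t\<bar> \<le> 1"
    and psi_0: "0 \<le> k \<Longrightarrow> psi \<epsilon> k 0 = 0"
    and psi_bounds: "0 \<le> psi \<epsilon> k t" "psi \<epsilon> k t \<le> max 0 (t - k) * psi' \<epsilon> k t" "psi \<epsilon> k t \<le> max 0 (t - k)"
    and psi'_below: "t \<le> k \<Longrightarrow> psi' \<epsilon> k t = 0"
proof -
  let ?r = "max 0 (t - k)"
  let ?s = "sqrt (\<epsilon>\<^sup>2 + ?r\<^sup>2)"
  have pos: "0 < \<epsilon>\<^sup>2 + x\<^sup>2" for x using \<epsilon> by (simp add: add_pos_nonneg)
  have s: "0 < ?s" using pos by simp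
  have rs: "?r \<le> ?s" by (rule real_le_rsqrt) simp
  have es: "\<epsilon> \<le> ?s" by (rule real_le_rsqrt) simp
  have ss: "?s * ?s = \<epsilon>\<^sup>2 + ?r\<^sup>2" using pos[of ?r] by (simp add: less_imp_le)
  show "(psi \<epsilon> k has_real_derivative psi' \<epsilon> k t) (at t)"
  proof -
    have "((\<lambda>t. \<epsilon>\<^sup>2 + (max 0 (t - k))\<^sup>2) has_real_derivative 2 * ?r) (at t)"
      using DERIV_add[OF DERIV_const has_derivative_pos_part_square[of k t]] by simp
    from DERIV_chain2[OF DERIV_real_sqrt[OF pos] this]
    have "((\<lambda>t. sqrt (\<epsilon>\<^sup>2 + (max 0 (t - k))\<^sup>2)) has_real_derivative inverse ?s / 2 * (2 * ?r)) (at t)" .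
    from DERIV_diff[OF this DERIV_const[of \<epsilon>]]
    have "(psi \<epsilon> k has_real_derivative inverse ?s / 2 * (2 * ?r) - 0) (at t)"
      unfolding psi_def[abs_def] .
    moreover have "inverse a / 2 * (2 * b) - 0 = b / a" for a b :: real by (simp add: field_simps)
    ultimately show ?thesis unfolding psi'_def by (simp only:)
  qed
  show "continuous_on UNIV (psi' \<epsilon> k)"
  proof -
    have "sqrt (\<epsilon>\<^sup>2 + (max 0 (x - k))\<^sup>2) \<noteq> 0" for x
      by (rule less_imp_neq[OF real_sqrt_gt_zero[OF pos], symmetric])
    then show ?thesis unfolding psi'_def[abs_def] by (intro continuous_on_divide continuous_on_real_sqrt continuous_intros) blast
  qed
  show p0: "0 \<le> psi' \<epsilon> k t" using s by (simp add: psi'_def)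
  show "\<bar>psi' \<epsilon> k t\<bar> \<le> 1" using s rs by (simp add: psi'_def)
  show "0 \<le> k \<Longrightarrow> psi \<epsilon> k 0 = 0" using \<epsilon> by (simp add: psi_def max_def)
  show "0 \<le> psi \<epsilon> k t" using es by (simp add: psi_def)
  show "psi \<epsilon> k t \<le> ?r * psi' \<epsilon> k t"
  proof -
    have "psi \<epsilon> k t * ?s = ?s * ?s - \<epsilon> * ?s" by (simp add: psi_def algebra_simps)
    also have "\<dots> \<le> ?r * ?r"
    proof -
      have "\<epsilon> * \<epsilon> \<le> \<epsilon> * ?s" using es \<epsilon> by (intro mult_left_mono) auto
      then show ?thesis unfolding ss by (simp add: power2_eq_square)
    qed
    finally have "psi \<epsilon> k t \<le> ?r * ?r / ?s" using s by (simp only: pos_le_divide_eq)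
    then show ?thesis by (simp add: psi'_def)
  qed
  also have "\<dots> \<le> ?r * 1"
    using \<open>\<bar>psi' \<epsilon> k t\<bar> \<le> 1\<close> by (intro mult_left_mono) auto
  finally show "psi \<epsilon> k t \<le> ?r" by simp
  show "t \<le> k \<Longrightarrow> psi' \<epsilon> k t = 0" by (simp add: psi'_def)
qed

lemma psi_tendsto: "(\<lambda>n. psi (1 / real (Suc n)) k t) \<longlonglongrightarrow> max 0 (t - k)"
  and psi'_tendsto: "k < t \<Longrightarrow> (\<lambda>n. psi' (1 / real (Suc n)) k t) \<longlonglongrightarrow> 1"
proof -
  let ?r = "max 0 (t - k)"
  have e: "(\<lambda>n. 1 / real (Suc n)) \<longlonglongrightarrow> 0" using LIMSEQ_inverse_real_of_nat by (simp add: inverse_eq_divide)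
  have "(\<lambda>n. sqrt ((1 / real (Suc n))\<^sup>2 + ?r\<^sup>2)) \<longlonglongrightarrow> sqrt (0\<^sup>2 + ?r\<^sup>2)"
    by (intro tendsto_real_sqrt tendsto_add tendsto_power e tendsto_const)
  then have s: "(\<lambda>n. sqrt ((1 / real (Suc n))\<^sup>2 + ?r\<^sup>2)) \<longlonglongrightarrow> ?r" by simp
  from tendsto_diff[OF s e] show "(\<lambda>n. psi (1 / real (Suc n)) k t) \<longlonglongrightarrow> ?r" by (simp add: psi_def)
  assume "k < t"
  then have "?r \<noteq> 0" by simp
  from tendsto_divide[OF tendsto_const[of ?r] s this] show "(\<lambda>n. psi' (1 / real (Suc n)) k t) \<longlonglongrightarrow> 1"
    using \<open>k < t\<close> by (simp add: psi'_def)
qed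

section \<open>From Lebesgue measurable to Borel measurable functions\<close>

lemma AE_lebesgue_on_iff:
  assumes "open \<Omega>"
  shows "(AE x in lebesgue_on \<Omega>. P x) \<longleftrightarrow> (AE x in lborel. x \<in> \<Omega> \<longrightarrow> P x)"
  using assms by (subst AE_restrict_space_iff) (auto simp: AE_completion_iff)

lemma nn_integral_lebesgue_on_eq:
  assumes \<Omega>: "open \<Omega>" and eq: "AE x in lebesgue_on \<Omega>. f x = g x"
  shows "(\<integral>\<^sup>+x. f x \<partial>lebesgue_on \<Omega>) = (\<integral>\<^sup>+x. indicator \<Omega> x * g x \<partial>lborel)"
proof -
  have "(\<integral>\<^sup>+x. f x \<partial>lebesgue_on \<Omega>) = (\<integral>\<^sup>+x. g x \<partial>lebesgue_on \<Omega>)" using eq by (rule nn_integral_cong_AE)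
  also have "\<dots> = (\<integral>\<^sup>+x. g x * indicator \<Omega> x \<partial>lebesgue)" using \<Omega> by (intro nn_integral_restrict_space) auto
  also have "\<dots> = (\<integral>\<^sup>+x. indicator \<Omega> x * g x \<partial>lborel)" by (simp add: nn_integral_completion mult.commute)
  finally show ?thesis .
qed

lemma borel_version:
  fixes f :: "'a::euclidean_space \<Rightarrow> real"
  assumes \<Omega>: "open \<Omega>" and f: "f \<in> borel_measurable (lebesgue_on \<Omega>)"
  obtains g where "g \<in> borel_measurable borel" "AE x in lebesgue_on \<Omega>. g x = f x"
proof -
  have "(\<lambda>x. if x \<in> \<Omega> then f x else 0) \<in> borel_measurable lebesgue"
    using f \<Omega> by (simp add: borel_measurable_if)
  then obtain g where g: "g \<in> borel_measurable lborel" "AE x in lborel. (if x \<in> \<Omega> then f x else 0) = g x"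
    using completion_ex_borel_measurable_real by blast
  show ?thesis
  proof (rule that[of g])
    show "g \<in> borel_measurable borel" using g(1) by simp
    show "AE x in lebesgue_on \<Omega>. g x = f x"
      unfolding AE_lebesgue_on_iff[OF \<Omega>] using g(2) by eventually_elim auto
  qed
qed

lemma borel_version_vec:
  fixes f :: "'a::euclidean_space \<Rightarrow> 'a"
  assumes \<Omega>: "open \<Omega>" and f: "f \<in> borel_measurable (lebesgue_on \<Omega>)"
  obtains g where "g \<in> borel_measurable borel" "AE x in lebesgue_on \<Omega>. g x = f x"
proof -
  have "\<exists>h. h \<in> borel_measurable borel \<and> (AE x in lebesgue_on \<Omega>. h x = f x \<bullet> b)" for b
  proof -
    have "(\<lambda>x. f x \<bullet> b) \<in> borel_measurable (lebesgue_on \<Omega>)" using f by simp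
    from borel_version[OF \<Omega> this] show ?thesis by blast
  qed
  then obtain h where h: "\<And>b. h b \<in> borel_measurable borel" "\<And>b. AE x in lebesgue_on \<Omega>. h b x = f x \<bullet> b"
    by metis
  show ?thesis
  proof (rule that[of "\<lambda>x. \<Sum>b\<in>Basis. h b x *\<^sub>R b"])
    show "(\<lambda>x. \<Sum>b\<in>Basis. h b x *\<^sub>R b) \<in> borel_measurable borel"
      using h(1) by measurable
    have "AE x in lebesgue_on \<Omega>. \<forall>b\<in>Basis. h b x = f x \<bullet> b" using h(2) by (intro AE_finite_allI) auto
    then show "AE x in lebesgue_on \<Omega>. (\<Sum>b\<in>Basis. h b x *\<^sub>R b) = f x"
      by eventually_elim (simp add: euclidean_representation)
  qed
qed

text \<open>Hyperplane integrals depend on values on null sets of the space. The iteration therefore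
  works with fixed Borel representatives, whose weights are nonnegative everywhere and which agree
  with the original functions almost everywhere in \<open>\<Omega>\<close>.\<close>

locale borel_versions = h1p_limit \<Omega> p lam mu v u G
  for \<Omega> :: "'a::euclidean_space set" and p lam mu v u G +
  fixes lamB muB uB :: "'a \<Rightarrow> real" and GB :: "'a \<Rightarrow> 'a"
  assumes B_meas [measurable]: "lamB \<in> borel_measurable borel" "muB \<in> borel_measurable borel"
      "uB \<in> borel_measurable borel" "GB \<in> borel_measurable borel"
    and B_nonneg: "\<And>x. 0 \<le> lamB x" "\<And>x. 0 \<le> muB x"
    and B_eq: "AE x in lebesgue_on \<Omega>. lamB x = lam x \<and> muB x = mu x \<and> uB x = u x \<and> GB x = G x"
begin

lemma h1p_test_psi:
  assumes \<xi>: "C1_grad \<xi> Y" "\<And>x. 0 \<le> \<xi> x" "\<And>x. \<xi> x \<le> 1" "\<And>x. x \<notin> K \<Longrightarrow> \<xi> x = 0"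
    and K: "compact K" "K \<subseteq> \<Omega>" and \<epsilon>: "0 < \<epsilon>" and k: "0 \<le> k"
  obtains B where "h1p_test \<Omega> p lam mu v u G \<xi> Y K B (psi \<epsilon> k) (psi' \<epsilon> k)"
proof -
  have "bounded (Y ` K)" using C1_gradD(2)[OF \<xi>(1)] K(1) by (intro compact_imp_bounded compact_continuous_image)
  then obtain B where B: "\<And>x. x \<in> K \<Longrightarrow> norm (Y x) \<le> B" unfolding bounded_iff by auto
  have Y0: "Y x = 0" if "x \<notin> K" for x
    using C1_grad_eq_0[OF \<xi>(1) compact_imp_closed[OF K(1)] \<xi>(4) that] .
  \<comment> \<open>The maximum covers the points outside \<open>K\<close>, where \<open>Y\<close>
    is 0; if \<open>K\<close> is empty, \<open>B\<close> may be negative.\<close>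
  have "h1p_test \<Omega> p lam mu v u G \<xi> Y K (max 0 B) (psi \<epsilon> k) (psi' \<epsilon> k)"
  proof
    show "norm (Y x) \<le> max 0 B" for x using B[of x] Y0[of x] by (cases "x \<in> K") auto
    show "\<bar>\<xi> x\<bar> \<le> 1" for x using \<xi>(2,3)[of x] by simp
    show "(psi \<epsilon> k has_real_derivative psi' \<epsilon> k t) (at t)" "\<bar>psi' \<epsilon> k t\<bar> \<le> 1" for t
      using psi_deriv[OF \<epsilon>] psi'_bounds[OF \<epsilon>] by auto
    show "continuous_on UNIV (psi' \<epsilon> k)" by (rule psi'_cont[OF \<epsilon>])
    show "psi \<epsilon> k 0 = 0" by (rule psi_0[OF \<epsilon> k])
  qed (use \<xi> K in auto)
  then show ?thesis using that by blast
qed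

text \<open>\<open>pot_representation_limit\<close> is applied to \<open>\<zeta>\<close> times
  \<open>psi \<epsilon> k\<close> of \<open>u\<close>, approximated by the functions of
  \<open>h1p_test\<close>. The resulting bound does not depend on \<open>\<epsilon>\<close>:
  \<open>psi'\<close> is at most 1 and vanishes off the level set, and \<open>psi\<close> is at most
  the excess. Hence \<open>\<epsilon>\<close> may tend to 0 along a sequence, with countably many
  exceptional null sets.\<close>

lemma excess_representation:
  assumes d: "2 \<le> DIM('a)" and Q: "cube c R0 \<subseteq> \<Omega>" and L: "0 \<le> L" "2 * R0 < L"
    and \<zeta>: "C1_grad \<zeta> F" "\<And>x. 0 \<le> \<zeta> x" "\<And>x. \<zeta> x \<le> 1" "\<And>x. x \<notin> cube c R0 \<Longrightarrow> \<zeta> x = 0"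
    and b: "b \<in> Basis" and k: "0 \<le> k"
  shows "AE x in lborel. ennreal (\<zeta> x * excess uB k x)
    \<le> ennreal (2 * DIM('a)) * pot b L (\<lambda>x. ennreal (\<zeta> x * level_grad uB (\<lambda>x. norm (GB x)) k x + norm (F x) * excess uB k x)) x"
    (is "AE x in lborel. _ \<le> ?P x")
proof -
  have F0: "F x = 0" if "x \<notin> cube c R0" for x
    using C1_grad_eq_0[OF \<zeta>(1) compact_imp_closed[OF compact_cube] \<zeta>(4) that] .
  have one: "AE x in lborel. ennreal (\<zeta> x * psi \<epsilon> k (uB x)) \<le> ?P x" if \<epsilon>: "0 < \<epsilon>" for \<epsilon>
  proof -
    obtain B where "h1p_test \<Omega> p lam mu v u G \<zeta> F (cube c R0) B (psi \<epsilon> k) (psi' \<epsilon> k)"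
      by (rule h1p_test_psi[OF \<zeta> compact_cube Q \<epsilon> k])
    then interpret T: h1p_test \<Omega> p lam mu v u G \<zeta> F "cube c R0" B "psi \<epsilon> k" "psi' \<epsilon> k" .
    define fn where "fn n x = (if x \<in> \<Omega> then T.\<phi>n n x else 0)" for n x
    define Fn where "Fn n x = (if x \<in> \<Omega> then grad (T.\<phi>n n) x else 0)" for n x
    define f where "f x = \<zeta> x * psi \<epsilon> k (uB x)" for x
    define H where "H x = (\<zeta> x * psi' \<epsilon> k (uB x)) *\<^sub>R GB x + psi \<epsilon> k (uB x) *\<^sub>R F x" for x
    have [measurable]: "psi \<epsilon> k \<in> borel_measurable borel" "psi' \<epsilon> k \<in> borel_measurable borel"
      using T.meas_test by auto
    have [measurable]: "\<zeta> \<in> borel_measurable borel" "F \<in> borel_measurable borel" using C1_gradD[OF \<zeta>(1)] by auto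
    have fm [measurable]: "f \<in> borel_measurable borel" "H \<in> borel_measurable borel"
      unfolding f_def[abs_def] H_def[abs_def] by measurable
    have "AE x in lborel. ennreal \<bar>f x\<bar> \<le> ennreal (2 * DIM('a)) * pot b L (\<lambda>x. ennreal (norm (H x))) x"
    proof (rule pot_representation_limit[where fn = fn and Fn = Fn and c = c, OF _ b d _ L fm])
      show "C1_grad (fn n) (Fn n)" for n
        unfolding fn_def[abs_def] Fn_def[abs_def]
        by (rule C1c_extend[OF op T.\<phi>n_C1(1) compact_cube Q]) (simp add: T.\<phi>n_def \<zeta>(4))
      show "fn n x \<noteq> 0 \<Longrightarrow> x \<in> cube c R0" for n x
        using \<zeta>(4)[of x] by (auto simp: fn_def T.\<phi>n_def split: if_splits)
      have "(\<integral>\<^sup>+x. ennreal (\<bar>fn n x - f x\<bar> + norm (Fn n x - H x)) \<partial>lborel)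
          = (\<integral>\<^sup>+x. ennreal (\<bar>T.\<phi>n n x - T.\<phi> x\<bar> + norm (T.\<Phi>n n x - T.\<Phi> x)) \<partial>M)" for n
      proof -
        have "AE x in M. ennreal (\<bar>T.\<phi>n n x - T.\<phi> x\<bar> + norm (T.\<Phi>n n x - T.\<Phi> x))
            = ennreal (\<bar>fn n x - f x\<bar> + norm (Fn n x - H x))"
          using B_eq AE_space
          by eventually_elim (simp add: fn_def Fn_def f_def H_def T.\<phi>_def T.\<Phi>_def T.\<phi>n_C1(2))
        from nn_integral_lebesgue_on_eq[OF op this]
        have "(\<integral>\<^sup>+x. ennreal (\<bar>T.\<phi>n n x - T.\<phi> x\<bar> + norm (T.\<Phi>n n x - T.\<Phi> x)) \<partial>M)
          = (\<integral>\<^sup>+x. indicator \<Omega> x * ennreal (\<bar>fn n x - f x\<bar> + norm (Fn n x - H x)) \<partial>lborel)" .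
        also have "\<dots> = (\<integral>\<^sup>+x. ennreal (\<bar>fn n x - f x\<bar> + norm (Fn n x - H x)) \<partial>lborel)"
        proof (rule nn_integral_cong)
          fix x
          have "x \<notin> \<Omega> \<Longrightarrow> \<zeta> x = 0 \<and> F x = 0" using Q \<zeta>(4) F0 by blast
          then show "indicator \<Omega> x * ennreal (\<bar>fn n x - f x\<bar> + norm (Fn n x - H x))
              = ennreal (\<bar>fn n x - f x\<bar> + norm (Fn n x - H x))"
            by (cases "x \<in> \<Omega>") (auto simp: fn_def Fn_def f_def H_def)
        qed
        finally show ?thesis ..
      qed
      then show "(\<lambda>n. \<integral>\<^sup>+x. ennreal (\<bar>fn n x - f x\<bar> + norm (Fn n x - H x)) \<partial>lborel) \<longlonglongrightarrow> 0"
        using T.\<phi>n_L1 by simp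
    qed
    then show ?thesis
    proof eventually_elim
      fix x assume le: "ennreal \<bar>f x\<bar> \<le> ennreal (2 * DIM('a)) * pot b L (\<lambda>x. ennreal (norm (H x))) x"
      have "ennreal (\<zeta> x * psi \<epsilon> k (uB x)) \<le> ennreal \<bar>f x\<bar>" by (simp add: f_def ennreal_leI)
      also note le
      also have "ennreal (2 * DIM('a)) * pot b L (\<lambda>x. ennreal (norm (H x))) x \<le> ?P x"
      proof (intro mult_left_mono pot_mono ennreal_leI)
        fix x
        have "norm (H x) \<le> norm ((\<zeta> x * psi' \<epsilon> k (uB x)) *\<^sub>R GB x) + norm (psi \<epsilon> k (uB x) *\<^sub>R F x)"
          unfolding H_def by (rule norm_triangle_ineq)
        also have "\<dots> \<le> \<zeta> x * level_grad uB (\<lambda>x. norm (GB x)) k x + norm (F x) * excess uB k x"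
        proof (rule add_mono)
          have 1: "psi' \<epsilon> k (uB x) * norm (GB x) \<le> level_grad uB (\<lambda>x. norm (GB x)) k x"
          proof (cases "k < uB x")
            case True
            then show ?thesis using psi'_bounds[OF \<epsilon>, of k "uB x"] by (simp add: level_grad_def mult_left_le_one_le)
          next
            case False
            then show ?thesis using psi'_below[OF \<epsilon>, of "uB x" k] by (simp add: level_grad_def)
          qed
          have "norm ((\<zeta> x * psi' \<epsilon> k (uB x)) *\<^sub>R GB x) = \<zeta> x * (psi' \<epsilon> k (uB x) * norm (GB x))"
            using \<zeta>(2)[of x] psi'_bounds[OF \<epsilon>, of k "uB x"] by (simp add: abs_mult)
          also have "\<dots> \<le> \<zeta> x * level_grad uB (\<lambda>x. norm (GB x)) k x" using 1 \<zeta>(2) by (intro mult_left_mono)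
          finally show "norm ((\<zeta> x * psi' \<epsilon> k (uB x)) *\<^sub>R GB x) \<le> \<zeta> x * level_grad uB (\<lambda>x. norm (GB x)) k x" .
          have "psi \<epsilon> k (uB x) * norm (F x) \<le> excess uB k x * norm (F x)"
            using psi_bounds(3)[OF \<epsilon>, of k "uB x"] unfolding excess_def by (intro mult_right_mono) auto
          then show "norm (psi \<epsilon> k (uB x) *\<^sub>R F x) \<le> norm (F x) * excess uB k x"
            using psi_bounds(1)[OF \<epsilon>, of k "uB x"] by (simp add: mult.commute)
        qed
        finally show "norm (H x) \<le> \<zeta> x * level_grad uB (\<lambda>x. norm (GB x)) k x + norm (F x) * excess uB k x" .
      qed simp
      finally show "ennreal (\<zeta> x * psi \<epsilon> k (uB x)) \<le> ?P x" .
    qed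
  qed
  have "AE x in lborel. \<forall>n. ennreal (\<zeta> x * psi (1 / real (Suc n)) k (uB x)) \<le> ?P x"
    unfolding AE_all_countable using one by auto
  then show ?thesis
  proof eventually_elim
    fix x assume le: "\<forall>n. ennreal (\<zeta> x * psi (1 / real (Suc n)) k (uB x)) \<le> ?P x"
    have "(\<lambda>n. ennreal (\<zeta> x * psi (1 / real (Suc n)) k (uB x))) \<longlonglongrightarrow> ennreal (\<zeta> x * excess uB k x)"
      unfolding excess_def by (rule tendsto_ennrealI[OF tendsto_mult[OF tendsto_const psi_tendsto]])
    then show "ennreal (\<zeta> x * excess uB k x) \<le> ?P x"
      by (rule LIMSEQ_le_const2) (use le in auto)
  qed
qed

text \<open>The inequality of \<open>caccioppoli\<close> for \<open>psi \<epsilon> k\<close> has a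
  right-hand side independent of \<open>\<epsilon>\<close>, while on the left \<open>psi'\<close>
  tends to the indicator of the level set; Fatou's lemma concludes.\<close>

lemma level_caccioppoli:
  assumes Q: "cube c R0 \<subseteq> \<Omega>" and mp: "p \<le> real m"
    and w: "AE x in M. ellip_lower p a x = ereal (lam x) \<and> ellip_upper p a x = ereal (mu x)"
    and aG: "AE x in M. lam x * norm (G x) powr p \<le> aG x \<bullet> G x"
      "AE x in M. norm (aG x) \<le> mu x powr (1 / p) * (aG x \<bullet> G x) powr ((p - 1) / p)"
    and sub: "\<And>\<phi> \<Phi>. \<phi> \<in> H1p0 p \<Omega> a \<Longrightarrow> has_W11_gradient \<Omega> \<phi> \<Phi> \<Longrightarrow> AE x in M. 0 \<le> \<phi> x \<Longrightarrow>
      integral_nonpos M (\<lambda>x. aG x \<bullet> \<Phi> x)"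
    and \<eta>: "C1_grad \<eta> F" "\<And>x. 0 \<le> \<eta> x" "\<And>x. \<eta> x \<le> 1" "\<And>x. x \<notin> cube c R0 \<Longrightarrow> \<eta> x = 0"
    and k: "0 \<le> k"
  shows "(\<integral>\<^sup>+x. ennreal (lamB x * \<eta> x ^ m * level_grad uB (\<lambda>x. norm (GB x)) k x powr p) \<partial>lborel)
    \<le> ennreal (2 * (2 powr (p - 1) * real m powr p)) *
       (\<integral>\<^sup>+x. ennreal (muB x * norm (F x) powr p * excess uB k x powr p) \<partial>lborel)" (is "_ \<le> ?R")
proof -
  have m0: "m \<noteq> 0" using mp p by auto
  have F0: "F x = 0" if "x \<notin> cube c R0" for x
    using C1_grad_eq_0[OF \<eta>(1) compact_imp_closed[OF compact_cube] \<eta>(4) that] .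
  have [measurable]: "\<eta> \<in> borel_measurable borel" using C1_gradD[OF \<eta>(1)] by auto
  have one: "(\<integral>\<^sup>+x. ennreal (lamB x * \<eta> x ^ m * psi' \<epsilon> k (uB x) * norm (GB x) powr p) \<partial>lborel) \<le> ?R"
    if \<epsilon>: "0 < \<epsilon>" for \<epsilon>
  proof -
    define Y where "Y = (\<lambda>x. (real m * \<eta> x ^ (m - 1)) *\<^sub>R F x)"
    have \<xi>: "C1_grad (\<lambda>x. \<eta> x ^ m) Y" unfolding Y_def by (rule C1_grad_power[OF \<eta>(1)])
    have \<xi>01: "0 \<le> \<eta> x ^ m" "\<eta> x ^ m \<le> 1" for x using \<eta>(2,3) by (auto intro: power_le_one)
    have \<xi>0: "\<eta> x ^ m = 0" if "x \<notin> cube c R0" for x using \<eta>(4)[OF that] m0 by simp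
    obtain B where "h1p_test \<Omega> p lam mu v u G (\<lambda>x. \<eta> x ^ m) Y (cube c R0) B (psi \<epsilon> k) (psi' \<epsilon> k)"
      by (rule h1p_test_psi[OF \<xi> \<xi>01 \<xi>0 compact_cube Q \<epsilon> k])
    then interpret T: h1p_test \<Omega> p lam mu v u G "\<lambda>x. \<eta> x ^ m" Y "cube c R0" B "psi \<epsilon> k" "psi' \<epsilon> k" .
    have "AE x in M. 0 \<le> T.\<phi> x"
      using \<xi>01 psi_bounds(1)[OF \<epsilon>] by (intro AE_I2) (simp add: T.\<phi>_def)
    then have "integral_nonpos M (\<lambda>x. aG x \<bullet> T.\<Phi> x)"
      by (rule sub[OF T.\<phi>_in_H1p0[OF w] T.has_W11_gradient_\<phi>])
    then have C: "(\<integral>\<^sup>+x. ennreal (lam x * \<eta> x ^ m * psi' \<epsilon> k (u x) * norm (G x) powr p) \<partial>M)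
      \<le> ennreal (2 * (2 powr (p - 1) * real m powr p)) * (\<integral>\<^sup>+x. ennreal (mu x * norm (F x) powr p * excess u k x powr p) \<partial>M)"
      by (intro T.caccioppoli[OF \<eta>(1-3) refl mp _ _ _ aG] psi_bounds[OF \<epsilon>] psi'_bounds[OF \<epsilon>])
    have 1: "(\<integral>\<^sup>+x. ennreal (lam x * \<eta> x ^ m * psi' \<epsilon> k (u x) * norm (G x) powr p) \<partial>M)
       = (\<integral>\<^sup>+x. ennreal (lamB x * \<eta> x ^ m * psi' \<epsilon> k (uB x) * norm (GB x) powr p) \<partial>lborel)"
    proof -
      have "AE x in M. ennreal (lam x * \<eta> x ^ m * psi' \<epsilon> k (u x) * norm (G x) powr p)
          = ennreal (lamB x * \<eta> x ^ m * psi' \<epsilon> k (uB x) * norm (GB x) powr p)"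
        using B_eq by eventually_elim simp
      moreover have "indicator \<Omega> x * ennreal (lamB x * \<eta> x ^ m * psi' \<epsilon> k (uB x) * norm (GB x) powr p)
          = ennreal (lamB x * \<eta> x ^ m * psi' \<epsilon> k (uB x) * norm (GB x) powr p)" for x
      proof (cases "x \<in> \<Omega>")
        case False
        then have z: "\<eta> x ^ m = 0" using Q by (intro \<xi>0) blast
        show ?thesis unfolding z by simp
      qed simp
      ultimately show ?thesis using nn_integral_lebesgue_on_eq[OF op] by simp
    qed
    have 2: "(\<integral>\<^sup>+x. ennreal (mu x * norm (F x) powr p * excess u k x powr p) \<partial>M)
       = (\<integral>\<^sup>+x. ennreal (muB x * norm (F x) powr p * excess uB k x powr p) \<partial>lborel)"
    proof -
      have "AE x in M. ennreal (mu x * norm (F x) powr p * excess u k x powr p)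
          = ennreal (muB x * norm (F x) powr p * excess uB k x powr p)"
        using B_eq by eventually_elim (simp add: excess_def)
      moreover have "indicator \<Omega> x * ennreal (muB x * norm (F x) powr p * excess uB k x powr p)
          = ennreal (muB x * norm (F x) powr p * excess uB k x powr p)" for x
      proof (cases "x \<in> \<Omega>")
        case False
        then have z: "F x = 0" using Q by (intro F0) blast
        show ?thesis unfolding z using p by simp
      qed simp
      ultimately show ?thesis using nn_integral_lebesgue_on_eq[OF op] by simp
    qed
    show ?thesis using C unfolding 1 2 .
  qed
  let ?f = "\<lambda>n x. ennreal (lamB x * \<eta> x ^ m * psi' (1 / real (Suc n)) k (uB x) * norm (GB x) powr p)"
  have [measurable]: "psi' (1 / real (Suc n)) k \<in> borel_measurable borel" for n
    by (rule borel_measurable_continuous_onI[OF psi'_cont]) simp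
  have "(\<integral>\<^sup>+x. ennreal (lamB x * \<eta> x ^ m * level_grad uB (\<lambda>x. norm (GB x)) k x powr p) \<partial>lborel)
      = (\<integral>\<^sup>+x. liminf (\<lambda>n. ?f n x) \<partial>lborel)"
  proof (rule nn_integral_cong)
    fix x
    have "(\<lambda>n. ?f n x) \<longlonglongrightarrow> ennreal (lamB x * \<eta> x ^ m * level_grad uB (\<lambda>x. norm (GB x)) k x powr p)"
    proof (cases "k < uB x")
      case True
      have "(\<lambda>n. ?f n x) \<longlonglongrightarrow> ennreal (lamB x * \<eta> x ^ m * 1 * norm (GB x) powr p)"
        by (rule tendsto_ennrealI[OF tendsto_mult[OF tendsto_mult[OF tendsto_const psi'_tendsto[OF True]] tendsto_const]])
      then show ?thesis using True by (simp add: level_grad_def)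
    next
      case False
      then show ?thesis using p psi'_below[of "1 / real (Suc _)" "uB x" k] by (simp add: level_grad_def)
    qed
    then show "ennreal (lamB x * \<eta> x ^ m * level_grad uB (\<lambda>x. norm (GB x)) k x powr p) = liminf (\<lambda>n. ?f n x)"
      by (intro lim_imp_Liminf[symmetric]) auto
  qed
  also have "\<dots> \<le> liminf (\<lambda>n. \<integral>\<^sup>+x. ?f n x \<partial>lborel)" by (rule nn_integral_liminf) measurable
  also have "\<dots> \<le> ?R" by (rule Liminf_le) (use one in auto)
  finally show ?thesis .
qed

end

section \<open>Local boundedness\<close>

lemma one_divide_ereal: "r \<noteq> 0 \<Longrightarrow> 1 / ereal r = ereal (1 / r)" "1 / ereal 0 = \<infinity>"
  unfolding one_ereal_def by simp_all

text \<open>The infimum is at most the quotient at a single basis vector, hence finite.\<close>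

lemma ellip_lower_real:
  assumes "0 \<le> ellip_lower p a (x::'a::euclidean_space)"
  shows "ellip_lower p a x = ereal (real_of_ereal (ellip_lower p a x))"
proof -
  obtain b :: 'a where b: "b \<in> Basis" using nonempty_Basis by blast
  then have "ellip_lower p a x \<le> ereal (a x b \<bullet> b) / ereal (norm b powr p)"
    unfolding ellip_lower_def by (intro INF_lower) auto
  also have "\<dots> < \<infinity>" using b by simp
  finally show ?thesis using assms by (cases "ellip_lower p a x") auto
qed

text \<open>As \<open>0 < l\<close>, the denominators in \<open>ellip_upper\<close> are positive for
  \<open>\<xi> \<noteq> 0\<close>, so the extended quotients are quotients of real numbers; the case
  \<open>\<xi> = 0\<close> rests on \<open>a x 0 = 0\<close>. For \<open>l \<le> m\<close> take a
  unit vector \<open>b\<close> and \<open>e = a x b \<bullet> b\<close>: then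
  \<open>l \<le> e\<close>, and
  \<open>e powr p \<le> norm (a x b) powr p \<le> m * e powr (p - 1)\<close> gives
  \<open>e \<le> m\<close>.\<close>

lemma ellip_bounds:
  fixes a :: "'a::euclidean_space \<Rightarrow> 'a \<Rightarrow> 'a"
  assumes p: "1 < p" and l: "ellip_lower p a x = ereal l" "0 < l" and m: "ellip_upper p a x = ereal m"
    and a0: "a x 0 = 0"
  shows "l * norm \<xi> powr p \<le> a x \<xi> \<bullet> \<xi>"
    and "norm (a x \<xi>) \<le> m powr (1 / p) * (a x \<xi> \<bullet> \<xi>) powr ((p - 1) / p)"
    and "l \<le> m"
proof -
  have A: "l * norm \<xi> powr p \<le> a x \<xi> \<bullet> \<xi>" for \<xi>
  proof (cases "\<xi> = 0")
    case False
    then have "ereal l \<le> ereal (a x \<xi> \<bullet> \<xi>) / ereal (norm \<xi> powr p)"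
      unfolding l(1)[symmetric] ellip_lower_def by (intro INF_lower) auto
    then show ?thesis using False by (simp add: field_simps)
  qed (use a0 p in simp)
  have B: "norm (a x \<xi>) powr p \<le> m * (a x \<xi> \<bullet> \<xi>) powr (p - 1)" "0 < a x \<xi> \<bullet> \<xi>" if "\<xi> \<noteq> 0" for \<xi>
  proof -
    have "0 < l * norm \<xi> powr p" using l that by simp
    then show pos: "0 < a x \<xi> \<bullet> \<xi>" using A[of \<xi>] by linarith
    have "ereal (norm (a x \<xi>) powr p) / ereal ((a x \<xi> \<bullet> \<xi>) powr (p - 1)) \<le> ereal m"
      unfolding m[symmetric] ellip_upper_def using that by (intro SUP_upper) auto
    then show "norm (a x \<xi>) powr p \<le> m * (a x \<xi> \<bullet> \<xi>) powr (p - 1)"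
      using pos by (simp add: field_simps)
  qed
  show "l * norm \<xi> powr p \<le> a x \<xi> \<bullet> \<xi>" by (rule A)
  have m0: "0 \<le> m"
  proof -
    obtain b :: 'a where b: "b \<in> Basis" using nonempty_Basis by blast
    then have "b \<noteq> 0" by auto
    then have "0 \<le> m * (a x b \<bullet> b) powr (p - 1)" "0 < (a x b \<bullet> b) powr (p - 1)"
      using B[of b] powr_ge_zero order_trans by (blast, simp)
    then show ?thesis by (simp add: zero_le_mult_iff)
  qed
  show "norm (a x \<xi>) \<le> m powr (1 / p) * (a x \<xi> \<bullet> \<xi>) powr ((p - 1) / p)"
  proof (cases "\<xi> = 0")
    case False
    have "norm (a x \<xi>) = (norm (a x \<xi>) powr p) powr (1 / p)" using p by (simp add: powr_powr)
    also have "\<dots> \<le> (m * (a x \<xi> \<bullet> \<xi>) powr (p - 1)) powr (1 / p)"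
      using B[OF False] p by (intro powr_mono2) auto
    also have "\<dots> = m powr (1 / p) * (a x \<xi> \<bullet> \<xi>) powr ((p - 1) / p)" by (simp add: powr_mult powr_powr)
    finally show ?thesis .
  qed (use a0 in simp)
  show "l \<le> m"
  proof -
    obtain b :: 'a where b: "b \<in> Basis" using nonempty_Basis by blast
    define e where "e = a x b \<bullet> b"
    have e: "0 < e" "l \<le> e" using B(2)[OF nonzero_Basis[OF b]] A[of b] b by (auto simp: e_def)
    have "e \<le> norm (a x b)" using Cauchy_Schwarz_ineq2[of "a x b" b] b by (simp add: e_def)
    then have "e powr p \<le> norm (a x b) powr p" using e p by (intro powr_mono2) auto
    also have "\<dots> \<le> m * e powr (p - 1)" unfolding e_def using b by (intro B) auto
    finally have "e * e powr (p - 1) \<le> m * e powr (p - 1)" using e by (simp add: powr_mult_base)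
    then have "e \<le> m" using e by simp
    then show ?thesis using e by simp
  qed
qed

text \<open>On compact sets, exponent infinity implies every finite exponent, and the strict
  inequality leaves room to replace infinite exponents by large finite ones. Each reciprocal grows
  by at most \<open>d\<close>, a quarter of the gap.\<close>

lemma real_exponents:
  fixes s t :: ereal and g p :: real
  assumes p: "1 < p" and s: "1 \<le> s" and t: "ereal (1 / (p - 1)) < t" and st: "1 / s + 1 / t < ereal g"
  obtains s' t' :: real where "1 \<le> s'" "1 / (p - 1) < t'" "1 / s' + 1 / t' < g"
    "s = \<infinity> \<or> s = ereal s'" "t = \<infinity> \<or> t = ereal t'"
proof -
  have t0: "0 < 1 / (p - 1)" using p by simp
  define \<sigma> where "\<sigma> = (if s = \<infinity> then 0 else 1 / real_of_ereal s)"
  define \<tau> where "\<tau> = (if t = \<infinity> then 0 else 1 / real_of_ereal t)"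
  have \<sigma>: "1 / s = ereal \<sigma>" using s by (cases s) (auto simp: \<sigma>_def one_divide_ereal)
  have \<tau>: "1 / t = ereal \<tau>"
  proof (cases t)
    case (real r)
    then have "r \<noteq> 0" using t t0 by auto
    then show ?thesis using real by (simp add: \<tau>_def one_divide_ereal)
  qed (use t in \<open>auto simp: \<tau>_def\<close>)
  define d where "d = (g - \<sigma> - \<tau>) / 4"
  have d: "0 < d" using st unfolding \<sigma> \<tau> by (simp add: d_def)
  define s' where "s' = (if s = \<infinity> then max 1 (1 / d) else real_of_ereal s)"
  define t' where "t' = (if t = \<infinity> then max (1 / (p - 1) + 1) (1 / d) else real_of_ereal t)"
  have 1: "1 \<le> s'" "s = \<infinity> \<or> s = ereal s'" using s by (cases s; auto simp: s'_def)+
  have 2: "1 / (p - 1) < t'" "t = \<infinity> \<or> t = ereal t'" using t by (cases t; auto simp: t'_def)+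
  have inv: "1 / max a (1 / d) \<le> d" if "0 < a" for a
    using d that by (simp add: max_def field_simps)
  have "1 / s' \<le> \<sigma> + d" using inv[of 1] d by (auto simp: s'_def \<sigma>_def)
  moreover have "1 / t' \<le> \<tau> + d" using inv[of "1 / (p - 1) + 1"] t0 d by (auto simp: t'_def \<tau>_def)
  ultimately have "1 / s' + 1 / t' \<le> \<sigma> + \<tau> + 2 * d" by simp
  also have "\<dots> < g" using d by (simp add: d_def field_simps)
  finally show ?thesis using that 1 2 by blast
qed

lemma in_Lp_imp_finite_on:
  assumes \<Omega>: "open \<Omega>" and Q: "compact Q" "Q \<subseteq> \<Omega>" and f: "in_Lp s (lebesgue_on \<Omega>) f"
    and s: "s = \<infinity> \<or> s = ereal s'" "0 < s'" and h: "AE x in lebesgue_on \<Omega>. h x = \<bar>real_of_ereal (f x)\<bar>"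
  shows "(\<integral>\<^sup>+x. indicator Q x * ennreal (h x powr s') \<partial>lborel) < \<infinity>"
proof -
  have h': "AE x in lborel. x \<in> \<Omega> \<longrightarrow> h x = \<bar>real_of_ereal (f x)\<bar>"
    using h unfolding AE_lebesgue_on_iff[OF \<Omega>] .
  show ?thesis
  proof (cases "s = \<infinity>")
    case True
    then obtain C where "AE x in lebesgue_on \<Omega>. \<bar>f x\<bar> \<le> ereal C" using f by (auto simp: in_Lp_def)
    then have C: "AE x in lborel. x \<in> \<Omega> \<longrightarrow> \<bar>f x\<bar> \<le> ereal C" unfolding AE_lebesgue_on_iff[OF \<Omega>] .
    have "(\<integral>\<^sup>+x. indicator Q x * ennreal (h x powr s') \<partial>lborel)
        \<le> (\<integral>\<^sup>+x. ennreal (\<bar>C\<bar> powr s') * indicator Q x \<partial>lborel)"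
    proof (rule nn_integral_mono_AE)
      show "AE x in lborel. indicator Q x * ennreal (h x powr s') \<le> ennreal (\<bar>C\<bar> powr s') * indicator Q x"
        using C h'
      proof eventually_elim
        fix x assume 1: "x \<in> \<Omega> \<longrightarrow> \<bar>f x\<bar> \<le> ereal C" and 2: "x \<in> \<Omega> \<longrightarrow> h x = \<bar>real_of_ereal (f x)\<bar>"
        have "h x powr s' \<le> \<bar>C\<bar> powr s'" if "x \<in> Q"
        proof -
          have "\<bar>f x\<bar> \<le> ereal C" "h x = \<bar>real_of_ereal (f x)\<bar>" using 1 2 that Q by auto
          then have "0 \<le> h x" "h x \<le> \<bar>C\<bar>" by (cases "f x"; auto)+
          then show ?thesis using s by (intro powr_mono2) auto
        qed
        then show "indicator Q x * ennreal (h x powr s') \<le> ennreal (\<bar>C\<bar> powr s') * indicator Q x"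
          by (auto intro: ennreal_leI split: split_indicator)
      qed
    qed
    also have "\<dots> = ennreal (\<bar>C\<bar> powr s') * emeasure lborel Q"
      using Q(1) by (intro nn_integral_cmult_indicator) (simp add: borel_compact)
    also have "\<dots> < \<infinity>" using emeasure_compact_finite[OF Q(1)] by (simp add: ennreal_mult_less_top)
    finally show ?thesis .
  next
    case False
    then have "s = ereal s'" using s by simp
    then have int: "integrable (lebesgue_on \<Omega>) (\<lambda>x. \<bar>real_of_ereal (f x)\<bar> powr s')" using f by (simp add: in_Lp_def)
    have "(\<integral>\<^sup>+x. indicator Q x * ennreal (h x powr s') \<partial>lborel) \<le> (\<integral>\<^sup>+x. indicator \<Omega> x * ennreal (h x powr s') \<partial>lborel)"
      using Q(2) by (intro nn_integral_mono) (auto split: split_indicator)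
    also have "\<dots> = (\<integral>\<^sup>+x. ennreal (\<bar>real_of_ereal (f x)\<bar> powr s') \<partial>lebesgue_on \<Omega>)"
      using h by (intro nn_integral_lebesgue_on_eq[OF \<Omega>, symmetric]) (auto elim: eventually_mono)
    also have "\<dots> < \<infinity>" using int by (simp add: integrable_iff_bounded)
    finally show ?thesis .
  qed
qed

theorem theorem1:
  fixes \<Omega> :: "'a::euclidean_space set"
    and a :: "'a \<Rightarrow> 'a \<Rightarrow> 'a"
    and p :: real and s t :: ereal
    and u :: "'a \<Rightarrow> real"
  assumes "DIM('a) \<ge> 2" and "p > 1"
    and "domain_set \<Omega>"
    and "1 \<le> s" and "ereal (1 / (p - 1)) < t"
    and "1 / s + 1 / t < ereal (p / (real DIM('a) - 1))"
    and "caratheodory \<Omega> a"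
    and "\<forall>x\<in>\<Omega>. a x 0 = 0"
    and "\<forall>x\<in>\<Omega>. 0 \<le> ellip_lower p a x \<and> 0 \<le> ellip_upper p a x"
    and "in_Lp s (lebesgue_on \<Omega>) (ellip_upper p a)"
    and "in_Lp t (lebesgue_on \<Omega>) (\<lambda>x. 1 / ellip_lower p a x)"
    and "in_Lp (ereal (1 / (p - 1))) (lebesgue_on \<Omega>) (\<lambda>x. 1 / ellip_lower p a x)"
    and "in_Lp 1 (lebesgue_on \<Omega>) (ellip_upper p a)"
    and "weak_subsolution p \<Omega> a u"
  shows "locally_bounded_above \<Omega> u"
proof -
  note d = assms(1) and p = assms(2)
  have op: "open \<Omega>" using assms(3) by (simp add: domain_set_def)
  have \<Omega>m: "\<Omega> \<in> sets lebesgue" using op by simp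
  let ?M = "lebesgue_on \<Omega>"
  have spM: "space ?M = \<Omega>" by simp
  obtain s' t' :: real where s': "1 \<le> s'" "s = \<infinity> \<or> s = ereal s'"
    and t': "1 / (p - 1) < t'" "t = \<infinity> \<or> t = ereal t'" and st': "1 / s' + 1 / t' < p / (real DIM('a) - 1)"
    by (rule real_exponents[OF p assms(4-6)])
  have t'0: "0 < t'" using t'(1) p by (smt (verit) zero_less_divide_1_iff)
  define lam where "lam x = (if x \<in> \<Omega> then real_of_ereal (ellip_lower p a x) else 0)" for x
  define mu where "mu x = (if x \<in> \<Omega> then real_of_ereal (ellip_upper p a x) else 0)" for x
  have nn: "0 \<le> lam x" "0 \<le> mu x" for x using assms(9) by (auto simp: lam_def mu_def real_of_ereal_pos)
  have low: "ellip_lower p a x = ereal (lam x)" if "x \<in> \<Omega>" for x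
    using ellip_lower_real[of p a x] assms(9) that by (simp add: lam_def)
  have fin_up: "AE x in ?M. ellip_upper p a x = ereal (mu x)"
  proof -
    have "AE x in ?M. \<bar>ellip_upper p a x\<bar> \<noteq> \<infinity>" using assms(13) by (simp add: in_Lp_def)
    then show ?thesis using AE_space
      by eventually_elim (auto simp: mu_def ereal_real)
  qed
  have w: "AE x in ?M. ellip_lower p a x = ereal (lam x) \<and> ellip_upper p a x = ereal (mu x)"
    using fin_up AE_space by eventually_elim (simp add: low)
  \<comment> \<open>The reciprocal is finite almost everywhere, and \<open>1 / 0\<close> is infinite
    in the extended reals, so \<open>lam\<close> cannot vanish on a set of positive measure.\<close>
  have lam_pos: "AE x in ?M. 0 < lam x"
  proof -
    have "AE x in ?M. \<bar>1 / ellip_lower p a x\<bar> \<noteq> \<infinity>" using assms(12) by (simp add: in_Lp_def)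
    then show ?thesis using AE_space
    proof eventually_elim
      fix x assume 1: "\<bar>1 / ellip_lower p a x\<bar> \<noteq> \<infinity>" and x: "x \<in> space ?M"
      have "lam x \<noteq> 0"
      proof
        assume "lam x = 0"
        then have "1 / ellip_lower p a x = \<infinity>" using low[of x] x one_divide_ereal(2) by simp
        then show False using 1 by simp
      qed
      then show "0 < lam x" using nn[of x] by simp
    qed
  qed
  \<comment> \<open>Measurability of \<open>lam\<close> is recovered from that of its reciprocal.
    Where \<open>lam\<close> is 0 the reciprocal is infinite and its reciprocal is 0 again, so
    inverting twice is the identity there too.\<close>
  have "(\<lambda>x. real_of_ereal (1 / (1 / ellip_lower p a x))) \<in> borel_measurable ?M"
    using assms(12) by (auto simp: in_Lp_def)
  moreover have "real_of_ereal (1 / (1 / ellip_lower p a x)) = lam x" if "x \<in> \<Omega>" for x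
  proof (cases "lam x = 0")
    case True
    show ?thesis unfolding low[OF that] True one_divide_ereal(2) by (simp add: divide_ereal_def)
  next
    case False
    then have "1 / lam x \<noteq> 0" by simp
    from one_divide_ereal(1)[OF this] show ?thesis unfolding low[OF that] one_divide_ereal(1)[OF False] by simp
  qed
  ultimately have lamM: "lam \<in> borel_measurable ?M" by (subst measurable_cong[of _ _ "\<lambda>x. real_of_ereal (1 / (1 / ellip_lower p a x))"]) auto
  have "(\<lambda>x. real_of_ereal (ellip_upper p a x)) \<in> borel_measurable ?M"
    using assms(13) by (auto simp: in_Lp_def)
  then have muM: "mu \<in> borel_measurable ?M"
    by (subst measurable_cong[of _ _ "\<lambda>x. real_of_ereal (ellip_upper p a x)"]) (auto simp: mu_def)
  have ell: "AE x in ?M. (\<forall>\<xi>. lam x * norm \<xi> powr p \<le> a x \<xi> \<bullet> \<xi>) \<and>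
      (\<forall>\<xi>. norm (a x \<xi>) \<le> mu x powr (1 / p) * (a x \<xi> \<bullet> \<xi>) powr ((p - 1) / p)) \<and> lam x \<le> mu x"
    using w lam_pos AE_space
  proof eventually_elim
    fix x assume lm: "ellip_lower p a x = ereal (lam x) \<and> ellip_upper p a x = ereal (mu x)"
      and l0: "0 < lam x" and x: "x \<in> space ?M"
    have "a x 0 = 0" using assms(8) x by simp
    note E = ellip_bounds[OF p conjunct1[OF lm] l0 conjunct2[OF lm] this]
    show "(\<forall>\<xi>. lam x * norm \<xi> powr p \<le> a x \<xi> \<bullet> \<xi>) \<and>
      (\<forall>\<xi>. norm (a x \<xi>) \<le> mu x powr (1 / p) * (a x \<xi> \<bullet> \<xi>) powr ((p - 1) / p)) \<and> lam x \<le> mu x"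
      using E by blast
  qed
  have W: "h1p_weight \<Omega> p lam mu"
  proof
    show "AE x in ?M. lam x \<le> mu x" using ell by eventually_elim blast
  qed (use op p lamM muM nn in auto)
  obtain G1 where uH: "u \<in> H1p p \<Omega> a" and G1: "has_W11_gradient \<Omega> u G1"
    and sub: "\<And>\<phi> \<Phi>. \<phi> \<in> H1p0 p \<Omega> a \<Longrightarrow> has_W11_gradient \<Omega> \<phi> \<Phi> \<Longrightarrow> AE x in ?M. 0 \<le> \<phi> x \<Longrightarrow>
      integral_nonpos ?M (\<lambda>x. a x (G1 x) \<bullet> \<Phi> x)"
    using assms(14) unfolding weak_subsolution_def by blast
  obtain v G where G: "has_W11_gradient \<Omega> u G" and Hl: "h1p_limit \<Omega> p lam mu v u G"
    by (rule H1p_approximation[OF W w uH])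
  \<comment> \<open>This ties the gradient of the approximating sequence to the one in the
    definition of a subsolution.\<close>
  have GG1: "AE x in ?M. G x = G1 x" by (rule has_W11_gradient_unique[OF op G G1])
  interpret H: h1p_limit \<Omega> p lam mu v u G by (rule Hl)
  obtain l0 where l0: "l0 \<in> borel_measurable borel" "AE x in ?M. l0 x = lam x" by (rule borel_version[OF op lamM])
  obtain m0 where m0: "m0 \<in> borel_measurable borel" "AE x in ?M. m0 x = mu x" by (rule borel_version[OF op muM])
  obtain uB where uB: "uB \<in> borel_measurable borel" "AE x in ?M. uB x = u x" by (rule borel_version[OF op H.meas(1)])
  obtain GB where GB: "GB \<in> borel_measurable borel" "AE x in ?M. GB x = G x" by (rule borel_version_vec[OF op H.meas(2)])
  \<comment> \<open>Absolute values make the representatives nonnegative everywhere without changing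
    them almost everywhere in \<open>\<Omega>\<close>.\<close>
  define lamB where "lamB x = \<bar>l0 x\<bar>" for x
  define muB where "muB x = \<bar>m0 x\<bar>" for x
  have Beq: "AE x in ?M. lamB x = lam x \<and> muB x = mu x \<and> uB x = u x \<and> GB x = G x"
    using l0(2) m0(2) uB(2) GB(2) by eventually_elim (use nn in \<open>auto simp: lamB_def muB_def\<close>)
  interpret B: borel_versions \<Omega> p lam mu v u G lamB muB uB GB
  proof
    show "lamB \<in> borel_measurable borel" "muB \<in> borel_measurable borel"
      unfolding lamB_def[abs_def] muB_def[abs_def] using l0(1) m0(1) by measurable
  qed (use uB(1) GB(1) Beq in \<open>auto simp: lamB_def muB_def\<close>)
  have Beq': "AE x in lborel. x \<in> \<Omega> \<longrightarrow> lamB x = lam x \<and> muB x = mu x \<and> uB x = u x \<and> GB x = G x"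
    using Beq unfolding AE_lebesgue_on_iff[OF op] .
  \<comment> \<open>An integer exponent of at least \<open>p\<close>, so that the power of the
    cutoff is differentiated by \<open>C1_grad_power\<close>.\<close>
  define m where "m = nat \<lceil>p\<rceil>"
  have mp: "p \<le> real m" unfolding m_def by (rule real_nat_ceiling_ge)
  then have m1: "1 \<le> m" using p by linarith
  have aG: "AE x in ?M. lam x * norm (G x) powr p \<le> a x (G1 x) \<bullet> G x"
    "AE x in ?M. norm (a x (G1 x)) \<le> mu x powr (1 / p) * (a x (G1 x) \<bullet> G x) powr ((p - 1) / p)"
    using ell GG1 by (eventually_elim, simp)+
  show ?thesis
    unfolding locally_bounded_above_def
  proof
    fix c assume c: "c \<in> \<Omega>"
    obtain e where e: "0 < e" "ball c e \<subseteq> \<Omega>" using op c openE by blast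
    \<comment> \<open>The norm is at most the sum of the absolute values of the d coordinates, so
      points of the cube have distance at most \<open>e / 2\<close> from \<open>c\<close>.\<close>
    define R0 where "R0 = e / (2 * real DIM('a))"
    have d0: "0 < real DIM('a)" using d by simp
    have R0: "0 < R0" using e d0 by (simp add: R0_def)
    let ?Q = "cube c R0"
    have Q: "?Q \<subseteq> \<Omega>"
    proof
      fix x assume x: "x \<in> ?Q"
      have "norm (x - c) \<le> (\<Sum>b\<in>Basis. \<bar>(x - c) \<bullet> b\<bar>)" by (rule norm_le_l1)
      also have "\<dots> \<le> (\<Sum>b\<in>(Basis::'a set). R0)"
        using x by (intro sum_mono) (auto simp: cube_def inner_diff_left)
      also have "\<dots> = e / 2" using d0 by (simp add: R0_def)
      finally have "x \<in> ball c e" using e(1) by (simp add: dist_norm norm_minus_commute)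
      then show "x \<in> \<Omega>" using e(2) by blast
    qed
    have onQ: "(\<integral>\<^sup>+x. indicator ?Q x * f x \<partial>lborel) < \<infinity>"
      if "(\<integral>\<^sup>+x. g x \<partial>?M) < \<infinity>" "AE x in ?M. g x = f x" for f g :: "'a \<Rightarrow> ennreal"
    proof -
      have "(\<integral>\<^sup>+x. indicator ?Q x * f x \<partial>lborel) \<le> (\<integral>\<^sup>+x. indicator \<Omega> x * f x \<partial>lborel)"
        using Q by (intro nn_integral_mono) (auto split: split_indicator)
      also have "\<dots> = (\<integral>\<^sup>+x. g x \<partial>?M)" by (rule nn_integral_lebesgue_on_eq[OF op that(2), symmetric])
      finally show ?thesis using that(1) by (rule le_less_trans)
    qed
    \<comment> \<open>The constant 2d is that of \<open>pot_representation\<close>, and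
      \<open>2 * R0 + 1\<close> is a length greater than the side \<open>2 * R0\<close> of the
      cube.\<close>
    have "degiorgi p s' t' c R0 (2 * real DIM('a)) (2 * R0 + 1) (2 * (2 powr (p - 1) * real m powr p)) m
        lamB muB uB (\<lambda>x. norm (GB x))"
    proof
      show "2 \<le> DIM('a)" "1 < p" "1 \<le> s'" "1 / (p - 1) < t'" "1 / s' + 1 / t' < p / (real DIM('a) - 1)" "0 < R0"
        "1 \<le> m" by fact+
      show "AE x in lborel. x \<in> ?Q \<longrightarrow> 0 < lamB x"
        using Beq' lam_pos[unfolded AE_lebesgue_on_iff[OF op]] by eventually_elim (use Q in auto)
      have "AE x in ?M. lam x \<le> mu x" using ell by eventually_elim blast
      then show "AE x in lborel. x \<in> ?Q \<longrightarrow> lamB x \<le> muB x"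
        unfolding AE_lebesgue_on_iff[OF op] using Beq' by eventually_elim (use Q in auto)
      show "(\<integral>\<^sup>+x. indicator ?Q x * ennreal (muB x powr s') \<partial>lborel) < \<infinity>"
      proof (rule in_Lp_imp_finite_on[OF op compact_cube Q assms(10) s'(2)])
        show "AE x in ?M. muB x = \<bar>real_of_ereal (ellip_upper p a x)\<bar>"
          using Beq w by eventually_elim (use nn in auto)
      qed (use s' in simp)
      have "(\<integral>\<^sup>+x. indicator ?Q x * ennreal ((1 / lamB x) powr t') \<partial>lborel) < \<infinity>"
      proof (rule in_Lp_imp_finite_on[OF op compact_cube Q assms(11) t'(2) t'0])
        show "AE x in ?M. 1 / lamB x = \<bar>real_of_ereal (1 / ellip_lower p a x)\<bar>"
          using Beq w lam_pos by eventually_elim (auto simp: one_divide_ereal)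
      qed
      moreover have "(1 / lamB x) powr t' = lamB x powr (- t')" for x
        by (subst powr_divide) (auto simp: powr_minus divide_inverse)
      ultimately show "(\<integral>\<^sup>+x. indicator ?Q x * ennreal (lamB x powr (- t')) \<partial>lborel) < \<infinity>" by simp
      show "(\<integral>\<^sup>+x. indicator ?Q x * ennreal (lamB x * norm (GB x) powr p) \<partial>lborel) < \<infinity>"
        by (rule onQ[OF H.lam_G_fin]) (use Beq in \<open>eventually_elim, simp\<close>)
      show "(\<integral>\<^sup>+x. indicator ?Q x * ennreal (muB x * \<bar>uB x\<bar> powr p) \<partial>lborel) < \<infinity>"
        by (rule onQ[OF H.mu_u_fin]) (use Beq in \<open>eventually_elim, simp\<close>)
      show "0 \<le> 2 * R0 + 1" using R0 by simp
      show "AE x in lborel. ennreal (\<zeta> x * excess uB k x) \<le> ennreal (2 * real DIM('a)) *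
          pot b (2 * R0 + 1) (\<lambda>x. ennreal (\<zeta> x * level_grad uB (\<lambda>x. norm (GB x)) k x + norm (F x) * excess uB k x)) x"
        if "C1_grad \<zeta> F" "\<And>x. 0 \<le> \<zeta> x" "\<And>x. \<zeta> x \<le> 1" "\<And>x. x \<notin> ?Q \<Longrightarrow> \<zeta> x = 0" "b \<in> Basis" "0 \<le> k"
        for \<zeta> F b k
        using B.excess_representation[OF d Q _ _ that, of "2 * R0 + 1"] R0 by simp
      show "(\<integral>\<^sup>+x. ennreal (lamB x * \<eta> x ^ m * level_grad uB (\<lambda>x. norm (GB x)) k x powr p) \<partial>lborel)
          \<le> ennreal (2 * (2 powr (p - 1) * real m powr p)) *
             (\<integral>\<^sup>+x. ennreal (muB x * norm (F x) powr p * excess uB k x powr p) \<partial>lborel)"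
        if "C1_grad \<eta> F" "\<And>x. 0 \<le> \<eta> x" "\<And>x. \<eta> x \<le> 1" "\<And>x. x \<notin> ?Q \<Longrightarrow> \<eta> x = 0" "0 \<le> k"
        for \<eta> F k
        by (rule B.level_caccioppoli[OF Q mp w aG sub that])
    qed (use B.B_meas B.B_nonneg in auto)
    then interpret D: degiorgi p s' t' c R0 "2 * real DIM('a)" "2 * R0 + 1" "2 * (2 powr (p - 1) * real m powr p)" m
        lamB muB uB "\<lambda>x. norm (GB x)" .
    obtain C where C: "AE x in lborel. x \<in> cube c (R0 / 2) \<longrightarrow> uB x \<le> C" using D.bounded_above by blast
    define U where "U = interior (cube c (R0 / 2))"
    have U: "open U" "U \<subseteq> cube c (R0 / 2)" by (auto simp: U_def interior_subset)
    have UO: "U \<subseteq> \<Omega>" using U(2) cube_mono[of "R0 / 2" R0 c] R0 Q by auto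
    have "c \<in> U"
    proof -
      have "ball c (R0 / 2) \<subseteq> cube c (R0 / 2)"
      proof
        fix x assume x: "x \<in> ball c (R0 / 2)"
        have "\<bar>x \<bullet> j - c \<bullet> j\<bar> \<le> R0 / 2" if "j \<in> Basis" for j
          using Basis_le_norm[OF that, of "x - c"] x by (simp add: inner_diff_left dist_norm norm_minus_commute)
        then show "x \<in> cube c (R0 / 2)" by (simp add: cube_def)
      qed
      then have "ball c (R0 / 2) \<subseteq> U" unfolding U_def by (intro interior_maximal) auto
      then show ?thesis using R0 by auto
    qed
    moreover have "AE y in lebesgue_on U. u y \<le> C"
      unfolding AE_lebesgue_on_iff[OF U(1)] using C Beq' by eventually_elim (use U(2) UO in auto)
    ultimately show "\<exists>U C. open U \<and> c \<in> U \<and> U \<subseteq> \<Omega> \<and> (AE y in lebesgue_on U. u y \<le> C)"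
      using U(1) UO by blast
  qed
qed

end
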